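(* Assume the control data $(U,\mathcal U),r,l,g$ satisfy Hypothesis (C), and that Hypothesis (S) holds (both stated in the context). Assume that $$\mathbb E\exp\big((3+C_r^4)A_T\big)<\infty,$$ and that there exists $\beta$ such that $$\beta>\sup|r-1|^2,\qquad\mathbb E\exp(\beta A_T)<\infty,\qquad\mathbb E\big[|g(X_T)|^2e^{\beta A_T}\big]<\infty,$$ where $\sup|r-1|=\sup\{|r_t(\omega,y,u)-1|:\omega\in\Omega,t\in[0,T],y\in K,u\in U\}$. Let $(Y,Z)\in\mathbb K^\beta$ denote the (unique) solution of the BSDE $$Y_t+\int_t^T\int_KZ_s(y)\,q(ds\,dy)=g(X_T)+\int_t^Tf(s,X_s,Z_s(\cdot))\,dA_s,\qquad t\in[0,T],$$ with $f$ the hamiltonian function, and let $u^*=\underline u^Z$ be the corresponding admissible control provided by Hypothesis (S). Then $u^*(\cdot)$ is optimal and $Y_0$ is the optimal cost, i.e. $$Y_0=J(u^*(\cdot))=\inf_{u(\cdot)\in\mathcal A}J(u(\cdot)).$$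
   Context: Marked point process. $(\Omega,\mathcal F,\mathbb P)$ is a complete probability space, $(K,\mathcal K)$ a measurable space, $(T_n,\xi_n)_{n\ge1}$ random variables with $T_n\in[0,\infty]$, $\xi_n\in K$; $T_0=0$; $\mathbb P$-a.s. $T_n<\infty\Rightarrow T_n<T_{n+1}$ for all $n\ge0$, and $T_n\to\infty$ $\mathbb P$-a.s. For $C\in\mathcal K$, $N_t(C)=\sum_{n\ge1}1_{T_n\le t}1_{\xi_n\in C}$, $N_t=N_t(K)$. $\mathcal F_t$ is the $\sigma$-algebra generated by $\{N_s(C):s\in[0,t],C\in\mathcal K\}$ and the $\mathbb P$-null sets of $\mathcal F$. Measurability notions refer to $(\mathcal F_t)$; $\mathcal P$ and $Prog$ are the predictable and progressive $\sigma$-algebras. $\xi_0\in K$ is deterministic, $X_t=\sum_{n\ge0}\xi_n1_{[T_n,T_{n+1})}(t)$, and $X_{0-}=X_0$. Random measure and compensator. $p(dt\,dy)=\sum_{n\ge1}\delta_{(T_n,\xi_n)}$ on $(0,\infty)\times K$ (sum over $T_n<\infty$). $A$ is the compensator of $N$: the increasing right-continuous predictable process with $A_0=0$ and $\mathbb E\int_0^\infty H_t\,dN_t=\mathbb E\int_0^\infty H_t\,dA_t$ for all nonnegative predictable $H$. It is assumed that $A$ has $\mathbb P$-a.s. continuous, finite-valued trajectories. It is assumed there exist probability measures $\phi_t(\omega,dy)$ on $(K,\mathcal K)$ with $(\omega,t)\mapsto\phi_t(\omega,C)$ predictable for every $C\in\mathcal K$ and $\mathbb E\int_0^\infty\int_K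 H_t(y)\,p(dt\,dy)=\mathbb E\int_0^\infty\int_KH_t(y)\,\phi_t(dy)\,dA_t$ for every nonnegative $\mathcal P\otimes\mathcal K$-measurable $H$. Write $q(dt\,dy)=p(dt\,dy)-\phi_t(dy)\,dA_t$; integrals with respect to $q$ are differences of the pathwise integrals with respect to $p$ and $\phi_t(dy)dA_t$. $\int_a^b$ means integration over $(a,b]$. $T>0$ is a fixed deterministic time. Spaces. $\mathbb K^\beta$ ($\beta>0$) is the space of pairs $(Y,Z)$, $Y$ real progressive on $\Omega\times[0,T]$, $Z:\Omega\times[0,T]\times K\to\mathbb R$ $\mathcal P\otimes\mathcal K$-measurable, with $\mathbb E\int_0^Te^{\beta A_t}|Y_t|^2dA_t+\mathbb E\int_0^T\int_Ke^{\beta A_t}|Z_t(y)|^2\phi_t(dy)dA_t<\infty$, identified when the corresponding distance is zero. $\mathcal L^{1,0}(p)$ is the set of $\mathcal P\otimes\mathcal K$-measurable $Z$ with $\mathbb E\int_0^T\int_K|Z_t(y)|\phi_t(dy)dA_t<\infty$ (it contains the $Z$-components of elements of $\mathbb K^\beta$). $\mathcal L^1(K,\mathcal K,\phi_t(\omega,dy))$ is the space of $\mathcal K$-measurable $z$ with $\int_K|z|\phi_t(\omega,dy)<\infty$. Hypothesis (C). $(U,\mathcal U)$ is a measurable space; $r,l:\Omega\times[0,T]\times K\times U\to\mathbb R$ are $\mathcal P\otimes\mathcal K\otimes\mathcal U$-measurable and there are constants $C_r>1$, $C_l>0$ with, $\mathbb P$-a.s., $0\le r_t(y,u)\le C_r$,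 $|l_t(x,u)|\le C_l$ for all $t\in[0,T]$, $x,y\in K$, $u\in U$; $g:\Omega\times K\to\mathbb R$ is $\mathcal F_T\otimes\mathcal K$-measurable. Control problem. $\mathcal A$ is the set of predictable $U$-valued processes $u=(u_t)_{t\in[0,T]}$ (admissible controls). For $u\in\mathcal A$ let $$L_t=\exp\Big(\int_0^t\int_K(1-r_s(y,u_s))\,\phi_s(dy)\,dA_s\Big)\prod_{n\ge1:\,T_n\le t}r_{T_n}(\xi_n,u_{T_n}),\quad t\in[0,T]$$ (empty product $=1$). Under the integrability condition $\mathbb E\exp((3+C_r^4)A_T)<\infty$ one has $\mathbb E L_T=1$; set $\mathbb P_u(d\omega)=L_T(\omega)\mathbb P(d\omega)$, with expectation $\mathbb E_u$, and $J(u(\cdot))=\mathbb E_u\big[\int_0^Tl_t(X_t,u_t)\,dA_t+g(X_T)\big]$. Hamiltonian. For $\omega\in\Omega$, $t\in[0,T]$, $x\in K$, $z\in\mathcal L^1(K,\mathcal K,\phi_t(\omega,dy))$, $f(\omega,t,x,z(\cdot))=\inf_{u\in U}\{l_t(\omega,x,u)+\int_Kz(y)(r_t(\omega,y,u)-1)\,\phi_t(\omega,dy)\}$. Hypothesis (S). For every $Z\in\mathcal L^{1,0}(p)$ there exists $\underline u^Z:\Omega\times[0,T]\to U$, measurable with respect to $\mathcal P$ and $\mathcal U$, such that for $dA_t(\omega)\mathbb P(d\omega)$-almost all $(\omega,t)$, $$f(\omega,t,X_{t-}(\omega),Z_t(\omega,\cdot))=l_t(\omega,X_{t-}(\omega),\underline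 u^Z(\omega,t))+\int_KZ_t(\omega,y)\big(r_t(\omega,y,\underline u^Z(\omega,t))-1\big)\phi_t(\omega,dy).$$ *)

theory Defs
  imports "HOL-Probability.Probability"
begin

text \<open>
  Processes are curried as \<open>\<omega>\<close>, then time, then marks and controls. The jump times are
  \<open>\<tau> n\<close> with values in \<open>[0,\<infinity>]\<close>, the marks are \<open>\<xi> n\<close>; the index 0 carries the initial
  data \<open>T\<^sub>0 = 0\<close> and \<open>\<xi>\<^sub>0\<close>, the points of the process are those with \<open>n \<ge> 1\<close>.
\<close>

definition counting_process ::
  "(nat \<Rightarrow> 'a \<Rightarrow> ennreal) \<Rightarrow> (nat \<Rightarrow> 'a \<Rightarrow> 'k) \<Rightarrow> 'k set \<Rightarrow> 'a \<Rightarrow> real \<Rightarrow> ennreal" where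
  "counting_process \<tau> \<xi> C \<omega> t =
     (\<Sum>n. if \<tau> (Suc n) \<omega> \<le> ennreal t \<and> \<xi> (Suc n) \<omega> \<in> C then 1 else 0)"

definition mpp_filtration ::
  "'a measure \<Rightarrow> 'k measure \<Rightarrow> (nat \<Rightarrow> 'a \<Rightarrow> ennreal) \<Rightarrow> (nat \<Rightarrow> 'a \<Rightarrow> 'k) \<Rightarrow> real \<Rightarrow> 'a measure" where
  "mpp_filtration M K \<tau> \<xi> t = sigma (space M)
     ({(\<lambda>\<omega>. counting_process \<tau> \<xi> C \<omega> s) -` B \<inter> space M |s C B.
         s \<in> {0..t} \<and> C \<in> sets K \<and> B \<in> sets borel} \<union> null_sets M)"

definition predictable_sigma :: "'a measure \<Rightarrow> (real \<Rightarrow> 'a measure) \<Rightarrow> ('a \<times> real) measure" where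
  "predictable_sigma M F = sigma (space M \<times> {0..})
     ({B \<times> {0} |B. B \<in> sets (F 0)} \<union>
      {B \<times> {s<..t} |B s t. 0 \<le> s \<and> s < t \<and> B \<in> sets (F s)})"

definition predictable_sigma_upto ::
  "'a measure \<Rightarrow> (real \<Rightarrow> 'a measure) \<Rightarrow> real \<Rightarrow> ('a \<times> real) measure" where
  "predictable_sigma_upto M F T = restrict_space (predictable_sigma M F) (space M \<times> {0..T})"

definition progressive_upto ::
  "(real \<Rightarrow> 'a measure) \<Rightarrow> real \<Rightarrow> ('a \<Rightarrow> real \<Rightarrow> real) \<Rightarrow> bool" where
  "progressive_upto F T Y \<longleftrightarrow>
     (\<forall>t\<in>{0..T}. (\<lambda>(\<omega>, s). Y \<omega> s) \<in> borel_measurable (F t \<Otimes>\<^sub>M restrict_space borel {0..t}))"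

text \<open>
  The sum defining \<open>X\<^sub>t\<close> has exactly one nonzero term almost surely, so \<open>X\<^sub>t\<close> is the mark of the
  interval \<open>[T\<^sub>n, T\<^sub>n\<^sub>+\<^sub>1)\<close> containing \<open>t\<close>. Its paths are step functions, hence the left limit
  at \<open>t > 0\<close> is the mark of the interval \<open>(T\<^sub>n, T\<^sub>n\<^sub>+\<^sub>1]\<close> containing \<open>t\<close>.
\<close>

definition mark_process ::
  "(nat \<Rightarrow> 'a \<Rightarrow> ennreal) \<Rightarrow> (nat \<Rightarrow> 'a \<Rightarrow> 'k) \<Rightarrow> 'a \<Rightarrow> real \<Rightarrow> 'k" where
  "mark_process \<tau> \<xi> \<omega> t = \<xi> (THE n. \<tau> n \<omega> \<le> ennreal t \<and> ennreal t < \<tau> (Suc n) \<omega>) \<omega>"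

definition mark_process_left ::
  "(nat \<Rightarrow> 'a \<Rightarrow> ennreal) \<Rightarrow> (nat \<Rightarrow> 'a \<Rightarrow> 'k) \<Rightarrow> 'a \<Rightarrow> real \<Rightarrow> 'k" where
  "mark_process_left \<tau> \<xi> \<omega> t =
     (if t \<le> 0 then mark_process \<tau> \<xi> \<omega> 0
      else \<xi> (THE n. \<tau> n \<omega> < ennreal t \<and> ennreal t \<le> \<tau> (Suc n) \<omega>) \<omega>)"

text \<open>
  The sum of Dirac masses \<open>p(dt dy)\<close> is an image of counting measure, \<open>dN\<^sub>t\<close> is its time
  marginal, and \<open>dA\<^sub>t\<close> is the Lebesgue-Stieltjes measure of a path of \<open>A\<close>, extended by the
  constant \<open>A\<^sub>0\<close> to negative times so that only \<open>(0,\<infinity>)\<close> is charged.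
\<close>

definition jump_measure ::
  "'k measure \<Rightarrow> (nat \<Rightarrow> 'a \<Rightarrow> ennreal) \<Rightarrow> (nat \<Rightarrow> 'a \<Rightarrow> 'k) \<Rightarrow> 'a \<Rightarrow> (real \<times> 'k) measure" where
  "jump_measure K \<tau> \<xi> \<omega> =
     distr (count_space {n. 1 \<le> n \<and> \<tau> n \<omega> < \<infinity>}) (borel \<Otimes>\<^sub>M K) (\<lambda>n. (enn2real (\<tau> n \<omega>), \<xi> n \<omega>))"

definition dN ::
  "'k measure \<Rightarrow> (nat \<Rightarrow> 'a \<Rightarrow> ennreal) \<Rightarrow> (nat \<Rightarrow> 'a \<Rightarrow> 'k) \<Rightarrow> 'a \<Rightarrow> real measure" where
  "dN K \<tau> \<xi> \<omega> = distr (jump_measure K \<tau> \<xi> \<omega>) borel fst"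

definition dA :: "('a \<Rightarrow> real \<Rightarrow> real) \<Rightarrow> 'a \<Rightarrow> real measure" where
  "dA A \<omega> = interval_measure (\<lambda>t. A \<omega> (max 0 t))"

definition dA_dP :: "'a measure \<Rightarrow> ('a \<Rightarrow> real \<Rightarrow> real) \<Rightarrow> ('a \<times> real) measure" where
  "dA_dP M A = measure_of (space M \<times> UNIV) (sets (M \<Otimes>\<^sub>M borel))
     (\<lambda>B. \<integral>\<^sup>+\<omega>. emeasure (dA A \<omega>) (Pair \<omega> -` B) \<partial>M)"

text \<open>
  That the times stay infinite after the first infinite one is the usual convention; without it
  the intervals \<open>[T\<^sub>n, T\<^sub>n\<^sub>+\<^sub>1)\<close> need not be disjoint and \<open>X\<close> is not defined.
\<close>

locale marked_point_process = prob_space M + complete_measure M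
  for M :: "'a measure" +
  fixes K :: "'k measure"
    and \<tau> :: "nat \<Rightarrow> 'a \<Rightarrow> ennreal"
    and \<xi> :: "nat \<Rightarrow> 'a \<Rightarrow> 'k"
    and \<xi>0 :: 'k
  assumes times_measurable: "\<And>n. \<tau> n \<in> borel_measurable M"
    and marks_measurable: "\<And>n. \<xi> n \<in> M \<rightarrow>\<^sub>M K"
    and time_0: "\<And>\<omega>. \<omega> \<in> space M \<Longrightarrow> \<tau> 0 \<omega> = 0"
    and initial_mark: "\<xi>0 \<in> space K" "\<And>\<omega>. \<omega> \<in> space M \<Longrightarrow> \<xi> 0 \<omega> = \<xi>0"
    and times_increasing: "AE \<omega> in M. \<forall>n. \<tau> n \<omega> < \<infinity> \<longrightarrow> \<tau> n \<omega> < \<tau> (Suc n) \<omega>"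
    and times_infinite: "AE \<omega> in M. \<forall>n. \<tau> n \<omega> = \<infinity> \<longrightarrow> \<tau> (Suc n) \<omega> = \<infinity>"
    and times_tendsto: "AE \<omega> in M. (\<lambda>n. \<tau> n \<omega>) \<longlonglongrightarrow> \<infinity>"

locale compensated_mpp = marked_point_process M K \<tau> \<xi> \<xi>0
  for M :: "'a measure" and K :: "'k measure" and \<tau> \<xi> \<xi>0 +
  fixes A :: "'a \<Rightarrow> real \<Rightarrow> real"
    and \<phi> :: "'a \<Rightarrow> real \<Rightarrow> 'k measure"
  assumes A_predictable:
      "(\<lambda>(\<omega>, t). A \<omega> t) \<in> borel_measurable (predictable_sigma M (mpp_filtration M K \<tau> \<xi>))"
    and A_0: "AE \<omega> in M. A \<omega> 0 = 0"
    and A_increasing: "AE \<omega> in M. mono_on {0..} (A \<omega>)"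
    and A_right_continuous: "AE \<omega> in M. \<forall>t\<ge>0. continuous (at_right t) (A \<omega>)"
    and A_compensator: "\<And>H :: 'a \<Rightarrow> real \<Rightarrow> ennreal.
      (\<lambda>(\<omega>, t). H \<omega> t) \<in> borel_measurable (predictable_sigma M (mpp_filtration M K \<tau> \<xi>)) \<Longrightarrow>
      (\<integral>\<^sup>+\<omega>. (\<integral>\<^sup>+t\<in>{0<..}. H \<omega> t \<partial>dN K \<tau> \<xi> \<omega>) \<partial>M) =
      (\<integral>\<^sup>+\<omega>. (\<integral>\<^sup>+t\<in>{0<..}. H \<omega> t \<partial>dA A \<omega>) \<partial>M)"
    and A_continuous: "AE \<omega> in M. continuous_on {0..} (A \<omega>)"
    and \<phi>_sets: "\<And>\<omega> t. \<omega> \<in> space M \<Longrightarrow> 0 \<le> t \<Longrightarrow> sets (\<phi> \<omega> t) = sets K"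
    and \<phi>_prob: "\<And>\<omega> t. \<omega> \<in> space M \<Longrightarrow> 0 \<le> t \<Longrightarrow> prob_space (\<phi> \<omega> t)"
    and \<phi>_predictable: "\<And>C. C \<in> sets K \<Longrightarrow>
      (\<lambda>(\<omega>, t). measure (\<phi> \<omega> t) C)
        \<in> borel_measurable (predictable_sigma M (mpp_filtration M K \<tau> \<xi>))"
    and \<phi>_compensator: "\<And>H :: 'a \<Rightarrow> real \<Rightarrow> 'k \<Rightarrow> ennreal.
      (\<lambda>((\<omega>, t), y). H \<omega> t y)
        \<in> borel_measurable (predictable_sigma M (mpp_filtration M K \<tau> \<xi>) \<Otimes>\<^sub>M K) \<Longrightarrow>
      (\<integral>\<^sup>+\<omega>. (\<integral>\<^sup>+x\<in>{0<..} \<times> space K. H \<omega> (fst x) (snd x) \<partial>jump_measure K \<tau> \<xi> \<omega>) \<partial>M) =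
      (\<integral>\<^sup>+\<omega>. (\<integral>\<^sup>+t\<in>{0<..}. (\<integral>\<^sup>+y. H \<omega> t y \<partial>\<phi> \<omega> t) \<partial>dA A \<omega>) \<partial>M)"

definition q_integral ::
  "'k measure \<Rightarrow> (nat \<Rightarrow> 'a \<Rightarrow> ennreal) \<Rightarrow> (nat \<Rightarrow> 'a \<Rightarrow> 'k) \<Rightarrow> ('a \<Rightarrow> real \<Rightarrow> real) \<Rightarrow>
   ('a \<Rightarrow> real \<Rightarrow> 'k measure) \<Rightarrow> ('a \<Rightarrow> real \<Rightarrow> 'k \<Rightarrow> real) \<Rightarrow> real \<Rightarrow> real \<Rightarrow> 'a \<Rightarrow> real" where
  "q_integral K \<tau> \<xi> A \<phi> Z a b \<omega> =
     (LINT x:{a<..b} \<times> space K|jump_measure K \<tau> \<xi> \<omega>. Z \<omega> (fst x) (snd x)) -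
     (LINT s:{a<..b}|dA A \<omega>. (\<integral>y. Z \<omega> s y \<partial>\<phi> \<omega> s))"

definition predictable_field ::
  "'a measure \<Rightarrow> 'k measure \<Rightarrow> (nat \<Rightarrow> 'a \<Rightarrow> ennreal) \<Rightarrow> (nat \<Rightarrow> 'a \<Rightarrow> 'k) \<Rightarrow> real \<Rightarrow>
   ('a \<Rightarrow> real \<Rightarrow> 'k \<Rightarrow> real) \<Rightarrow> bool" where
  "predictable_field M K \<tau> \<xi> T Z \<longleftrightarrow>
     (\<lambda>((\<omega>, t), y). Z \<omega> t y)
       \<in> borel_measurable (predictable_sigma_upto M (mpp_filtration M K \<tau> \<xi>) T \<Otimes>\<^sub>M K)"

definition L10 ::
  "'a measure \<Rightarrow> 'k measure \<Rightarrow> (nat \<Rightarrow> 'a \<Rightarrow> ennreal) \<Rightarrow> (nat \<Rightarrow> 'a \<Rightarrow> 'k) \<Rightarrow>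
   ('a \<Rightarrow> real \<Rightarrow> real) \<Rightarrow> ('a \<Rightarrow> real \<Rightarrow> 'k measure) \<Rightarrow> real \<Rightarrow> ('a \<Rightarrow> real \<Rightarrow> 'k \<Rightarrow> real) set" where
  "L10 M K \<tau> \<xi> A \<phi> T = {Z. predictable_field M K \<tau> \<xi> T Z \<and>
     (\<integral>\<^sup>+\<omega>. (\<integral>\<^sup>+t\<in>{0<..T}. (\<integral>\<^sup>+y. ennreal \<bar>Z \<omega> t y\<bar> \<partial>\<phi> \<omega> t) \<partial>dA A \<omega>) \<partial>M) < \<infinity>}"

text \<open>Elements of \<open>\<bbbK>\<^sup>\<beta>\<close> are given by representatives.\<close>

definition K_space ::
  "'a measure \<Rightarrow> 'k measure \<Rightarrow> (nat \<Rightarrow> 'a \<Rightarrow> ennreal) \<Rightarrow> (nat \<Rightarrow> 'a \<Rightarrow> 'k) \<Rightarrow>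
   ('a \<Rightarrow> real \<Rightarrow> real) \<Rightarrow> ('a \<Rightarrow> real \<Rightarrow> 'k measure) \<Rightarrow> real \<Rightarrow> real \<Rightarrow>
   (('a \<Rightarrow> real \<Rightarrow> real) \<times> ('a \<Rightarrow> real \<Rightarrow> 'k \<Rightarrow> real)) set" where
  "K_space M K \<tau> \<xi> A \<phi> T \<beta> = {(Y, Z).
     progressive_upto (mpp_filtration M K \<tau> \<xi>) T Y \<and>
     predictable_field M K \<tau> \<xi> T Z \<and>
     (\<integral>\<^sup>+\<omega>. (\<integral>\<^sup>+t\<in>{0<..T}. ennreal (exp (\<beta> * A \<omega> t) * \<bar>Y \<omega> t\<bar>\<^sup>2) \<partial>dA A \<omega>) \<partial>M) +
     (\<integral>\<^sup>+\<omega>. (\<integral>\<^sup>+t\<in>{0<..T}. (\<integral>\<^sup>+y. ennreal (exp (\<beta> * A \<omega> t) * \<bar>Z \<omega> t y\<bar>\<^sup>2) \<partial>\<phi> \<omega> t)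
        \<partial>dA A \<omega>) \<partial>M) < \<infinity>}"

definition hypothesis_C ::
  "'a measure \<Rightarrow> 'k measure \<Rightarrow> (nat \<Rightarrow> 'a \<Rightarrow> ennreal) \<Rightarrow> (nat \<Rightarrow> 'a \<Rightarrow> 'k) \<Rightarrow> real \<Rightarrow> 'u measure \<Rightarrow>
   ('a \<Rightarrow> real \<Rightarrow> 'k \<Rightarrow> 'u \<Rightarrow> real) \<Rightarrow> ('a \<Rightarrow> real \<Rightarrow> 'k \<Rightarrow> 'u \<Rightarrow> real) \<Rightarrow> ('a \<Rightarrow> 'k \<Rightarrow> real) \<Rightarrow>
   real \<Rightarrow> real \<Rightarrow> bool" where
  "hypothesis_C M K \<tau> \<xi> T U r l g C\<^sub>r C\<^sub>l \<longleftrightarrow>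
     (\<lambda>(((\<omega>, t), y), u). r \<omega> t y u) \<in> borel_measurable
       ((predictable_sigma_upto M (mpp_filtration M K \<tau> \<xi>) T \<Otimes>\<^sub>M K) \<Otimes>\<^sub>M U) \<and>
     (\<lambda>(((\<omega>, t), x), u). l \<omega> t x u) \<in> borel_measurable
       ((predictable_sigma_upto M (mpp_filtration M K \<tau> \<xi>) T \<Otimes>\<^sub>M K) \<Otimes>\<^sub>M U) \<and>
     (\<lambda>(\<omega>, x). g \<omega> x) \<in> borel_measurable (mpp_filtration M K \<tau> \<xi> T \<Otimes>\<^sub>M K) \<and>
     1 < C\<^sub>r \<and> 0 < C\<^sub>l \<and>
     (AE \<omega> in M. \<forall>t\<in>{0..T}. \<forall>y\<in>space K. \<forall>u\<in>space U. 0 \<le> r \<omega> t y u \<and> r \<omega> t y u \<le> C\<^sub>r) \<and>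
     (AE \<omega> in M. \<forall>t\<in>{0..T}. \<forall>x\<in>space K. \<forall>u\<in>space U. \<bar>l \<omega> t x u\<bar> \<le> C\<^sub>l)"

definition admissible ::
  "'a measure \<Rightarrow> 'k measure \<Rightarrow> (nat \<Rightarrow> 'a \<Rightarrow> ennreal) \<Rightarrow> (nat \<Rightarrow> 'a \<Rightarrow> 'k) \<Rightarrow> real \<Rightarrow> 'u measure \<Rightarrow>
   ('a \<Rightarrow> real \<Rightarrow> 'u) set" where
  "admissible M K \<tau> \<xi> T U =
     {u. (\<lambda>(\<omega>, t). u \<omega> t) \<in> predictable_sigma_upto M (mpp_filtration M K \<tau> \<xi>) T \<rightarrow>\<^sub>M U}"

definition control_density ::
  "(nat \<Rightarrow> 'a \<Rightarrow> ennreal) \<Rightarrow> (nat \<Rightarrow> 'a \<Rightarrow> 'k) \<Rightarrow> ('a \<Rightarrow> real \<Rightarrow> real) \<Rightarrow>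
   ('a \<Rightarrow> real \<Rightarrow> 'k measure) \<Rightarrow> ('a \<Rightarrow> real \<Rightarrow> 'k \<Rightarrow> 'u \<Rightarrow> real) \<Rightarrow>
   ('a \<Rightarrow> real \<Rightarrow> 'u) \<Rightarrow> 'a \<Rightarrow> real \<Rightarrow> real" where
  "control_density \<tau> \<xi> A \<phi> r u \<omega> t =
     exp (LINT s:{0<..t}|dA A \<omega>. (\<integral>y. 1 - r \<omega> s y (u \<omega> s) \<partial>\<phi> \<omega> s)) *
     (\<Prod>n\<in>{n. 1 \<le> n \<and> \<tau> n \<omega> \<le> ennreal t}.
        r \<omega> (enn2real (\<tau> n \<omega>)) (\<xi> n \<omega>) (u \<omega> (enn2real (\<tau> n \<omega>))))"

definition controlled_measure ::
  "'a measure \<Rightarrow> (nat \<Rightarrow> 'a \<Rightarrow> ennreal) \<Rightarrow> (nat \<Rightarrow> 'a \<Rightarrow> 'k) \<Rightarrow> ('a \<Rightarrow> real \<Rightarrow> real) \<Rightarrow>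
   ('a \<Rightarrow> real \<Rightarrow> 'k measure) \<Rightarrow> real \<Rightarrow> ('a \<Rightarrow> real \<Rightarrow> 'k \<Rightarrow> 'u \<Rightarrow> real) \<Rightarrow>
   ('a \<Rightarrow> real \<Rightarrow> 'u) \<Rightarrow> 'a measure" where
  "controlled_measure M \<tau> \<xi> A \<phi> T r u =
     density M (\<lambda>\<omega>. ennreal (control_density \<tau> \<xi> A \<phi> r u \<omega> T))"

definition cost ::
  "'a measure \<Rightarrow> (nat \<Rightarrow> 'a \<Rightarrow> ennreal) \<Rightarrow> (nat \<Rightarrow> 'a \<Rightarrow> 'k) \<Rightarrow> ('a \<Rightarrow> real \<Rightarrow> real) \<Rightarrow>
   ('a \<Rightarrow> real \<Rightarrow> 'k measure) \<Rightarrow> real \<Rightarrow> ('a \<Rightarrow> real \<Rightarrow> 'k \<Rightarrow> 'u \<Rightarrow> real) \<Rightarrow>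
   ('a \<Rightarrow> real \<Rightarrow> 'k \<Rightarrow> 'u \<Rightarrow> real) \<Rightarrow> ('a \<Rightarrow> 'k \<Rightarrow> real) \<Rightarrow> ('a \<Rightarrow> real \<Rightarrow> 'u) \<Rightarrow> real" where
  "cost M \<tau> \<xi> A \<phi> T r l g u =
     (\<integral>\<omega>. (LINT t:{0<..T}|dA A \<omega>. l \<omega> t (mark_process \<tau> \<xi> \<omega> t) (u \<omega> t)) +
          g \<omega> (mark_process \<tau> \<xi> \<omega> T) \<partial>controlled_measure M \<tau> \<xi> A \<phi> T r u)"

definition optimal_control ::
  "'a measure \<Rightarrow> 'k measure \<Rightarrow> (nat \<Rightarrow> 'a \<Rightarrow> ennreal) \<Rightarrow> (nat \<Rightarrow> 'a \<Rightarrow> 'k) \<Rightarrow> ('a \<Rightarrow> real \<Rightarrow> real) \<Rightarrow>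
   ('a \<Rightarrow> real \<Rightarrow> 'k measure) \<Rightarrow> real \<Rightarrow> 'u measure \<Rightarrow> ('a \<Rightarrow> real \<Rightarrow> 'k \<Rightarrow> 'u \<Rightarrow> real) \<Rightarrow>
   ('a \<Rightarrow> real \<Rightarrow> 'k \<Rightarrow> 'u \<Rightarrow> real) \<Rightarrow> ('a \<Rightarrow> 'k \<Rightarrow> real) \<Rightarrow> ('a \<Rightarrow> real \<Rightarrow> 'u) \<Rightarrow> bool" where
  "optimal_control M K \<tau> \<xi> A \<phi> T U r l g u \<longleftrightarrow>
     u \<in> admissible M K \<tau> \<xi> T U \<and>
     (\<forall>v\<in>admissible M K \<tau> \<xi> T U. cost M \<tau> \<xi> A \<phi> T r l g u \<le> cost M \<tau> \<xi> A \<phi> T r l g v)"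

text \<open>
  For \<open>z\<close> in \<open>\<L>\<^sup>1(K, \<phi>\<^sub>t(\<omega>,dy))\<close> and \<open>\<omega>\<close> outside the exceptional null set of the bounds on \<open>r\<close> and
  \<open>l\<close>, the infimum below is taken over a bounded set.
\<close>

definition hamiltonian ::
  "('a \<Rightarrow> real \<Rightarrow> 'k measure) \<Rightarrow> 'u measure \<Rightarrow> ('a \<Rightarrow> real \<Rightarrow> 'k \<Rightarrow> 'u \<Rightarrow> real) \<Rightarrow>
   ('a \<Rightarrow> real \<Rightarrow> 'k \<Rightarrow> 'u \<Rightarrow> real) \<Rightarrow> 'a \<Rightarrow> real \<Rightarrow> 'k \<Rightarrow> ('k \<Rightarrow> real) \<Rightarrow> real" where
  "hamiltonian \<phi> U r l \<omega> t x z =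
     (INF u\<in>space U. l \<omega> t x u + (\<integral>y. z y * (r \<omega> t y u - 1) \<partial>\<phi> \<omega> t))"

definition minimizing_control ::
  "'a measure \<Rightarrow> 'k measure \<Rightarrow> (nat \<Rightarrow> 'a \<Rightarrow> ennreal) \<Rightarrow> (nat \<Rightarrow> 'a \<Rightarrow> 'k) \<Rightarrow> ('a \<Rightarrow> real \<Rightarrow> real) \<Rightarrow>
   ('a \<Rightarrow> real \<Rightarrow> 'k measure) \<Rightarrow> real \<Rightarrow> 'u measure \<Rightarrow> ('a \<Rightarrow> real \<Rightarrow> 'k \<Rightarrow> 'u \<Rightarrow> real) \<Rightarrow>
   ('a \<Rightarrow> real \<Rightarrow> 'k \<Rightarrow> 'u \<Rightarrow> real) \<Rightarrow> ('a \<Rightarrow> real \<Rightarrow> 'k \<Rightarrow> real) \<Rightarrow> ('a \<Rightarrow> real \<Rightarrow> 'u) \<Rightarrow> bool" where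
  "minimizing_control M K \<tau> \<xi> A \<phi> T U r l Z u \<longleftrightarrow>
     u \<in> admissible M K \<tau> \<xi> T U \<and>
     (AE (\<omega>, t) in dA_dP M A. t \<in> {0..T} \<longrightarrow>
        hamiltonian \<phi> U r l \<omega> t (mark_process_left \<tau> \<xi> \<omega> t) (Z \<omega> t) =
        l \<omega> t (mark_process_left \<tau> \<xi> \<omega> t) (u \<omega> t) +
        (\<integral>y. Z \<omega> t y * (r \<omega> t y (u \<omega> t) - 1) \<partial>\<phi> \<omega> t))"

definition hypothesis_S ::
  "'a measure \<Rightarrow> 'k measure \<Rightarrow> (nat \<Rightarrow> 'a \<Rightarrow> ennreal) \<Rightarrow> (nat \<Rightarrow> 'a \<Rightarrow> 'k) \<Rightarrow> ('a \<Rightarrow> real \<Rightarrow> real) \<Rightarrow>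
   ('a \<Rightarrow> real \<Rightarrow> 'k measure) \<Rightarrow> real \<Rightarrow> 'u measure \<Rightarrow> ('a \<Rightarrow> real \<Rightarrow> 'k \<Rightarrow> 'u \<Rightarrow> real) \<Rightarrow>
   ('a \<Rightarrow> real \<Rightarrow> 'k \<Rightarrow> 'u \<Rightarrow> real) \<Rightarrow> bool" where
  "hypothesis_S M K \<tau> \<xi> A \<phi> T U r l \<longleftrightarrow>
     (\<forall>Z\<in>L10 M K \<tau> \<xi> A \<phi> T. \<exists>u. minimizing_control M K \<tau> \<xi> A \<phi> T U r l Z u)"

text \<open>
  The hamiltonian is an infimum over a possibly uncountable set, so along a path it agrees only
  \<open>dA\<close>-almost everywhere with a Borel function of time. The generator is therefore integrated
  against the completion of \<open>dA\<close>; for Borel integrands this is the integral against \<open>dA\<close>.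
\<close>

definition bsde_solution ::
  "'a measure \<Rightarrow> 'k measure \<Rightarrow> (nat \<Rightarrow> 'a \<Rightarrow> ennreal) \<Rightarrow> (nat \<Rightarrow> 'a \<Rightarrow> 'k) \<Rightarrow> ('a \<Rightarrow> real \<Rightarrow> real) \<Rightarrow>
   ('a \<Rightarrow> real \<Rightarrow> 'k measure) \<Rightarrow> real \<Rightarrow> ('a \<Rightarrow> 'k \<Rightarrow> real) \<Rightarrow>
   ('a \<Rightarrow> real \<Rightarrow> 'k \<Rightarrow> ('k \<Rightarrow> real) \<Rightarrow> real) \<Rightarrow>
   ('a \<Rightarrow> real \<Rightarrow> real) \<Rightarrow> ('a \<Rightarrow> real \<Rightarrow> 'k \<Rightarrow> real) \<Rightarrow> bool" where
  "bsde_solution M K \<tau> \<xi> A \<phi> T g f Y Z \<longleftrightarrow>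
     (\<forall>t\<in>{0..T}. AE \<omega> in M.
        Y \<omega> t + q_integral K \<tau> \<xi> A \<phi> Z t T \<omega> =
        g \<omega> (mark_process \<tau> \<xi> \<omega> T) +
        (LINT s:{t<..T}|completion (dA A \<omega>). f \<omega> s (mark_process \<tau> \<xi> \<omega> s) (Z \<omega> s)))"

end

theory Submission
  imports Defs
begin

text \<open>
  For a bounded predictable field \<open>R\<close>, the exponential \<open>L\<close> with jump factors \<open>R(T\<^sub>n, \<xi>\<^sub>n)\<close> solves a linear
  integral equation along each path; taking expectations with the compensator formula gives
  \<open>E L\<^sub>T = 1\<close>. A truncated constant \<open>R\<close> bounds the exponential moments of \<open>N\<^sub>T\<close>, hence \<open>sup L\<close> in \<open>L\<^sup>2\<close>.
  Differentiating \<open>E L\<^sub>T(R(1 - \<epsilon>h)) = 1\<close> at \<open>\<epsilon> = 0\<close> shows that under \<open>L\<^sub>T P\<close> the compensator of \<open>p\<close> is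
  \<open>R \<phi> dA\<close>. Integrating the BSDE under the measure of a control \<open>u\<close> therefore expresses \<open>J(u) - Y\<^sub>0\<close> as
  the mean of the integral of a gap that is nonnegative by the definition of the hamiltonian
  as an infimum, and that vanishes for the minimizing control. \<open>Y\<^sub>0\<close> is a constant since \<open>F\<^sub>0\<close> is trivial.
\<close>

section \<open>Integration along a continuous path\<close>

text \<open>The probabilistic input is the compensator identity for nonnegative predictable
  integrands. So every integrand must first be shown predictable, and sums stay in
  \<open>ennreal\<close> until finiteness permits subtraction. There is a circle to break: mean 1 of
  \<open>L\<close> needs an integrable majorant, hence moments of \<open>N_T\<close>, and these come
  from exponentials of mean 1. Exponentials whose factor is 1 after \<open>k\<close> jumps are
  bounded by a constant before each jump and start the argument. The constant \<open>3 + C^4\<close>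
  comes from splitting \<open>(C^N e^A)^2\<close> into two factors: the square of one is
  \<open>(C^4)^N e^(-(C^4-1)A)\<close>, of mean at most 1, and the square of the other is
  \<open>e^((3+C^4)A)\<close>. Paths of \<open>A\<close> are only continuous and increasing, so the
  chain rule for \<open>exp\<close> compares increments to second order in \<open>A\<close> instead
  of differentiating in time. The hamiltonian is an infimum over a possibly uncountable set and is
  not known to be predictable; the gap is therefore measured from the integrand at the minimizing
  control, which is predictable and agrees with the hamiltonian \<open>dA\<close>-almost
  everywhere.\<close>

lemma constant_if_quadratic_increments:
  fixes f a :: "real \<Rightarrow> real"
  assumes "x \<le> y" and a: "continuous_on {x..y} a" "mono_on {x..y} a"
    and f: "\<And>s t. x \<le> s \<Longrightarrow> s \<le> t \<Longrightarrow> t \<le> y \<Longrightarrow> \<bar>f t - f s\<bar> \<le> C * (a t - a s)\<^sup>2"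
  shows "f y = f x"
proof -
  have f': "\<bar>f t - f s\<bar> \<le> C * (a t - a s)\<^sup>2" if "s \<in> {x..y}" "t \<in> {x..y}" for s t
    using f[of s t] f[of t s] that by (cases "s \<le> t") (auto simp: abs_minus_commute power2_commute)
  \<comment> \<open>\<open>h\<close> is \<open>f\<close> read in the variable \<open>a t\<close>. As
    \<open>a\<close> need not be strictly increasing, a preimage is chosen; by \<open>f'\<close> two
    times with the same value of \<open>a\<close> have the same value of \<open>f\<close>, so the
    choice does not matter.\<close>
  define h where "h v = f (SOME t. t \<in> {x..y} \<and> a t = v)" for v
  have h: "\<exists>t\<in>{x..y}. a t = v \<and> h v = f t" if "v \<in> {a x..a y}" for v
  proof -
    have "\<exists>t. t \<in> {x..y} \<and> a t = v"
      using IVT'[of a x v y] that a \<open>x \<le> y\<close> by auto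
    from someI_ex[OF this] show ?thesis unfolding h_def by blast
  qed
  have h_eq: "h (a t) = f t" if "t \<in> {x..y}" for t
  proof -
    have "a t \<in> {a x..a y}" using a(2) that by (auto simp: monotone_on_def)
    then obtain t' where "t' \<in> {x..y}" "a t' = a t" "h (a t) = f t'" using h by blast
    then show ?thesis using f'[of t' t] that by simp
  qed
  have h_quad: "\<bar>h v - h w\<bar> \<le> C * (v - w)\<^sup>2" if "v \<in> {a x..a y}" "w \<in> {a x..a y}" for v w
    using h[OF that(1)] h[OF that(2)] f' by metis
  \<comment> \<open>The difference quotients of \<open>h\<close> are at most
    \<open>\<bar>C\<bar> * \<bar>w - v\<bar>\<close>, hence tend to 0.\<close>
  have "(h has_field_derivative 0) (at v within {a x..a y})" if v: "v \<in> {a x..a y}" for v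
  proof -
    have "((\<lambda>w. (h w - h v) / (w - v)) \<longlongrightarrow> 0) (at v within {a x..a y})"
    proof (rule Lim_null_comparison)
      show "\<forall>\<^sub>F w in at v within {a x..a y}. norm ((h w - h v) / (w - v)) \<le> \<bar>C\<bar> * \<bar>w - v\<bar>"
        unfolding eventually_at_filter
      proof (intro always_eventually allI impI)
        fix w assume w: "w \<noteq> v" "w \<in> {a x..a y}"
        have "\<bar>h w - h v\<bar> \<le> C * (w - v)\<^sup>2" by (rule h_quad[OF w(2) v])
        also have "\<dots> \<le> \<bar>C\<bar> * (w - v)\<^sup>2" by (intro mult_right_mono) auto
        also have "\<dots> = \<bar>C\<bar> * \<bar>w - v\<bar> * \<bar>w - v\<bar>" by (metis abs_mult_self_eq mult.assoc power2_eq_square)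
        finally show "norm ((h w - h v) / (w - v)) \<le> \<bar>C\<bar> * \<bar>w - v\<bar>"
          using w by (simp add: pos_divide_le_eq)
      qed
      have "((\<lambda>w. \<bar>C\<bar> * \<bar>w - v\<bar>) \<longlongrightarrow> \<bar>C\<bar> * \<bar>v - v\<bar>) (at v within {a x..a y})"
        by (intro tendsto_intros)
      then show "((\<lambda>w. \<bar>C\<bar> * \<bar>w - v\<bar>) \<longlongrightarrow> 0) (at v within {a x..a y})" by simp
    qed
    then show ?thesis by (simp add: has_field_derivative_iff)
  qed
  then obtain c where "\<And>v. v \<in> {a x..a y} \<Longrightarrow> h v = c"
    using has_field_derivative_zero_constant[of "{a x..a y}" h] by auto
  moreover have "a x \<le> a y" using a(2) \<open>x \<le> y\<close> by (auto simp: monotone_on_def)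
  ultimately show ?thesis using h_eq[of x] h_eq[of y] \<open>x \<le> y\<close> by auto
qed

text \<open>Both parts rest on the tangent inequality
  \<open>exp u - exp v \<le> exp u * (u - v)\<close>. It makes the remainder in the second part
  nonnegative and at most \<open>(exp x - exp y) * (x - y)\<close>, to which the first part
  applies.\<close>

lemma exp_quadratic_remainder:
  fixes x y :: real
  assumes "\<bar>x\<bar> \<le> m" "\<bar>y\<bar> \<le> m"
  shows "\<bar>exp x - exp y\<bar> \<le> exp m * \<bar>x - y\<bar>"
    and "\<bar>exp x - exp y - exp y * (x - y)\<bar> \<le> exp m * (x - y)\<^sup>2"
proof -
  have le: "exp u - exp v \<le> exp u * (u - v)" for u v :: real
  proof -
    have "exp u * (1 + (v - u)) \<le> exp u * exp (v - u)" by (intro mult_left_mono exp_ge_add_one_self) auto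
    then show ?thesis by (simp add: exp_diff algebra_simps)
  qed
  have lip: "\<bar>exp u - exp v\<bar> \<le> exp m * \<bar>u - v\<bar>" if "u \<le> m" "v \<le> m" for u v :: real
  proof -
    have *: "exp w * \<bar>u - v\<bar> \<le> exp m * \<bar>u - v\<bar>" if "w \<le> m" for w
      using that by (intro mult_right_mono) auto
    have "exp u * (u - v) \<le> exp u * \<bar>u - v\<bar>" "exp v * (v - u) \<le> exp v * \<bar>u - v\<bar>"
      by (intro mult_left_mono; simp)+
    then show ?thesis using le[of u v] le[of v u] *[of u] *[of v] that by linarith
  qed
  show "\<bar>exp x - exp y\<bar> \<le> exp m * \<bar>x - y\<bar>" using lip assms by auto
  have "exp x - exp y - exp y * (x - y) \<ge> 0" using le[of y x] by (simp add: algebra_simps)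
  moreover have "exp x - exp y - exp y * (x - y) \<le> (exp x - exp y) * (x - y)"
    using le[of x y] by (simp add: algebra_simps)
  moreover have "(exp x - exp y) * (x - y) \<le> exp m * \<bar>x - y\<bar> * \<bar>x - y\<bar>"
  proof -
    have "(exp x - exp y) * (x - y) \<le> \<bar>exp x - exp y\<bar> * \<bar>x - y\<bar>"
      by (metis abs_ge_self abs_mult)
    also have "\<dots> \<le> exp m * \<bar>x - y\<bar> * \<bar>x - y\<bar>" using lip assms by (intro mult_right_mono) auto
    finally show ?thesis .
  qed
  moreover have "\<bar>x - y\<bar> * \<bar>x - y\<bar> = (x - y)\<^sup>2" by (simp add: power2_eq_square abs_mult[symmetric])
  ultimately show "\<bar>exp x - exp y - exp y * (x - y)\<bar> \<le> exp m * (x - y)\<^sup>2"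
    by (simp add: mult.assoc)
qed

section \<open>Stieltjes calculus along one continuous increasing path\<close>

locale continuous_path =
  fixes \<mu> :: "real measure" and a :: "real \<Rightarrow> real"
  assumes sets_\<mu>[measurable_cong]: "sets \<mu> = sets borel"
    and path_0: "a 0 = 0"
    and path_mono: "mono_on {0..} a"
    and path_continuous: "continuous_on {0..} a"
    and emeasure_Ioc: "\<And>s t. 0 \<le> s \<Longrightarrow> s \<le> t \<Longrightarrow> emeasure \<mu> {s<..t} = ennreal (a t - a s)"
begin

lemma path_le: "0 \<le> s \<Longrightarrow> s \<le> t \<Longrightarrow> a s \<le> a t"
  using path_mono by (auto simp: monotone_on_def)

lemma path_nonneg: "0 \<le> t \<Longrightarrow> 0 \<le> a t"
  using path_le[of 0 t] path_0 by simp

lemma measure_Ioc: "0 \<le> s \<Longrightarrow> s \<le> t \<Longrightarrow> measure \<mu> {s<..t} = a t - a s"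
  using emeasure_Ioc[of s t] path_le[of s t] by (simp add: measure_def)

text \<open>Measurability and the bound are asked only on \<open>{s<..t}\<close>: the locale fixes
  \<open>\<mu>\<close> on intervals of the positive half-line, and integrands such as
  \<open>exp (primitive v)\<close> are controlled only there.\<close>

lemma bounded_set_integrable:
  fixes f :: "real \<Rightarrow> real"
  assumes "set_borel_measurable borel {s<..t} f" "0 \<le> s" "\<And>v. s < v \<Longrightarrow> v \<le> t \<Longrightarrow> \<bar>f v\<bar> \<le> C"
  shows "set_integrable \<mu> {s<..t} f"
proof (cases "s \<le> t")
  case True
  have m: "(\<lambda>v. indicator {s<..t} v *\<^sub>R f v) \<in> borel_measurable \<mu>"
    using assms(1) by (simp add: set_borel_measurable_def measurable_cong_sets[OF sets_\<mu> refl])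
  have "integrable \<mu> (\<lambda>v. indicator {s<..t} v *\<^sub>R \<bar>C\<bar>)"
    using emeasure_Ioc[OF assms(2) True] by (intro integrable_scaleR_left integrable_real_indicator) auto
  then show ?thesis
    unfolding set_integrable_def
  proof (rule Bochner_Integration.integrable_bound[OF _ m])
    show "AE v in \<mu>. norm (indicator {s<..t} v *\<^sub>R f v) \<le> norm (indicator {s<..t} v *\<^sub>R \<bar>C\<bar>)"
      using assms(3) by (intro always_eventually) (force simp: indicator_def)
  qed
qed (simp add: set_integrable_def)

lemma abs_set_integral_le:
  fixes f :: "real \<Rightarrow> real"
  assumes "set_borel_measurable borel {s<..t} f" "0 \<le> s" "s \<le> t"
    and "\<And>v. s < v \<Longrightarrow> v \<le> t \<Longrightarrow> \<bar>f v\<bar> \<le> C"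
  shows "\<bar>LINT v:{s<..t}|\<mu>. f v\<bar> \<le> C * (a t - a s)"
proof -
  note i = bounded_set_integrable[OF assms(1,2,4)]
  have "\<bar>LINT v:{s<..t}|\<mu>. f v\<bar> \<le> (LINT v:{s<..t}|\<mu>. \<bar>f v\<bar>)"
    unfolding set_lebesgue_integral_def
    by (rule order_trans[OF integral_abs_bound]) (simp add: abs_mult)
  also have "\<dots> \<le> (LINT v:{s<..t}|\<mu>. C)"
    using i assms emeasure_Ioc[of s t]
    by (intro set_integral_mono set_integrable_abs) (auto simp: set_integrable_def)
  also have "\<dots> = C * (a t - a s)"
    using emeasure_Ioc[of s t] measure_Ioc[of s t] assms
    by (simp add: set_lebesgue_integral_def sets_\<mu>)
  finally show ?thesis .
qed

lemma set_integral_Ioc_split: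
  fixes f :: "real \<Rightarrow> real"
  assumes "set_integrable \<mu> {0<..t} f" "0 \<le> s" "s \<le> t"
  shows "(LINT v:{0<..t}|\<mu>. f v) = (LINT v:{0<..s}|\<mu>. f v) + (LINT v:{s<..t}|\<mu>. f v)"
proof -
  have "{0<..t} = {0<..s} \<union> {s<..t}" using assms by auto
  moreover have "set_integrable \<mu> {0<..s} f" "set_integrable \<mu> {s<..t} f"
    using assms by (auto intro!: set_integrable_subset[OF assms(1)] simp: sets_\<mu>)
  ultimately show ?thesis by (metis set_integral_Un ivl_disj_int_two(6))
qed

context
  fixes b :: "real \<Rightarrow> real" and C :: real
  assumes b_measurable: "b \<in> borel_measurable borel" and b_bounded: "\<And>t. \<bar>b t\<bar> \<le> C"
begin

definition primitive :: "real \<Rightarrow> real" where "primitive t = (LINT v:{0<..t}|\<mu>. b v)"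

lemma b_integrable: "0 \<le> s \<Longrightarrow> set_integrable \<mu> {s<..t} b"
  using b_measurable b_bounded by (intro bounded_set_integrable) (auto simp: set_borel_measurable_def)

lemma primitive_diff: "0 \<le> s \<Longrightarrow> s \<le> t \<Longrightarrow> primitive t - primitive s = (LINT v:{s<..t}|\<mu>. b v)"
  unfolding primitive_def using set_integral_Ioc_split[OF b_integrable, of s t] by simp

lemma primitive_lipschitz: "0 \<le> s \<Longrightarrow> s \<le> t \<Longrightarrow> \<bar>primitive t - primitive s\<bar> \<le> C * (a t - a s)"
  unfolding primitive_diff using b_measurable b_bounded
  by (intro abs_set_integral_le) (auto simp: set_borel_measurable_def)

lemma primitive_0: "primitive 0 = 0"
  by (simp add: primitive_def set_lebesgue_integral_def)

lemma primitive_bounded: "0 \<le> t \<Longrightarrow> t \<le> T \<Longrightarrow> \<bar>primitive t\<bar> \<le> C * a T"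
  using primitive_lipschitz[of 0 t] primitive_0 path_0 path_le[of t T] b_bounded[of 0]
  by (smt (verit) mult_left_mono)

text \<open>The Lipschitz bound is with respect to \<open>a\<close>, so continuity is inherited from
  \<open>a\<close>.\<close>

lemma primitive_continuous: "continuous_on {0..} primitive"
proof -
  have *: "\<bar>primitive t - primitive s\<bar> \<le> C * \<bar>a t - a s\<bar>" if "0 \<le> s" "0 \<le> t" for s t
    using primitive_lipschitz[of s t] primitive_lipschitz[of t s] path_le[of s t] path_le[of t s] that
    by (cases "s \<le> t") (auto simp: abs_minus_commute)
  show ?thesis
    unfolding continuous_on_def
  proof
    fix s :: real assume s: "s \<in> {0..}"
    have "((\<lambda>t. C * \<bar>a t - a s\<bar>) \<longlongrightarrow> C * \<bar>a s - a s\<bar>) (at s within {0..})"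
      using path_continuous s by (intro tendsto_intros) (auto simp: continuous_on_def)
    then have "((\<lambda>t. C * \<bar>a t - a s\<bar>) \<longlongrightarrow> 0) (at s within {0..})" by simp
    moreover have "\<forall>\<^sub>F t in at s within {0..}. norm (primitive t - primitive s) \<le> C * \<bar>a t - a s\<bar>"
      using * s by (simp add: eventually_at_filter)
    ultimately have "((\<lambda>t. primitive t - primitive s) \<longlongrightarrow> 0) (at s within {0..})"
      by (rule Lim_null_comparison[rotated])
    then show "(primitive \<longlongrightarrow> primitive s) (at s within {0..})" by (rule LIM_zero_cancel)
  qed
qed

lemma exp_primitive_measurable:
  "0 \<le> s \<Longrightarrow> set_borel_measurable borel {s<..t} (\<lambda>v. exp (primitive v))"
  unfolding set_borel_measurable_def
  by (intro borel_measurable_continuous_on_indicator continuous_on_exp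
      continuous_on_subset[OF primitive_continuous]) auto

lemma exp_primitive_b_measurable:
  "0 \<le> s \<Longrightarrow> set_borel_measurable borel {s<..t} (\<lambda>v. exp (primitive v) * b v)"
  using borel_measurable_times[OF exp_primitive_measurable[of s t, unfolded set_borel_measurable_def] b_measurable]
  by (simp add: set_borel_measurable_def mult.assoc)

lemma exp_primitive_b_bound:
  "0 \<le> t \<Longrightarrow> t \<le> T \<Longrightarrow> \<bar>exp (primitive t) * b t\<bar> \<le> exp (C * a T) * C"
  using primitive_bounded[of t T] b_bounded[of t]
  by (subst abs_mult) (intro mult_mono, auto)

lemma exp_primitive_b_integrable:
  "0 \<le> s \<Longrightarrow> set_integrable \<mu> {s<..t} (\<lambda>v. exp (primitive v) * b v)"
  by (rule bounded_set_integrable[OF exp_primitive_b_measurable, of s t "exp (C * a t) * C"])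
     (auto intro!: exp_primitive_b_bound)

text \<open>Chain rule for a path that need not be differentiable or absolutely continuous in time.
  The defect \<open>h\<close> has increments of second order in \<open>a\<close>: the remainder of
  \<open>exp\<close> contributes \<open>exp m * C\<^sup>2 * (a w - a v)\<^sup>2\<close>, and
  freezing the integrand at the left end point contributes the same amount again. Hence
  \<open>h\<close> is constant.\<close>

lemma exp_primitive_eq:
  assumes "0 \<le> s" "s \<le> t"
  shows "exp (primitive t) - exp (primitive s) = (LINT v:{s<..t}|\<mu>. exp (primitive v) * b v)"
proof -
  define m where "m = C * a t"
  define h where "h v = exp (primitive v) - (LINT w:{0<..v}|\<mu>. exp (primitive w) * b w)" for v
  have C: "0 \<le> C" using b_bounded[of 0] by simp
  have m: "\<bar>primitive v\<bar> \<le> m" if "0 \<le> v" "v \<le> t" for v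
    unfolding m_def by (rule primitive_bounded[OF that])
  have "\<bar>h w - h v\<bar> \<le> (2 * exp m * C\<^sup>2) * (a w - a v)\<^sup>2" if vw: "s \<le> v" "v \<le> w" "w \<le> t" for v w
  proof -
    let ?d = "primitive w - primitive v"
    have vw': "0 \<le> v" "0 \<le> w" using vw assms by auto
    have d: "\<bar>?d\<bar> \<le> C * (a w - a v)" by (rule primitive_lipschitz[OF vw'(1) vw(2)])
    have i1: "set_integrable \<mu> {v<..w} (\<lambda>x. exp (primitive x) * b x)"
      by (rule exp_primitive_b_integrable[OF vw'(1)])
    have i2: "set_integrable \<mu> {v<..w} (\<lambda>x. exp (primitive v) * b x)"
      using b_integrable[OF vw'(1), of w] by simp
    have "h w - h v = exp (primitive w) - exp (primitive v) - (LINT x:{v<..w}|\<mu>. exp (primitive x) * b x)"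
      unfolding h_def using set_integral_Ioc_split[OF exp_primitive_b_integrable[of 0 w] vw'(1) vw(2)] by simp
    also have "(LINT x:{v<..w}|\<mu>. exp (primitive x) * b x) =
       (LINT x:{v<..w}|\<mu>. (exp (primitive x) - exp (primitive v)) * b x) + exp (primitive v) * ?d"
      using set_integral_diff(2)[OF i1 i2] primitive_diff[OF vw'(1) vw(2)] by (simp add: left_diff_distrib)
    finally have eq: "h w - h v = (exp (primitive w) - exp (primitive v) - exp (primitive v) * ?d)
       - (LINT x:{v<..w}|\<mu>. (exp (primitive x) - exp (primitive v)) * b x)" by simp
    have "\<bar>LINT x:{v<..w}|\<mu>. (exp (primitive x) - exp (primitive v)) * b x\<bar>
        \<le> (exp m * (C * (a w - a v)) * C) * (a w - a v)"
    proof (rule abs_set_integral_le[OF _ vw'(1) vw(2)])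
      show "set_borel_measurable borel {v<..w} (\<lambda>x. (exp (primitive x) - exp (primitive v)) * b x)"
        using borel_measurable_diff[OF exp_primitive_b_measurable[OF vw'(1), of w, unfolded set_borel_measurable_def],
            of "\<lambda>x. indicator {v<..w} x *\<^sub>R (exp (primitive v) * b x)"] b_measurable
        by (simp add: set_borel_measurable_def algebra_simps)
    next
      fix x assume x: "v < x" "x \<le> w"
      have "\<bar>exp (primitive x) - exp (primitive v)\<bar> \<le> exp m * \<bar>primitive x - primitive v\<bar>"
        using x vw vw' by (intro exp_quadratic_remainder m) auto
      also have "\<bar>primitive x - primitive v\<bar> \<le> C * (a x - a v)"
        using primitive_lipschitz[of v x] x vw' by auto
      also have "\<dots> \<le> C * (a w - a v)"
        using path_le[of x w] x vw' C by (intro mult_left_mono) auto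
      finally have "\<bar>exp (primitive x) - exp (primitive v)\<bar> \<le> exp m * (C * (a w - a v))" by simp
      then show "\<bar>(exp (primitive x) - exp (primitive v)) * b x\<bar> \<le> exp m * (C * (a w - a v)) * C"
        unfolding abs_mult using b_bounded[of x] C path_le[of v w] vw vw' by (intro mult_mono) auto
    qed
    moreover have "\<bar>exp (primitive w) - exp (primitive v) - exp (primitive v) * ?d\<bar> \<le> exp m * ?d\<^sup>2"
      using vw vw' by (intro exp_quadratic_remainder m) auto
    moreover have "?d\<^sup>2 \<le> (C * (a w - a v))\<^sup>2" using d by (simp add: abs_le_square_iff[symmetric])
    then have "exp m * ?d\<^sup>2 \<le> exp m * (C * (a w - a v))\<^sup>2" by simp
    moreover have "exp m * (C * (a w - a v))\<^sup>2 = exp m * C\<^sup>2 * (a w - a v)\<^sup>2"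
      by (simp add: power_mult_distrib)
    moreover have "(exp m * (C * (a w - a v)) * C) * (a w - a v) = exp m * C\<^sup>2 * (a w - a v)\<^sup>2"
      by (simp add: power2_eq_square algebra_simps)
    ultimately have "\<bar>h w - h v\<bar> \<le> exp m * C\<^sup>2 * (a w - a v)\<^sup>2 + exp m * C\<^sup>2 * (a w - a v)\<^sup>2"
      unfolding eq by (smt (verit))
    then show ?thesis by simp
  qed
  then have "h t = h s"
    using assms by (intro constant_if_quadratic_increments[of s t a])
       (auto intro: continuous_on_subset[OF path_continuous] monotone_on_subset[OF path_mono])
  then show ?thesis
    using set_integral_Ioc_split[OF exp_primitive_b_integrable[of 0 t] assms] by (simp add: h_def)
qed

end

end

section \<open>Jump times and jump products along one path\<close>

definition jumps_upto :: "(nat \<Rightarrow> ennreal) \<Rightarrow> ennreal \<Rightarrow> nat set" where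
  "jumps_upto \<theta> s = {n. 1 \<le> n \<and> \<theta> n \<le> s}"

definition jumps_before :: "(nat \<Rightarrow> ennreal) \<Rightarrow> ennreal \<Rightarrow> nat set" where
  "jumps_before \<theta> s = {n. 1 \<le> n \<and> \<theta> n < s}"

locale jump_times =
  fixes \<theta> :: "nat \<Rightarrow> ennreal"
  assumes start: "\<theta> 0 = 0"
    and increasing: "\<And>n. \<theta> n < \<infinity> \<Longrightarrow> \<theta> n < \<theta> (Suc n)"
    and stays_infinite: "\<And>n. \<theta> n = \<infinity> \<Longrightarrow> \<theta> (Suc n) = \<infinity>"
    and tends_to_infinity: "\<theta> \<longlonglongrightarrow> \<infinity>"
begin

lemma mono_times: "i \<le> j \<Longrightarrow> \<theta> i \<le> \<theta> j"
proof (induction rule: dec_induct)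
  case (step n)
  have "\<theta> n \<le> \<theta> (Suc n)"
    using increasing[of n] stays_infinite[of n] by (cases "\<theta> n = \<infinity>") (auto simp: less_top)
  with step show ?case by simp
qed simp

lemma strict_mono_times: "i < j \<Longrightarrow> \<theta> i < \<infinity> \<Longrightarrow> \<theta> i < \<theta> j"
  using increasing[of i] mono_times[of "Suc i" j] by (meson Suc_leI less_le_trans)

lemma times_pos: "1 \<le> n \<Longrightarrow> 0 < \<theta> n"
  using strict_mono_times[of 0 n] start by simp

lemma exceeds: "s < \<infinity> \<Longrightarrow> \<exists>n. s < \<theta> n"
  using order_tendstoD(1)[OF tends_to_infinity, of s] by (auto simp: eventually_sequentially)

lemma bracket:
  assumes "s < \<infinity>"
  obtains m where "\<theta> m \<le> s" "s < \<theta> (Suc m)"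
proof -
  define n where "n = (LEAST n. s < \<theta> n)"
  have n: "s < \<theta> n" unfolding n_def using exceeds[OF assms] by (rule LeastI_ex)
  then obtain m where m: "n = Suc m" using start by (cases n) auto
  then have "\<not> s < \<theta> m" unfolding n_def by (intro not_less_Least) simp
  with n m that[of m] show thesis by auto
qed

text \<open>The interval is closed on the right here, so when \<open>s\<close> is itself a jump time
  the index is one less than the one given by \<open>bracket\<close>.\<close>

lemma bracket_left:
  assumes "0 < s" "s < \<infinity>"
  obtains m where "\<theta> m < s" "s \<le> \<theta> (Suc m)"
proof -
  obtain k where k: "\<theta> k \<le> s" "s < \<theta> (Suc k)" using bracket[OF assms(2)] by blast
  show thesis
  proof (cases "\<theta> k = s")
    case True
    then obtain m where m: "k = Suc m" using start assms by (cases k) auto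
    have "\<theta> m < \<infinity>" using True assms mono_times[of m k] m by (simp add: order_le_less_trans)
    then show thesis using that[of m] increasing[of m] True m by auto
  qed (use that[of k] k in auto)
qed

lemma jumps_upto_eq: "\<theta> m \<le> s \<Longrightarrow> s < \<theta> (Suc m) \<Longrightarrow> jumps_upto \<theta> s = {1..m}"
proof -
  assume m: "\<theta> m \<le> s" "s < \<theta> (Suc m)"
  have le: "\<theta> n \<le> s" if "n \<le> m" for n
    using that m(1) mono_times[of n m] order_trans by blast
  have gt: "\<not> \<theta> n \<le> s" if "Suc m \<le> n" for n
    using that m(2) mono_times[of "Suc m" n] by (meson leD less_le_trans)
  have "\<theta> n \<le> s \<longleftrightarrow> n \<le> m" for n
    using le[of n] gt[of n] not_less_eq_eq by blast
  then show ?thesis unfolding jumps_upto_def atLeastAtMost_def atLeast_def atMost_def by blast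
qed

lemma jumps_before_eq: "\<theta> m < s \<Longrightarrow> s \<le> \<theta> (Suc m) \<Longrightarrow> jumps_before \<theta> s = {1..m}"
proof -
  assume m: "\<theta> m < s" "s \<le> \<theta> (Suc m)"
  have le: "\<theta> n < s" if "n \<le> m" for n
    using that m(1) mono_times[of n m] le_less_trans by blast
  have gt: "\<not> \<theta> n < s" if "Suc m \<le> n" for n
    using that m(2) mono_times[of "Suc m" n] by (meson leD order_trans)
  have "\<theta> n < s \<longleftrightarrow> n \<le> m" for n
    using le[of n] gt[of n] not_less_eq_eq by blast
  then show ?thesis unfolding jumps_before_def atLeastAtMost_def atLeast_def atMost_def by blast
qed

lemma jumps_before_time:
  assumes "1 \<le> n" "\<theta> n < \<infinity>"
  shows "jumps_before \<theta> (\<theta> n) = {1..n - 1}"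
proof (rule jumps_before_eq)
  have "\<theta> (n - 1) < \<infinity>" using mono_times[of "n - 1" n] assms by (simp add: order_le_less_trans)
  then show "\<theta> (n - 1) < \<theta> n" using assms by (intro strict_mono_times) auto
  show "\<theta> n \<le> \<theta> (Suc (n - 1))" using assms by simp
qed

lemma finite_jumps_upto: "s < \<infinity> \<Longrightarrow> finite (jumps_upto \<theta> s)"
  using bracket[of s] jumps_upto_eq by (metis finite_atLeastAtMost)

lemma jumps_before_subset: "jumps_before \<theta> s \<subseteq> jumps_upto \<theta> s"
  by (auto simp: jumps_before_def jumps_upto_def)

lemma finite_jumps_before: "s < \<infinity> \<Longrightarrow> finite (jumps_before \<theta> s)"
  using finite_jumps_upto jumps_before_subset finite_subset by blast

end

text \<open>Induction on the number of jumps. Between two jumps \<open>D\<close> is constant and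
  \<open>exp_primitive_eq\<close> gives the increment; at the \<open>n\<close>-th jump the product
  gains the factor \<open>\<rho> n\<close>, which adds
  \<open>E * D * (\<rho> n - 1)\<close>.\<close>

lemma (in continuous_path) exp_primitive_jumps:
  fixes \<rho> :: "nat \<Rightarrow> real"
  assumes b: "b \<in> borel_measurable borel" "\<And>t. \<bar>b t\<bar> \<le> C" and \<theta>: "jump_times \<theta>" and "0 \<le> T"
  defines "E \<equiv> (\<lambda>t. exp (primitive b t))"
    and "D \<equiv> (\<lambda>s. \<Prod>i\<in>jumps_before \<theta> s. \<rho> i)"
  shows "set_integrable \<mu> {0<..T} (\<lambda>s. E s * D (ennreal s) * b s)"
    and "E T * (\<Prod>n\<in>jumps_upto \<theta> (ennreal T). \<rho> n) = 1
      + (\<Sum>n\<in>jumps_upto \<theta> (ennreal T). E (enn2real (\<theta> n)) * D (\<theta> n) * (\<rho> n - 1))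
      + (LINT s:{0<..T}|\<mu>. E s * D (ennreal s) * b s)"
proof -
  interpret jump_times \<theta> by fact
  define P where "P m = (\<Prod>i\<in>{1..m}. \<rho> i)" for m
  define t where "t n = enn2real (\<theta> n)" for n
  have t: "\<theta> n = ennreal (t n)" if "\<theta> n < \<infinity>" for n using that by (simp add: t_def less_top)
  have t0: "0 \<le> t n" for n by (simp add: t_def)
  have D: "D (ennreal s) = P m" if "\<theta> m < ennreal s" "ennreal s \<le> \<theta> (Suc m)" for s m
    using jumps_before_eq[OF that] by (simp add: D_def P_def)
  have piece: "set_integrable \<mu> {t m<..s} (\<lambda>v. E v * D (ennreal v) * b v) \<and>
      (LINT v:{t m<..s}|\<mu>. E v * D (ennreal v) * b v) = P m * (E s - E (t m))"
    if "\<theta> m \<le> ennreal s" "ennreal s \<le> \<theta> (Suc m)" "0 \<le> s" for m s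
  proof -
    have fin: "\<theta> m < \<infinity>" using that(1) by (simp add: order_le_less_trans)
    have tm: "t m \<le> s" using that(1,3) t[OF fin] by simp
    have cong: "indicator {t m<..s} v *\<^sub>R (E v * D (ennreal v) * b v) =
        indicator {t m<..s} v *\<^sub>R (P m * (E v * b v))" for v
    proof (cases "v \<in> {t m<..s}")
      case True
      then have "0 \<le> v" using t0[of m] by auto
      then have "\<theta> m < ennreal v" "ennreal v \<le> \<theta> (Suc m)"
        using True t[OF fin] t0[of m] that(2,3) by (auto simp: ennreal_less_iff elim!: order_trans[rotated])
      then show ?thesis using D by simp
    qed simp
    have "set_integrable \<mu> {t m<..s} (\<lambda>v. P m * (E v * b v))"
      unfolding E_def using exp_primitive_b_integrable[OF b t0[of m]] by simp
    moreover have "(LINT v:{t m<..s}|\<mu>. P m * (E v * b v)) = P m * (E s - E (t m))"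
      unfolding E_def using exp_primitive_eq[OF b t0[of m] tm] by simp
    ultimately show ?thesis
      unfolding set_integrable_def set_lebesgue_integral_def cong by simp
  qed
  \<comment> \<open>The right end is included: at \<open>s = \<theta> (Suc m)\<close> the formula
    still holds with the product before that jump is applied. The induction step uses the hypothesis
    at exactly this time.\<close>
  have main: "set_integrable \<mu> {0<..s} (\<lambda>v. E v * D (ennreal v) * b v) \<and>
      E s * P m = 1 + (\<Sum>n\<in>{1..m}. E (t n) * P (n - 1) * (\<rho> n - 1))
        + (LINT v:{0<..s}|\<mu>. E v * D (ennreal v) * b v)"
    if "\<theta> m \<le> ennreal s" "ennreal s \<le> \<theta> (Suc m)" "0 \<le> s" for m s
    using that
  proof (induction m arbitrary: s)
    case 0
    then show ?case using piece[of 0 s] by (simp add: start t_def P_def E_def primitive_0[OF b])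
  next
    case (Suc m)
    have fin: "\<theta> (Suc m) < \<infinity>" using Suc.prems(1) by (simp add: order_le_less_trans)
    have tm: "t (Suc m) \<le> s" using Suc.prems t[OF fin] by simp
    have "\<theta> m \<le> ennreal (t (Suc m))" "ennreal (t (Suc m)) \<le> \<theta> (Suc m)"
      using t[OF fin] mono_times[of m "Suc m"] by auto
    note IH = Suc.IH[OF this t0]
    note pc = piece[OF Suc.prems]
    have un: "{0<..s} = {0<..t (Suc m)} \<union> {t (Suc m)<..s}" using tm t0[of "Suc m"] by auto
    have int: "set_integrable \<mu> {0<..s} (\<lambda>v. E v * D (ennreal v) * b v)"
      unfolding un using IH pc by (intro set_integrable_Un) (auto simp: sets_\<mu>)
    let ?I = "\<lambda>s. LINT v:{0<..s}|\<mu>. E v * D (ennreal v) * b v" and ?e = "E (t (Suc m)) * P m"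
    have P: "P (Suc m) = P m * \<rho> (Suc m)" by (simp add: P_def)
    have "?I s = ?I (t (Suc m)) + P (Suc m) * (E s - E (t (Suc m)))"
      using set_integral_Ioc_split[OF int t0 tm] pc by simp
    moreover have "E s * P (Suc m) = P (Suc m) * (E s - E (t (Suc m))) + ?e + ?e * (\<rho> (Suc m) - 1)"
      by (simp add: P algebra_simps)
    moreover have "(\<Sum>n\<in>{1..Suc m}. E (t n) * P (n - 1) * (\<rho> n - 1)) =
        (\<Sum>n\<in>{1..m}. E (t n) * P (n - 1) * (\<rho> n - 1)) + ?e * (\<rho> (Suc m) - 1)"
      by simp
    ultimately show ?case using IH int by linarith
  qed
  obtain m where m: "\<theta> m \<le> ennreal T" "ennreal T < \<theta> (Suc m)" using bracket[of "ennreal T"] by auto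
  note M = main[OF m(1) less_imp_le[OF m(2)] \<open>0 \<le> T\<close>]
  show "set_integrable \<mu> {0<..T} (\<lambda>s. E s * D (ennreal s) * b s)" using M by simp
  have "E (enn2real (\<theta> n)) * D (\<theta> n) * (\<rho> n - 1) = E (t n) * P (n - 1) * (\<rho> n - 1)" if "n \<in> {1..m}" for n
  proof -
    have "\<theta> n < \<infinity>" using mono_times[of n m] m(1) that by (auto simp: order_le_less_trans)
    then show ?thesis using jumps_before_time[of n] that by (simp add: D_def P_def t_def)
  qed
  then have "(\<Sum>n\<in>{1..m}. E (enn2real (\<theta> n)) * D (\<theta> n) * (\<rho> n - 1)) =
      (\<Sum>n\<in>{1..m}. E (t n) * P (n - 1) * (\<rho> n - 1))"
    by (intro sum.cong refl)
  then show "E T * (\<Prod>n\<in>jumps_upto \<theta> (ennreal T). \<rho> n) = 1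
      + (\<Sum>n\<in>jumps_upto \<theta> (ennreal T). E (enn2real (\<theta> n)) * D (\<theta> n) * (\<rho> n - 1))
      + (LINT s:{0<..T}|\<mu>. E s * D (ennreal s) * b s)"
    unfolding jumps_upto_eq[OF m] P_def[symmetric] using M by linarith
qed

lemma (in continuous_path) set_nn_integral_eq:
  fixes f :: "real \<Rightarrow> real"
  assumes "set_integrable \<mu> {s<..t} f" "\<And>v. s < v \<Longrightarrow> v \<le> t \<Longrightarrow> 0 \<le> f v"
  shows "(\<integral>\<^sup>+v\<in>{s<..t}. ennreal (f v) \<partial>\<mu>) = ennreal (LINT v:{s<..t}|\<mu>. f v)"
proof -
  have "(\<integral>\<^sup>+v\<in>{s<..t}. ennreal (f v) \<partial>\<mu>) = (\<integral>\<^sup>+v. ennreal (indicator {s<..t} v *\<^sub>R f v) \<partial>\<mu>)"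
    by (intro nn_integral_cong) (auto simp: indicator_def)
  also have "\<dots> = ennreal (LINT v:{s<..t}|\<mu>. f v)"
    unfolding set_lebesgue_integral_def using assms
    by (intro nn_integral_eq_integral) (auto simp: set_integrable_def indicator_def)
  finally show ?thesis .
qed

text \<open>Substituting the value of \<open>a\<close> for time, this is an integral of
  \<open>exp (- \<beta> * v)\<close> over \<open>[0, a T]\<close>, so the bound does not depend on
  the path. The substitution is \<open>exp_primitive_eq\<close> with the constant integrand
  \<open>- \<beta>\<close>.\<close>

lemma (in continuous_path) nn_integral_exp_uminus_le:
  assumes "0 < \<beta>" "0 \<le> T"
  shows "(\<integral>\<^sup>+s\<in>{0<..T}. ennreal (exp (- \<beta> * a s)) \<partial>\<mu>) \<le> ennreal (1 / \<beta>)"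
proof -
  have b: "(\<lambda>_. - \<beta>) \<in> borel_measurable borel" "\<And>t::real. \<bar>- \<beta>\<bar> \<le> \<beta>" using assms by auto
  have prim: "primitive (\<lambda>_. - \<beta>) t = - \<beta> * a t" if "0 \<le> t" for t
    using measure_Ioc[of 0 t] emeasure_Ioc[of 0 t] that path_0
    by (simp add: primitive_def[OF b] set_lebesgue_integral_def sets_\<mu>)
  have int: "set_integrable \<mu> {0<..T} (\<lambda>s. exp (- \<beta> * a s))"
  proof -
    have "set_integrable \<mu> {0<..T} (\<lambda>s. (exp (primitive (\<lambda>_. - \<beta>) s) * - \<beta>) * (- 1 / \<beta>))"
      by (rule set_integrable_mult_left) (rule exp_primitive_b_integrable[OF b order_refl])
    then show ?thesis
      unfolding set_integrable_def
      by (rule Bochner_Integration.integrable_cong[THEN iffD1, rotated -1])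
        (use assms in \<open>auto simp: indicator_def prim\<close>)
  qed
  have "exp (- \<beta> * a T) - 1 = (LINT s:{0<..T}|\<mu>. exp (primitive (\<lambda>_. - \<beta>) s) * - \<beta>)"
    using exp_primitive_eq[OF b, of 0 T] assms by (simp add: prim path_0)
  also have "\<dots> = (LINT s:{0<..T}|\<mu>. exp (primitive (\<lambda>_. - \<beta>) s)) * - \<beta>"
    by (rule set_integral_mult_left)
  also have "(LINT s:{0<..T}|\<mu>. exp (primitive (\<lambda>_. - \<beta>) s)) = (LINT s:{0<..T}|\<mu>. exp (- \<beta> * a s))"
    unfolding set_lebesgue_integral_def
    by (intro Bochner_Integration.integral_cong) (auto simp: indicator_def prim)
  finally have "\<beta> * (LINT s:{0<..T}|\<mu>. exp (- \<beta> * a s)) = 1 - exp (- \<beta> * a T)"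
    by (simp add: algebra_simps)
  also have "\<dots> \<le> 1" by simp
  finally have "(LINT s:{0<..T}|\<mu>. exp (- \<beta> * a s)) \<le> 1 / \<beta>"
    using assms by (simp add: field_simps)
  then show ?thesis by (subst set_nn_integral_eq[OF int]) (auto intro!: ennreal_leI)
qed

text \<open>
  The integral equation \<open>L\<^sub>T = 1 + \<integral>L\<^sub>s\<^sub>-(\<rho> - 1) dN\<^sub>s + \<integral>L\<^sub>s\<^sub>-(1 - c) da\<^sub>s\<close> of the stochastic exponential,
  with all negative terms moved to the other side.
\<close>

lemma (in continuous_path) stochastic_exponential_path:
  fixes \<rho> :: "nat \<Rightarrow> real"
  assumes c: "c \<in> borel_measurable borel" "\<And>t. 0 \<le> c t" "\<And>t. c t \<le> C"
    and \<theta>: "jump_times \<theta>" and "0 \<le> T" and \<rho>: "\<And>n. 0 \<le> \<rho> n"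
  defines "e \<equiv> (\<lambda>t. exp (a t - (LINT s:{0<..t}|\<mu>. c s)))"
  defines "W \<equiv> (\<lambda>t. e t * (\<Prod>i\<in>jumps_before \<theta> (ennreal t). \<rho> i))"
  shows "ennreal (e T * (\<Prod>n\<in>jumps_upto \<theta> (ennreal T). \<rho> n))
      + (\<Sum>n\<in>jumps_upto \<theta> (ennreal T). ennreal (W (enn2real (\<theta> n))))
      + (\<integral>\<^sup>+s\<in>{0<..T}. ennreal (W s * c s) \<partial>\<mu>) =
    1 + (\<Sum>n\<in>jumps_upto \<theta> (ennreal T). ennreal (W (enn2real (\<theta> n)) * \<rho> n))
      + (\<integral>\<^sup>+s\<in>{0<..T}. ennreal (W s) \<partial>\<mu>)"
proof -
  interpret jump_times \<theta> by fact
  let ?J = "jumps_upto \<theta> (ennreal T)"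
  define b where "b t = 1 - c t" for t
  have b: "b \<in> borel_measurable borel" "\<bar>b t\<bar> \<le> \<bar>C\<bar> + 1" for t
    using c(1) c(2,3)[of t] by (auto simp: b_def[abs_def])
  have cb: "\<bar>c t\<bar> \<le> \<bar>C\<bar>" for t using c(2,3)[of t] by auto
  have ci: "set_integrable \<mu> {0<..t} c" for t by (rule b_integrable[OF c(1) cb]) simp
  have prim: "primitive b t = a t - (LINT s:{0<..t}|\<mu>. c s)" if "0 \<le> t" for t
  proof -
    have one: "set_integrable \<mu> {0<..t} (\<lambda>_. 1::real)" "(LINT s:{0<..t}|\<mu>. (1::real)) = a t"
      using measure_Ioc[of 0 t] emeasure_Ioc[of 0 t] that path_0
      by (auto simp: set_lebesgue_integral_def set_integrable_def sets_\<mu>)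
    show ?thesis using set_integral_diff(2)[OF one(1) ci] one(2) by (simp add: primitive_def[OF b] b_def)
  qed
  have fin: "finite ?J" by (rule finite_jumps_upto) simp
  define D where "D s = (\<Prod>i\<in>jumps_before \<theta> s. \<rho> i)" for s
  define k where "k = (\<Prod>i\<in>?J. max 1 (\<rho> i))"
  \<comment> \<open>Over the fixed finite index set \<open>?J\<close> the product becomes a finite
    product of step functions of \<open>s\<close>, hence measurable in \<open>s\<close>. The
    constant \<open>k\<close> bounds it because factors below 1 are raised to 1.\<close>
  have D_eq: "D (ennreal s) = (\<Prod>i\<in>?J. if \<theta> i < ennreal s then \<rho> i else 1)" if "s \<le> T" for s
  proof -
    have "jumps_before \<theta> (ennreal s) \<subseteq> ?J"
      using that by (auto simp: jumps_before_def jumps_upto_def intro: order_trans[OF less_imp_le] ennreal_leI)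
    then show ?thesis unfolding D_def
      by (intro prod.mono_neutral_cong_left fin) (auto simp: jumps_before_def jumps_upto_def)
  qed
  have D_bound: "0 \<le> D (ennreal s) \<and> D (ennreal s) \<le> k" if "s \<le> T" for s
    unfolding D_eq[OF that] k_def using \<rho> by (auto intro!: prod_nonneg prod_mono)
  have W_eq: "W s = exp (primitive b s) * D (ennreal s)" if "0 \<le> s" for s
    by (simp add: W_def e_def prim[OF that] D_def)
  have W_nn: "0 \<le> W s" for s unfolding W_def e_def using \<rho> by (simp add: prod_nonneg)
  have Wm: "set_borel_measurable borel {0<..T} W"
  proof -
    have "(\<lambda>s. (indicator {0<..T} s *\<^sub>R exp (primitive b s)) *
        (\<Prod>i\<in>?J. if \<theta> i < ennreal s then \<rho> i else 1)) \<in> borel_measurable borel"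
      using exp_primitive_measurable[OF b, of 0 T] unfolding set_borel_measurable_def by measurable
    also have "?this \<longleftrightarrow> ?thesis"
      unfolding set_borel_measurable_def
      by (intro measurable_cong) (auto simp: indicator_def W_eq D_eq)
    finally show ?thesis .
  qed
  have Wi: "set_integrable \<mu> {0<..T} W"
  proof (rule bounded_set_integrable[OF Wm])
    fix s assume "0 < s" "s \<le> T"
    then have "exp (primitive b s) \<le> exp ((\<bar>C\<bar> + 1) * a T)"
      using primitive_bounded[OF b, of s T] by simp
    then show "\<bar>W s\<bar> \<le> exp ((\<bar>C\<bar> + 1) * a T) * k"
      using W_eq[of s] D_bound[of s] \<open>0 < s\<close> \<open>s \<le> T\<close> by (auto intro!: mult_mono)
  qed simp
  note main = exp_primitive_jumps[OF b \<theta> \<open>0 \<le> T\<close>, of \<rho>, folded D_def]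
  have Wb: "indicator {0<..T} s *\<^sub>R (exp (primitive b s) * D (ennreal s) * b s) = indicator {0<..T} s *\<^sub>R (W s * b s)" for s
    by (auto simp: indicator_def W_eq)
  have Wbi: "set_integrable \<mu> {0<..T} (\<lambda>s. W s * b s)"
    using main(1) unfolding set_integrable_def Wb .
  have Wci: "set_integrable \<mu> {0<..T} (\<lambda>s. W s * c s)"
    using set_integral_diff(1)[OF Wi Wbi] by (simp add: b_def algebra_simps)
  have Wc: "(LINT s:{0<..T}|\<mu>. W s * c s) = (LINT s:{0<..T}|\<mu>. W s) - (LINT s:{0<..T}|\<mu>. W s * b s)"
    using set_integral_diff(2)[OF Wi Wbi] by (simp add: b_def algebra_simps)
  have t: "ennreal (enn2real (\<theta> n)) = \<theta> n" if "n \<in> ?J" for n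
    using that by (intro ennreal_enn2real) (auto simp: jumps_upto_def order_le_less_trans)
  have "(\<Sum>n\<in>?J. exp (primitive b (enn2real (\<theta> n))) * D (\<theta> n) * (\<rho> n - 1)) =
      (\<Sum>n\<in>?J. W (enn2real (\<theta> n)) * \<rho> n) - (\<Sum>n\<in>?J. W (enn2real (\<theta> n)))"
    unfolding sum_subtractf[symmetric] by (intro sum.cong refl) (auto simp: W_eq t algebra_simps)
  moreover have "(LINT s:{0<..T}|\<mu>. exp (primitive b s) * D (ennreal s) * b s) = (LINT s:{0<..T}|\<mu>. W s * b s)"
    unfolding set_lebesgue_integral_def Wb ..
  moreover have "e T = exp (primitive b T)" using \<open>0 \<le> T\<close> by (simp add: e_def prim)
  note main(2)[folded this]
  ultimately have eq: "e T * (\<Prod>n\<in>?J. \<rho> n) + (\<Sum>n\<in>?J. W (enn2real (\<theta> n))) + (LINT s:{0<..T}|\<mu>. W s * c s) =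
    1 + (\<Sum>n\<in>?J. W (enn2real (\<theta> n)) * \<rho> n) + (LINT s:{0<..T}|\<mu>. W s)"
    using Wc by linarith
  have nn: "0 \<le> e T * (\<Prod>n\<in>?J. \<rho> n)" "0 \<le> (\<Sum>n\<in>?J. W (enn2real (\<theta> n)))"
     "0 \<le> (LINT s:{0<..T}|\<mu>. W s * c s)" "0 \<le> (\<Sum>n\<in>?J. W (enn2real (\<theta> n)) * \<rho> n)" "0 \<le> (LINT s:{0<..T}|\<mu>. W s)"
    using W_nn \<rho> c(2)
    by (auto simp: e_def set_lebesgue_integral_def
        intro!: mult_nonneg_nonneg prod_nonneg sum_nonneg Bochner_Integration.integral_nonneg)
  \<comment> \<open>All six terms are nonnegative, so the real identity carries over to
    \<open>ennreal\<close>, where expectations can be taken before anything is known to be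
    integrable.\<close>
  have "ennreal (e T * (\<Prod>n\<in>?J. \<rho> n)) + ennreal (\<Sum>n\<in>?J. W (enn2real (\<theta> n))) + ennreal (LINT s:{0<..T}|\<mu>. W s * c s) =
    1 + ennreal (\<Sum>n\<in>?J. W (enn2real (\<theta> n)) * \<rho> n) + ennreal (LINT s:{0<..T}|\<mu>. W s)"
    using arg_cong[OF eq, of ennreal] nn by (simp add: ennreal_plus)
  then show ?thesis
    using W_nn \<rho> c(2) by (simp add: set_nn_integral_eq Wi Wci sum_ennreal)
qed

text \<open>Intervals shrinking to \<open>t\<close> from the left have vanishing mass because
  \<open>a\<close> is continuous. Jump times are therefore not charged by \<open>dA\<close>, which
  later allows the current mark to be exchanged with the left mark.\<close>

lemma (in continuous_path) emeasure_singleton: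
  assumes "0 < t"
  shows "emeasure \<mu> {t} = 0"
proof -
  have "emeasure \<mu> {t} \<le> ennreal (a t - a s)" if "s \<in> {0..<t}" for s
    using that emeasure_Ioc[of s t] emeasure_mono[of "{t}" "{s<..t}" \<mu>] by (simp add: sets_\<mu>)
  then have le: "emeasure \<mu> {t} \<le> ennreal (a t - a (t - t / real (Suc n)))" for n
    using assms by (simp add: field_simps)
  have "(\<lambda>n. t - t / real (Suc n)) \<longlonglongrightarrow> t - 0"
    by (intro tendsto_diff tendsto_const LIMSEQ_Suc lim_const_over_n)
  then have "(\<lambda>n. a (t - t / real (Suc n))) \<longlonglongrightarrow> a t"
    using assms by (intro continuous_on_tendsto_compose[OF path_continuous]) (auto simp: field_simps)
  then have "(\<lambda>n. ennreal (a t - a (t - t / real (Suc n)))) \<longlonglongrightarrow> ennreal (a t - a t)"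
    by (intro tendsto_ennrealI tendsto_diff tendsto_const)
  then have "emeasure \<mu> {t} \<le> ennreal (a t - a t)"
    using le by (intro LIMSEQ_le_const) auto
  then show ?thesis by simp
qed

section \<open>Elementary estimates for the perturbed exponential\<close>

lemma one_minus_exp_prod_limit:
  fixes h :: "'i \<Rightarrow> real"
  assumes "finite J" and h: "\<And>i. i \<in> J \<Longrightarrow> 0 \<le> h i" "\<And>i. i \<in> J \<Longrightarrow> h i \<le> 1"
  shows "(\<lambda>n. (1 - exp (1 / real (n + 2) * a) * (\<Prod>i\<in>J. 1 - 1 / real (n + 2) * h i)) * real (n + 2))
    \<longlonglongrightarrow> (\<Sum>i\<in>J. h i) - a"
proof -
  \<comment> \<open>The expression is minus a difference quotient at 0 of
    \<open>exp (\<epsilon> * a)\<close> times the product. Taking logarithms of the factors turns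
    the product into a sum that is easy to differentiate; the step sizes
    \<open>1 / real (n + 2)\<close> are at most one half, so all factors are positive and the
    logarithms are the true ones.\<close>
  define f where "f \<epsilon> = exp (\<epsilon> * a + (\<Sum>i\<in>J. ln (1 - \<epsilon> * h i)))" for \<epsilon>
  have "(f has_real_derivative (a - (\<Sum>i\<in>J. h i))) (at 0)"
    unfolding f_def by (auto intro!: derivative_eq_intros simp: sum_negf)
  then have lim: "((\<lambda>\<epsilon>. (f \<epsilon> - f 0) / (\<epsilon> - 0)) \<longlongrightarrow> a - (\<Sum>i\<in>J. h i)) (at 0)"
    by (simp add: has_field_derivative_iff)
  have "filterlim (\<lambda>n. 1 / real (n + 2)) (at 0) sequentially"
    unfolding filterlim_at
  proof
    show "\<forall>\<^sub>F n in sequentially. 1 / real (n + 2) \<in> UNIV \<and> 1 / real (n + 2) \<noteq> 0" by simp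
    show "(\<lambda>n. 1 / real (n + 2)) \<longlonglongrightarrow> 0"
      by (rule LIMSEQ_ignore_initial_segment[OF lim_1_over_n])
  qed
  from filterlim_compose[OF lim this]
  have "(\<lambda>n. - ((f (1 / real (n + 2)) - f 0) / (1 / real (n + 2) - 0))) \<longlonglongrightarrow> - (a - (\<Sum>i\<in>J. h i))"
    by (rule tendsto_minus)
  moreover have "- ((f (1 / real (n + 2)) - f 0) / (1 / real (n + 2) - 0)) =
      (1 - exp (1 / real (n + 2) * a) * (\<Prod>i\<in>J. 1 - 1 / real (n + 2) * h i)) * real (n + 2)" for n
  proof -
    have "0 < 1 - 1 / real (n + 2) * h i" if "i \<in> J" for i
      using h[OF that] by (simp add: field_simps)
    then have "f (1 / real (n + 2)) = exp (1 / real (n + 2) * a) * (\<Prod>i\<in>J. 1 - 1 / real (n + 2) * h i)"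
      unfolding f_def exp_add using \<open>finite J\<close> by (simp add: exp_sum)
    moreover have "f 0 = 1" by (simp add: f_def)
    moreover have "- ((x - 1) / (1 / real (n + 2) - 0)) = (1 - x) * real (n + 2)" for x
      by (simp add: field_simps)
    ultimately show ?thesis by simp
  qed
  ultimately show ?thesis by simp
qed

text \<open>The Weierstrass product inequality, by induction on the index set.\<close>

lemma one_minus_sum_le_prod:
  fixes x :: "'i \<Rightarrow> real"
  assumes "finite J" "\<And>i. i \<in> J \<Longrightarrow> 0 \<le> x i \<and> x i \<le> 1"
  shows "1 - (\<Sum>i\<in>J. x i) \<le> (\<Prod>i\<in>J. 1 - x i)"
  using assms
proof (induction J)
  case (insert i J)
  have "(\<Prod>i\<in>J. 1 - x i) \<le> 1" using insert.prems by (intro prod_le_1) auto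
  then have "x i * (\<Prod>i\<in>J. 1 - x i) \<le> x i" using insert.prems by (intro mult_left_le) auto
  then show ?case using insert by (simp add: left_diff_distrib)
qed simp

text \<open>The bound is linear in \<open>\<epsilon>\<close>, so dividing by
  \<open>\<epsilon>\<close> leaves a majorant free of \<open>\<epsilon>\<close> for dominated
  convergence. The product falls short of 1 by at most \<open>\<epsilon> * card J\<close>, the
  exponential exceeds 1 by at most \<open>\<epsilon> * a * exp a\<close>.\<close>

lemma one_minus_exp_prod_bound:
  fixes h :: "'i \<Rightarrow> real"
  assumes J: "finite J" and h: "\<And>i. i \<in> J \<Longrightarrow> 0 \<le> h i" "\<And>i. i \<in> J \<Longrightarrow> h i \<le> 1"
    and \<epsilon>: "0 \<le> \<epsilon>" "\<epsilon> \<le> 1" and a: "0 \<le> a"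
  shows "\<bar>1 - exp (\<epsilon> * a) * (\<Prod>i\<in>J. 1 - \<epsilon> * h i)\<bar> \<le> \<epsilon> * (real (card J) + a * exp a)"
proof -
  let ?p = "\<Prod>i\<in>J. 1 - \<epsilon> * h i"
  have eh: "0 \<le> \<epsilon> * h i \<and> \<epsilon> * h i \<le> 1 \<and> \<epsilon> * h i \<le> \<epsilon>" if "i \<in> J" for i
    using h[OF that] \<epsilon> by (auto simp: mult_left_le mult_le_one)
  have p1: "?p \<le> 1" using eh by (intro prod_le_1) auto
  have p0: "0 \<le> ?p" using eh by (intro prod_nonneg) auto
  have pl: "1 - \<epsilon> * real (card J) \<le> ?p"
  proof -
    have "1 - (\<Sum>i\<in>J. \<epsilon> * h i) \<le> ?p" using eh by (intro one_minus_sum_le_prod[OF J]) auto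
    moreover have "(\<Sum>i\<in>J. \<epsilon> * h i) \<le> (\<Sum>i\<in>J. \<epsilon>)" using eh by (intro sum_mono) auto
    ultimately show ?thesis by (simp add: mult.commute)
  qed
  have e1: "1 \<le> exp (\<epsilon> * a)" using \<epsilon> a by simp
  have "exp (\<epsilon> * a) * (1 - \<epsilon> * a) \<le> exp (\<epsilon> * a) * exp (- (\<epsilon> * a))"
    using exp_ge_add_one_self[of "- (\<epsilon> * a)"] by (intro mult_left_mono) auto
  then have "exp (\<epsilon> * a) - 1 \<le> \<epsilon> * (a * exp (\<epsilon> * a))" by (simp add: exp_minus algebra_simps)
  also have "\<epsilon> * (a * exp (\<epsilon> * a)) \<le> \<epsilon> * (a * exp a)"
    using \<epsilon> a by (intro mult_left_mono) (auto simp: mult_left_le_one_le)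
  finally have e2: "exp (\<epsilon> * a) - 1 \<le> \<epsilon> * (a * exp a)" .
  have "exp (\<epsilon> * a) * ?p \<le> exp (\<epsilon> * a) * 1" using p1 by (intro mult_left_mono) auto
  moreover have "1 * ?p \<le> exp (\<epsilon> * a) * ?p" using p0 e1 by (intro mult_right_mono) auto
  moreover have "0 \<le> \<epsilon> * real (card J)" "0 \<le> \<epsilon> * (a * exp a)" using \<epsilon> a by auto
  ultimately show ?thesis using e2 pl unfolding abs_le_iff distrib_left by (intro conjI; linarith)
qed

section \<open>Tools on kernels, completeness and extended reals\<close>

lemma finite_kernel_nn_integral_measurable:
  assumes N: "sets N = sigma_sets \<Omega> G" "Int_stable G" "G \<subseteq> Pow \<Omega>" "\<Omega> \<noteq> {}"
    and sets: "\<And>x. x \<in> space M \<Longrightarrow> sets (\<kappa> x) = sets N"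
    and finite: "\<And>x. x \<in> space M \<Longrightarrow> emeasure (\<kappa> x) \<Omega> < \<infinity>"
    and meas: "\<And>A. A \<in> G \<Longrightarrow> (\<lambda>x. emeasure (\<kappa> x) A) \<in> borel_measurable M"
      "(\<lambda>x. emeasure (\<kappa> x) \<Omega>) \<in> borel_measurable M"
    and f: "f \<in> borel_measurable N"
  shows "(\<lambda>x. \<integral>\<^sup>+y. f y \<partial>\<kappa> x) \<in> borel_measurable M"
proof -
  \<comment> \<open>The masses are finite at each point but not bounded. Dividing by
    \<open>w\<close>, which is finite and at least 1, gives a subprobability kernel, whose
    measurability can be checked on an intersection-stable generator; the factor \<open>w\<close> is
    restored at the end.\<close>
  define w where "w x = 1 + emeasure (\<kappa> x) \<Omega>" for x
  have w: "w \<in> borel_measurable M" unfolding w_def using meas by measurable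
  have w0: "w x \<noteq> 0" "x \<in> space M \<Longrightarrow> w x \<noteq> \<infinity>" for x using finite[of x] by (auto simp: w_def)
  have space: "space (\<kappa> x) = \<Omega>" if "x \<in> space M" for x
    using sets_eq_imp_space_eq[OF sets[OF that]] sets_eq_imp_space_eq[of N "sigma \<Omega> G"] N by simp
  define \<kappa>' where "\<kappa>' x = scale_measure (1 / w x) (\<kappa> x)" for x
  have "\<kappa>' \<in> M \<rightarrow>\<^sub>M subprob_algebra N"
  proof (rule measurable_subprob_algebra_generated[OF N(1-3)])
    fix x assume x: "x \<in> space M"
    show "sets (\<kappa>' x) = sets N" by (simp add: \<kappa>'_def sets[OF x])
    show "subprob_space (\<kappa>' x)"
    proof
      have "emeasure (\<kappa>' x) (space (\<kappa>' x)) = emeasure (\<kappa> x) \<Omega> / w x"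
        using space[OF x] by (simp add: \<kappa>'_def space_scale_measure ennreal_divide_times)
      also have "\<dots> \<le> 1"
        using w0(2)[OF x] w0(1)[of x] by (subst divide_le_posI_ennreal) (auto simp: w_def zero_less_iff_neq_zero)
      finally show "emeasure (\<kappa>' x) (space (\<kappa>' x)) \<le> 1" .
      show "space (\<kappa>' x) \<noteq> {}"
        using N(4) space[OF x] by (simp add: \<kappa>'_def space_scale_measure)
    qed
  qed (use w meas in \<open>auto simp: \<kappa>'_def intro!: borel_measurable_times\<close>)
  then have m: "(\<lambda>x. \<integral>\<^sup>+y. f y \<partial>\<kappa>' x) \<in> borel_measurable M"
    by (rule measurable_compose[OF _ nn_integral_measurable_subprob_algebra[OF f]])
  have eq: "(\<integral>\<^sup>+y. f y \<partial>\<kappa> x) = w x * (\<integral>\<^sup>+y. f y \<partial>\<kappa>' x)" if "x \<in> space M" for x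
  proof -
    have fm: "f \<in> borel_measurable (\<kappa> x)" using f by (simp add: measurable_cong_sets[OF sets[OF that] refl])
    have "w x * (1 / w x) = 1"
      using w0(1)[of x] w0(2)[OF that] by (simp add: ennreal_times_divide less_top)
    then show ?thesis
      unfolding \<kappa>'_def using nn_integral_scale_measure[OF fm] by (simp add: mult.assoc[symmetric])
  qed
  have "(\<lambda>x. w x * (\<integral>\<^sup>+y. f y \<partial>\<kappa>' x)) \<in> borel_measurable M" using w m by measurable
  also have "?this \<longleftrightarrow> ?thesis" by (intro measurable_cong) (simp add: eq)
  finally show ?thesis .
qed

text \<open>Preimages under \<open>f\<close> and \<open>h\<close> differ by a null set, and
  completeness makes such a change measurable. This serves for quantities known only almost
  everywhere, such as the control density, the cost integrand and the path of the
  hamiltonian.\<close>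

lemma borel_measurable_AE_complete:
  assumes "complete_measure M" "f \<in> M \<rightarrow>\<^sub>M N" "AE x in M. f x = h x" "\<And>x. x \<in> space M \<Longrightarrow> h x \<in> space N"
  shows "h \<in> M \<rightarrow>\<^sub>M N"
proof (rule measurableI)
  interpret complete_measure M by fact
  fix B assume B: "B \<in> sets N"
  have m: "f -` B \<inter> space M \<in> sets M" using assms(2) B by (rule measurable_sets)
  show "h -` B \<inter> space M \<in> sets M"
  proof (rule in_sets_AE[OF _ m])
    show "AE x in M. (x \<in> f -` B \<inter> space M) = (x \<in> h -` B \<inter> space M)"
      using assms(3) by eventually_elim auto
  qed auto
qed (fact assms(4))

lemma integral_enn2real:
  assumes f[measurable]: "f \<in> borel_measurable M" and fin: "(\<integral>\<^sup>+x. f x \<partial>M) < \<infinity>"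
  shows "integrable M (\<lambda>x. enn2real (f x))" "(\<integral>x. enn2real (f x) \<partial>M) = enn2real (\<integral>\<^sup>+x. f x \<partial>M)"
proof -
  have "AE x in M. f x \<noteq> \<infinity>" using fin by (intro nn_integral_PInf_AE) auto
  then have eq: "(\<integral>\<^sup>+x. ennreal (enn2real (f x)) \<partial>M) = (\<integral>\<^sup>+x. f x \<partial>M)"
    by (intro nn_integral_cong_AE) (auto simp: less_top)
  show "integrable M (\<lambda>x. enn2real (f x))"
    using fin eq by (intro integrableI_bounded) auto
  show "(\<integral>x. enn2real (f x) \<partial>M) = enn2real (\<integral>\<^sup>+x. f x \<partial>M)"
    by (subst integral_eq_nn_integral) (auto simp: eq)
qed

lemma abs_diff_enn2real_le:
  assumes "a \<le> c" "b \<le> c"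
  shows "ennreal \<bar>enn2real a - enn2real b\<bar> \<le> c"
proof (cases "c = \<top>")
  case False
  then have "enn2real a \<le> enn2real c" "enn2real b \<le> enn2real c" using assms by (auto intro!: enn2real_mono simp: less_top)
  then have "\<bar>enn2real a - enn2real b\<bar> \<le> enn2real c"
    using enn2real_nonneg[of a] enn2real_nonneg[of b] by linarith
  then have "ennreal \<bar>enn2real a - enn2real b\<bar> \<le> ennreal (enn2real c)" by (rule ennreal_leI)
  also have "ennreal (enn2real c) = c" using False by (simp add: less_top)
  finally show ?thesis .
qed simp

section \<open>Predictable processes\<close>

context marked_point_process
begin

abbreviation F :: "real \<Rightarrow> 'a measure" where "F \<equiv> mpp_filtration M K \<tau> \<xi>"

abbreviation P :: "('a \<times> real) measure" where "P \<equiv> predictable_sigma M F"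

lemma counting_process_measurable:
  assumes "C \<in> sets K"
  shows "(\<lambda>\<omega>. counting_process \<tau> \<xi> C \<omega> t) \<in> borel_measurable M"
  unfolding counting_process_def
  using times_measurable marks_measurable assms by measurable

lemma F_generator_subset:
  "{(\<lambda>\<omega>. counting_process \<tau> \<xi> C \<omega> s) -` B \<inter> space M |s C B.
      s \<in> {0..t} \<and> C \<in> sets K \<and> B \<in> sets borel} \<union> null_sets M \<subseteq> sets M"
  using measurable_sets[OF counting_process_measurable] by auto

lemma space_F[simp]: "space (F t) = space M"
  unfolding mpp_filtration_def using F_generator_subset[of t] sets.space_closed[of M]
  by (intro space_measure_of) blast

lemma sets_F: "sets (F t) = sigma_sets (space M) ({(\<lambda>\<omega>. counting_process \<tau> \<xi> C \<omega> s) -` B \<inter> space M |s C B.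
      s \<in> {0..t} \<and> C \<in> sets K \<and> B \<in> sets borel} \<union> null_sets M)"
  unfolding mpp_filtration_def using F_generator_subset[of t] sets.space_closed[of M]
  by (intro sets_measure_of) blast

lemma sets_F_subset: "sets (F t) \<subseteq> sets M"
  unfolding sets_F using F_generator_subset by (rule sets.sigma_sets_subset)

lemma sets_F_mono: "s \<le> t \<Longrightarrow> sets (F s) \<subseteq> sets (F t)"
  unfolding sets_F by (intro sigma_sets_mono') fastforce

lemma null_sets_F: "N \<in> null_sets M \<Longrightarrow> N \<in> sets (F t)"
  unfolding sets_F by blast

lemma AE_sets_F: "AE \<omega> in M. Q \<omega> \<Longrightarrow> {\<omega> \<in> space M. Q \<omega>} \<in> sets (F t)"
proof -
  assume "AE \<omega> in M. Q \<omega>"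
  then have "{\<omega> \<in> space M. \<not> Q \<omega>} \<in> sets (F t)" by (simp add: AE_iff_null_sets null_sets_F)
  then have "space (F t) - {\<omega> \<in> space M. \<not> Q \<omega>} \<in> sets (F t)" by (rule sets.compl_sets)
  moreover have "space (F t) - {\<omega> \<in> space M. \<not> Q \<omega>} = {\<omega> \<in> space M. Q \<omega>}" by auto
  ultimately show ?thesis by simp
qed

lemma counting_process_adapted:
  assumes "C \<in> sets K" "0 \<le> s" "s \<le> t"
  shows "(\<lambda>\<omega>. counting_process \<tau> \<xi> C \<omega> s) \<in> borel_measurable (F t)"
  using assms by (intro measurableI) (auto simp: sets_F)

definition predictable_generator :: "('a \<times> real) set set" where
  "predictable_generator = {B \<times> {0} |B. B \<in> sets (F 0)} \<union>
      {B \<times> {s<..t} |B s t. 0 \<le> s \<and> s < t \<and> B \<in> sets (F s)}"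

lemma predictable_generator_subset: "predictable_generator \<subseteq> Pow (space M \<times> {0..})"
  using sets.sets_into_space[of _ "F _"] by (fastforce simp: predictable_generator_def)

lemma predictable_generatorI:
  "B \<in> sets (F 0) \<Longrightarrow> B \<times> {0} \<in> predictable_generator"
  "0 \<le> s \<Longrightarrow> s < t \<Longrightarrow> B \<in> sets (F s) \<Longrightarrow> B \<times> {s<..t} \<in> predictable_generator"
  unfolding predictable_generator_def by blast+

lemma predictable_generatorE:
  assumes "D \<in> predictable_generator"
  obtains (zero) B where "D = B \<times> {0}" "B \<in> sets (F 0)"
    | (Ioc) B s t where "D = B \<times> {s<..t}" "0 \<le> s" "s < t" "B \<in> sets (F s)"
  using assms unfolding predictable_generator_def by blast

lemma space_P[simp]: "space P = space M \<times> {0..}"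
  unfolding predictable_sigma_def predictable_generator_def[symmetric]
  by (rule space_measure_of[OF predictable_generator_subset])

lemma sets_P: "sets P = sigma_sets (space M \<times> {0..}) predictable_generator"
  unfolding predictable_sigma_def predictable_generator_def[symmetric]
  by (rule sets_measure_of[OF predictable_generator_subset])

lemma measurable_into_P:
  assumes "f \<in> space N \<rightarrow> space M \<times> {0..}" "\<And>D. D \<in> predictable_generator \<Longrightarrow> f -` D \<inter> space N \<in> sets N"
  shows "f \<in> N \<rightarrow>\<^sub>M P"
  by (rule measurable_sigma_sets[OF sets_P predictable_generator_subset assms])

text \<open>Two strips meet in a strip starting at the later of the two left end points, where both
  base sets are already known.\<close>

lemma Int_stable_predictable_generator: "Int_stable predictable_generator"
proof (rule Int_stableI)
  fix a b assume "a \<in> predictable_generator" "b \<in> predictable_generator"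
  have empty: "{} \<in> predictable_generator" by (auto simp: predictable_generator_def)
  have Ioc: "(B \<times> {s<..t}) \<inter> (B' \<times> {s'<..t'}) \<in> predictable_generator"
    if "0 \<le> s" "0 \<le> s'" "B \<in> sets (F s)" "B' \<in> sets (F s')" for B B' s s' t t'
  proof (cases "max s s' < min t t'")
    case True
    have "B \<inter> B' \<in> sets (F (max s s'))"
      using that sets_F_mono[of s "max s s'"] sets_F_mono[of s' "max s s'"] by auto
    moreover have "(B \<times> {s<..t}) \<inter> (B' \<times> {s'<..t'}) = (B \<inter> B') \<times> {max s s'<..min t t'}" by auto
    ultimately show ?thesis using True that predictable_generatorI(2)[of "max s s'" "min t t'" "B \<inter> B'"] by simp
  next
    case False
    then have "(B \<times> {s<..t}) \<inter> (B' \<times> {s'<..t'}) = {}" by auto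
    then show ?thesis using empty by simp
  qed
  have zero: "(B \<times> {0}) \<inter> (B' \<times> {s<..t}) = {}" "(B' \<times> {s<..t}) \<inter> (B \<times> {0}) = {}" if "0 \<le> s"
    for B B' :: "'a set" and s t :: real
    using that by auto
  from \<open>a \<in> predictable_generator\<close> consider (a0) B where "a = B \<times> {0}" "B \<in> sets (F 0)"
    | (a1) B s t where "a = B \<times> {s<..t}" "0 \<le> s" "B \<in> sets (F s)"
    by (auto simp: predictable_generator_def)
  then show "a \<inter> b \<in> predictable_generator"
  proof cases
    case a0
    from \<open>b \<in> predictable_generator\<close> consider (b0) B where "b = B \<times> {0}" "B \<in> sets (F 0)"
      | (b1) B s t where "b = B \<times> {s<..t}" "0 \<le> s" "B \<in> sets (F s)"
      by (auto simp: predictable_generator_def)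
    then show ?thesis
    proof cases
      case (b0 B')
      then have "a \<inter> b = (B \<inter> B') \<times> {0}" using a0 by auto
      then show ?thesis using a0 b0 unfolding predictable_generator_def by blast
    qed (use a0 zero empty in auto)
  next
    case a1
    from \<open>b \<in> predictable_generator\<close> consider (b0) B where "b = B \<times> {0}" "B \<in> sets (F 0)"
      | (b1) B s t where "b = B \<times> {s<..t}" "0 \<le> s" "B \<in> sets (F s)"
      by (auto simp: predictable_generator_def)
    then show ?thesis using a1 Ioc zero empty by cases auto
  qed
qed

lemma sets_P_Ioi:
  assumes "B \<in> sets (F s)" "0 \<le> s"
  shows "B \<times> {s<..} \<in> sets P"
proof -
  have "{s<..} = (\<Union>n. {s<..s + real (Suc n)})"
  proof -
    have "\<exists>n. t \<le> s + real (Suc n)" for t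
      using real_arch_simple[of "t - s"] by (metis add.commute diff_le_eq le_Suc_eq of_nat_mono order_trans order_refl)
    then show ?thesis by auto
  qed
  then have "B \<times> {s<..} = (\<Union>n. B \<times> {s<..s + real (Suc n)})" by blast
  moreover have "B \<times> {s<..s + real (Suc n)} \<in> sets P" for n
    unfolding sets_P using assms by (intro sigma_sets.Basic predictable_generatorI) auto
  ultimately show ?thesis by auto
qed

lemma sets_P_Ici:
  assumes "B \<in> sets (F 0)"
  shows "B \<times> {0..} \<in> sets P"
proof -
  have "B \<times> {0} \<in> sets P"
    unfolding sets_P using assms by (intro sigma_sets.Basic predictable_generatorI)
  moreover have "({0..} :: real set) = {0} \<union> {0<..}" by auto
  then have "B \<times> {0::real..} = B \<times> {0} \<union> B \<times> {0<..}" by auto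
  ultimately show ?thesis using sets_P_Ioi[OF assms] by auto
qed

lemma time_measurable_P[measurable]: "snd \<in> borel_measurable P"
  unfolding borel_measurable_iff_greater
proof
  fix c :: real
  have "space M \<in> sets (F s)" for s using sets.top[of "F s"] by simp
  then have "space M \<times> {c<..} \<in> sets P" if "0 \<le> c" using sets_P_Ioi that by blast
  moreover have "{w \<in> space P. c < snd w} = (if 0 \<le> c then space M \<times> {c<..} else space P)" by auto
  ultimately show "{w \<in> space P. c < snd w} \<in> sets P" using sets.top[of P] by (auto split: if_splits)
qed

text \<open>The building block of predictable processes: a quantity known at time \<open>s\<close>
  is used only strictly after \<open>s\<close>.\<close>

lemma after_time_measurable_P:
  assumes f: "f \<in> F s \<rightarrow>\<^sub>M N" and "0 \<le> s" "c \<in> space N"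
  shows "(\<lambda>(\<omega>, t). if s < t then f \<omega> else c) \<in> P \<rightarrow>\<^sub>M N"
proof (rule measurableI)
  fix w assume "w \<in> space P"
  then show "(case w of (\<omega>, t) \<Rightarrow> if s < t then f \<omega> else c) \<in> space N"
    using assms measurable_space[OF f] by auto
next
  fix B assume "B \<in> sets N"
  then have "(f -` B \<inter> space M) \<times> {s<..} \<in> sets P"
    using measurable_sets[OF f] assms by (intro sets_P_Ioi) auto
  moreover have "{w \<in> space P. snd w \<le> s} \<in> sets P" by measurable
  moreover have "(\<lambda>(\<omega>, t). if s < t then f \<omega> else c) -` B \<inter> space P =
      (f -` B \<inter> space M) \<times> {s<..} \<union> (if c \<in> B then {w \<in> space P. snd w \<le> s} else {})"
    using \<open>0 \<le> s\<close> by (auto split: if_splits)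
  ultimately show "(\<lambda>(\<omega>, t). if s < t then f \<omega> else c) -` B \<inter> space P \<in> sets P" by auto
qed

text \<open>Predictable processes are adapted. The section of a strip
  \<open>B \<times> {s<..s'}\<close> at \<open>t\<close> can be nonempty only for
  \<open>s < t\<close>, and then \<open>B\<close> belongs to \<open>F t\<close>.\<close>

lemma section_measurable_F: "0 \<le> t \<Longrightarrow> (\<lambda>\<omega>. (\<omega>, t)) \<in> F t \<rightarrow>\<^sub>M P"
proof (rule measurable_into_P)
  fix D assume "0 \<le> t" "D \<in> predictable_generator"
  then consider (1) B where "D = B \<times> {0}" "B \<in> sets (F 0)"
    | (2) B s s' where "D = B \<times> {s<..s'}" "0 \<le> s" "B \<in> sets (F s)"
    by (auto simp: predictable_generator_def)
  then show "(\<lambda>\<omega>. (\<omega>, t)) -` D \<inter> space (F t) \<in> sets (F t)"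
  proof cases
    case 1
    then have "(\<lambda>\<omega>. (\<omega>, t)) -` D \<inter> space (F t) = (if t = 0 then B else {})"
      using sets.sets_into_space[OF 1(2)] by auto
    then show ?thesis using 1 by auto
  next
    case 2
    then have "(\<lambda>\<omega>. (\<omega>, t)) -` D \<inter> space (F t) = (if s < t \<and> t \<le> s' then B else {})"
      using sets.sets_into_space[OF 2(3)] by auto
    then show ?thesis using 2 sets_F_mono[of s t] by auto
  qed
qed auto

lemma section_measurable_M[measurable]: "0 \<le> t \<Longrightarrow> (\<lambda>\<omega>. (\<omega>, t)) \<in> M \<rightarrow>\<^sub>M P"
  using section_measurable_F[of t] sets_F_subset[of t] by (auto simp: measurable_def)

lemma path_measurable_P: "\<omega> \<in> space M \<Longrightarrow> (\<lambda>t. (\<omega>, t)) \<in> restrict_space borel {0..} \<rightarrow>\<^sub>M P"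
proof (rule measurable_into_P)
  fix D assume "\<omega> \<in> space M" "D \<in> predictable_generator"
  then consider (1) B where "D = B \<times> {0}" "B \<in> sets (F 0)"
    | (2) B s s' where "D = B \<times> {s<..s'}" "0 \<le> s" "B \<in> sets (F s)"
    by (auto simp: predictable_generator_def)
  then show "(\<lambda>t. (\<omega>, t)) -` D \<inter> space (restrict_space borel {0..}) \<in> sets (restrict_space borel {0..})"
  proof cases
    case 1
    then have "(\<lambda>t. (\<omega>, t)) -` D \<inter> space (restrict_space borel {0..}) = (if \<omega> \<in> B then {0} else {})"
      by (auto simp: space_restrict_space)
    then show ?thesis by (auto simp: sets_restrict_space_iff)
  next
    case 2
    then have "(\<lambda>t. (\<omega>, t)) -` D \<inter> space (restrict_space borel {0..}) = (if \<omega> \<in> B then {s<..s'} else {})"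
      by (auto simp: space_restrict_space)
    moreover have "{s<..s'} \<in> sets (restrict_space borel {0..})"
      using 2(2) by (subst sets_restrict_space_iff) auto
    ultimately show ?thesis by auto
  qed
qed (auto simp: space_restrict_space)

text \<open>The data of the control problem live on \<open>[0,T]\<close>, the predictable
  sigma-algebra on the half-line. Composition with this map extends the data by their value at
  \<open>T\<close> and keeps them predictable.\<close>

lemma stop_measurable_P:
  assumes "0 \<le> T"
  shows "(\<lambda>(\<omega>, t). (\<omega>, min t T)) \<in> P \<rightarrow>\<^sub>M P"
proof (rule measurable_into_P)
  fix D assume "D \<in> predictable_generator"
  then consider (1) B where "D = B \<times> {0}" "B \<in> sets (F 0)"
    | (2) B s s' where "D = B \<times> {s<..s'}" "0 \<le> s" "B \<in> sets (F s)"
    by (auto simp: predictable_generator_def)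
  then show "(\<lambda>(\<omega>, t). (\<omega>, min t T)) -` D \<inter> space P \<in> sets P"
  proof cases
    case 1
    have "B \<times> {0} \<in> sets P"
      unfolding sets_P using 1 by (intro sigma_sets.Basic predictable_generatorI)
    moreover have "(\<lambda>(\<omega>, t). (\<omega>, min t T)) -` D \<inter> space P = (if T = 0 then B \<times> {0..} else B \<times> {0})"
      using 1 assms sets.sets_into_space[OF 1(2)] by (auto simp: min_def split: if_splits)
    ultimately show ?thesis using sets_P_Ici[OF 1(2)] by auto
  next
    case 2
    have "(\<lambda>(\<omega>, t). (\<omega>, min t T)) -` D \<inter> space P =
        (if s < T then B \<times> {s<..} \<inter> {w \<in> space P. min (snd w) T \<le> s'} else {})"
      using 2 assms sets.sets_into_space[OF 2(3)] by (auto simp: min_def split: if_splits)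
    moreover have "{w \<in> space P. min (snd w) T \<le> s'} \<in> sets P" by measurable
    ultimately show ?thesis using sets_P_Ioi[OF 2(3,2)] by auto
  qed
qed (use assms in auto)

abbreviation jump_time :: "nat \<Rightarrow> 'a \<Rightarrow> real" where "jump_time n \<omega> \<equiv> enn2real (\<tau> n \<omega>)"

abbreviation jumped :: "'a \<Rightarrow> real \<Rightarrow> nat set" where
  "jumped \<omega> t \<equiv> jumps_upto (\<lambda>n. \<tau> n \<omega>) (ennreal t)"

abbreviation jumped_before :: "'a \<Rightarrow> real \<Rightarrow> nat set" where
  "jumped_before \<omega> t \<equiv> jumps_before (\<lambda>n. \<tau> n \<omega>) (ennreal t)"

lemma AE_jump_times: "AE \<omega> in M. jump_times (\<lambda>n. \<tau> n \<omega>)"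
  using times_increasing times_infinite times_tendsto AE_space
  by eventually_elim (simp add: jump_times_def time_0)

lemma mark_in_space: "\<omega> \<in> space M \<Longrightarrow> \<xi> n \<omega> \<in> space K"
  using marks_measurable[of n] by (rule measurable_space)

lemma counting_process_eq_sum:
  assumes "jump_times (\<lambda>n. \<tau> n \<omega>)"
  shows "counting_process \<tau> \<xi> C \<omega> t = (\<Sum>n\<in>jumped \<omega> t. indicator C (\<xi> n \<omega>))"
proof -
  interpret jump_times "\<lambda>n. \<tau> n \<omega>" by fact
  have fin: "finite (jumped \<omega> t)" by (rule finite_jumps_upto) simp
  have fin': "finite (Suc -` jumped \<omega> t)" using fin by (rule finite_vimageI) simp
  have "counting_process \<tau> \<xi> C \<omega> t = (\<Sum>n\<in>Suc -` jumped \<omega> t. indicator C (\<xi> (Suc n) \<omega>))"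
    unfolding counting_process_def
    by (subst suminf_finite[OF fin']) (auto simp: jumps_upto_def intro!: sum.cong)
  also have "\<dots> = (\<Sum>n\<in>Suc ` (Suc -` jumped \<omega> t). indicator C (\<xi> n \<omega>))"
    by (subst sum.reindex) auto
  also have "Suc ` (Suc -` jumped \<omega> t) = jumped \<omega> t"
    by (auto simp: jumps_upto_def image_iff) (metis Suc_le_D)
  finally show ?thesis .
qed

text \<open>\<open>P\<close> contains only nonnegative times, whereas \<open>dA\<close> is a measure
  on the whole line; the path is therefore extended by its value at 0. Integrals over subsets of
  \<open>(0,T]\<close> do not see the extension.\<close>

lemma path_measurable:
  assumes "(\<lambda>(\<omega>, t). X \<omega> t) \<in> P \<rightarrow>\<^sub>M N" "\<omega> \<in> space M"
  shows "(\<lambda>t. X \<omega> (max 0 t)) \<in> borel \<rightarrow>\<^sub>M N"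
proof -
  have "(\<lambda>t. max 0 t) \<in> borel \<rightarrow>\<^sub>M restrict_space borel {0::real..}"
    by (rule measurable_restrict_space2) auto
  from measurable_compose[OF measurable_compose[OF this path_measurable_P[OF assms(2)]] assms(1)]
  show ?thesis by simp
qed

lemma field_path_measurable:
  assumes "(\<lambda>((\<omega>, t), y). X \<omega> t y) \<in> P \<Otimes>\<^sub>M K \<rightarrow>\<^sub>M N" "\<omega> \<in> space M"
  shows "(\<lambda>(t, y). X \<omega> (max 0 t) y) \<in> borel \<Otimes>\<^sub>M K \<rightarrow>\<^sub>M N"
proof -
  have 1: "(\<lambda>t. max 0 t) \<in> borel \<rightarrow>\<^sub>M restrict_space borel {0::real..}"
    by (rule measurable_restrict_space2) auto
  have "(\<lambda>t. (\<omega>, max 0 t)) \<in> borel \<rightarrow>\<^sub>M P"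
    using measurable_compose[OF 1 path_measurable_P[OF assms(2)]] by simp
  then have "(\<lambda>x. ((\<omega>, max 0 (fst x)), snd x)) \<in> borel \<Otimes>\<^sub>M K \<rightarrow>\<^sub>M P \<Otimes>\<^sub>M K" by measurable
  from measurable_compose[OF this assms(1)] show ?thesis by (simp add: case_prod_unfold)
qed

text \<open>Progressive measurability at time 0 involves the one-point time set
  \<open>{0..0}\<close>, and its section there is measurable with respect to \<open>F 0\<close>.
  This is what will make the initial value of \<open>Y\<close> deterministic.\<close>

lemma progressive_time_0:
  assumes "progressive_upto F T Y" "0 \<le> T"
  shows "(\<lambda>\<omega>. Y \<omega> 0) \<in> borel_measurable (F 0)"
proof -
  have Y: "(\<lambda>(\<omega>, s). Y \<omega> s) \<in> borel_measurable (F 0 \<Otimes>\<^sub>M restrict_space borel {0..0})"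
    using assms(1) unfolding progressive_upto_def by (rule bspec) (use assms(2) in simp)
  have "(\<lambda>\<omega>. (\<omega>, 0)) \<in> F 0 \<rightarrow>\<^sub>M F 0 \<Otimes>\<^sub>M restrict_space borel {0..0::real}"
    by (rule measurable_Pair2') (simp add: space_restrict_space)
  from measurable_compose[OF this Y] show ?thesis by simp
qed

end

section \<open>Good paths and predictable time integrals\<close>

context compensated_mpp
begin

text \<open>
  Null sets belong to every \<open>F\<^sub>t\<close>, so changing a process off the good paths keeps it predictable.
\<close>

definition good :: "'a \<Rightarrow> bool" where
  "good \<omega> \<longleftrightarrow> \<omega> \<in> space M \<and> jump_times (\<lambda>n. \<tau> n \<omega>) \<and> continuous_path (dA A \<omega>) (A \<omega>) \<and>
    emeasure (dA A \<omega>) {..0} = 0"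

lemma AE_good: "AE \<omega> in M. good \<omega>"
  using A_0 A_increasing A_continuous AE_jump_times AE_space
proof eventually_elim
  case (elim \<omega>)
  define a where "a t = A \<omega> (max 0 t)" for t
  have mono: "a x \<le> a y" if "x \<le> y" for x y
    using elim(2) that by (auto simp: a_def monotone_on_def)
  have "continuous_on UNIV a"
    unfolding a_def using elim(3) by (rule continuous_on_compose2) (auto intro!: continuous_intros)
  then have "continuous (at_right x) a" for x
    by (auto simp: continuous_on_eq_continuous_within intro: continuous_within_subset)
  note em = emeasure_interval_measure_Ioc[OF _ mono this]
  have "continuous_path (dA A \<omega>) (A \<omega>)"
  proof
    show "emeasure (dA A \<omega>) {s<..t} = ennreal (A \<omega> t - A \<omega> s)" if "0 \<le> s" "s \<le> t" for s t
      using em[OF that(2)] that by (simp add: dA_def a_def[abs_def])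
  qed (use elim in \<open>auto simp: dA_def\<close>)
  \<comment> \<open>The extended path is constant on negative times and continuous at 0, so these
    intervals carry no mass, not even an atom at 0.\<close>
  moreover have "{- real n<..0} \<in> null_sets (dA A \<omega>)" for n
    using em[of "- real n" 0] by (simp add: dA_def a_def[abs_def] null_sets_def)
  then have "(\<Union>n. {- real n<..0}) \<in> null_sets (dA A \<omega>)" by (intro null_sets_UN)
  moreover have "(\<Union>n. {- real n<..0}) = {..0::real}"
  proof -
    have "\<exists>n. - real n < x" for x
      using reals_Archimedean2[of "- x"] by (metis minus_less_iff)
    then show ?thesis by auto
  qed
  ultimately show ?case using elim by (auto simp: good_def null_sets_def)
qed

lemma good_sets_F: "Collect good \<in> sets (F t)"
proof -
  have "{\<omega> \<in> space M. good \<omega>} = Collect good" by (auto simp: good_def)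
  then show ?thesis using AE_sets_F[OF AE_good, of t] by simp
qed

lemma good_space: "good \<omega> \<Longrightarrow> \<omega> \<in> space M" by (simp add: good_def)

lemma good_measurable_P[measurable]: "Measurable.pred P (\<lambda>w. good (fst w))"
proof -
  have "{w \<in> space P. good (fst w)} = Collect good \<times> {0..}"
    using good_space by auto
  then show ?thesis unfolding pred_def using sets_P_Ici[OF good_sets_F] by simp
qed

lemma good_measurable_M[measurable]: "Measurable.pred M good"
proof -
  have "{\<omega> \<in> space M. good \<omega>} = Collect good" using good_space by auto
  then show ?thesis unfolding pred_def using good_sets_F[of 0] sets_F_subset[of 0] by auto
qed

lemma good_measurable_F[measurable]: "Measurable.pred (F t) good"
proof -
  have "{\<omega> \<in> space (F t). good \<omega>} = Collect good" using good_space by auto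
  then show ?thesis unfolding pred_def using good_sets_F[of t] by auto
qed

definition A_path :: "'a \<Rightarrow> real \<Rightarrow> real" where "A_path \<omega> t = (if good \<omega> then A \<omega> t else 0)"

lemma A_path_predictable: "(\<lambda>(\<omega>, t). A_path \<omega> t) \<in> borel_measurable P"
proof -
  have "(\<lambda>w. if good (fst w) then (case w of (\<omega>, t) \<Rightarrow> A \<omega> t) else 0) \<in> borel_measurable P"
    using A_predictable by measurable
  then show ?thesis by (simp add: A_path_def case_prod_unfold cong: if_cong)
qed

lemma stopped_path_predictable: "0 \<le> s \<Longrightarrow> (\<lambda>(\<omega>, t). A_path \<omega> (min t s)) \<in> borel_measurable P"
  using measurable_compose[OF stop_measurable_P A_path_predictable] by (simp add: case_prod_unfold)

lemma good_A_path:
  assumes "good \<omega>"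
  shows "continuous_path (dA A \<omega>) (A_path \<omega>)"
  using assms by (simp add: A_path_def[abs_def] good_def)

lemma sets_dA[simp, measurable_cong]: "sets (dA A \<omega>) = sets borel"
  by (simp add: dA_def)

lemma space_dA[simp]: "space (dA A \<omega>) = UNIV"
  by (simp add: dA_def)

text \<open>The integral up to \<open>t\<close> is an integral of \<open>H\<close> against a finite
  kernel: the image of \<open>dA\<close> restricted to \<open>(0,t]\<close> under \<open>s\<close>
  maps to \<open>(\<omega>, s)\<close>. It suffices to measure generating sets. A set at time 0 has
  mass 0, and on \<open>B \<times> {s<..s'}\<close> the mass is a difference of two stopped paths of
  \<open>A\<close>, switched on by \<open>B\<close> after \<open>s\<close>.\<close>

lemma predictable_time_integral:
  fixes H :: "'a \<Rightarrow> real \<Rightarrow> ennreal"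
  assumes H: "(\<lambda>(\<omega>, t). H \<omega> t) \<in> borel_measurable P"
  shows "(\<lambda>(\<omega>, t). if good \<omega> then \<integral>\<^sup>+s\<in>{0<..t}. H \<omega> s \<partial>dA A \<omega> else 0) \<in> borel_measurable P"
proof -
  define \<kappa> where "\<kappa> w = (if good (fst w) then
      distr (restrict_space (dA A (fst w)) {0<..snd w}) P (\<lambda>s. (fst w, s)) else null_measure P)" for w
  have meas: "(\<lambda>s. (\<omega>, s)) \<in> restrict_space (dA A \<omega>) {0<..t} \<rightarrow>\<^sub>M P" if "good \<omega>" for \<omega> t
  proof -
    have "(\<lambda>s. s) \<in> restrict_space (dA A \<omega>) {0<..t} \<rightarrow>\<^sub>M restrict_space borel {0..}"
      by (rule measurable_restrict_space2)
        (auto simp: space_restrict_space intro!: measurable_restrict_space1)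
    from measurable_compose[OF this path_measurable_P[OF good_space[OF that]]] show ?thesis .
  qed
  have int: "(\<integral>\<^sup>+v. f v \<partial>\<kappa> (\<omega>, t)) = (if good \<omega> then \<integral>\<^sup>+s\<in>{0<..t}. f (\<omega>, s) \<partial>dA A \<omega> else 0)"
    if "f \<in> borel_measurable P" for f \<omega> t
    using that by (auto simp: \<kappa>_def nn_integral_distr meas nn_integral_restrict_space)
  have em: "emeasure (\<kappa> (\<omega>, t)) D = (if good \<omega> then \<integral>\<^sup>+s\<in>{0<..t}. indicator D (\<omega>, s) \<partial>dA A \<omega> else 0)"
    if "D \<in> sets P" for D \<omega> t
    using int[of "indicator D" \<omega> t] that nn_integral_indicator[of D "\<kappa> (\<omega>, t)"]
    by (simp add: \<kappa>_def del: nn_integral_indicator split: if_splits)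
  have em_Ioc: "emeasure (dA A \<omega>) {s<..t} = ennreal (A_path \<omega> t - A_path \<omega> s)" if "good \<omega>" "0 \<le> s" "s \<le> t" for \<omega> s t
    using continuous_path.emeasure_Ioc[OF good_A_path[OF that(1)] that(2,3)] .
  have "(\<lambda>w. \<integral>\<^sup>+v. (case v of (\<omega>, t) \<Rightarrow> H \<omega> t) \<partial>\<kappa> w) \<in> borel_measurable P"
  proof (rule finite_kernel_nn_integral_measurable[OF sets_P Int_stable_predictable_generator
        predictable_generator_subset _ _ _ _ _ H])
    show "space M \<times> {0::real..} \<noteq> {}" using not_empty by auto
    show "sets (\<kappa> w) = sets P" for w by (simp add: \<kappa>_def)
    have total: "emeasure (\<kappa> (\<omega>, t)) (space M \<times> {0..}) = ennreal (A_path \<omega> t - A_path \<omega> 0)" if "0 \<le> t" for \<omega> t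
    proof (cases "good \<omega>")
      case True
      have "emeasure (\<kappa> (\<omega>, t)) (space P) = (\<integral>\<^sup>+s\<in>{0<..t}. 1 \<partial>dA A \<omega>)"
        using True good_space[OF True]
        by (subst em[OF sets.top]) (auto intro!: nn_integral_cong simp: indicator_def)
      then show ?thesis using True em_Ioc[OF True order_refl that] by simp
    next
      case False
      have "emeasure (\<kappa> (\<omega>, t)) (space P) = 0" using False by (subst em[OF sets.top]) auto
      then show ?thesis using False by (simp add: A_path_def)
    qed
    show "emeasure (\<kappa> w) (space M \<times> {0..}) < \<infinity>" if "w \<in> space P" for w
      using that total by (cases w) auto
    have "(\<lambda>w. ennreal ((case w of (\<omega>, t) \<Rightarrow> A_path \<omega> t) - (case w of (\<omega>, t) \<Rightarrow> A_path \<omega> (min t 0)))) \<in> borel_measurable P"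
      using A_path_predictable stopped_path_predictable[of 0] by measurable
    also have "?this \<longleftrightarrow> (\<lambda>w. emeasure (\<kappa> w) (space M \<times> {0..})) \<in> borel_measurable P"
      by (intro measurable_cong) (auto simp: total)
    finally show "(\<lambda>w. emeasure (\<kappa> w) (space M \<times> {0..})) \<in> borel_measurable P" .
    fix D assume D: "D \<in> predictable_generator"
    then have DP: "D \<in> sets P" by (simp add: sets_P)
    from D show "(\<lambda>w. emeasure (\<kappa> w) D) \<in> borel_measurable P"
    proof (cases rule: predictable_generatorE)
      case (zero B)
      have null: "indicator D (\<omega>, s) * indicator {0<..t} s = (0::ennreal)" for \<omega> s t
        by (auto simp: zero indicator_def)
      then have "emeasure (\<kappa> (\<omega>, t)) D = 0" for \<omega> t
        unfolding em[OF DP] null by simp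
      then have "emeasure (\<kappa> w) D = 0" for w by (cases w) simp
      then show ?thesis by simp
    next
      case (Ioc B s s')
      have [measurable]: "(\<lambda>(\<omega>, t). A_path \<omega> (min t s)) \<in> borel_measurable P"
        "(\<lambda>(\<omega>, t). A_path \<omega> (min t s')) \<in> borel_measurable P" "B \<times> {s<..} \<in> sets P"
        using stopped_path_predictable Ioc(2,3) sets_P_Ioi[OF Ioc(4,2)] by auto
      have "(\<lambda>w. indicator (B \<times> {s<..}) w * ennreal ((case w of (\<omega>, t) \<Rightarrow> A_path \<omega> (min t s'))
          - (case w of (\<omega>, t) \<Rightarrow> A_path \<omega> (min t s)))) \<in> borel_measurable P"
        by measurable
      also have "?this \<longleftrightarrow> ?thesis"
      proof (intro measurable_cong)
        fix w assume "w \<in> space P"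
        obtain \<omega> t where w: "w = (\<omega>, t)" by (cases w)
        show "indicator (B \<times> {s<..}) w * ennreal ((case w of (\<omega>, t) \<Rightarrow> A_path \<omega> (min t s'))
          - (case w of (\<omega>, t) \<Rightarrow> A_path \<omega> (min t s))) = emeasure (\<kappa> w) D"
        proof (cases "good \<omega> \<and> \<omega> \<in> B \<and> s < t")
          case True
          have "emeasure (\<kappa> w) D = (\<integral>\<^sup>+v. indicator {s<..min t s'} v \<partial>dA A \<omega>)"
            unfolding w em[OF DP] using True \<open>0 \<le> s\<close>
            by (auto intro!: nn_integral_cong simp: Ioc(1) indicator_def)
          also have "\<dots> = ennreal (A_path \<omega> (min t s') - A_path \<omega> (min t s))"
            using True Ioc(2,3) em_Ioc[of \<omega> s "min t s'"] by simp
          finally show ?thesis using True by (simp add: w)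
        next
          case False
          then have "emeasure (\<kappa> w) D = 0"
            unfolding w em[OF DP] by (auto simp: Ioc(1) indicator_def intro!: nn_integral_zero')
          then show ?thesis using False by (auto simp: w indicator_def A_path_def)
        qed
      qed
      finally show ?thesis .
    qed
  qed
  also have "?this \<longleftrightarrow> ?thesis"
    by (intro measurable_cong) (auto simp: int[OF H])
  finally show ?thesis .
qed

section \<open>Jump counts and jump sums as predictable processes\<close>

lemma good_jump_times: "good \<omega> \<Longrightarrow> jump_times (\<lambda>n. \<tau> n \<omega>)"
  by (simp add: good_def)

lemma finite_jumped[simp]: "good \<omega> \<Longrightarrow> finite (jumped \<omega> t)"
  by (intro jump_times.finite_jumps_upto good_jump_times) auto

lemma finite_jumped_before[simp]: "good \<omega> \<Longrightarrow> finite (jumped_before \<omega> t)"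
  by (intro jump_times.finite_jumps_before good_jump_times) auto

lemma jumped_jump_time: "n \<in> jumped \<omega> t \<Longrightarrow> \<tau> n \<omega> = ennreal (jump_time n \<omega>)"
  by (auto simp: jumps_upto_def order_le_less_trans)

lemma jumped_before_jump_time: "n \<in> jumped_before \<omega> t \<Longrightarrow> \<tau> n \<omega> = ennreal (jump_time n \<omega>)"
  by (auto simp: jumps_before_def order_less_trans)

lemma jumped_before_less: "n \<in> jumped_before \<omega> t \<Longrightarrow> jump_time n \<omega> < t"
  using jumped_before_jump_time[of n \<omega> t] unfolding jumps_before_def
  by (metis (mono_tags, lifting) ennreal_less_iff enn2real_nonneg mem_Collect_eq)

lemma jumped_le: "n \<in> jumped \<omega> t \<Longrightarrow> 0 \<le> t \<Longrightarrow> jump_time n \<omega> \<le> t"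
  using jumped_jump_time[of n \<omega> t] unfolding jumps_upto_def
  by (metis (mono_tags, lifting) ennreal_le_iff mem_Collect_eq)

lemma jumped_mono: "s \<le> t \<Longrightarrow> jumped \<omega> s \<subseteq> jumped \<omega> t"
  unfolding jumps_upto_def using ennreal_leI order_trans by blast

text \<open>The number of jumps after \<open>s\<close> and strictly before \<open>t\<close> is
  left-continuous in \<open>t\<close>, so it is the supremum over rational \<open>q\<close> between
  \<open>s\<close> and \<open>t\<close> of the counts up to \<open>q\<close>. Each of these is known
  at time \<open>q\<close> and used only after \<open>q\<close>.\<close>

lemma predictable_counting_after:
  assumes B: "B \<in> sets (F s)" and "0 \<le> s" and C: "C \<in> sets K"
  shows "(\<lambda>(\<omega>, t). if good \<omega> \<and> \<omega> \<in> B then \<Sum>n\<in>jumped_before \<omega> t - jumped \<omega> s. indicator C (\<xi> n \<omega>) else (0::ennreal))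
    \<in> borel_measurable P"
proof -
  define g :: "real \<Rightarrow> 'a \<Rightarrow> ennreal" where "g q \<omega> = (if good \<omega> \<and> \<omega> \<in> B then
    counting_process \<tau> \<xi> C \<omega> q - counting_process \<tau> \<xi> C \<omega> s else 0)" for q \<omega>
  have g_eq: "g q \<omega> = (\<Sum>n\<in>jumped \<omega> q - jumped \<omega> s. indicator C (\<xi> n \<omega>))" if "s \<le> q" "good \<omega>" "\<omega> \<in> B" for q \<omega>
  proof -
    have "jumped \<omega> s \<subseteq> jumped \<omega> q" using that(1) by (rule jumped_mono)
    then have "counting_process \<tau> \<xi> C \<omega> q =
        (\<Sum>n\<in>jumped \<omega> q - jumped \<omega> s. indicator C (\<xi> n \<omega>)) + counting_process \<tau> \<xi> C \<omega> s"
      using that by (simp add: counting_process_eq_sum good_jump_times sum.subset_diff)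
    moreover have "counting_process \<tau> \<xi> C \<omega> s \<noteq> \<top>"
      using that by (auto simp: counting_process_eq_sum good_jump_times indicator_def)
    ultimately show ?thesis using that by (simp add: g_def)
  qed
  have g_meas: "g q \<in> borel_measurable (F q)" if "s < q" for q
  proof -
    have [measurable]: "B \<in> sets (F q)" using B sets_F_mono[of s q] that by auto
    have [measurable]: "(\<lambda>\<omega>. counting_process \<tau> \<xi> C \<omega> q) \<in> borel_measurable (F q)"
      "(\<lambda>\<omega>. counting_process \<tau> \<xi> C \<omega> s) \<in> borel_measurable (F q)"
      using counting_process_adapted[OF C] that \<open>0 \<le> s\<close> by auto
    show ?thesis unfolding g_def[abs_def] by measurable
  qed
  let ?Q = "{q \<in> \<rat>. s < q}"
  have "(\<lambda>w. SUP q\<in>?Q. (case w of (\<omega>, t) \<Rightarrow> if q < t then g q \<omega> else 0)) \<in> borel_measurable P"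
    using g_meas \<open>0 \<le> s\<close>
    by (intro borel_measurable_SUP after_time_measurable_P countable_subset[OF _ countable_rat]) auto
  also have "(\<lambda>w. SUP q\<in>?Q. (case w of (\<omega>, t) \<Rightarrow> if q < t then g q \<omega> else 0)) =
    (\<lambda>(\<omega>, t). if good \<omega> \<and> \<omega> \<in> B then \<Sum>n\<in>jumped_before \<omega> t - jumped \<omega> s. indicator C (\<xi> n \<omega>) else (0::ennreal))"
  proof (rule ext, clarify)
    fix \<omega> t
    have ne: "?Q \<noteq> {}" using Rats_dense_in_real[of s "s + 1"] by auto
    show "(SUP q\<in>?Q. if q < t then g q \<omega> else 0) =
      (if good \<omega> \<and> \<omega> \<in> B then \<Sum>n\<in>jumped_before \<omega> t - jumped \<omega> s. indicator C (\<xi> n \<omega>) else 0)"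
    proof (cases "good \<omega> \<and> \<omega> \<in> B")
      case True
      then have good: "good \<omega>" by simp
      show ?thesis
      proof (rule antisym)
        show "(SUP q\<in>?Q. if q < t then g q \<omega> else 0) \<le> (if good \<omega> \<and> \<omega> \<in> B then \<Sum>n\<in>jumped_before \<omega> t - jumped \<omega> s. indicator C (\<xi> n \<omega>) else 0)"
        proof (rule SUP_least)
          fix q assume q: "q \<in> ?Q"
          have "jumped \<omega> q \<subseteq> jumped_before \<omega> t" if "q < t"
            using that q \<open>0 \<le> s\<close> by (auto simp: jumps_upto_def jumps_before_def ennreal_less_iff intro: le_less_trans)
          then show "(if q < t then g q \<omega> else 0) \<le> (if good \<omega> \<and> \<omega> \<in> B then \<Sum>n\<in>jumped_before \<omega> t - jumped \<omega> s. indicator C (\<xi> n \<omega>) else 0)"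
            using True q by (auto simp: g_eq intro!: sum_mono2)
        qed
        show "(if good \<omega> \<and> \<omega> \<in> B then \<Sum>n\<in>jumped_before \<omega> t - jumped \<omega> s. indicator C (\<xi> n \<omega>) else 0) \<le> (SUP q\<in>?Q. if q < t then g q \<omega> else 0)"
        proof (cases "s < t")
          case False
          then have e: "jumped_before \<omega> t - jumped \<omega> s = {}"
            by (auto simp: jumps_upto_def jumps_before_def not_less intro: order_trans[OF less_imp_le ennreal_leI])
          then show ?thesis unfolding e by simp
        next
          case st: True
          \<comment> \<open>The last jump before \<open>t\<close>, or \<open>s\<close> if there is
            none after it. A rational \<open>q\<close> between \<open>m\<close> and \<open>t\<close>
            already sees every jump before \<open>t\<close>, so the supremum is attained.\<close>
          define m where "m = Max (insert s ((\<lambda>n. jump_time n \<omega>) ` jumped_before \<omega> t))"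
          have "jump_time n \<omega> < t" if "n \<in> jumped_before \<omega> t" for n
            by (rule jumped_before_less[OF that])
          then have "m < t" using st good by (auto simp: m_def)
          then obtain q where q: "q \<in> \<rat>" "m < q" "q < t" using Rats_dense_in_real by blast
          have m: "s \<le> m" "\<And>n. n \<in> jumped_before \<omega> t \<Longrightarrow> jump_time n \<omega> \<le> m"
            unfolding m_def using good by (auto intro!: Max_ge)
          have "jumped_before \<omega> t \<subseteq> jumped \<omega> q"
          proof
            fix n assume n: "n \<in> jumped_before \<omega> t"
            have "ennreal (jump_time n \<omega>) \<le> ennreal q" using m(2)[OF n] q by (intro ennreal_leI) simp
            then show "n \<in> jumped \<omega> q" using n jumped_before_jump_time[OF n] by (simp add: jumps_upto_def jumps_before_def)
          qed
          then have "(\<Sum>n\<in>jumped_before \<omega> t - jumped \<omega> s. indicator C (\<xi> n \<omega>)) \<le> (if q < t then g q \<omega> else 0)"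
            using True q m by (auto simp: g_eq intro!: sum_mono2)
          also have "\<dots> \<le> (SUP q\<in>?Q. if q < t then g q \<omega> else 0)"
            using q m by (intro SUP_upper) auto
          finally show ?thesis using True by simp
        qed
      qed
    next
      case False
      then have z: "(if q < t then g q \<omega> else 0) = 0" for q by (auto simp: g_def)
      show ?thesis unfolding z using False ne by auto
    qed
  qed
  finally show ?thesis .
qed

lemma pair_generator_subset:
  "{D \<times> C |D C. D \<in> predictable_generator \<and> C \<in> sets K} \<subseteq> Pow (space P \<times> space K)"
proof
  fix E assume "E \<in> {D \<times> C |D C. D \<in> predictable_generator \<and> C \<in> sets K}"
  then obtain D C where E: "E = D \<times> C" "D \<in> predictable_generator" "C \<in> sets K" by blast
  have "D \<subseteq> space P" "C \<subseteq> space K"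
    using E predictable_generator_subset sets.sets_into_space[of C K] by (simp_all add: subset_iff)
  then show "E \<in> Pow (space P \<times> space K)" unfolding E by blast
qed

text \<open>Products of generators generate the product because the predictable generator contains a
  countable cover of \<open>space P\<close>: time 0 and the strips up to
  \<open>real (Suc n)\<close>.\<close>

lemma sets_P_pair:
  "sets (P \<Otimes>\<^sub>M K) = sigma_sets (space P \<times> space K) {D \<times> C |D C. D \<in> predictable_generator \<and> C \<in> sets K}"
proof -
  have top: "space M \<in> sets (F 0)" using sets.top[of "F 0"] by simp
  let ?cover = "insert (space M \<times> {0}) (range (\<lambda>n. space M \<times> {0<..real (Suc n)}))"
  have "sets (P \<Otimes>\<^sub>M K) = sets (sigma (space P \<times> space K) {D \<times> C |D C. D \<in> predictable_generator \<and> C \<in> sets K})"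
  proof (rule sets_pair_eq)
    show "predictable_generator \<subseteq> Pow (space P)" "sets P = sigma_sets (space P) predictable_generator"
      using predictable_generator_subset sets_P by simp_all
    show "countable ?cover" by simp
    show "?cover \<subseteq> predictable_generator" using predictable_generatorI top by auto
    have "\<exists>n. t \<le> real (Suc n)" for t
      by (meson real_arch_simple le_Suc_eq of_nat_mono order_refl order_trans)
    then show "\<Union>?cover = space P" by fastforce
    show "sets K \<subseteq> Pow (space K)" by (rule sets.space_closed)
    show "sets K = sigma_sets (space K) (sets K)" by (simp add: sets.sigma_sets_eq)
    show "countable {space K}" "{space K} \<subseteq> sets K" "\<Union>{space K} = space K" by auto
  qed
  also have "\<dots> = sigma_sets (space P \<times> space K) {D \<times> C |D C. D \<in> predictable_generator \<and> C \<in> sets K}"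
    by (rule sets_measure_of[OF pair_generator_subset])
  finally show ?thesis .
qed

text \<open>The marked jumps strictly before \<open>t\<close> form a finite kernel, so again only
  generating rectangles have to be checked. Excluding a jump at \<open>t\<close> itself is what
  makes the sum predictable rather than merely adapted.\<close>

lemma predictable_jump_sum:
  fixes H :: "'a \<Rightarrow> real \<Rightarrow> 'k \<Rightarrow> ennreal"
  assumes H: "(\<lambda>((\<omega>, t), y). H \<omega> t y) \<in> borel_measurable (P \<Otimes>\<^sub>M K)"
  shows "(\<lambda>(\<omega>, t). if good \<omega> then \<Sum>n\<in>jumped_before \<omega> t. H \<omega> (jump_time n \<omega>) (\<xi> n \<omega>) else 0) \<in> borel_measurable P"
proof -
  define \<kappa> where "\<kappa> w = (if good (fst w) then
      distr (count_space (jumped_before (fst w) (snd w))) (P \<Otimes>\<^sub>M K) (\<lambda>n. ((fst w, jump_time n (fst w)), \<xi> n (fst w)))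
      else null_measure (P \<Otimes>\<^sub>M K))" for w
  have int: "(\<integral>\<^sup>+v. f v \<partial>\<kappa> (\<omega>, t)) = (if good \<omega> then \<Sum>n\<in>jumped_before \<omega> t. f ((\<omega>, jump_time n \<omega>), \<xi> n \<omega>) else 0)"
    if "f \<in> borel_measurable (P \<Otimes>\<^sub>M K)" for f \<omega> t
    using that by (auto simp: \<kappa>_def nn_integral_distr space_pair_measure good_space mark_in_space
        nn_integral_count_space_finite)
  have em: "emeasure (\<kappa> (\<omega>, t)) D = (if good \<omega> then \<Sum>n\<in>jumped_before \<omega> t. indicator D ((\<omega>, jump_time n \<omega>), \<xi> n \<omega>) else 0)"
    if "D \<in> sets (P \<Otimes>\<^sub>M K)" for D \<omega> t
    using int[of "indicator D" \<omega> t] that nn_integral_indicator[of D "\<kappa> (\<omega>, t)"]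
    by (simp add: \<kappa>_def del: nn_integral_indicator split: if_splits)
  have zero: "jumped \<omega> 0 = {}" if "good \<omega>" for \<omega>
  proof -
    have "\<tau> n \<omega> \<noteq> 0" if "1 \<le> n" for n
      using jump_times.times_pos[OF good_jump_times[OF \<open>good \<omega>\<close>] that] by simp
    then show ?thesis by (auto simp: jumps_upto_def)
  qed
  have "(\<lambda>w. \<integral>\<^sup>+v. (\<lambda>((\<omega>, t), y). H \<omega> t y) v \<partial>\<kappa> w) \<in> borel_measurable P"
  proof (rule finite_kernel_nn_integral_measurable[where \<kappa> = \<kappa> and M = P, OF sets_P_pair _ _ _ _ _ _ _ H])
    show "Int_stable {D \<times> C |D C. D \<in> predictable_generator \<and> C \<in> sets K}"
    proof (rule Int_stableI, clarify)
      fix D C D' C' assume "D \<in> predictable_generator" "D' \<in> predictable_generator" "C \<in> sets K" "C' \<in> sets K"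
      then show "\<exists>E B. D \<times> C \<inter> D' \<times> C' = E \<times> B \<and> E \<in> predictable_generator \<and> B \<in> sets K"
        using Int_stableD[OF Int_stable_predictable_generator] by (intro exI[of _ "D \<inter> D'"] exI[of _ "C \<inter> C'"]) auto
    qed
    show "{D \<times> C |D C. D \<in> predictable_generator \<and> C \<in> sets K} \<subseteq> Pow (space P \<times> space K)"
      by (rule pair_generator_subset)
    show "space P \<times> space K \<noteq> {}" using not_empty initial_mark(1) by auto
    show "sets (\<kappa> w) = sets (P \<Otimes>\<^sub>M K)" for w by (simp add: \<kappa>_def)
    have total: "emeasure (\<kappa> (\<omega>, t)) (space P \<times> space K) =
        (if good \<omega> \<and> \<omega> \<in> space M then \<Sum>n\<in>jumped_before \<omega> t - jumped \<omega> 0. indicator (space K) (\<xi> n \<omega>) else 0)" for \<omega> t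
      using em[OF sets.top, of \<omega> t] zero[of \<omega>] good_space[of \<omega>] mark_in_space[of \<omega>]
      by (auto simp: space_pair_measure)
    have "emeasure (\<kappa> (\<omega>, t)) (space P \<times> space K) < \<infinity>" for \<omega> t
      unfolding total by (auto simp: less_top[symmetric] indicator_def)
    then show "emeasure (\<kappa> w) (space P \<times> space K) < \<infinity>" for w by (cases w) simp
    have "space M \<in> sets (F 0)" using sets.top[of "F 0"] by simp
    from predictable_counting_after[OF this order_refl sets.top]
    show "(\<lambda>w. emeasure (\<kappa> w) (space P \<times> space K)) \<in> borel_measurable P"
      by (simp add: total[symmetric] case_prod_unfold)
    fix E assume "E \<in> {D \<times> C |D C. D \<in> predictable_generator \<and> C \<in> sets K}"
    then obtain D C where E: "E = D \<times> C" "D \<in> predictable_generator" "C \<in> sets K" by blast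
    then have ES: "E \<in> sets (P \<Otimes>\<^sub>M K)" by (auto simp: sets_P)
    from E(2) show "(\<lambda>w. emeasure (\<kappa> w) E) \<in> borel_measurable P"
    proof (cases rule: predictable_generatorE)
      case D: (zero B)
      have "emeasure (\<kappa> (\<omega>, t)) E = 0" for \<omega> t
      proof -
        have "jump_time n \<omega> \<noteq> 0" if "good \<omega>" "n \<in> jumped_before \<omega> t" for n
          using jumped_before_jump_time[OF that(2)] jump_times.times_pos[OF good_jump_times[OF that(1)], of n] that(2)
          by (auto simp: jumps_before_def)
        then show ?thesis unfolding em[OF ES] by (auto simp: E D indicator_def)
      qed
      then have "emeasure (\<kappa> w) E = 0" for w by (cases w) simp
      then show ?thesis by simp
    next
      case D: (Ioc B s s')
      \<comment> \<open>The jumps of a rectangle lie in \<open>(s, s']\<close>: count those after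
        \<open>s\<close> and subtract those after \<open>s'\<close>. The base set \<open>B\<close>
        belongs to both \<open>F s\<close> and \<open>F s'\<close>.\<close>
      define h where "h v w = (case w of (\<omega>, t) \<Rightarrow> if good \<omega> \<and> \<omega> \<in> B then \<Sum>n\<in>jumped_before \<omega> t - jumped \<omega> v. indicator C (\<xi> n \<omega>) else (0::ennreal))" for v w
      have "(\<lambda>w. h s w - h s' w) \<in> borel_measurable P"
      proof -
        have "h s \<in> borel_measurable P" "h s' \<in> borel_measurable P"
          unfolding h_def[abs_def] using D E sets_F_mono[of s s']
          by (auto intro!: predictable_counting_after)
        then show ?thesis by measurable
      qed
      also have "?this \<longleftrightarrow> ?thesis"
      proof (intro measurable_cong)
        fix w assume "w \<in> space P"
        obtain \<omega> t where w: "w = (\<omega>, t)" by (cases w)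
        show "h s w - h s' w = emeasure (\<kappa> w) E"
        proof (cases "good \<omega> \<and> \<omega> \<in> B")
          case True
          have "jumped \<omega> s \<subseteq> jumped \<omega> s'" using D(3) by (intro jumped_mono) simp
          then have split: "jumped_before \<omega> t - jumped \<omega> s = (jumped_before \<omega> t - jumped \<omega> s') \<union> (jumped_before \<omega> t \<inter> (jumped \<omega> s' - jumped \<omega> s))"
            by auto
          have "h s w = (\<Sum>n\<in>jumped_before \<omega> t \<inter> (jumped \<omega> s' - jumped \<omega> s). indicator C (\<xi> n \<omega>)) + h s' w"
            using True unfolding h_def w by (simp add: split, subst sum.union_disjoint) (auto simp: add.commute)
          moreover have "h s' w \<noteq> \<top>" using True by (auto simp: h_def w indicator_def)
          ultimately have "h s w - h s' w = (\<Sum>n\<in>jumped_before \<omega> t \<inter> (jumped \<omega> s' - jumped \<omega> s). indicator C (\<xi> n \<omega>))" by simp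
          also have "\<dots> = (\<Sum>n\<in>jumped_before \<omega> t. indicator E ((\<omega>, jump_time n \<omega>), \<xi> n \<omega>))"
          proof (rule sum.mono_neutral_cong_left)
            have iff: "n \<in> jumped \<omega> v \<longleftrightarrow> jump_time n \<omega> \<le> v" if "n \<in> jumped_before \<omega> t" "0 \<le> v" for n v
              using jumped_before_jump_time[OF that(1)] that by (auto simp: jumps_upto_def jumps_before_def) (metis ennreal_le_iff)+
            show "\<forall>n\<in>jumped_before \<omega> t - jumped_before \<omega> t \<inter> (jumped \<omega> s' - jumped \<omega> s). indicator E ((\<omega>, jump_time n \<omega>), \<xi> n \<omega>) = (0::ennreal)"
              using iff[of _ s] iff[of _ s'] D by (auto simp: E indicator_def)
            show "indicator C (\<xi> n \<omega>) = (indicator E ((\<omega>, jump_time n \<omega>), \<xi> n \<omega>) :: ennreal)"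
              if "n \<in> jumped_before \<omega> t \<inter> (jumped \<omega> s' - jumped \<omega> s)" for n
              using that iff[of n s] iff[of n s'] D True by (auto simp: E indicator_def)
          qed (use True in auto)
          finally show ?thesis using True by (simp add: w em[OF ES])
        next
          case False
          then have "emeasure (\<kappa> (\<omega>, t)) E = 0" unfolding em[OF ES] by (auto simp: E(1) D(1))
          then show ?thesis using False by (auto simp: w h_def)
        qed
      qed
      finally show ?thesis .
    qed
  qed
  also have "?this \<longleftrightarrow> ?thesis"
    by (intro measurable_cong) (auto simp: int[OF H])
  finally show ?thesis .
qed

lemma \<phi>_kernel: "(\<lambda>w. \<phi> (fst w) (snd w)) \<in> P \<rightarrow>\<^sub>M subprob_algebra K"
proof (rule measurable_subprob_algebra)
  fix w assume w: "w \<in> space P"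
  then interpret phi: prob_space "\<phi> (fst w) (snd w)" by (intro \<phi>_prob) auto
  show "subprob_space (\<phi> (fst w) (snd w))" by (rule prob_space_imp_subprob_space) (rule phi.prob_space_axioms)
  show "sets (\<phi> (fst w) (snd w)) = sets K" using w by (intro \<phi>_sets) auto
next
  fix C assume "C \<in> sets K"
  from \<phi>_predictable[OF this]
  have "(\<lambda>w. ennreal (measure (\<phi> (fst w) (snd w)) C)) \<in> borel_measurable P"
    by (simp add: case_prod_unfold)
  also have "?this \<longleftrightarrow> (\<lambda>w. emeasure (\<phi> (fst w) (snd w)) C) \<in> borel_measurable P"
  proof (rule measurable_cong)
    fix w assume "w \<in> space P"
    then interpret phi: prob_space "\<phi> (fst w) (snd w)" by (intro \<phi>_prob) auto
    show "ennreal (measure (\<phi> (fst w) (snd w)) C) = emeasure (\<phi> (fst w) (snd w)) C"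
      by (simp add: phi.emeasure_eq_measure)
  qed
  finally show "(\<lambda>w. emeasure (\<phi> (fst w) (snd w)) C) \<in> borel_measurable P" .
qed

lemma predictable_\<phi>_nn_integral:
  fixes H :: "'a \<Rightarrow> real \<Rightarrow> 'k \<Rightarrow> ennreal"
  assumes "(\<lambda>((\<omega>, t), y). H \<omega> t y) \<in> borel_measurable (P \<Otimes>\<^sub>M K)"
  shows "(\<lambda>(\<omega>, t). \<integral>\<^sup>+y. H \<omega> t y \<partial>\<phi> \<omega> t) \<in> borel_measurable P"
  using nn_integral_measurable_subprob_algebra2[OF _ \<phi>_kernel, of "\<lambda>w. H (fst w) (snd w)"] assms
  by (simp add: case_prod_unfold)

lemma predictable_\<phi>_integral:
  fixes H :: "'a \<Rightarrow> real \<Rightarrow> 'k \<Rightarrow> real"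
  assumes "(\<lambda>((\<omega>, t), y). H \<omega> t y) \<in> borel_measurable (P \<Otimes>\<^sub>M K)"
  shows "(\<lambda>(\<omega>, t). \<integral>y. H \<omega> t y \<partial>\<phi> \<omega> t) \<in> borel_measurable P"
proof -
  have field: "(\<lambda>((\<omega>, t), y). ennreal (h (H \<omega> t y))) \<in> borel_measurable (P \<Otimes>\<^sub>M K)"
    if "h \<in> borel_measurable borel" for h :: "real \<Rightarrow> real"
    using measurable_compose[OF assms measurable_compose[OF that measurable_ennreal]]
    by (simp add: case_prod_unfold)
  have [measurable]: "(\<lambda>w. \<integral>\<^sup>+y. ennreal (h (H (fst w) (snd w) y)) \<partial>\<phi> (fst w) (snd w)) \<in> borel_measurable P"
    if "h \<in> borel_measurable borel" for h :: "real \<Rightarrow> real"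
    using predictable_\<phi>_nn_integral[OF field[OF that]] by (simp add: case_prod_unfold)
  \<comment> \<open>The test on the norm reproduces the default value 0 of the Bochner integral at
    points where \<open>H\<close> is not integrable; elsewhere the integral is the difference of its
    positive and negative parts.\<close>
  have "(\<lambda>w. if (\<integral>\<^sup>+y. ennreal (norm (H (fst w) (snd w) y)) \<partial>\<phi> (fst w) (snd w)) < \<infinity>
      then enn2real (\<integral>\<^sup>+y. ennreal (H (fst w) (snd w) y) \<partial>\<phi> (fst w) (snd w)) -
        enn2real (\<integral>\<^sup>+y. ennreal (- H (fst w) (snd w) y) \<partial>\<phi> (fst w) (snd w)) else 0) \<in> borel_measurable P"
    by measurable
  also have "?this \<longleftrightarrow> (\<lambda>w. \<integral>y. H (fst w) (snd w) y \<partial>\<phi> (fst w) (snd w)) \<in> borel_measurable P"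
  proof (rule measurable_cong)
    fix w assume w: "w \<in> space P"
    have "H (fst w) (snd w) \<in> borel_measurable K"
      using measurable_compose[OF measurable_Pair1'[OF w] assms] by (simp add: case_prod_unfold)
    moreover have "sets (\<phi> (fst w) (snd w)) = sets K" using w by (intro \<phi>_sets) auto
    ultimately have m: "H (fst w) (snd w) \<in> borel_measurable (\<phi> (fst w) (snd w))"
      using measurable_cong_sets by blast
    show "(if (\<integral>\<^sup>+y. ennreal (norm (H (fst w) (snd w) y)) \<partial>\<phi> (fst w) (snd w)) < \<infinity>
      then enn2real (\<integral>\<^sup>+y. ennreal (H (fst w) (snd w) y) \<partial>\<phi> (fst w) (snd w)) -
        enn2real (\<integral>\<^sup>+y. ennreal (- H (fst w) (snd w) y) \<partial>\<phi> (fst w) (snd w)) else 0) =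
      (\<integral>y. H (fst w) (snd w) y \<partial>\<phi> (fst w) (snd w))"
      using m by (auto simp: real_lebesgue_integral_def integrable_iff_bounded not_integrable_integral_eq)
  qed
  finally show ?thesis by (simp add: case_prod_unfold)
qed

section \<open>Jump sums, time integrals and the compensator identity up to a fixed time\<close>

definition jump_sum :: "('a \<Rightarrow> real \<Rightarrow> 'k \<Rightarrow> 'b) \<Rightarrow> 'a \<Rightarrow> real \<Rightarrow> 'b :: comm_monoid_add" where
  "jump_sum H \<omega> t = (if good \<omega> then \<Sum>n\<in>jumped \<omega> t. H \<omega> (jump_time n \<omega>) (\<xi> n \<omega>) else 0)"

definition time_integral :: "('a \<Rightarrow> real \<Rightarrow> ennreal) \<Rightarrow> 'a \<Rightarrow> real \<Rightarrow> ennreal" where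
  "time_integral H \<omega> t = (if good \<omega> then \<integral>\<^sup>+s\<in>{0<..t}. H \<omega> s \<partial>dA A \<omega> else 0)"

text \<open>Predictable jump sums count jumps strictly before a time. To include a jump at
  \<open>T\<close>, the sum is taken at the later time \<open>T + 1\<close> with the terms after
  \<open>T\<close> removed.\<close>

lemma jumped_eq_before:
  assumes "0 \<le> T"
  shows "jumped \<omega> T = {n \<in> jumped_before \<omega> (T + 1). jump_time n \<omega> \<le> T}"
proof (intro set_eqI iffI)
  fix n assume n: "n \<in> jumped \<omega> T"
  have "ennreal T < ennreal (T + 1)" using assms by (simp add: ennreal_less_iff)
  then have "\<tau> n \<omega> < ennreal (T + 1)" using n by (auto simp: jumps_upto_def)
  then show "n \<in> {n \<in> jumped_before \<omega> (T + 1). jump_time n \<omega> \<le> T}"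
    using n jumped_le[OF n assms] by (auto simp: jumps_upto_def jumps_before_def)
next
  fix n assume n: "n \<in> {n \<in> jumped_before \<omega> (T + 1). jump_time n \<omega> \<le> T}"
  then have "\<tau> n \<omega> = ennreal (jump_time n \<omega>)" using jumped_before_jump_time by blast
  then have "\<tau> n \<omega> \<le> ennreal T" using n by (metis (mono_tags, lifting) ennreal_leI mem_Collect_eq)
  then show "n \<in> jumped \<omega> T" using n by (auto simp: jumps_upto_def jumps_before_def)
qed

lemma jump_sum_measurable:
  fixes H :: "'a \<Rightarrow> real \<Rightarrow> 'k \<Rightarrow> ennreal"
  assumes H: "(\<lambda>((\<omega>, t), y). H \<omega> t y) \<in> borel_measurable (P \<Otimes>\<^sub>M K)" and "0 \<le> T"
  shows "(\<lambda>\<omega>. jump_sum H \<omega> T) \<in> borel_measurable M"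
proof -
  define H' where "H' \<omega> t y = (if t \<le> T then H \<omega> t y else 0)" for \<omega> t y
  have "(\<lambda>w. if snd (fst w) \<le> T then (\<lambda>((\<omega>, t), y). H \<omega> t y) w else 0) \<in> borel_measurable (P \<Otimes>\<^sub>M K)"
    using H by measurable
  then have "(\<lambda>((\<omega>, t), y). H' \<omega> t y) \<in> borel_measurable (P \<Otimes>\<^sub>M K)"
    by (simp add: H'_def case_prod_unfold cong: if_cong)
  from measurable_compose[OF section_measurable_M predictable_jump_sum[OF this], of "T + 1"] \<open>0 \<le> T\<close>
  have "(\<lambda>\<omega>. if good \<omega> then \<Sum>n\<in>jumped_before \<omega> (T + 1). H' \<omega> (jump_time n \<omega>) (\<xi> n \<omega>) else 0) \<in> borel_measurable M"
    by simp
  also have "(\<lambda>\<omega>. if good \<omega> then \<Sum>n\<in>jumped_before \<omega> (T + 1). H' \<omega> (jump_time n \<omega>) (\<xi> n \<omega>) else 0) = (\<lambda>\<omega>. jump_sum H \<omega> T)"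
    unfolding jump_sum_def jumped_eq_before[OF \<open>0 \<le> T\<close>]
    by (intro ext if_cong refl) (auto simp: H'_def sum.inter_filter)
  finally show ?thesis .
qed

lemma time_integral_predictable:
  "(\<lambda>(\<omega>, t). H \<omega> t) \<in> borel_measurable P \<Longrightarrow> (\<lambda>(\<omega>, t). time_integral H \<omega> t) \<in> borel_measurable P"
  unfolding time_integral_def by (rule predictable_time_integral)

lemma time_integral_measurable:
  assumes "(\<lambda>(\<omega>, t). H \<omega> t) \<in> borel_measurable P" "0 \<le> T"
  shows "(\<lambda>\<omega>. time_integral H \<omega> T) \<in> borel_measurable M"
  using measurable_compose[OF section_measurable_M time_integral_predictable, of T H] assms by simp

lemma jump_measure_map_measurable:
  "\<omega> \<in> space M \<Longrightarrow> (\<lambda>n. (jump_time n \<omega>, \<xi> n \<omega>)) \<in> count_space X \<rightarrow>\<^sub>M borel \<Otimes>\<^sub>M K"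
  by (simp add: space_pair_measure mark_in_space)

lemma nn_integral_jump_measure:
  assumes "good \<omega>" "f \<in> borel_measurable (borel \<Otimes>\<^sub>M K)" "0 \<le> T" and zero: "\<And>t y. t \<notin> {0<..T} \<Longrightarrow> f (t, y) = 0"
  shows "(\<integral>\<^sup>+x. f x \<partial>jump_measure K \<tau> \<xi> \<omega>) = (\<Sum>n\<in>jumped \<omega> T. f (jump_time n \<omega>, \<xi> n \<omega>))"
proof -
  have "(\<integral>\<^sup>+x. f x \<partial>jump_measure K \<tau> \<xi> \<omega>) =
      (\<integral>\<^sup>+n. f (jump_time n \<omega>, \<xi> n \<omega>) \<partial>count_space {n. 1 \<le> n \<and> \<tau> n \<omega> < \<infinity>})"
    unfolding jump_measure_def
    using assms(2) by (subst nn_integral_distr[OF jump_measure_map_measurable[OF good_space[OF assms(1)]]]) auto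
  also have "\<dots> = (\<Sum>n\<in>jumped \<omega> T. f (jump_time n \<omega>, \<xi> n \<omega>))"
  proof (rule nn_integral_count_space')
    show "jumped \<omega> T \<subseteq> {n. 1 \<le> n \<and> \<tau> n \<omega> < \<infinity>}"
      by (auto simp: jumps_upto_def order_le_less_trans)
    fix n assume n: "n \<in> {n. 1 \<le> n \<and> \<tau> n \<omega> < \<infinity>}" "n \<notin> jumped \<omega> T"
    then have "\<tau> n \<omega> = ennreal (jump_time n \<omega>)" by simp
    then have "\<not> jump_time n \<omega> \<le> T" using n by (metis (mono_tags, lifting) ennreal_leI jumps_upto_def mem_Collect_eq)
    then show "f (jump_time n \<omega>, \<xi> n \<omega>) = 0" by (intro zero) simp
  qed (use assms(1) in simp)
  finally show ?thesis .
qed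

lemma jump_time_pos: "good \<omega> \<Longrightarrow> n \<in> jumped \<omega> t \<Longrightarrow> 0 < jump_time n \<omega>"
  using jumped_jump_time[of n \<omega> t] jump_times.times_pos[OF good_jump_times, of \<omega> n]
  by (auto simp: jumps_upto_def enn2real_positive_iff order_le_less_trans)

text \<open>The identity of the locale runs over all positive times; it is applied to
  \<open>H\<close> cut off after \<open>T\<close>. Along a good path the integral against the jump
  measure is then a finite sum.\<close>

lemma compensator:
  fixes H :: "'a \<Rightarrow> real \<Rightarrow> 'k \<Rightarrow> ennreal"
  assumes H: "(\<lambda>((\<omega>, t), y). H \<omega> t y) \<in> borel_measurable (P \<Otimes>\<^sub>M K)" and "0 \<le> T"
  shows "(\<integral>\<^sup>+\<omega>. jump_sum H \<omega> T \<partial>M) =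
    (\<integral>\<^sup>+\<omega>. time_integral (\<lambda>\<omega> t. \<integral>\<^sup>+y. H \<omega> t y \<partial>\<phi> \<omega> t) \<omega> T \<partial>M)"
proof -
  define H' where "H' \<omega> t y = (if t \<le> T then H \<omega> t y else 0)" for \<omega> t y
  have "(\<lambda>w. if snd (fst w) \<le> T then (\<lambda>((\<omega>, t), y). H \<omega> t y) w else 0) \<in> borel_measurable (P \<Otimes>\<^sub>M K)"
    using H by measurable
  then have H': "(\<lambda>((\<omega>, t), y). H' \<omega> t y) \<in> borel_measurable (P \<Otimes>\<^sub>M K)"
    by (simp add: H'_def case_prod_unfold cong: if_cong)
  have "(\<integral>\<^sup>+\<omega>. jump_sum H \<omega> T \<partial>M) =
      (\<integral>\<^sup>+\<omega>. (\<integral>\<^sup>+x\<in>{0<..} \<times> space K. H' \<omega> (fst x) (snd x) \<partial>jump_measure K \<tau> \<xi> \<omega>) \<partial>M)"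
  proof (rule nn_integral_cong_AE, rule AE_mp[OF AE_good], rule AE_I2, rule impI)
    fix \<omega> assume good: "good \<omega>"
    define f where "f x = (\<lambda>(t, y). H' \<omega> (max 0 t) y) x * indicator ({0<..} \<times> space K) x" for x
    have f: "f \<in> borel_measurable (borel \<Otimes>\<^sub>M K)"
      unfolding f_def using field_path_measurable[OF H' good_space[OF good]] by measurable
    have "(\<integral>\<^sup>+x\<in>{0<..} \<times> space K. H' \<omega> (fst x) (snd x) \<partial>jump_measure K \<tau> \<xi> \<omega>) = (\<integral>\<^sup>+x. f x \<partial>jump_measure K \<tau> \<xi> \<omega>)"
      by (intro nn_integral_cong) (auto simp: f_def indicator_def)
    also have "\<dots> = (\<Sum>n\<in>jumped \<omega> T. f (jump_time n \<omega>, \<xi> n \<omega>))"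
      by (rule nn_integral_jump_measure[OF good f \<open>0 \<le> T\<close>]) (auto simp: f_def H'_def indicator_def)
    also have "\<dots> = jump_sum H \<omega> T"
      unfolding jump_sum_def using \<open>0 \<le> T\<close> good jump_time_pos[OF good] jumped_le[OF _ \<open>0 \<le> T\<close>] mark_in_space[OF good_space[OF good]]
      by (auto intro!: sum.cong simp: f_def H'_def)
    finally show "jump_sum H \<omega> T = (\<integral>\<^sup>+x\<in>{0<..} \<times> space K. H' \<omega> (fst x) (snd x) \<partial>jump_measure K \<tau> \<xi> \<omega>)" by simp
  qed
  also have "\<dots> = (\<integral>\<^sup>+\<omega>. (\<integral>\<^sup>+t\<in>{0<..}. (\<integral>\<^sup>+y. H' \<omega> t y \<partial>\<phi> \<omega> t) \<partial>dA A \<omega>) \<partial>M)"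
    by (rule \<phi>_compensator[OF H'])
  also have "\<dots> = (\<integral>\<^sup>+\<omega>. time_integral (\<lambda>\<omega> t. \<integral>\<^sup>+y. H \<omega> t y \<partial>\<phi> \<omega> t) \<omega> T \<partial>M)"
    by (rule nn_integral_cong_AE, rule AE_mp[OF AE_good], rule AE_I2)
       (auto simp: time_integral_def H'_def indicator_def intro!: nn_integral_cong)
  finally show ?thesis .
qed

section \<open>The stochastic exponential\<close>

text \<open>The bounds hold at every argument and not just almost surely, so the exponential needs
  no further exceptional set. The control data are clipped later to meet this.\<close>

definition bounded_field :: "real \<Rightarrow> ('a \<Rightarrow> real \<Rightarrow> 'k \<Rightarrow> real) \<Rightarrow> bool" where
  "bounded_field C R \<longleftrightarrow> (\<lambda>((\<omega>, t), y). R \<omega> t y) \<in> borel_measurable (P \<Otimes>\<^sub>M K) \<and>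
     (\<forall>\<omega> t y. 0 \<le> R \<omega> t y \<and> R \<omega> t y \<le> C)"

lemma bounded_fieldD:
  assumes "bounded_field C R"
  shows "(\<lambda>((\<omega>, t), y). R \<omega> t y) \<in> borel_measurable (P \<Otimes>\<^sub>M K)" "0 \<le> R \<omega> t y" "R \<omega> t y \<le> C" "0 \<le> C"
proof -
  show "(\<lambda>((\<omega>, t), y). R \<omega> t y) \<in> borel_measurable (P \<Otimes>\<^sub>M K)" "0 \<le> R \<omega> t y" "R \<omega> t y \<le> C"
    using assms by (auto simp: bounded_field_def)
  have "0 \<le> R undefined undefined undefined" "R undefined undefined undefined \<le> C"
    using assms by (auto simp: bounded_field_def)
  then show "0 \<le> C" by linarith
qed

lemma field_compose:
  assumes "(\<lambda>((\<omega>, t), y). R \<omega> t y) \<in> P \<Otimes>\<^sub>M K \<rightarrow>\<^sub>M N" "h \<in> N \<rightarrow>\<^sub>M N'"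
  shows "(\<lambda>((\<omega>, t), y). h (R \<omega> t y)) \<in> P \<Otimes>\<^sub>M K \<rightarrow>\<^sub>M N'"
  using measurable_compose[OF assms] by (simp add: case_prod_unfold)

lemma process_field:
  assumes "(\<lambda>(\<omega>, t). X \<omega> t) \<in> P \<rightarrow>\<^sub>M N"
  shows "(\<lambda>((\<omega>, t), y). X \<omega> t) \<in> P \<Otimes>\<^sub>M K \<rightarrow>\<^sub>M N"
  using measurable_compose[OF measurable_fst assms] by (simp add: case_prod_unfold)

text \<open>
  The product is the exponential of a jump sum of logarithms, after \<open>R\<close> is replaced by
  \<open>max R (1/j)\<close> because it may vanish.
\<close>

lemma predictable_jump_prod:
  assumes R: "bounded_field C R"
  shows "(\<lambda>(\<omega>, t). if good \<omega> then \<Prod>n\<in>jumped_before \<omega> t. R \<omega> (jump_time n \<omega>) (\<xi> n \<omega>) else 0) \<in> borel_measurable P"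
proof -
  \<comment> \<open>\<open>D\<close> dominates every \<open>R'\<close>, so the terms
    \<open>ln (D / R')\<close> are nonnegative and their sums fall under
    \<open>predictable_jump_sum\<close>; the jump count \<open>?N\<close> times \<open>ln D\<close>
    then restores \<open>ln R'\<close>.\<close>
  define D where "D = max C 1"
  define R' where "R' j \<omega> t y = max (R \<omega> t y) (1 / real (Suc j))" for j \<omega> t y
  have D: "0 < D" "R' j \<omega> t y \<le> D" "0 < R' j \<omega> t y" for j \<omega> t y
  proof -
    show "0 < D" "0 < R' j \<omega> t y" by (auto simp: D_def R'_def less_max_iff_disj)
    show "R' j \<omega> t y \<le> D"
      unfolding D_def R'_def by (rule max.mono[OF bounded_fieldD(3)[OF R]]) simp
  qed
  let ?N = "\<lambda>\<omega> t. if good \<omega> then \<Sum>n\<in>jumped_before \<omega> t. (1::ennreal) else 0"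
  let ?S = "\<lambda>j \<omega> t. if good \<omega> then \<Sum>n\<in>jumped_before \<omega> t. ennreal (ln (D / R' j \<omega> (jump_time n \<omega>) (\<xi> n \<omega>))) else 0"
  have N: "(\<lambda>(\<omega>, t). ?N \<omega> t) \<in> borel_measurable P"
    by (rule predictable_jump_sum[of "\<lambda>_ _ _. 1"]) (simp add: case_prod_unfold)
  have S: "(\<lambda>(\<omega>, t). ?S j \<omega> t) \<in> borel_measurable P" for j
  proof (rule predictable_jump_sum[of "\<lambda>\<omega> t y. ennreal (ln (D / R' j \<omega> t y))"])
    show "(\<lambda>((\<omega>, t), y). ennreal (ln (D / R' j \<omega> t y))) \<in> borel_measurable (P \<Otimes>\<^sub>M K)"
      unfolding R'_def by (rule field_compose[OF bounded_fieldD(1)[OF R]]) measurable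
  qed
  have "(\<lambda>w. if good (fst w) then exp (enn2real ((\<lambda>(\<omega>, t). ?N \<omega> t) w) * ln D - enn2real ((\<lambda>(\<omega>, t). ?S j \<omega> t) w)) else 0)
      \<in> borel_measurable P" for j
    using N S[of j] by measurable
  moreover have "(\<lambda>j. if good (fst w) then exp (enn2real ((\<lambda>(\<omega>, t). ?N \<omega> t) w) * ln D - enn2real ((\<lambda>(\<omega>, t). ?S j \<omega> t) w)) else 0)
    \<longlonglongrightarrow> (\<lambda>(\<omega>, t). if good \<omega> then \<Prod>n\<in>jumped_before \<omega> t. R \<omega> (jump_time n \<omega>) (\<xi> n \<omega>) else 0) w" for w
  proof -
    obtain \<omega> t where w: "w = (\<omega>, t)" by (cases w)
    show ?thesis
    proof (cases "good \<omega>")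
      case True
      let ?J = "jumped_before \<omega> t" and ?r = "\<lambda>j n. R' j \<omega> (jump_time n \<omega>) (\<xi> n \<omega>)"
      have "exp (enn2real (?N \<omega> t) * ln D - enn2real (?S j \<omega> t)) = (\<Prod>n\<in>?J. ?r j n)" for j
      proof -
        have ln: "ln (D / ?r j n) = ln D - ln (?r j n)" "0 \<le> ln (D / ?r j n)" for n
          using D(1,2,3) by (auto simp: ln_div less_imp_neq[symmetric])
        have "enn2real (?N \<omega> t) = real (card ?J)" using True by simp
        moreover have "enn2real (?S j \<omega> t) = (\<Sum>n\<in>?J. ln D - ln (?r j n))"
          using True ln(2) by (simp add: sum_ennreal sum_nonneg flip: ln(1))
        ultimately have "enn2real (?N \<omega> t) * ln D - enn2real (?S j \<omega> t) = (\<Sum>n\<in>?J. ln (?r j n))"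
          by (simp add: sum_subtractf)
        then show ?thesis using True D(3) by (simp add: exp_sum)
      qed
      moreover have "(\<lambda>j. \<Prod>n\<in>?J. ?r j n) \<longlonglongrightarrow> (\<Prod>n\<in>?J. max (R \<omega> (jump_time n \<omega>) (\<xi> n \<omega>)) 0)"
        unfolding R'_def by (intro tendsto_prod tendsto_max tendsto_const LIMSEQ_Suc lim_1_over_n)
      ultimately show ?thesis using True bounded_fieldD(2)[OF R] by (simp add: w)
    qed (simp add: w)
  qed
  ultimately show ?thesis by (rule borel_measurable_LIMSEQ_real[rotated])
qed

definition intensity :: "('a \<Rightarrow> real \<Rightarrow> 'k \<Rightarrow> real) \<Rightarrow> 'a \<Rightarrow> real \<Rightarrow> ennreal" where
  "intensity R \<omega> t = (\<integral>\<^sup>+y. ennreal (R \<omega> t y) \<partial>\<phi> \<omega> t)"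

definition compensating :: "('a \<Rightarrow> real \<Rightarrow> 'k \<Rightarrow> real) \<Rightarrow> 'a \<Rightarrow> real \<Rightarrow> real" where
  "compensating R \<omega> t = enn2real (time_integral (intensity R) \<omega> t)"

text \<open>As \<open>\<phi>\<close> has mass 1, for a bounded field the exponent is the integral of
  \<open>1 - R\<close> against \<open>\<phi> dA\<close>. This is the Doleans-Dade exponential of the
  integral of \<open>R - 1\<close> against \<open>q\<close>, the density process of the control
  problem with \<open>R\<close> in place of the controlled rate.\<close>

definition stoch_exp :: "('a \<Rightarrow> real \<Rightarrow> 'k \<Rightarrow> real) \<Rightarrow> 'a \<Rightarrow> real \<Rightarrow> real" where
  "stoch_exp R \<omega> t = (if good \<omega> then exp (A \<omega> t - compensating R \<omega> t) *
     (\<Prod>n\<in>jumped \<omega> t. R \<omega> (jump_time n \<omega>) (\<xi> n \<omega>)) else 0)"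

text \<open>The left limit at positive times: for bounded \<open>R\<close> the exponent is
  continuous in \<open>t\<close>, so only the product changes.\<close>

definition stoch_exp_left :: "('a \<Rightarrow> real \<Rightarrow> 'k \<Rightarrow> real) \<Rightarrow> 'a \<Rightarrow> real \<Rightarrow> real" where
  "stoch_exp_left R \<omega> t = (if good \<omega> then exp (A \<omega> t - compensating R \<omega> t) *
     (\<Prod>n\<in>jumped_before \<omega> t. R \<omega> (jump_time n \<omega>) (\<xi> n \<omega>)) else 0)"

lemma intensity_predictable:
  assumes "(\<lambda>((\<omega>, t), y). R \<omega> t y) \<in> borel_measurable (P \<Otimes>\<^sub>M K)"
  shows "(\<lambda>(\<omega>, t). intensity R \<omega> t) \<in> borel_measurable P"
  unfolding intensity_def
  by (rule predictable_\<phi>_nn_integral[of "\<lambda>\<omega> t y. ennreal (R \<omega> t y)"]) (rule field_compose[OF assms measurable_ennreal])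

lemma emeasure_\<phi>_space: "\<omega> \<in> space M \<Longrightarrow> 0 \<le> t \<Longrightarrow> emeasure (\<phi> \<omega> t) (space (\<phi> \<omega> t)) = 1"
  by (rule prob_space.emeasure_space_1[OF \<phi>_prob])

lemma nn_integral_\<phi>_const: "\<omega> \<in> space M \<Longrightarrow> 0 \<le> t \<Longrightarrow> (\<integral>\<^sup>+y. c \<partial>\<phi> \<omega> t) = c"
  by (simp add: emeasure_\<phi>_space)

lemma intensity_le:
  assumes "\<And>y. R \<omega> t y \<le> C" "\<omega> \<in> space M" "0 \<le> t"
  shows "intensity R \<omega> t \<le> ennreal C"
proof -
  have "intensity R \<omega> t \<le> (\<integral>\<^sup>+y. ennreal C \<partial>\<phi> \<omega> t)"
    unfolding intensity_def using assms by (intro nn_integral_mono ennreal_leI) auto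
  also have "\<dots> = ennreal C" using assms by (simp add: emeasure_\<phi>_space)
  finally show ?thesis .
qed

lemma compensating_predictable:
  assumes "(\<lambda>((\<omega>, t), y). R \<omega> t y) \<in> borel_measurable (P \<Otimes>\<^sub>M K)"
  shows "(\<lambda>(\<omega>, t). compensating R \<omega> t) \<in> borel_measurable P"
  using measurable_compose[OF time_integral_predictable[OF intensity_predictable[OF assms]] borel_measurable_enn2real]
  unfolding compensating_def by (simp add: case_prod_unfold)

lemma stoch_exp_left_predictable:
  assumes R: "bounded_field C R"
  shows "(\<lambda>(\<omega>, t). stoch_exp_left R \<omega> t) \<in> borel_measurable P"
proof -
  have "(\<lambda>w. exp ((\<lambda>(\<omega>, t). A_path \<omega> t) w - (\<lambda>(\<omega>, t). compensating R \<omega> t) w) *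
     (\<lambda>(\<omega>, t). if good \<omega> then \<Prod>n\<in>jumped_before \<omega> t. R \<omega> (jump_time n \<omega>) (\<xi> n \<omega>) else 0) w) \<in> borel_measurable P"
    using A_path_predictable compensating_predictable[OF bounded_fieldD(1)[OF R]] predictable_jump_prod[OF R]
    by measurable
  also have "(\<lambda>w. exp ((\<lambda>(\<omega>, t). A_path \<omega> t) w - (\<lambda>(\<omega>, t). compensating R \<omega> t) w) *
     (\<lambda>(\<omega>, t). if good \<omega> then \<Prod>n\<in>jumped_before \<omega> t. R \<omega> (jump_time n \<omega>) (\<xi> n \<omega>) else 0) w) =
     (\<lambda>(\<omega>, t). stoch_exp_left R \<omega> t)"
    by (auto simp: stoch_exp_left_def A_path_def)
  finally show ?thesis .
qed

lemma stoch_exp_measurable: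
  assumes R: "bounded_field C R" and "0 \<le> T"
  shows "(\<lambda>\<omega>. stoch_exp R \<omega> T) \<in> borel_measurable M"
proof -
  \<comment> \<open>Factors after \<open>T\<close> are set to 1, so the product over jumps before
    \<open>T + 1\<close>, which is a section of a predictable process, is the product over jumps up
    to \<open>T\<close>.\<close>
  define R' where "R' \<omega> t y = (if t \<le> T then R \<omega> t y else 1)" for \<omega> t y
  have "(\<lambda>w. if snd (fst w) \<le> T then (\<lambda>((\<omega>, t), y). R \<omega> t y) w else 1) \<in> borel_measurable (P \<Otimes>\<^sub>M K)"
    using bounded_fieldD(1)[OF R] by measurable
  then have m: "(\<lambda>((\<omega>, t), y). R' \<omega> t y) \<in> borel_measurable (P \<Otimes>\<^sub>M K)"
    by (simp add: R'_def case_prod_unfold cong: if_cong)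
  have R': "bounded_field (max C 1) R'"
    unfolding bounded_field_def
  proof (intro conjI allI)
    show "(\<lambda>((\<omega>, t), y). R' \<omega> t y) \<in> borel_measurable (P \<Otimes>\<^sub>M K)" by (rule m)
  qed (use bounded_fieldD(2,3)[OF R] in \<open>simp_all add: R'_def le_max_iff_disj\<close>)
  have [measurable]: "(\<lambda>\<omega>. if good \<omega> then \<Prod>n\<in>jumped_before \<omega> (T + 1). R' \<omega> (jump_time n \<omega>) (\<xi> n \<omega>) else 0) \<in> borel_measurable M"
    using measurable_compose[OF section_measurable_M predictable_jump_prod[OF R'], of "T + 1"] \<open>0 \<le> T\<close> by simp
  have [measurable]: "(\<lambda>\<omega>. A_path \<omega> T) \<in> borel_measurable M" "(\<lambda>\<omega>. compensating R \<omega> T) \<in> borel_measurable M"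
    using measurable_compose[OF section_measurable_M A_path_predictable, of T] \<open>0 \<le> T\<close>
      measurable_compose[OF section_measurable_M compensating_predictable[OF bounded_fieldD(1)[OF R]], of T] by auto
  have "(\<lambda>\<omega>. exp (A_path \<omega> T - compensating R \<omega> T) *
      (if good \<omega> then \<Prod>n\<in>jumped_before \<omega> (T + 1). R' \<omega> (jump_time n \<omega>) (\<xi> n \<omega>) else 0)) \<in> borel_measurable M"
    by measurable
  also have "(\<lambda>\<omega>. exp (A_path \<omega> T - compensating R \<omega> T) *
      (if good \<omega> then \<Prod>n\<in>jumped_before \<omega> (T + 1). R' \<omega> (jump_time n \<omega>) (\<xi> n \<omega>) else 0)) = (\<lambda>\<omega>. stoch_exp R \<omega> T)"
    unfolding stoch_exp_def jumped_eq_before[OF \<open>0 \<le> T\<close>]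
    by (auto simp: A_path_def R'_def prod.inter_filter intro!: ext)
  finally show ?thesis .
qed

lemma stoch_exp_nonneg: "bounded_field C R \<Longrightarrow> 0 \<le> stoch_exp R \<omega> t"
  and stoch_exp_left_nonneg: "bounded_field C R \<Longrightarrow> 0 \<le> stoch_exp_left R \<omega> t"
  using bounded_fieldD(2)[of C R] by (auto simp: stoch_exp_def stoch_exp_left_def intro!: mult_nonneg_nonneg prod_nonneg)

text \<open>\<open>stochastic_exponential_path\<close> for one good path, with \<open>c\<close> the
  intensity of \<open>R\<close> and the factors read off at the jumps. The integral over marks of
  \<open>L R\<close> is the left limit of \<open>L\<close> times the intensity, since that limit
  does not depend on the mark.\<close>

lemma stoch_exp_equation:
  assumes R: "bounded_field C R" and "0 \<le> T" and good: "good \<omega>"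
  shows "ennreal (stoch_exp R \<omega> T) + jump_sum (\<lambda>\<omega> t y. ennreal (stoch_exp_left R \<omega> t)) \<omega> T +
      time_integral (\<lambda>\<omega> t. \<integral>\<^sup>+y. ennreal (stoch_exp_left R \<omega> t * R \<omega> t y) \<partial>\<phi> \<omega> t) \<omega> T =
    1 + jump_sum (\<lambda>\<omega> t y. ennreal (stoch_exp_left R \<omega> t * R \<omega> t y)) \<omega> T +
      time_integral (\<lambda>\<omega> t. ennreal (stoch_exp_left R \<omega> t)) \<omega> T"
proof -
  interpret continuous_path "dA A \<omega>" "A \<omega>" using good by (simp add: good_def)
  note R0 = bounded_fieldD(2,3)[OF R] and C0 = bounded_fieldD(4)[OF R]
  define c where "c t = enn2real (intensity R \<omega> (max 0 t))" for t
  have i_le: "intensity R \<omega> t \<le> ennreal C" if "0 \<le> t" for t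
    using R0 good_space[OF good] that by (intro intensity_le)
  have c_eq: "ennreal (c t) = intensity R \<omega> t" if "0 \<le> t" for t
    using i_le[OF that] that by (simp add: c_def order_le_less_trans)
  have c1: "c \<in> borel_measurable borel"
    unfolding c_def using path_measurable[OF intensity_predictable[OF bounded_fieldD(1)[OF R]] good_space[OF good]] by measurable
  have c2: "0 \<le> c t" for t by (simp add: c_def)
  have c3: "c t \<le> C" for t
    using enn2real_mono[OF i_le[of "max 0 t"]] C0 by (simp add: c_def)
  have ci: "set_integrable (dA A \<omega>) {0<..t} c" for t
    using c1 c2 c3 by (intro bounded_set_integrable) (auto simp: set_borel_measurable_def)
  have LINT: "(LINT s:{0<..t}|dA A \<omega>. c s) = compensating R \<omega> t" if "0 \<le> t" for t
  proof -
    have "time_integral (intensity R) \<omega> t = (\<integral>\<^sup>+s\<in>{0<..t}. ennreal (c s) \<partial>dA A \<omega>)"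
      using good by (auto simp: time_integral_def c_eq indicator_def intro!: nn_integral_cong)
    also have "\<dots> = ennreal (LINT s:{0<..t}|dA A \<omega>. c s)"
      by (rule set_nn_integral_eq[OF ci c2])
    finally show ?thesis
      using c2 by (simp add: compensating_def set_lebesgue_integral_def Bochner_Integration.integral_nonneg)
  qed
  define W where "W t = exp (A \<omega> t - (LINT s:{0<..t}|dA A \<omega>. c s)) *
      (\<Prod>i\<in>jumped_before \<omega> t. R \<omega> (jump_time i \<omega>) (\<xi> i \<omega>))" for t
  have W: "W t = stoch_exp_left R \<omega> t" if "0 \<le> t" for t
    using good that by (simp add: W_def stoch_exp_left_def LINT)
  have L: "exp (A \<omega> T - (LINT s:{0<..T}|dA A \<omega>. c s)) *
      (\<Prod>n\<in>jumped \<omega> T. R \<omega> (jump_time n \<omega>) (\<xi> n \<omega>)) = stoch_exp R \<omega> T"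
    using good \<open>0 \<le> T\<close> by (simp add: stoch_exp_def LINT)
  have inner: "(\<integral>\<^sup>+y. ennreal (stoch_exp_left R \<omega> s * R \<omega> s y) \<partial>\<phi> \<omega> s) = ennreal (W s * c s)" if "0 < s" for s
  proof -
    have m: "R \<omega> s \<in> borel_measurable (\<phi> \<omega> s)"
    proof -
      have "(\<omega>, s) \<in> space P" using good_space[OF good] that by simp
      from measurable_compose[OF measurable_Pair1'[OF this] bounded_fieldD(1)[OF R]]
      have "R \<omega> s \<in> borel_measurable K" by simp
      moreover have "sets (\<phi> \<omega> s) = sets K" using \<phi>_sets[OF good_space[OF good], of s] that by simp
      ultimately show ?thesis using measurable_cong_sets by blast
    qed
    have "(\<integral>\<^sup>+y. ennreal (stoch_exp_left R \<omega> s * R \<omega> s y) \<partial>\<phi> \<omega> s) = ennreal (stoch_exp_left R \<omega> s) * intensity R \<omega> s"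
      unfolding intensity_def using m
      by (subst nn_integral_cmult[symmetric])
        (auto simp: ennreal_mult[OF stoch_exp_left_nonneg[OF R] R0(1)])
    also have "\<dots> = ennreal (W s) * ennreal (c s)" using that by (simp add: W c_eq)
    also have "\<dots> = ennreal (W s * c s)"
      using that c2[of s] W[of s] stoch_exp_left_nonneg[OF R, of \<omega> s] by (simp add: ennreal_mult)
    finally show ?thesis .
  qed
  have "ennreal (stoch_exp R \<omega> T) + (\<Sum>n\<in>jumped \<omega> T. ennreal (W (jump_time n \<omega>))) +
      (\<integral>\<^sup>+s\<in>{0<..T}. ennreal (W s * c s) \<partial>dA A \<omega>) =
    1 + (\<Sum>n\<in>jumped \<omega> T. ennreal (W (jump_time n \<omega>) * R \<omega> (jump_time n \<omega>) (\<xi> n \<omega>))) +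
      (\<integral>\<^sup>+s\<in>{0<..T}. ennreal (W s) \<partial>dA A \<omega>)"
    using stochastic_exponential_path[OF c1 c2 c3 good_jump_times[OF good] \<open>0 \<le> T\<close>,
        of "\<lambda>n. R \<omega> (jump_time n \<omega>) (\<xi> n \<omega>)"] R0 unfolding L W_def by blast
  moreover have "(\<Sum>n\<in>jumped \<omega> T. ennreal (W (jump_time n \<omega>))) = jump_sum (\<lambda>\<omega> t y. ennreal (stoch_exp_left R \<omega> t)) \<omega> T"
    "(\<Sum>n\<in>jumped \<omega> T. ennreal (W (jump_time n \<omega>) * R \<omega> (jump_time n \<omega>) (\<xi> n \<omega>))) =
      jump_sum (\<lambda>\<omega> t y. ennreal (stoch_exp_left R \<omega> t * R \<omega> t y)) \<omega> T"
    using good by (simp_all add: jump_sum_def W)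
  moreover have "(\<integral>\<^sup>+s\<in>{0<..T}. ennreal (W s * c s) \<partial>dA A \<omega>) =
      time_integral (\<lambda>\<omega> t. \<integral>\<^sup>+y. ennreal (stoch_exp_left R \<omega> t * R \<omega> t y) \<partial>\<phi> \<omega> t) \<omega> T"
    "(\<integral>\<^sup>+s\<in>{0<..T}. ennreal (W s) \<partial>dA A \<omega>) = time_integral (\<lambda>\<omega> t. ennreal (stoch_exp_left R \<omega> t)) \<omega> T"
    using good by (auto simp: time_integral_def indicator_def inner W intro!: nn_integral_cong)
  ultimately show ?thesis by simp
qed

text \<open>Take the mean of \<open>stoch_exp_equation\<close>. By the compensator identity the jump
  sum of the left limit and its time integral have the same mean \<open>?a\<close>, and likewise
  \<open>?b\<close> for the left limit times \<open>R\<close>. So \<open>?a + ?b\<close> stands on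
  both sides, and finiteness allows it to be cancelled.\<close>

lemma expectation_stoch_exp:
  assumes R: "bounded_field C R" and "0 \<le> T"
    and fin: "(\<integral>\<^sup>+\<omega>. time_integral (\<lambda>\<omega> t. ennreal (stoch_exp_left R \<omega> t)) \<omega> T \<partial>M) < \<infinity>"
  shows "(\<integral>\<^sup>+\<omega>. ennreal (stoch_exp R \<omega> T) \<partial>M) = 1"
proof -
  note left = stoch_exp_left_predictable[OF R]
  let ?W = "\<lambda>\<omega> t y. ennreal (stoch_exp_left R \<omega> t)" and ?WR = "\<lambda>\<omega> t y. ennreal (stoch_exp_left R \<omega> t * R \<omega> t y)"
  have W: "(\<lambda>((\<omega>, t), y). ?W \<omega> t y) \<in> borel_measurable (P \<Otimes>\<^sub>M K)"
    by (rule field_compose[OF process_field[OF left] measurable_ennreal])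
  have "(\<lambda>w. (\<lambda>((\<omega>, t), y). stoch_exp_left R \<omega> t) w * (\<lambda>((\<omega>, t), y). R \<omega> t y) w) \<in> borel_measurable (P \<Otimes>\<^sub>M K)"
    using process_field[OF left] bounded_fieldD(1)[OF R] by measurable
  then have WR: "(\<lambda>((\<omega>, t), y). ?WR \<omega> t y) \<in> borel_measurable (P \<Otimes>\<^sub>M K)"
    by (intro field_compose[OF _ measurable_ennreal]) (simp add: case_prod_unfold)
  let ?a = "\<integral>\<^sup>+\<omega>. time_integral (\<lambda>\<omega> t. ennreal (stoch_exp_left R \<omega> t)) \<omega> T \<partial>M"
  let ?b = "\<integral>\<^sup>+\<omega>. time_integral (\<lambda>\<omega> t. \<integral>\<^sup>+y. ?WR \<omega> t y \<partial>\<phi> \<omega> t) \<omega> T \<partial>M"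
  note [measurable] = jump_sum_measurable[OF W \<open>0 \<le> T\<close>] jump_sum_measurable[OF WR \<open>0 \<le> T\<close>]
    time_integral_measurable[OF predictable_\<phi>_nn_integral[OF WR] \<open>0 \<le> T\<close>]
    stoch_exp_measurable[OF R \<open>0 \<le> T\<close>]
  have [measurable]: "(\<lambda>\<omega>. time_integral (\<lambda>\<omega> t. ennreal (stoch_exp_left R \<omega> t)) \<omega> T) \<in> borel_measurable M"
    using measurable_compose[OF left measurable_ennreal] \<open>0 \<le> T\<close>
    by (intro time_integral_measurable) (auto simp: case_prod_unfold)
  have const: "time_integral (\<lambda>\<omega> t. \<integral>\<^sup>+y. ?W \<omega> t y \<partial>\<phi> \<omega> t) \<omega> T =
      time_integral (\<lambda>\<omega> t. ennreal (stoch_exp_left R \<omega> t)) \<omega> T" for \<omega>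
    using good_space by (auto simp: time_integral_def emeasure_\<phi>_space indicator_def intro!: nn_integral_cong)
  have a: "(\<integral>\<^sup>+\<omega>. jump_sum ?W \<omega> T \<partial>M) = ?a"
    using compensator[OF W \<open>0 \<le> T\<close>] unfolding const .
  have b: "(\<integral>\<^sup>+\<omega>. jump_sum ?WR \<omega> T \<partial>M) = ?b"
    by (rule compensator[OF WR \<open>0 \<le> T\<close>])
  \<comment> \<open>Since \<open>R\<close> is at most \<open>C\<close>, finiteness of
    \<open>?a\<close>, which is assumed, passes to \<open>?b\<close>.\<close>
  have "?b \<le> ennreal C * ?a"
  proof -
    have "?b \<le> (\<integral>\<^sup>+\<omega>. ennreal C * time_integral (\<lambda>\<omega> t. ennreal (stoch_exp_left R \<omega> t)) \<omega> T \<partial>M)"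
    proof (rule nn_integral_mono)
      fix \<omega> assume \<omega>: "\<omega> \<in> space M"
      have *: "(\<integral>\<^sup>+y. ?WR \<omega> s y \<partial>\<phi> \<omega> s) \<le> ennreal C * ennreal (stoch_exp_left R \<omega> s)" if "0 \<le> s" for s
      proof -
        have "(\<integral>\<^sup>+y. ?WR \<omega> s y \<partial>\<phi> \<omega> s) \<le> (\<integral>\<^sup>+y. ennreal (C * stoch_exp_left R \<omega> s) \<partial>\<phi> \<omega> s)"
          using bounded_fieldD(3)[OF R] stoch_exp_left_nonneg[OF R]
          by (intro nn_integral_mono ennreal_leI) (auto simp: mult.commute[of C] intro: mult_left_mono)
        then show ?thesis using \<omega> that bounded_fieldD(4)[OF R] by (simp add: emeasure_\<phi>_space ennreal_mult')
      qed
      have m: "(\<lambda>s. ennreal (stoch_exp_left R \<omega> (max 0 s)) * indicator {0<..T} s) \<in> borel_measurable borel"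
        using path_measurable[OF left \<omega>] by measurable
      show "time_integral (\<lambda>\<omega> t. \<integral>\<^sup>+y. ?WR \<omega> t y \<partial>\<phi> \<omega> t) \<omega> T \<le> ennreal C * time_integral (\<lambda>\<omega> t. ennreal (stoch_exp_left R \<omega> t)) \<omega> T"
      proof (cases "good \<omega>")
        case True
        have "(\<integral>\<^sup>+s\<in>{0<..T}. (\<integral>\<^sup>+y. ?WR \<omega> s y \<partial>\<phi> \<omega> s) \<partial>dA A \<omega>) \<le>
            (\<integral>\<^sup>+s. ennreal C * (ennreal (stoch_exp_left R \<omega> (max 0 s)) * indicator {0<..T} s) \<partial>dA A \<omega>)"
          using * by (intro nn_integral_mono) (auto simp: indicator_def)
        also have "\<dots> = ennreal C * (\<integral>\<^sup>+s. ennreal (stoch_exp_left R \<omega> (max 0 s)) * indicator {0<..T} s \<partial>dA A \<omega>)"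
          using m by (intro nn_integral_cmult) simp
        also have "(\<integral>\<^sup>+s. ennreal (stoch_exp_left R \<omega> (max 0 s)) * indicator {0<..T} s \<partial>dA A \<omega>) =
            (\<integral>\<^sup>+s\<in>{0<..T}. ennreal (stoch_exp_left R \<omega> s) \<partial>dA A \<omega>)"
          by (intro nn_integral_cong) (auto simp: indicator_def)
        finally show ?thesis using True by (simp add: time_integral_def)
      qed (simp add: time_integral_def)
    qed
    also have "\<dots> = ennreal C * ?a" by (rule nn_integral_cmult) measurable
    finally show ?thesis .
  qed
  then have b_fin: "?b < \<infinity>" using fin by (auto intro: order_le_less_trans simp: ennreal_mult_less_top)
  have "(\<integral>\<^sup>+\<omega>. ennreal (stoch_exp R \<omega> T) \<partial>M) + ?a + ?b = 1 + ?b + ?a"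
  proof -
    have "(\<integral>\<^sup>+\<omega>. ennreal (stoch_exp R \<omega> T) + jump_sum ?W \<omega> T + time_integral (\<lambda>\<omega> t. \<integral>\<^sup>+y. ?WR \<omega> t y \<partial>\<phi> \<omega> t) \<omega> T \<partial>M) =
      (\<integral>\<^sup>+\<omega>. 1 + jump_sum ?WR \<omega> T + time_integral (\<lambda>\<omega> t. ennreal (stoch_exp_left R \<omega> t)) \<omega> T \<partial>M)"
      by (rule nn_integral_cong_AE, rule AE_mp[OF AE_good], rule AE_I2) (use stoch_exp_equation[OF R \<open>0 \<le> T\<close>] in simp)
    then show ?thesis by (simp add: nn_integral_add a b emeasure_space_1)
  qed
  then have "(?a + ?b) + (\<integral>\<^sup>+\<omega>. ennreal (stoch_exp R \<omega> T) \<partial>M) = (?a + ?b) + 1"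
    by (simp only: ac_simps)
  moreover have "?a + ?b < \<top>"
    using fin b_fin by (simp only: ennreal_add_less_top infinity_ennreal_def)
  then have "?a + ?b \<noteq> \<infinity>" unfolding infinity_ennreal_def by (rule less_imp_neq)
  ultimately show ?thesis unfolding ennreal_add_left_cancel by blast
qed

section \<open>Pathwise bounds and the algebra of exponentials\<close>

lemma A_nonneg: "good \<omega> \<Longrightarrow> 0 \<le> t \<Longrightarrow> 0 \<le> A \<omega> t"
  using continuous_path.path_nonneg[of "dA A \<omega>" "A \<omega>" t] by (simp add: good_def)

lemma A_mono: "good \<omega> \<Longrightarrow> 0 \<le> s \<Longrightarrow> s \<le> t \<Longrightarrow> A \<omega> s \<le> A \<omega> t"
  using continuous_path.path_le[of "dA A \<omega>" "A \<omega>" s t] by (simp add: good_def)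

lemma A_measurable[measurable]: "0 \<le> t \<Longrightarrow> (\<lambda>\<omega>. A \<omega> t) \<in> borel_measurable M"
  using measurable_compose[OF section_measurable_M A_predictable, of t] by simp

lemma time_integral_const:
  assumes "good \<omega>" "0 \<le> T"
  shows "time_integral (\<lambda>_ _. c) \<omega> T = c * ennreal (A \<omega> T)"
  using continuous_path.emeasure_Ioc[of "dA A \<omega>" "A \<omega>" 0 T] continuous_path.path_0[of "dA A \<omega>" "A \<omega>"] assms
  by (simp add: time_integral_def good_def nn_integral_cmult_indicator)

lemma time_integral_mono:
  assumes "\<And>t. good \<omega> \<Longrightarrow> 0 < t \<Longrightarrow> t \<le> T \<Longrightarrow> H \<omega> t \<le> H' \<omega> t"
  shows "time_integral H \<omega> T \<le> time_integral H' \<omega> T"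
  using assms by (auto simp: time_integral_def indicator_def intro!: nn_integral_mono)

lemma time_integral_le:
  assumes "\<And>t. 0 < t \<Longrightarrow> t \<le> T \<Longrightarrow> H \<omega> t \<le> c" "good \<omega>" "0 \<le> T"
  shows "time_integral H \<omega> T \<le> c * ennreal (A \<omega> T)"
  unfolding time_integral_const[OF assms(2,3), symmetric] by (rule time_integral_mono) (rule assms(1))

lemma jumped_eq:
  assumes "good \<omega>"
  shows "jumped \<omega> t = {1..card (jumped \<omega> t)}"
proof -
  obtain m where "jumped \<omega> t = {1..m}"
    using jump_times.bracket[OF good_jump_times[OF assms], of "ennreal t"]
      jump_times.jumps_upto_eq[OF good_jump_times[OF assms], of _ "ennreal t"] by (metis ennreal_less_top infinity_ennreal_def)
  then show ?thesis by simp
qed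

lemma jumped_before_subset_jumped: "s \<le> t \<Longrightarrow> jumped_before \<omega> s \<subseteq> jumped \<omega> t"
  using jumped_mono[of s t \<omega>] by (auto simp: jumps_before_def jumps_upto_def)

lemma jumped_before_eq:
  assumes "good \<omega>"
  shows "jumped_before \<omega> t = {1..card (jumped_before \<omega> t)}"
proof (cases "0 < t")
  case True
  then obtain m where "jumped_before \<omega> t = {1..m}"
    using jump_times.bracket_left[OF good_jump_times[OF assms], of "ennreal t"]
      jump_times.jumps_before_eq[OF good_jump_times[OF assms], of _ "ennreal t"]
    by (metis ennreal_less_top ennreal_less_zero_iff infinity_ennreal_def)
  then show ?thesis by simp
next
  case False
  then have "jumped_before \<omega> t = {}" by (auto simp: jumps_before_def ennreal_neg)
  then show ?thesis by simp
qed

lemma card_jumped_before_jump: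
  assumes "good \<omega>" "n \<in> jumped \<omega> t"
  shows "card (jumped_before \<omega> (jump_time n \<omega>)) = n - 1"
proof -
  have "1 \<le> n" "\<tau> n \<omega> < \<infinity>" using assms(2) by (auto simp: jumps_upto_def order_le_less_trans)
  from jump_times.jumps_before_time[OF good_jump_times[OF assms(1)] this]
  show ?thesis using jumped_jump_time[OF assms(2)] by simp
qed

lemma compensating_le:
  assumes R: "bounded_field C R" and "good \<omega>" "0 \<le> t"
  shows "time_integral (intensity R) \<omega> t \<le> ennreal (C * A \<omega> t)" "compensating R \<omega> t \<le> C * A \<omega> t"
proof -
  have "time_integral (intensity R) \<omega> t \<le> ennreal C * ennreal (A \<omega> t)"
    using bounded_fieldD(3)[OF R] good_space assms by (intro time_integral_le intensity_le) auto
  then show *: "time_integral (intensity R) \<omega> t \<le> ennreal (C * A \<omega> t)"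
    using bounded_fieldD(4)[OF R] by (simp add: ennreal_mult')
  show "compensating R \<omega> t \<le> C * A \<omega> t"
    using enn2real_mono[OF *] bounded_fieldD(4)[OF R] A_nonneg[OF assms(2,3)] by (simp add: compensating_def)
qed

lemma prod_le_power_card:
  assumes "finite J" "J \<subseteq> J'" "finite J'" "\<And>n. 0 \<le> \<rho> n" "\<And>n. \<rho> n \<le> C" "1 \<le> C"
  shows "(\<Prod>n\<in>J. \<rho> n) \<le> (C :: real) ^ card J'"
proof -
  have "(\<Prod>n\<in>J. \<rho> n) \<le> (\<Prod>n\<in>J. C)" using assms by (intro prod_mono) auto
  also have "\<dots> = C ^ card J" by simp
  also have "\<dots> \<le> C ^ card J'" using assms by (intro power_increasing card_mono) auto
  finally show ?thesis .
qed

definition dominating :: "real \<Rightarrow> real \<Rightarrow> 'a \<Rightarrow> real" where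
  "dominating C T \<omega> = C ^ card (jumped \<omega> T) * exp (A \<omega> T)"

lemma stoch_exp_le_dominating:
  assumes R: "bounded_field C R" "1 \<le> C" and "good \<omega>" "0 \<le> t" "t \<le> T"
  shows "stoch_exp_left R \<omega> t \<le> dominating C T \<omega>" "stoch_exp R \<omega> t \<le> dominating C T \<omega>"
proof -
  have e: "exp (A \<omega> t - compensating R \<omega> t) \<le> exp (A \<omega> T)"
    using A_mono[OF assms(3-5)] by (simp add: compensating_def add_increasing2 diff_le_eq)
  note p = prod_le_power_card[OF _ _ _ bounded_fieldD(2)[OF R(1)] bounded_fieldD(3)[OF R(1)] R(2)]
  have nn: "0 \<le> (\<Prod>n\<in>J. R \<omega> (jump_time n \<omega>) (\<xi> n \<omega>))" for J
    by (intro prod_nonneg bounded_fieldD(2)[OF R(1)])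
  show "stoch_exp_left R \<omega> t \<le> dominating C T \<omega>"
    using assms(3) unfolding stoch_exp_left_def dominating_def
    by (simp, subst mult.commute, intro mult_mono p e nn jumped_before_subset_jumped) (use assms in auto)
  show "stoch_exp R \<omega> t \<le> dominating C T \<omega>"
    using assms(3) unfolding stoch_exp_def dominating_def
    by (simp, subst mult.commute, intro mult_mono p e nn jumped_mono) (use assms in auto)
qed

lemma card_jumped_measurable[measurable]:
  assumes "0 \<le> T"
  shows "(\<lambda>\<omega>. if good \<omega> then card (jumped \<omega> T) else 0) \<in> M \<rightarrow>\<^sub>M count_space UNIV"
proof -
  have "(\<lambda>\<omega>. jump_sum (\<lambda>_ _ _. 1 :: ennreal) \<omega> T) \<in> borel_measurable M"
    using assms by (intro jump_sum_measurable) (auto simp: case_prod_unfold)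
  then have "(\<lambda>\<omega>. nat \<lfloor>enn2real (jump_sum (\<lambda>_ _ _. 1 :: ennreal) \<omega> T)\<rfloor>) \<in> M \<rightarrow>\<^sub>M count_space UNIV"
    by measurable
  also have "(\<lambda>\<omega>. nat \<lfloor>enn2real (jump_sum (\<lambda>_ _ _. 1 :: ennreal) \<omega> T)\<rfloor>) = (\<lambda>\<omega>. if good \<omega> then card (jumped \<omega> T) else 0)"
    by (auto simp: jump_sum_def)
  finally show ?thesis .
qed

lemma card_jumped_before_predictable:
  "(\<lambda>(\<omega>, t). if good \<omega> then real (card (jumped_before \<omega> t)) else 0) \<in> borel_measurable P"
proof -
  have "(\<lambda>(\<omega>, t). if good \<omega> then \<Sum>n\<in>jumped_before \<omega> t. (1::ennreal) else 0) \<in> borel_measurable P"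
    by (rule predictable_jump_sum[of "\<lambda>_ _ _. 1"]) (simp add: case_prod_unfold)
  then have "(\<lambda>w. enn2real (case w of (\<omega>, t) \<Rightarrow> if good \<omega> then \<Sum>n\<in>jumped_before \<omega> t. (1::ennreal) else 0)) \<in> borel_measurable P"
    by (rule borel_measurable_enn2real)
  also have "(\<lambda>w. enn2real (case w of (\<omega>, t) \<Rightarrow> if good \<omega> then \<Sum>n\<in>jumped_before \<omega> t. (1::ennreal) else 0)) =
    (\<lambda>(\<omega>, t). if good \<omega> then real (card (jumped_before \<omega> t)) else 0)"
    by auto
  finally show ?thesis .
qed

lemma field_section_measurable:
  assumes "(\<lambda>((\<omega>, t), y). R \<omega> t y) \<in> P \<Otimes>\<^sub>M K \<rightarrow>\<^sub>M N" "\<omega> \<in> space M" "0 \<le> t"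
  shows "R \<omega> t \<in> \<phi> \<omega> t \<rightarrow>\<^sub>M N"
proof -
  have "(\<omega>, t) \<in> space P" using assms by simp
  from measurable_compose[OF measurable_Pair1'[OF this] assms(1)]
  have "R \<omega> t \<in> K \<rightarrow>\<^sub>M N" by simp
  moreover have "sets (\<phi> \<omega> t) = sets K" using assms by (intro \<phi>_sets)
  ultimately show ?thesis using measurable_cong_sets by blast
qed

lemma time_integral_cong:
  "(\<And>t. good \<omega> \<Longrightarrow> 0 < t \<Longrightarrow> t \<le> T \<Longrightarrow> H \<omega> t = H' \<omega> t) \<Longrightarrow> time_integral H \<omega> T = time_integral H' \<omega> T"
  by (auto simp: time_integral_def indicator_def intro!: nn_integral_cong)

lemma time_integral_max:
  "good \<omega> \<Longrightarrow> time_integral H \<omega> T = (\<integral>\<^sup>+s. H \<omega> (max 0 s) * indicator {0<..T} s \<partial>dA A \<omega>)"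
  by (auto simp: time_integral_def indicator_def intro!: nn_integral_cong)

lemma time_integral_add_cmult:
  assumes "(\<lambda>(\<omega>, t). H \<omega> t) \<in> borel_measurable P" "(\<lambda>(\<omega>, t). H' \<omega> t) \<in> borel_measurable P"
  shows "time_integral (\<lambda>\<omega> t. H \<omega> t + c * H' \<omega> t) \<omega> T = time_integral H \<omega> T + c * time_integral H' \<omega> T"
proof (cases "good \<omega>")
  case True
  note [measurable] = path_measurable[OF assms(1) good_space[OF True]] path_measurable[OF assms(2) good_space[OF True]]
  show ?thesis
    unfolding time_integral_max[OF True]
    by (simp add: nn_integral_add[symmetric] nn_integral_cmult[symmetric] distrib_right mult.assoc)
qed (simp add: time_integral_def)

lemma time_integral_cmult:
  assumes "(\<lambda>(\<omega>, t). H \<omega> t) \<in> borel_measurable P"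
  shows "time_integral (\<lambda>\<omega> t. c * H \<omega> t) \<omega> T = c * time_integral H \<omega> T"
proof (cases "good \<omega>")
  case True
  note [measurable] = path_measurable[OF assms(1) good_space[OF True]]
  show ?thesis
    unfolding time_integral_max[OF True]
    by (simp add: nn_integral_cmult[symmetric] mult.assoc)
qed (simp add: time_integral_def)

lemma compensating_add_cmult:
  assumes R: "bounded_field C R" and S: "bounded_field D S" and c: "0 \<le> c" and good: "good \<omega>" and T: "0 \<le> T"
  shows "compensating (\<lambda>\<omega> t y. R \<omega> t y + c * S \<omega> t y) \<omega> T = compensating R \<omega> T + c * compensating S \<omega> T"
proof -
  have "time_integral (intensity (\<lambda>\<omega> t y. R \<omega> t y + c * S \<omega> t y)) \<omega> T =
      time_integral (\<lambda>\<omega> t. intensity R \<omega> t + ennreal c * intensity S \<omega> t) \<omega> T"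
  proof (rule time_integral_cong)
    fix t :: real assume "0 < t"
    then have [measurable]: "R \<omega> t \<in> borel_measurable (\<phi> \<omega> t)" "S \<omega> t \<in> borel_measurable (\<phi> \<omega> t)"
      using good_space[OF good]
      by (auto intro: field_section_measurable[OF bounded_fieldD(1)[OF R]] field_section_measurable[OF bounded_fieldD(1)[OF S]])
    show "intensity (\<lambda>\<omega> t y. R \<omega> t y + c * S \<omega> t y) \<omega> t = intensity R \<omega> t + ennreal c * intensity S \<omega> t"
      unfolding intensity_def using bounded_fieldD(2)[OF R] bounded_fieldD(2)[OF S] c
      by (simp add: nn_integral_add[symmetric] nn_integral_cmult[symmetric] ennreal_mult)
  qed
  also have "\<dots> = time_integral (intensity R) \<omega> T + ennreal c * time_integral (intensity S) \<omega> T"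
    by (intro time_integral_add_cmult intensity_predictable bounded_fieldD(1)[OF R] bounded_fieldD(1)[OF S])
  finally show ?thesis
    unfolding compensating_def using compensating_le(1)[OF R good T] compensating_le(1)[OF S good T] c
    by (simp add: enn2real_plus enn2real_mult order_le_less_trans ennreal_mult_less_top)
qed

lemma bounded_field_mult:
  assumes "bounded_field C R" "bounded_field D S"
  shows "bounded_field (C * D) (\<lambda>\<omega> t y. R \<omega> t y * S \<omega> t y)"
  unfolding bounded_field_def
proof (intro conjI allI)
  have "(\<lambda>w. (\<lambda>((\<omega>, t), y). R \<omega> t y) w * (\<lambda>((\<omega>, t), y). S \<omega> t y) w) \<in> borel_measurable (P \<Otimes>\<^sub>M K)"
    using bounded_fieldD(1)[OF assms(1)] bounded_fieldD(1)[OF assms(2)] by measurable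
  then show "(\<lambda>((\<omega>, t), y). R \<omega> t y * S \<omega> t y) \<in> borel_measurable (P \<Otimes>\<^sub>M K)"
    by (simp add: case_prod_unfold)
qed (use bounded_fieldD(2-4)[OF assms(1)] bounded_fieldD(2-4)[OF assms(2)] in \<open>auto intro!: mult_mono\<close>)

lemma bounded_field_one_minus:
  assumes "bounded_field 1 h" "0 \<le> \<epsilon>" "\<epsilon> \<le> 1"
  shows "bounded_field 1 (\<lambda>\<omega> t y. 1 - \<epsilon> * h \<omega> t y)"
  unfolding bounded_field_def
proof (intro conjI allI)
  show "(\<lambda>((\<omega>, t), y). 1 - \<epsilon> * h \<omega> t y) \<in> borel_measurable (P \<Otimes>\<^sub>M K)"
    by (rule field_compose[OF bounded_fieldD(1)[OF assms(1)], of "\<lambda>x. 1 - \<epsilon> * x"]) measurable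
qed (use bounded_fieldD(2,3)[OF assms(1)] assms in \<open>auto intro!: mult_le_one\<close>)

text \<open>The compensating term is linear in the field, and \<open>R\<close> is the sum of the
  perturbed field and \<open>\<epsilon> * R * h\<close>; the product of the jump factors
  splits.\<close>

lemma stoch_exp_perturbed:
  assumes R: "bounded_field C R" and h: "bounded_field 1 h" and \<epsilon>: "0 \<le> \<epsilon>" "\<epsilon> \<le> 1"
    and good: "good \<omega>" and T: "0 \<le> T"
  shows "stoch_exp (\<lambda>\<omega> t y. R \<omega> t y * (1 - \<epsilon> * h \<omega> t y)) \<omega> T = stoch_exp R \<omega> T *
    (exp (\<epsilon> * compensating (\<lambda>\<omega> t y. R \<omega> t y * h \<omega> t y) \<omega> T) *
      (\<Prod>n\<in>jumped \<omega> T. 1 - \<epsilon> * h \<omega> (jump_time n \<omega>) (\<xi> n \<omega>)))"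
proof -
  have "compensating (\<lambda>\<omega> t y. R \<omega> t y * (1 - \<epsilon> * h \<omega> t y) + \<epsilon> * (R \<omega> t y * h \<omega> t y)) \<omega> T =
    compensating (\<lambda>\<omega> t y. R \<omega> t y * (1 - \<epsilon> * h \<omega> t y)) \<omega> T + \<epsilon> * compensating (\<lambda>\<omega> t y. R \<omega> t y * h \<omega> t y) \<omega> T"
    by (rule compensating_add_cmult[OF bounded_field_mult[OF R bounded_field_one_minus[OF h \<epsilon>]] bounded_field_mult[OF R h] \<epsilon>(1) good T])
  moreover have "(\<lambda>\<omega> t y. R \<omega> t y * (1 - \<epsilon> * h \<omega> t y) + \<epsilon> * (R \<omega> t y * h \<omega> t y)) = R"
    by (intro ext) (simp add: algebra_simps)
  ultimately have eq: "A \<omega> T - compensating (\<lambda>\<omega> t y. R \<omega> t y * (1 - \<epsilon> * h \<omega> t y)) \<omega> T =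
      (A \<omega> T - compensating R \<omega> T) + \<epsilon> * compensating (\<lambda>\<omega> t y. R \<omega> t y * h \<omega> t y) \<omega> T" by simp
  show ?thesis using good unfolding stoch_exp_def eq exp_add by (simp add: prod.distrib)
qed

lemma good_integrable_bound:
  fixes f :: "'a \<Rightarrow> real"
  assumes "f \<in> borel_measurable M" "g \<in> borel_measurable M" "(\<integral>\<^sup>+\<omega>. ennreal (g \<omega>) \<partial>M) < \<infinity>"
    and "\<And>\<omega>. good \<omega> \<Longrightarrow> \<bar>f \<omega>\<bar> \<le> g \<omega>"
  shows "integrable M f"
proof -
  have "(\<integral>\<^sup>+\<omega>. ennreal (norm (f \<omega>)) \<partial>M) \<le> (\<integral>\<^sup>+\<omega>. ennreal (g \<omega>) \<partial>M)"
    by (rule nn_integral_mono_AE, rule AE_mp[OF AE_good], rule AE_I2) (use assms in \<open>auto intro: ennreal_leI\<close>)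
  then show ?thesis using assms by (intro integrableI_bounded) (auto intro: order_le_less_trans)
qed

lemma jump_sum_ennreal:
  "(\<And>\<omega> t y. 0 \<le> h \<omega> t y) \<Longrightarrow> jump_sum (\<lambda>\<omega> t y. ennreal (h \<omega> t y)) \<omega> T = ennreal (jump_sum h \<omega> T)"
  by (simp add: jump_sum_def sum_ennreal)

section \<open>Monotone limits and integrals of signed integrands\<close>

lemma tendsto_time_integral:
  fixes H :: "nat \<Rightarrow> 'a \<Rightarrow> real \<Rightarrow> ennreal"
  assumes "\<And>n. (\<lambda>(\<omega>, t). H n \<omega> t) \<in> borel_measurable P"
    and "\<And>t. good \<omega> \<Longrightarrow> 0 \<le> t \<Longrightarrow> incseq (\<lambda>n. H n \<omega> t)"
    and "\<And>t. good \<omega> \<Longrightarrow> 0 \<le> t \<Longrightarrow> (\<lambda>n. H n \<omega> t) \<longlonglongrightarrow> G \<omega> t"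
  shows "(\<lambda>n. time_integral (H n) \<omega> T) \<longlonglongrightarrow> time_integral G \<omega> T"
proof (cases "good \<omega>")
  case True
  show ?thesis
    unfolding time_integral_max[OF True]
  proof (rule nn_integral_LIMSEQ)
    show "incseq (\<lambda>n s. H n \<omega> (max 0 s) * indicator {0<..T} s)"
      using assms(2)[OF True] by (auto simp: incseq_def le_fun_def intro!: mult_right_mono)
    show "(\<lambda>s. H n \<omega> (max 0 s) * indicator {0<..T} s) \<in> borel_measurable (dA A \<omega>)" for n
      using path_measurable[OF assms(1) good_space[OF True]] by measurable
    show "(\<lambda>n. H n \<omega> (max 0 s) * indicator {0<..T} s) \<longlonglongrightarrow> G \<omega> (max 0 s) * indicator {0<..T} s" for s
      using assms(3)[OF True, of "max 0 s"] by (auto simp: indicator_def)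
  qed
qed (simp add: time_integral_def)

lemma jump_sum_cmult:
  "jump_sum (\<lambda>\<omega> t y. c * H \<omega> t y) \<omega> T = (c :: ennreal) * jump_sum H \<omega> T"
  by (simp add: jump_sum_def sum_distrib_left)

lemma process_compose:
  assumes "(\<lambda>(\<omega>, t). X \<omega> t) \<in> P \<rightarrow>\<^sub>M N" "h \<in> N \<rightarrow>\<^sub>M N'"
  shows "(\<lambda>(\<omega>, t). h (X \<omega> t)) \<in> P \<rightarrow>\<^sub>M N'"
  using measurable_compose[OF assms] by (simp add: case_prod_unfold)

lemma time_integral_enn2real:
  assumes H: "(\<lambda>(\<omega>, t). H \<omega> t) \<in> borel_measurable P" and good: "good \<omega>" and fin: "time_integral H \<omega> T < \<infinity>"
  shows "set_integrable (dA A \<omega>) {0<..T} (\<lambda>s. enn2real (H \<omega> s))"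
    "(LINT s:{0<..T}|dA A \<omega>. enn2real (H \<omega> s)) = enn2real (time_integral H \<omega> T)"
    "AE s in dA A \<omega>. s \<in> {0<..T} \<longrightarrow> H \<omega> s < \<infinity>"
proof -
  let ?f = "\<lambda>s. H \<omega> (max 0 s) * indicator {0<..T} s"
  have f[measurable]: "?f \<in> borel_measurable (dA A \<omega>)"
    using path_measurable[OF H good_space[OF good]] by measurable
  have eq: "indicator {0<..T} s *\<^sub>R enn2real (H \<omega> s) = enn2real (?f s)" for s
    by (auto simp: indicator_def)
  have fin': "(\<integral>\<^sup>+s. ?f s \<partial>dA A \<omega>) < \<infinity>" using fin unfolding time_integral_max[OF good] .
  show "set_integrable (dA A \<omega>) {0<..T} (\<lambda>s. enn2real (H \<omega> s))"
    unfolding set_integrable_def eq using integral_enn2real(1)[OF f fin'] .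
  show "(LINT s:{0<..T}|dA A \<omega>. enn2real (H \<omega> s)) = enn2real (time_integral H \<omega> T)"
    unfolding set_lebesgue_integral_def eq time_integral_max[OF good] using integral_enn2real(2)[OF f fin'] .
  have "AE s in dA A \<omega>. ?f s \<noteq> \<infinity>" using fin' by (intro nn_integral_PInf_AE) auto
  then show "AE s in dA A \<omega>. s \<in> {0<..T} \<longrightarrow> H \<omega> s < \<infinity>"
    by eventually_elim (auto simp: less_top)
qed

text \<open>Positive and negative parts are integrated separately, so that measurability in
  \<open>\<omega>\<close> reduces to the nonnegative case. The value is the Lebesgue integral on
  good paths where \<open>W\<close> is absolutely integrable.\<close>

definition real_time_integral :: "('a \<Rightarrow> real \<Rightarrow> real) \<Rightarrow> 'a \<Rightarrow> real \<Rightarrow> real" where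
  "real_time_integral W \<omega> T = enn2real (time_integral (\<lambda>\<omega> t. ennreal (W \<omega> t)) \<omega> T) -
     enn2real (time_integral (\<lambda>\<omega> t. ennreal (- W \<omega> t)) \<omega> T)"

lemma real_time_integral_measurable:
  assumes "(\<lambda>(\<omega>, t). W \<omega> t) \<in> borel_measurable P" "0 \<le> T"
  shows "(\<lambda>\<omega>. real_time_integral W \<omega> T) \<in> borel_measurable M"
proof -
  have "(\<lambda>(\<omega>, t). ennreal (W \<omega> t)) \<in> borel_measurable P" "(\<lambda>(\<omega>, t). ennreal (- W \<omega> t)) \<in> borel_measurable P"
    by ((rule process_compose[OF assms(1)], measurable)[1])+
  note [measurable] = this[THEN time_integral_measurable, OF assms(2)]
  show ?thesis unfolding real_time_integral_def by measurable
qed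

lemma abs_real_time_integral_le:
  "ennreal \<bar>real_time_integral W \<omega> T\<bar> \<le> time_integral (\<lambda>\<omega> t. ennreal \<bar>W \<omega> t\<bar>) \<omega> T"
  unfolding real_time_integral_def by (intro abs_diff_enn2real_le time_integral_mono ennreal_leI) auto

lemma real_time_integral_eq:
  assumes W: "(\<lambda>(\<omega>, t). W \<omega> t) \<in> borel_measurable P" and good: "good \<omega>"
    and fin: "time_integral (\<lambda>\<omega> t. ennreal \<bar>W \<omega> t\<bar>) \<omega> T < \<infinity>"
  shows "set_integrable (dA A \<omega>) {0<..T} (W \<omega>)" "(LINT s:{0<..T}|dA A \<omega>. W \<omega> s) = real_time_integral W \<omega> T"
proof -
  have m: "(\<lambda>(\<omega>, t). ennreal (W \<omega> t)) \<in> borel_measurable P" "(\<lambda>(\<omega>, t). ennreal (- W \<omega> t)) \<in> borel_measurable P"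
    by ((rule process_compose[OF W], measurable)[1])+
  have f: "time_integral (\<lambda>\<omega> t. ennreal (W \<omega> t)) \<omega> T < \<infinity>" "time_integral (\<lambda>\<omega> t. ennreal (- W \<omega> t)) \<omega> T < \<infinity>"
    by (rule order_le_less_trans[OF time_integral_mono fin]; simp add: ennreal_leI)+
  note p = time_integral_enn2real[OF m(1) good f(1)] and n = time_integral_enn2real[OF m(2) good f(2)]
  have eq: "W \<omega> = (\<lambda>s. enn2real (ennreal (W \<omega> s)) - enn2real (ennreal (- W \<omega> s)))"
  proof
    show "W \<omega> s = enn2real (ennreal (W \<omega> s)) - enn2real (ennreal (- W \<omega> s))" for s
      by (cases "0 \<le> W \<omega> s") (auto simp: ennreal_neg)
  qed
  show "set_integrable (dA A \<omega>) {0<..T} (W \<omega>)"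
    by (subst eq) (rule set_integral_diff(1)[OF p(1) n(1)])
  show "(LINT s:{0<..T}|dA A \<omega>. W \<omega> s) = real_time_integral W \<omega> T"
    by (subst eq) (simp only: set_integral_diff(2)[OF p(1) n(1)] p(2) n(2) real_time_integral_def)
qed

text \<open>The integral of \<open>Q\<close> against \<open>\<phi> dA\<close> alone, without the
  jump part. The positive and negative parts are separated for the double integral as a whole, which
  keeps it measurable in \<open>\<omega>\<close>.\<close>

definition compensated_integral :: "('a \<Rightarrow> real \<Rightarrow> 'k \<Rightarrow> real) \<Rightarrow> 'a \<Rightarrow> real \<Rightarrow> real" where
  "compensated_integral Q \<omega> T =
     enn2real (time_integral (\<lambda>\<omega> t. \<integral>\<^sup>+y. ennreal (Q \<omega> t y) \<partial>\<phi> \<omega> t) \<omega> T) -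
     enn2real (time_integral (\<lambda>\<omega> t. \<integral>\<^sup>+y. ennreal (- Q \<omega> t y) \<partial>\<phi> \<omega> t) \<omega> T)"

lemma compensated_integral_eq:
  assumes Q: "(\<lambda>((\<omega>, t), y). Q \<omega> t y) \<in> borel_measurable (P \<Otimes>\<^sub>M K)" and good: "good \<omega>"
    and fin: "time_integral (\<lambda>\<omega> t. \<integral>\<^sup>+y. ennreal \<bar>Q \<omega> t y\<bar> \<partial>\<phi> \<omega> t) \<omega> T < \<infinity>"
  shows "AE s in dA A \<omega>. s \<in> {0<..T} \<longrightarrow> integrable (\<phi> \<omega> s) (Q \<omega> s)"
    "set_integrable (dA A \<omega>) {0<..T} (\<lambda>s. \<integral>y. Q \<omega> s y \<partial>\<phi> \<omega> s)"
    "(LINT s:{0<..T}|dA A \<omega>. (\<integral>y. Q \<omega> s y \<partial>\<phi> \<omega> s)) = compensated_integral Q \<omega> T"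
proof -
  have f: "(\<lambda>((\<omega>, t), y). ennreal (Q \<omega> t y)) \<in> borel_measurable (P \<Otimes>\<^sub>M K)"
    "(\<lambda>((\<omega>, t), y). ennreal (- Q \<omega> t y)) \<in> borel_measurable (P \<Otimes>\<^sub>M K)"
    "(\<lambda>((\<omega>, t), y). ennreal \<bar>Q \<omega> t y\<bar>) \<in> borel_measurable (P \<Otimes>\<^sub>M K)"
    by ((rule field_compose[OF Q], measurable)[1])+
  note m = f[THEN predictable_\<phi>_nn_integral]
  have le: "(\<integral>\<^sup>+y. ennreal (Q \<omega> t y) \<partial>\<phi> \<omega> t) \<le> (\<integral>\<^sup>+y. ennreal \<bar>Q \<omega> t y\<bar> \<partial>\<phi> \<omega> t)"
    "(\<integral>\<^sup>+y. ennreal (- Q \<omega> t y) \<partial>\<phi> \<omega> t) \<le> (\<integral>\<^sup>+y. ennreal \<bar>Q \<omega> t y\<bar> \<partial>\<phi> \<omega> t)" for t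
    by (intro nn_integral_mono ennreal_leI; simp)+
  have fin': "time_integral (\<lambda>\<omega> t. \<integral>\<^sup>+y. ennreal (Q \<omega> t y) \<partial>\<phi> \<omega> t) \<omega> T < \<infinity>"
    "time_integral (\<lambda>\<omega> t. \<integral>\<^sup>+y. ennreal (- Q \<omega> t y) \<partial>\<phi> \<omega> t) \<omega> T < \<infinity>"
    by (rule order_le_less_trans[OF time_integral_mono fin]; rule le)+
  note p = time_integral_enn2real[OF m(1) good fin'(1)] and n = time_integral_enn2real[OF m(2) good fin'(2)]
  show int: "AE s in dA A \<omega>. s \<in> {0<..T} \<longrightarrow> integrable (\<phi> \<omega> s) (Q \<omega> s)"
    using time_integral_enn2real(3)[OF m(3) good fin]
  proof eventually_elim
    case (elim s)
    show ?case
    proof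
      assume s: "s \<in> {0<..T}"
      have "Q \<omega> s \<in> borel_measurable (\<phi> \<omega> s)"
        using s by (intro field_section_measurable[OF Q good_space[OF good]]) auto
      then show "integrable (\<phi> \<omega> s) (Q \<omega> s)" using elim s by (intro integrableI_bounded) auto
    qed
  qed
  let ?d = "\<lambda>s. enn2real (\<integral>\<^sup>+y. ennreal (Q \<omega> s y) \<partial>\<phi> \<omega> s) - enn2real (\<integral>\<^sup>+y. ennreal (- Q \<omega> s y) \<partial>\<phi> \<omega> s)"
  have d: "set_integrable (dA A \<omega>) {0<..T} ?d" "(LINT s:{0<..T}|dA A \<omega>. ?d s) = compensated_integral Q \<omega> T"
    using set_integral_diff[OF p(1) n(1)] p(2) n(2) by (simp_all add: compensated_integral_def)
  \<comment> \<open>At times where \<open>Q\<close> is not integrable over the marks, the Bochner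
    integral has its default value, which may differ from \<open>?d\<close>; these times are null
    for \<open>dA\<close>.\<close>
  have AE: "AE s in dA A \<omega>. indicator {0<..T} s *\<^sub>R ?d s = indicator {0<..T} s *\<^sub>R (\<integral>y. Q \<omega> s y \<partial>\<phi> \<omega> s)"
    using int by eventually_elim (auto simp: real_lebesgue_integral_def indicator_def)
  have meas: "(\<lambda>s. indicator {0<..T} s *\<^sub>R (\<integral>y. Q \<omega> s y \<partial>\<phi> \<omega> s)) \<in> borel_measurable (dA A \<omega>)"
  proof -
    have "(\<lambda>s. indicator {0<..T} s *\<^sub>R (\<integral>y. Q \<omega> (max 0 s) y \<partial>\<phi> \<omega> (max 0 s))) \<in> borel_measurable (dA A \<omega>)"
      using path_measurable[OF predictable_\<phi>_integral[OF Q] good_space[OF good]] by measurable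
    also have "(\<lambda>s. indicator {0<..T} s *\<^sub>R (\<integral>y. Q \<omega> (max 0 s) y \<partial>\<phi> \<omega> (max 0 s))) =
      (\<lambda>s. indicator {0<..T} s *\<^sub>R (\<integral>y. Q \<omega> s y \<partial>\<phi> \<omega> s))" by (auto simp: indicator_def)
    finally show ?thesis .
  qed
  show "set_integrable (dA A \<omega>) {0<..T} (\<lambda>s. \<integral>y. Q \<omega> s y \<partial>\<phi> \<omega> s)"
    using d(1) unfolding set_integrable_def by (rule integrable_cong_AE_imp[OF _ meas]) (use AE in \<open>auto elim: AE_mp\<close>)
  have dm: "(\<lambda>s. indicator {0<..T} s *\<^sub>R ?d s) \<in> borel_measurable (dA A \<omega>)"
    using d(1) unfolding set_integrable_def by (rule borel_measurable_integrable)
  show "(LINT s:{0<..T}|dA A \<omega>. (\<integral>y. Q \<omega> s y \<partial>\<phi> \<omega> s)) = compensated_integral Q \<omega> T"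
    unfolding d(2)[symmetric] set_lebesgue_integral_def
    by (rule integral_cong_AE[OF meas dm]) (use AE in \<open>auto elim: AE_mp\<close>)
qed

text \<open>Reduces measurability of real jump sums to nonnegative ones: \<open>ennreal\<close>
  truncates negative terms to 0, so the two sums collect the positive and the negative
  parts.\<close>

lemma jump_sum_eq_diff:
  fixes Q :: "'a \<Rightarrow> real \<Rightarrow> 'k \<Rightarrow> real"
  shows "jump_sum Q \<omega> T = enn2real (jump_sum (\<lambda>\<omega> t y. ennreal (Q \<omega> t y)) \<omega> T) -
    enn2real (jump_sum (\<lambda>\<omega> t y. ennreal (- Q \<omega> t y)) \<omega> T)"
proof -
  have e: "enn2real (\<Sum>n\<in>J. ennreal (q n)) = (\<Sum>n\<in>J. max 0 (q n))" for J :: "nat set" and q :: "nat \<Rightarrow> real"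
  proof -
    have "(\<Sum>n\<in>J. ennreal (q n)) = (\<Sum>n\<in>J. ennreal (max 0 (q n)))"
      by (intro sum.cong refl) (auto simp: max_def ennreal_neg)
    also have "\<dots> = ennreal (\<Sum>n\<in>J. max 0 (q n))" by (rule sum_ennreal) simp
    finally show ?thesis by (simp add: sum_nonneg)
  qed
  show ?thesis
    by (auto simp: jump_sum_def e sum_subtractf[symmetric] max_def intro!: sum.cong)
qed

lemma real_jump_sum_measurable:
  fixes Q :: "'a \<Rightarrow> real \<Rightarrow> 'k \<Rightarrow> real"
  assumes "(\<lambda>((\<omega>, t), y). Q \<omega> t y) \<in> borel_measurable (P \<Otimes>\<^sub>M K)" "0 \<le> T"
  shows "(\<lambda>\<omega>. jump_sum Q \<omega> T) \<in> borel_measurable M"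
proof -
  have "(\<lambda>((\<omega>, t), y). ennreal (Q \<omega> t y)) \<in> borel_measurable (P \<Otimes>\<^sub>M K)"
    "(\<lambda>((\<omega>, t), y). ennreal (- Q \<omega> t y)) \<in> borel_measurable (P \<Otimes>\<^sub>M K)"
    by ((rule field_compose[OF assms(1)], measurable)[1])+
  note [measurable] = this[THEN jump_sum_measurable, OF assms(2)]
  show ?thesis unfolding jump_sum_eq_diff by measurable
qed

section \<open>Moments and change of measure\<close>

context
  fixes C T :: real
  assumes C: "1 < C" and T: "0 \<le> T"
    and exp_integrable: "(\<integral>\<^sup>+\<omega>. ennreal (exp ((3 + C ^ 4) * A \<omega> T)) \<partial>M) < \<infinity>"
begin

lemma nn_integral_A_finite: "(\<integral>\<^sup>+\<omega>. ennreal (A \<omega> T) \<partial>M) < \<infinity>"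
proof -
  have "(\<integral>\<^sup>+\<omega>. ennreal (A \<omega> T) \<partial>M) \<le> (\<integral>\<^sup>+\<omega>. ennreal (exp ((3 + C ^ 4) * A \<omega> T)) \<partial>M)"
  proof (rule nn_integral_mono_AE, rule AE_mp[OF AE_good], rule AE_I2, rule impI, rule ennreal_leI)
    fix \<omega> assume "good \<omega>"
    have "0 \<le> A \<omega> T" by (rule A_nonneg[OF \<open>good \<omega>\<close> T])
    moreover have "1 \<le> 3 + C ^ 4" using C by (simp add: add_increasing2)
    ultimately have "1 * A \<omega> T \<le> (3 + C ^ 4) * A \<omega> T" by (intro mult_right_mono)
    then show "A \<omega> T \<le> exp ((3 + C ^ 4) * A \<omega> T)" using exp_ge_add_one_self[of "(3 + C ^ 4) * A \<omega> T"] by linarith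
  qed
  then show ?thesis using exp_integrable by (rule order_le_less_trans)
qed

text \<open>
  For the constant intensity \<open>D\<close> switched off after \<open>k\<close> jumps the exponential is bounded before
  each jump, so its mean is 1; letting \<open>k\<close> grow bounds the exponential moments of \<open>N\<^sub>T\<close>.
\<close>

lemma truncated_moment:
  fixes k :: nat
  assumes D: "1 \<le> D"
  shows "(\<integral>\<^sup>+\<omega>. ennreal (D ^ min (if good \<omega> then card (jumped \<omega> T) else 0) k * exp (- (D - 1) * A \<omega> T)) \<partial>M) \<le> 1"
proof -
  \<comment> \<open>At the \<open>n\<close>-th jump exactly \<open>n - 1\<close> jumps lie strictly
    before, so the strict test against \<open>k\<close> gives the factor \<open>D\<close> to the
    first \<open>k\<close> jumps and 1 to all later ones.\<close>
  define R where "R \<omega> t y = (if (if good \<omega> then real (card (jumped_before \<omega> t)) else 0) < real k then D else 1)"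
    for \<omega> t and y :: 'k
  have "(\<lambda>w. if (\<lambda>(\<omega>, t). if good \<omega> then real (card (jumped_before \<omega> t)) else 0) w < real k then D else 1) \<in> borel_measurable P"
    using card_jumped_before_predictable by measurable
  then have m: "(\<lambda>(\<omega>, t). if (if good \<omega> then real (card (jumped_before \<omega> t)) else 0) < real k then D else 1) \<in> borel_measurable P"
    by (simp add: case_prod_unfold)
  have R: "bounded_field D R"
    unfolding bounded_field_def
  proof (intro conjI allI)
    show "(\<lambda>((\<omega>, t), y). R \<omega> t y) \<in> borel_measurable (P \<Otimes>\<^sub>M K)"
      unfolding R_def by (rule process_field[OF m])
  qed (use D in \<open>auto simp: R_def\<close>)
  have prod: "(\<Prod>n\<in>{1..m}. if n \<le> k then D else 1) = D ^ min m k" for m :: nat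
    by (induction m) (auto simp: min_def not_le less_Suc_eq_le le_Suc_eq dest: le_antisym)
  have R_jump: "R \<omega> (jump_time n \<omega>) y = (if n \<le> k then D else 1)" if "good \<omega>" "n \<in> jumped \<omega> t" for \<omega> n t y
  proof -
    have "1 \<le> n" using that(2) by (simp add: jumps_upto_def)
    then show ?thesis using card_jumped_before_jump[OF that] that(1) by (auto simp: R_def)
  qed
  have prod_left: "(\<Prod>n\<in>jumped_before \<omega> t. R \<omega> (jump_time n \<omega>) (\<xi> n \<omega>)) = D ^ min (card (jumped_before \<omega> t)) k"
    if "good \<omega>" for \<omega> t
  proof -
    have "(\<Prod>n\<in>jumped_before \<omega> t. R \<omega> (jump_time n \<omega>) (\<xi> n \<omega>)) = (\<Prod>n\<in>jumped_before \<omega> t. if n \<le> k then D else 1)"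
      using R_jump[OF that, of _ t] jumped_before_subset_jumped[of t t \<omega>] by (intro prod.cong) auto
    then show ?thesis by (subst (asm) (2) jumped_before_eq[OF that]) (simp only: prod)
  qed
  have prod_T: "(\<Prod>n\<in>jumped \<omega> T. R \<omega> (jump_time n \<omega>) (\<xi> n \<omega>)) = D ^ min (card (jumped \<omega> T)) k"
    if "good \<omega>" for \<omega>
  proof -
    have "(\<Prod>n\<in>jumped \<omega> T. R \<omega> (jump_time n \<omega>) (\<xi> n \<omega>)) = (\<Prod>n\<in>jumped \<omega> T. if n \<le> k then D else 1)"
      using R_jump[OF that, of _ T] by (intro prod.cong) auto
    then show ?thesis by (subst (asm) (2) jumped_eq[OF that]) (simp only: prod)
  qed
  \<comment> \<open>As \<open>R\<close> is at least 1, its compensating term is at least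
    \<open>A\<close>. The exponent is then at most 0, and what remains is at most
    \<open>D ^ k\<close>.\<close>
  have left_le: "stoch_exp_left R \<omega> t \<le> D ^ k" if "good \<omega>" "0 \<le> t" for \<omega> t
  proof -
    have "1 * ennreal (A \<omega> t) \<le> time_integral (intensity R) \<omega> t"
      unfolding time_integral_const[OF that, symmetric]
    proof (rule time_integral_mono)
      fix s :: real assume s: "0 < s"
      have "(\<integral>\<^sup>+y. ennreal 1 \<partial>\<phi> \<omega> s) \<le> intensity R \<omega> s"
        unfolding intensity_def using D by (intro nn_integral_mono ennreal_leI) (auto simp: R_def)
      then show "1 \<le> intensity R \<omega> s" using good_space[OF that(1)] s by (simp add: emeasure_\<phi>_space)
    qed
    moreover have "time_integral (intensity R) \<omega> t < \<top>"
      using compensating_le(1)[OF R that] by (simp add: order_le_less_trans)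
    ultimately have "A \<omega> t \<le> compensating R \<omega> t"
      using enn2real_mono[of "ennreal (A \<omega> t)" "time_integral (intensity R) \<omega> t"] A_nonneg[OF that]
      by (simp add: compensating_def)
    then have "exp (A \<omega> t - compensating R \<omega> t) * D ^ min (card (jumped_before \<omega> t)) k \<le> 1 * D ^ k"
      using D by (intro mult_mono power_increasing) auto
    then show ?thesis using that by (simp add: stoch_exp_left_def prod_left)
  qed
  have "(\<integral>\<^sup>+\<omega>. time_integral (\<lambda>\<omega> t. ennreal (stoch_exp_left R \<omega> t)) \<omega> T \<partial>M) \<le>
      (\<integral>\<^sup>+\<omega>. ennreal (D ^ k) * ennreal (A \<omega> T) \<partial>M)"
    by (rule nn_integral_mono_AE, rule AE_mp[OF AE_good], rule AE_I2, rule impI)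
       (use left_le T in \<open>auto intro!: time_integral_le ennreal_leI\<close>)
  also have "\<dots> = ennreal (D ^ k) * (\<integral>\<^sup>+\<omega>. ennreal (A \<omega> T) \<partial>M)" using T by (intro nn_integral_cmult) measurable
  also have "\<dots> < \<infinity>" using nn_integral_A_finite by (simp add: ennreal_mult_less_top)
  finally have one: "(\<integral>\<^sup>+\<omega>. ennreal (stoch_exp R \<omega> T) \<partial>M) = 1" by (rule expectation_stoch_exp[OF R T])
  have "(\<integral>\<^sup>+\<omega>. ennreal (D ^ min (if good \<omega> then card (jumped \<omega> T) else 0) k * exp (- (D - 1) * A \<omega> T)) \<partial>M)
      \<le> (\<integral>\<^sup>+\<omega>. ennreal (stoch_exp R \<omega> T) \<partial>M)"
  proof (rule nn_integral_mono_AE, rule AE_mp[OF AE_good], rule AE_I2, rule impI, rule ennreal_leI)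
    fix \<omega> assume good: "good \<omega>"
    \<comment> \<open>As \<open>R\<close> is at most \<open>D\<close>, its compensating term is at
      most \<open>D * A\<close>, which bounds the exponent from below.\<close>
    have "- (D - 1) * A \<omega> T \<le> A \<omega> T - compensating R \<omega> T"
      using compensating_le(2)[OF R good T] by (simp add: algebra_simps)
    then have "D ^ min (card (jumped \<omega> T)) k * exp (- (D - 1) * A \<omega> T) \<le>
        D ^ min (card (jumped \<omega> T)) k * exp (A \<omega> T - compensating R \<omega> T)"
      using D by (intro mult_left_mono) auto
    then show "D ^ min (if good \<omega> then card (jumped \<omega> T) else 0) k * exp (- (D - 1) * A \<omega> T) \<le> stoch_exp R \<omega> T"
      using good by (simp add: stoch_exp_def prod_T mult.commute)
  qed
  then show ?thesis unfolding one .
qed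

text \<open>Fatou's lemma in \<open>k\<close>: for each \<open>\<omega>\<close> the truncated
  integrands are eventually equal to the limit, and the bound 1 does not depend on
  \<open>k\<close>.\<close>

lemma moment:
  assumes D: "1 \<le> D"
  shows "(\<integral>\<^sup>+\<omega>. ennreal (D ^ (if good \<omega> then card (jumped \<omega> T) else 0) * exp (- (D - 1) * A \<omega> T)) \<partial>M) \<le> 1"
proof -
  define N where "N \<omega> = (if good \<omega> then card (jumped \<omega> T) else 0)" for \<omega>
  have N[measurable]: "N \<in> M \<rightarrow>\<^sub>M count_space UNIV"
    unfolding N_def[abs_def] by (rule card_jumped_measurable[OF T])
  let ?u = "\<lambda>k \<omega>. ennreal (D ^ min (N \<omega>) k * exp (- (D - 1) * A \<omega> T))"
  have [measurable]: "(\<lambda>\<omega>. A \<omega> T) \<in> borel_measurable M" using T by measurable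
  have "(\<integral>\<^sup>+\<omega>. ennreal (D ^ N \<omega> * exp (- (D - 1) * A \<omega> T)) \<partial>M) = (\<integral>\<^sup>+\<omega>. liminf (\<lambda>k. ?u k \<omega>) \<partial>M)"
  proof (intro nn_integral_cong)
    fix \<omega>
    have "\<forall>\<^sub>F k in sequentially. ?u k \<omega> = ennreal (D ^ N \<omega> * exp (- (D - 1) * A \<omega> T))"
      using eventually_ge_at_top[of "N \<omega>"] by eventually_elim simp
    then have "(\<lambda>k. ?u k \<omega>) \<longlonglongrightarrow> ennreal (D ^ N \<omega> * exp (- (D - 1) * A \<omega> T))" by (rule tendsto_eventually)
    then show "ennreal (D ^ N \<omega> * exp (- (D - 1) * A \<omega> T)) = liminf (\<lambda>k. ?u k \<omega>)"
      by (simp add: lim_imp_Liminf)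
  qed
  also have "\<dots> \<le> liminf (\<lambda>k. \<integral>\<^sup>+\<omega>. ?u k \<omega> \<partial>M)"
    by (rule nn_integral_liminf) measurable
  also have "\<dots> \<le> liminf (\<lambda>k. 1)"
    using truncated_moment[OF D] by (intro Liminf_mono always_eventually allI) (simp add: N_def)
  also have "\<dots> = (1::ennreal)" by (simp add: Liminf_const)
  finally show ?thesis by (simp add: N_def)
qed

lemma dominating_ge: "good \<omega> \<Longrightarrow> exp (A \<omega> T) \<le> dominating C T \<omega>" "good \<omega> \<Longrightarrow> C ^ card (jumped \<omega> T) \<le> dominating C T \<omega>"
  "good \<omega> \<Longrightarrow> 1 \<le> dominating C T \<omega>"
proof -
  assume good: "good \<omega>"
  have 1: "1 \<le> C ^ card (jumped \<omega> T)" "1 \<le> exp (A \<omega> T)" using C A_nonneg[OF good T] by auto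
  show *: "exp (A \<omega> T) \<le> dominating C T \<omega>" unfolding dominating_def using mult_right_mono[OF 1(1), of "exp (A \<omega> T)"] by simp
  show "C ^ card (jumped \<omega> T) \<le> dominating C T \<omega>"
    unfolding dominating_def using mult_left_mono[OF 1(2), of "C ^ card (jumped \<omega> T)"] 1 by simp
  show "1 \<le> dominating C T \<omega>" using * 1 by linarith
qed

lemma dominating_measurable: "(\<lambda>\<omega>. dominating C T \<omega>) \<in> borel_measurable M"
proof (rule borel_measurable_AE_complete)
  have [measurable]: "(\<lambda>\<omega>. A \<omega> T) \<in> borel_measurable M" using T by measurable
  note card_jumped_measurable[OF T, measurable]
  show "(\<lambda>\<omega>. C ^ (if good \<omega> then card (jumped \<omega> T) else 0) * exp (A \<omega> T)) \<in> borel_measurable M" by measurable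
  show "AE \<omega> in M. C ^ (if good \<omega> then card (jumped \<omega> T) else 0) * exp (A \<omega> T) = dominating C T \<omega>"
    using AE_good by eventually_elim (simp add: dominating_def)
qed (auto intro: complete_measure_axioms)

text \<open>Origin of the constant \<open>3 + C ^ 4\<close>. The square of \<open>dominating\<close>
  is \<open>x * y\<close>, where \<open>x\<close> squared is the integrand of \<open>moment\<close>
  for \<open>D = C ^ 4\<close> and \<open>y\<close> squared is the exponential assumed integrable;
  the halved exponents \<open>-(C ^ 4 - 1)\<close> and \<open>3 + C ^ 4\<close> add up to 2. Then
  \<open>x * y\<close> is at most the sum of the two squares.\<close>

lemma dominating_square_finite: "(\<integral>\<^sup>+\<omega>. ennreal ((dominating C T \<omega>)\<^sup>2) \<partial>M) < \<infinity>"
proof -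
  define N where "N \<omega> = (if good \<omega> then card (jumped \<omega> T) else 0)" for \<omega>
  have [measurable]: "N \<in> M \<rightarrow>\<^sub>M count_space UNIV"
    unfolding N_def[abs_def] by (rule card_jumped_measurable[OF T])
  have [measurable]: "(\<lambda>\<omega>. A \<omega> T) \<in> borel_measurable M" using T by measurable
  have "(\<integral>\<^sup>+\<omega>. ennreal ((dominating C T \<omega>)\<^sup>2) \<partial>M) \<le>
     (\<integral>\<^sup>+\<omega>. ennreal ((C ^ 4) ^ N \<omega> * exp (- (C ^ 4 - 1) * A \<omega> T)) + ennreal (exp ((3 + C ^ 4) * A \<omega> T)) \<partial>M)"
  proof (rule nn_integral_mono_AE, rule AE_mp[OF AE_good], rule AE_I2, rule impI)
    fix \<omega> assume good: "good \<omega>"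
    define x where "x = (C\<^sup>2) ^ N \<omega> * exp (- (C ^ 4 - 1) * A \<omega> T / 2)"
    define y where "y = exp ((3 + C ^ 4) * A \<omega> T / 2)"
    have "x * y = (C\<^sup>2) ^ N \<omega> * exp (- (C ^ 4 - 1) * A \<omega> T / 2 + (3 + C ^ 4) * A \<omega> T / 2)"
      by (simp add: x_def y_def exp_add)
    also have "- (C ^ 4 - 1) * A \<omega> T / 2 + (3 + C ^ 4) * A \<omega> T / 2 = 2 * A \<omega> T"
      by (simp add: field_simps)
    also have "(C\<^sup>2) ^ N \<omega> * exp (2 * A \<omega> T) = (dominating C T \<omega>)\<^sup>2"
      using good by (simp add: dominating_def N_def power_mult_distrib exp_double power_mult[symmetric] mult.commute[of _ "2::nat"])
    finally have xy: "(dominating C T \<omega>)\<^sup>2 = x * y" by simp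
    have "0 \<le> x * y" unfolding xy[symmetric] by simp
    moreover have "0 \<le> (x - y)\<^sup>2" by simp
    ultimately have "x * y \<le> x\<^sup>2 + y\<^sup>2" by (simp add: power2_diff)
    moreover have "x\<^sup>2 = (C ^ 4) ^ N \<omega> * exp (- (C ^ 4 - 1) * A \<omega> T)"
      by (simp add: x_def power_mult_distrib power_mult[symmetric] mult.commute exp_double[symmetric])
    moreover have "y\<^sup>2 = exp ((3 + C ^ 4) * A \<omega> T)" by (simp add: y_def exp_double[symmetric])
    ultimately have "(dominating C T \<omega>)\<^sup>2 \<le> (C ^ 4) ^ N \<omega> * exp (- (C ^ 4 - 1) * A \<omega> T) + exp ((3 + C ^ 4) * A \<omega> T)"
      using xy by simp
    then have "ennreal ((dominating C T \<omega>)\<^sup>2) \<le>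
        ennreal ((C ^ 4) ^ N \<omega> * exp (- (C ^ 4 - 1) * A \<omega> T) + exp ((3 + C ^ 4) * A \<omega> T))"
      by (rule ennreal_leI)
    also have "\<dots> = ennreal ((C ^ 4) ^ N \<omega> * exp (- (C ^ 4 - 1) * A \<omega> T)) + ennreal (exp ((3 + C ^ 4) * A \<omega> T))"
      using C by (intro ennreal_plus) auto
    finally show "ennreal ((dominating C T \<omega>)\<^sup>2) \<le>
        ennreal ((C ^ 4) ^ N \<omega> * exp (- (C ^ 4 - 1) * A \<omega> T)) + ennreal (exp ((3 + C ^ 4) * A \<omega> T))" .
  qed
  also have "\<dots> = (\<integral>\<^sup>+\<omega>. ennreal ((C ^ 4) ^ N \<omega> * exp (- (C ^ 4 - 1) * A \<omega> T)) \<partial>M) +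
      (\<integral>\<^sup>+\<omega>. ennreal (exp ((3 + C ^ 4) * A \<omega> T)) \<partial>M)"
    by (rule nn_integral_add) measurable
  also have "\<dots> \<le> 1 + (\<integral>\<^sup>+\<omega>. ennreal (exp ((3 + C ^ 4) * A \<omega> T)) \<partial>M)"
    using moment[of "C ^ 4"] C by (intro add_right_mono) (simp add: N_def)
  also have "\<dots> < \<infinity>" using exp_integrable by (simp add: ennreal_add_less_top)
  finally show ?thesis .
qed

text \<open>The time integral of the left limit is at most \<open>dominating\<close> times
  \<open>A\<close>, and \<open>A\<close> is itself below \<open>dominating\<close>. So the
  finiteness asked by \<open>expectation_stoch_exp\<close> is the second moment of
  \<open>dominating\<close>.\<close>

lemma stoch_exp_mean:
  assumes R: "bounded_field C R"
  shows "(\<integral>\<^sup>+\<omega>. ennreal (stoch_exp R \<omega> T) \<partial>M) = 1"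
proof (rule expectation_stoch_exp[OF R T])
  have "(\<integral>\<^sup>+\<omega>. time_integral (\<lambda>\<omega> t. ennreal (stoch_exp_left R \<omega> t)) \<omega> T \<partial>M) \<le> (\<integral>\<^sup>+\<omega>. ennreal ((dominating C T \<omega>)\<^sup>2) \<partial>M)"
  proof (rule nn_integral_mono_AE, rule AE_mp[OF AE_good], rule AE_I2, rule impI)
    fix \<omega> assume good: "good \<omega>"
    have "A \<omega> T \<le> dominating C T \<omega>"
      using dominating_ge(1)[OF good] exp_ge_add_one_self[of "A \<omega> T"] by linarith
    then have A: "ennreal (A \<omega> T) \<le> ennreal (dominating C T \<omega>)" by (rule ennreal_leI)
    have "time_integral (\<lambda>\<omega> t. ennreal (stoch_exp_left R \<omega> t)) \<omega> T \<le> ennreal (dominating C T \<omega>) * ennreal (A \<omega> T)"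
      using stoch_exp_le_dominating(1)[OF R _ good] C T good by (intro time_integral_le ennreal_leI) auto
    also have "\<dots> \<le> ennreal (dominating C T \<omega>) * ennreal (dominating C T \<omega>)"
      using A by (intro mult_left_mono) auto
    also have "\<dots> = ennreal ((dominating C T \<omega>)\<^sup>2)"
      using dominating_ge(3)[OF good] by (simp add: ennreal_mult power2_eq_square)
    finally show "time_integral (\<lambda>\<omega> t. ennreal (stoch_exp_left R \<omega> t)) \<omega> T \<le> ennreal ((dominating C T \<omega>)\<^sup>2)" .
  qed
  then show "(\<integral>\<^sup>+\<omega>. time_integral (\<lambda>\<omega> t. ennreal (stoch_exp_left R \<omega> t)) \<omega> T \<partial>M) < \<infinity>"
    using dominating_square_finite by (rule order_le_less_trans)
qed

lemma stoch_exp_integrable: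
  assumes R: "bounded_field C R"
  shows "integrable M (\<lambda>\<omega>. stoch_exp R \<omega> T)" "(\<integral>\<omega>. stoch_exp R \<omega> T \<partial>M) = 1"
proof -
  have "integrable M (\<lambda>\<omega>. stoch_exp R \<omega> T) \<and> (\<integral>\<omega>. stoch_exp R \<omega> T \<partial>M) = 1"
    using stoch_exp_mean[OF R] stoch_exp_measurable[OF R T] stoch_exp_nonneg[OF R]
    by (subst nn_integral_eq_integrable[symmetric]) auto
  then show "integrable M (\<lambda>\<omega>. stoch_exp R \<omega> T)" "(\<integral>\<omega>. stoch_exp R \<omega> T \<partial>M) = 1" by auto
qed

text \<open>
  Multiplying \<open>R\<close> by \<open>1 - \<epsilon>h\<close> gives another exponential of mean 1; the identity is the derivative
  of this constant mean at \<open>\<epsilon> = 0\<close>. The bound on \<open>h\<close> makes the compensator of \<open>h\<close> bounded.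
\<close>

lemma girsanov_bounded:
  assumes R: "bounded_field C R" and h: "bounded_field 1 h" and h_le: "\<And>\<omega> t y. h \<omega> t y \<le> exp (- A_path \<omega> t)"
  shows "(\<integral>\<^sup>+\<omega>. ennreal (stoch_exp R \<omega> T) * jump_sum (\<lambda>\<omega> t y. ennreal (h \<omega> t y)) \<omega> T \<partial>M) =
    (\<integral>\<^sup>+\<omega>. ennreal (stoch_exp R \<omega> T) * time_integral (intensity (\<lambda>\<omega> t y. R \<omega> t y * h \<omega> t y)) \<omega> T \<partial>M)"
proof -
  let ?Rh = "\<lambda>\<omega> t y. R \<omega> t y * h \<omega> t y"
  define L where "L \<omega> = stoch_exp R \<omega> T" for \<omega>
  define S where "S \<omega> = jump_sum h \<omega> T" for \<omega>
  define a where "a \<omega> = compensating ?Rh \<omega> T" for \<omega>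
  have Rh: "bounded_field C ?Rh" using bounded_field_mult[OF R h] by simp
  have [measurable]: "L \<in> borel_measurable M"
    unfolding L_def[abs_def] by (rule stoch_exp_measurable[OF R T])
  have hm: "(\<lambda>((\<omega>, t), y). ennreal (h \<omega> t y)) \<in> borel_measurable (P \<Otimes>\<^sub>M K)"
    by (rule field_compose[OF bounded_fieldD(1)[OF h] measurable_ennreal])
  have S_eq: "jump_sum (\<lambda>\<omega> t y. ennreal (h \<omega> t y)) \<omega> T = ennreal (S \<omega>)" for \<omega>
    unfolding S_def by (rule jump_sum_ennreal[OF bounded_fieldD(2)[OF h]])
  have S0: "0 \<le> S \<omega>" for \<omega>
    using bounded_fieldD(2)[OF h] by (auto simp: S_def jump_sum_def intro!: sum_nonneg)
  have [measurable]: "S \<in> borel_measurable M"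
  proof -
    have "(\<lambda>\<omega>. enn2real (jump_sum (\<lambda>\<omega> t y. ennreal (h \<omega> t y)) \<omega> T)) \<in> borel_measurable M"
      using jump_sum_measurable[OF hm T] by measurable
    then show ?thesis using S0 by (simp add: S_eq)
  qed
  have [measurable]: "a \<in> borel_measurable M"
    unfolding a_def[abs_def] using measurable_compose[OF section_measurable_M compensating_predictable[OF bounded_fieldD(1)[OF Rh]], of T] T
    by simp
  have a0: "0 \<le> a \<omega>" for \<omega> by (simp add: a_def compensating_def)
  \<comment> \<open>The integrand is at most \<open>C * exp (- A)\<close>, and the integral of
    \<open>exp (- A)\<close> against \<open>dA\<close> is at most 1 whatever the path.\<close>
  have ti_le: "time_integral (intensity ?Rh) \<omega> T \<le> ennreal C" if good: "good \<omega>" for \<omega>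
  proof -
    have "time_integral (intensity ?Rh) \<omega> T \<le> time_integral (\<lambda>\<omega> t. ennreal C * ennreal (exp (- A_path \<omega> t))) \<omega> T"
    proof (rule time_integral_mono)
      fix t :: real assume t: "0 < t"
      have "R \<omega> t y * h \<omega> t y \<le> C * exp (- A_path \<omega> t)" for y
        using bounded_fieldD[OF R] bounded_fieldD(2)[OF h] h_le by (intro mult_mono) auto
      then have "intensity ?Rh \<omega> t \<le> ennreal (C * exp (- A_path \<omega> t))"
        using good_space[OF good] t by (intro intensity_le) auto
      then show "intensity ?Rh \<omega> t \<le> ennreal C * ennreal (exp (- A_path \<omega> t))"
        using C by (simp add: ennreal_mult)
    qed
    also have "\<dots> = ennreal C * time_integral (\<lambda>\<omega> t. ennreal (exp (- A_path \<omega> t))) \<omega> T"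
    proof (rule time_integral_cmult)
      have "(\<lambda>w. ennreal (exp (- (\<lambda>(\<omega>, t). A_path \<omega> t) w))) \<in> borel_measurable P"
        using A_path_predictable by measurable
      then show "(\<lambda>(\<omega>, t). ennreal (exp (- A_path \<omega> t))) \<in> borel_measurable P" by (simp add: case_prod_unfold)
    qed
    also have "time_integral (\<lambda>\<omega> t. ennreal (exp (- A_path \<omega> t))) \<omega> T \<le> 1"
      using continuous_path.nn_integral_exp_uminus_le[of "dA A \<omega>" "A \<omega>" 1 T] good T
      by (simp add: time_integral_def A_path_def good_def)
    finally show ?thesis by (simp add: mult_left_mono)
  qed
  have ti_eq: "time_integral (intensity ?Rh) \<omega> T = ennreal (a \<omega>)" if "good \<omega>" for \<omega>
    using ti_le[OF that] by (simp add: a_def compensating_def order_le_less_trans)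
  have a_le: "a \<omega> \<le> C" if "good \<omega>" for \<omega>
    using ti_le[OF that] C by (simp add: ti_eq[OF that])
  define G where "G n \<omega> = exp (1 / real (n + 2) * a \<omega>) * (\<Prod>i\<in>jumped \<omega> T. 1 - 1 / real (n + 2) * h \<omega> (jump_time i \<omega>) (\<xi> i \<omega>))" for n \<omega>
  define R' where "R' n \<omega> t y = R \<omega> t y * (1 - 1 / real (n + 2) * h \<omega> t y)" for n \<omega> t y
  have eps: "0 \<le> 1 / real (n + 2)" "1 / real (n + 2) \<le> 1" for n by auto
  have R': "bounded_field C (R' n)" for n
    unfolding R'_def[abs_def] using bounded_field_mult[OF R bounded_field_one_minus[OF h eps]] by simp
  have L': "stoch_exp (R' n) \<omega> T = L \<omega> * G n \<omega>" if "good \<omega>" for n \<omega>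
    unfolding R'_def[abs_def] L_def G_def a_def using stoch_exp_perturbed[OF R h eps that T] .
  define f where "f n \<omega> = (L \<omega> - stoch_exp (R' n) \<omega> T) * real (n + 2)" for n \<omega>
  have f_eq: "f n \<omega> = L \<omega> * ((1 - G n \<omega>) * real (n + 2))" if "good \<omega>" for n \<omega>
    unfolding f_def L'[OF that] by (simp add: algebra_simps)
  have f_int: "integrable M (f n)" "(\<integral>\<omega>. f n \<omega> \<partial>M) = 0" for n
    using stoch_exp_integrable[OF R] stoch_exp_integrable[OF R', of n] by (simp_all add: f_def[abs_def] L_def)
  \<comment> \<open>Majorant of the difference quotients. One factor \<open>dominating\<close>
    bounds \<open>L\<close>; the other bounds the jump count, since Bernoulli's inequality gives
    \<open>N * (C - 1) \<le> C ^ N\<close>. The term \<open>a * exp a\<close> is at most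
    \<open>C * exp C\<close> because the compensator \<open>a\<close> is at most
    \<open>C\<close>.\<close>
  define w where "w \<omega> = (dominating C T \<omega>)\<^sup>2 * (1 / (C - 1) + C * exp C)" for \<omega>
  have [measurable]: "(\<lambda>\<omega>. dominating C T \<omega>) \<in> borel_measurable M" by (rule dominating_measurable)
  have [measurable]: "w \<in> borel_measurable M" unfolding w_def[abs_def] by measurable
  have w_fin: "(\<integral>\<^sup>+\<omega>. ennreal (w \<omega>) \<partial>M) < \<infinity>"
  proof -
    have "(\<integral>\<^sup>+\<omega>. ennreal (w \<omega>) \<partial>M) = (\<integral>\<^sup>+\<omega>. ennreal ((dominating C T \<omega>)\<^sup>2) * ennreal (1 / (C - 1) + C * exp C) \<partial>M)"
      using C by (intro nn_integral_cong) (simp add: w_def ennreal_mult)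
    also have "\<dots> = (\<integral>\<^sup>+\<omega>. ennreal ((dominating C T \<omega>)\<^sup>2) \<partial>M) * ennreal (1 / (C - 1) + C * exp C)"
      by (rule nn_integral_multc) measurable
    also have "\<dots> < \<infinity>"
      using dominating_square_finite by (simp add: ennreal_mult_less_top)
    finally show ?thesis .
  qed
  have L_bound: "L \<omega> * (real (card (jumped \<omega> T)) + x) \<le> w \<omega>" if good: "good \<omega>" and x: "0 \<le> x" "x \<le> C * exp C" for \<omega> x
  proof -
    let ?d = "dominating C T \<omega>" and ?N = "card (jumped \<omega> T)"
    note ge = dominating_ge[OF good]
    have "1 + real ?N * (C - 1) \<le> (1 + (C - 1)) ^ ?N" using C by (intro Bernoulli_inequality) auto
    then have "real ?N * (C - 1) \<le> ?d" using ge(2) by simp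
    then have N: "real ?N \<le> ?d / (C - 1)" using C by (simp add: field_simps)
    have "1 * (C * exp C) \<le> ?d * (C * exp C)" using ge(3) C by (intro mult_right_mono) auto
    then have "x \<le> ?d * (C * exp C)" using x by linarith
    with N have "real ?N + x \<le> ?d * (1 / (C - 1) + C * exp C)" by (simp add: distrib_left)
    moreover have "L \<omega> \<le> ?d" unfolding L_def using C T by (intro stoch_exp_le_dominating[OF R _ good]) auto
    ultimately have "L \<omega> * (real ?N + x) \<le> ?d * (?d * (1 / (C - 1) + C * exp C))"
      using ge(3) x by (intro mult_mono) auto
    then show ?thesis by (simp add: w_def power2_eq_square mult.assoc)
  qed
  have L0: "0 \<le> L \<omega>" for \<omega> unfolding L_def by (rule stoch_exp_nonneg[OF R])
  have "(\<lambda>n. \<integral>\<omega>. f n \<omega> \<partial>M) \<longlonglongrightarrow> (\<integral>\<omega>. L \<omega> * (S \<omega> - a \<omega>) \<partial>M)"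
  proof (rule integral_dominated_convergence)
    show "integrable M w"
      using w_fin C by (intro integrableI_bounded) (auto simp: w_def)
    show "AE \<omega> in M. (\<lambda>n. f n \<omega>) \<longlonglongrightarrow> L \<omega> * (S \<omega> - a \<omega>)"
      using AE_good
    proof eventually_elim
      case (elim \<omega>)
      have "(\<lambda>n. (1 - G n \<omega>) * real (n + 2)) \<longlonglongrightarrow> S \<omega> - a \<omega>"
        unfolding G_def S_def jump_sum_def using elim one_minus_exp_prod_limit[of "jumped \<omega> T" "\<lambda>i. h \<omega> (jump_time i \<omega>) (\<xi> i \<omega>)" "a \<omega>"]
          bounded_fieldD(2,3)[OF h] by simp
      then show ?case unfolding f_eq[OF elim] by (intro tendsto_intros)
    qed
    show "AE \<omega> in M. norm (f n \<omega>) \<le> w \<omega>" for n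
      using AE_good
    proof eventually_elim
      case (elim \<omega>)
      have "\<bar>1 - G n \<omega>\<bar> \<le> 1 / real (n + 2) * (real (card (jumped \<omega> T)) + a \<omega> * exp (a \<omega>))"
        unfolding G_def using bounded_fieldD(2,3)[OF h] elim a0 eps by (intro one_minus_exp_prod_bound) auto
      then have "\<bar>1 - G n \<omega>\<bar> * real (n + 2) \<le> real (card (jumped \<omega> T)) + a \<omega> * exp (a \<omega>)"
        by (simp add: field_simps)
      then have "norm (f n \<omega>) \<le> L \<omega> * (real (card (jumped \<omega> T)) + a \<omega> * exp (a \<omega>))"
        unfolding f_eq[OF elim] using L0[of \<omega>] by (simp add: abs_mult mult_left_mono)
      also have "\<dots> \<le> w \<omega>"
        using elim a0[of \<omega>] a_le[OF elim] C by (intro L_bound mult_mono) auto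
      finally show ?case .
    qed
  qed (use f_int in \<open>auto intro: borel_measurable_integrable\<close>)
  then have zero: "(\<integral>\<omega>. L \<omega> * (S \<omega> - a \<omega>) \<partial>M) = 0"
    by (simp add: f_int(2) LIMSEQ_const_iff)
  have LS: "integrable M (\<lambda>\<omega>. L \<omega> * S \<omega>)"
  proof (rule good_integrable_bound[OF _ _ w_fin])
    fix \<omega> assume good: "good \<omega>"
    have "S \<omega> \<le> real (card (jumped \<omega> T))"
      using good sum_mono[of "jumped \<omega> T" "\<lambda>n. h \<omega> (jump_time n \<omega>) (\<xi> n \<omega>)" "\<lambda>_. 1"] bounded_fieldD(3)[OF h]
      by (simp add: S_def jump_sum_def)
    then have "L \<omega> * S \<omega> \<le> L \<omega> * (real (card (jumped \<omega> T)) + 0)" using L0 by (intro mult_left_mono) auto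
    also have "\<dots> \<le> w \<omega>" using C good by (intro L_bound) auto
    finally show "\<bar>L \<omega> * S \<omega>\<bar> \<le> w \<omega>" using L0[of \<omega>] S0[of \<omega>] by simp
  qed measurable
  have La: "integrable M (\<lambda>\<omega>. L \<omega> * a \<omega>)"
  proof (rule good_integrable_bound[OF _ _ w_fin])
    fix \<omega> assume good: "good \<omega>"
    have "C * 1 \<le> C * exp C" using C by (intro mult_left_mono) auto
    then have "L \<omega> * (real (card (jumped \<omega> T)) + a \<omega>) \<le> w \<omega>" using good a0 a_le[OF good] by (intro L_bound) auto
    moreover have "L \<omega> * a \<omega> \<le> L \<omega> * (real (card (jumped \<omega> T)) + a \<omega>)" using L0 by (intro mult_left_mono) auto
    ultimately show "\<bar>L \<omega> * a \<omega>\<bar> \<le> w \<omega>" using L0[of \<omega>] a0[of \<omega>] by simp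
  qed measurable
  have "(\<integral>\<omega>. L \<omega> * S \<omega> \<partial>M) = (\<integral>\<omega>. L \<omega> * a \<omega> \<partial>M)"
    using zero LS La by (simp add: right_diff_distrib)
  then have "(\<integral>\<^sup>+\<omega>. ennreal (L \<omega> * S \<omega>) \<partial>M) = (\<integral>\<^sup>+\<omega>. ennreal (L \<omega> * a \<omega>) \<partial>M)"
    using LS La L0 S0 a0 by (simp add: nn_integral_eq_integral)
  moreover have "(\<integral>\<^sup>+\<omega>. ennreal (L \<omega> * S \<omega>) \<partial>M) = (\<integral>\<^sup>+\<omega>. ennreal (L \<omega>) * jump_sum (\<lambda>\<omega> t y. ennreal (h \<omega> t y)) \<omega> T \<partial>M)"
    using L0 S0 by (simp add: S_eq ennreal_mult)
  moreover have "(\<integral>\<^sup>+\<omega>. ennreal (L \<omega> * a \<omega>) \<partial>M) = (\<integral>\<^sup>+\<omega>. ennreal (L \<omega>) * time_integral (intensity ?Rh) \<omega> T \<partial>M)"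
    by (rule nn_integral_cong_AE, rule AE_mp[OF AE_good], rule AE_I2) (use L0 a0 in \<open>simp add: ti_eq ennreal_mult\<close>)
  ultimately show ?thesis by (simp add: L_def)
qed

text \<open>Truncating \<open>H\<close> at \<open>n * e\<close> and dividing by \<open>n\<close>
  gives a field to which \<open>girsanov_bounded\<close> applies. Since \<open>e\<close> is positive
  everywhere, the truncations increase to \<open>H\<close>, and both sides converge by monotone
  convergence.\<close>

lemma girsanov:
  fixes H :: "'a \<Rightarrow> real \<Rightarrow> 'k \<Rightarrow> ennreal"
  assumes R: "bounded_field C R" and H: "(\<lambda>((\<omega>, t), y). H \<omega> t y) \<in> borel_measurable (P \<Otimes>\<^sub>M K)"
  shows "(\<integral>\<^sup>+\<omega>. ennreal (stoch_exp R \<omega> T) * jump_sum H \<omega> T \<partial>M) =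
    (\<integral>\<^sup>+\<omega>. ennreal (stoch_exp R \<omega> T) * time_integral (\<lambda>\<omega> t. \<integral>\<^sup>+y. ennreal (R \<omega> t y) * H \<omega> t y \<partial>\<phi> \<omega> t) \<omega> T \<partial>M)"
proof -
  \<comment> \<open>The field must be at most 1 at every argument. At nonnegative times
    \<open>exp (- A_path)\<close> has this property already; the minimum enforces it at negative
    times, where \<open>A_path\<close> is not controlled.\<close>
  define e where "e \<omega> t = min 1 (exp (- A_path \<omega> t))" for \<omega> t
  have e0: "0 < e \<omega> t" "e \<omega> t \<le> 1" "e \<omega> t \<le> exp (- A_path \<omega> t)" for \<omega> t by (auto simp: e_def)
  have e: "(\<lambda>(\<omega>, t). e \<omega> t) \<in> borel_measurable P"
  proof -
    have "(\<lambda>w. min 1 (exp (- (\<lambda>(\<omega>, t). A_path \<omega> t) w))) \<in> borel_measurable P"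
      using A_path_predictable by measurable
    then show ?thesis by (simp add: case_prod_unfold e_def)
  qed
  define Q where "Q n \<omega> t y = min (H \<omega> t y) (ennreal (real n * e \<omega> t))" for n \<omega> t y
  define h where "h n \<omega> t y = enn2real (Q n \<omega> t y) * (1 / real n)" for n \<omega> t y
  have Q: "(\<lambda>((\<omega>, t), y). Q n \<omega> t y) \<in> borel_measurable (P \<Otimes>\<^sub>M K)" for n
  proof -
    have "(\<lambda>w. min ((\<lambda>((\<omega>, t), y). H \<omega> t y) w) (ennreal (real n * (\<lambda>((\<omega>, t), y). e \<omega> t) w))) \<in> borel_measurable (P \<Otimes>\<^sub>M K)"
      using H process_field[OF e] by measurable
    then show ?thesis by (simp add: case_prod_unfold Q_def)
  qed
  have Qh: "Q n \<omega> t y = ennreal (real n) * ennreal (h n \<omega> t y)" for n \<omega> t y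
  proof (cases "n = 0")
    case False
    have "Q n \<omega> t y < \<top>" by (simp add: Q_def min_less_iff_disj)
    then have "Q n \<omega> t y = ennreal (real n * h n \<omega> t y)" using False by (simp add: h_def)
    then show ?thesis by (simp add: ennreal_mult')
  qed (simp add: Q_def)
  have Q_le: "enn2real (Q n \<omega> t y) \<le> real n * e \<omega> t" for n \<omega> t y
    using enn2real_mono[of "Q n \<omega> t y" "ennreal (real n * e \<omega> t)"] e0(1)[of \<omega> t] by (simp add: Q_def)
  have h_le: "h n \<omega> t y \<le> e \<omega> t" for n \<omega> t y
    using Q_le[of n \<omega> t y] e0(1)[of \<omega> t] by (cases "n = 0") (auto simp: h_def field_simps)
  have h: "bounded_field 1 (h n)" for n
    unfolding bounded_field_def
  proof (intro conjI allI)
    show "(\<lambda>((\<omega>, t), y). h n \<omega> t y) \<in> borel_measurable (P \<Otimes>\<^sub>M K)"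
      unfolding h_def by (rule field_compose[OF Q, of "\<lambda>x. enn2real x * (1 / real n)" borel]) measurable
    show "0 \<le> h n \<omega> t y" "h n \<omega> t y \<le> 1" for \<omega> t y
      using h_le[of n \<omega> t y] e0(2)[of \<omega> t] by (auto simp: h_def)
  qed
  define IQ where "IQ n \<omega> t = (\<integral>\<^sup>+y. ennreal (R \<omega> t y) * Q n \<omega> t y \<partial>\<phi> \<omega> t)" for n \<omega> t
  have RQ: "(\<lambda>((\<omega>, t), y). ennreal (R \<omega> t y) * Q n \<omega> t y) \<in> borel_measurable (P \<Otimes>\<^sub>M K)" for n
  proof -
    have "(\<lambda>w. ennreal ((\<lambda>((\<omega>, t), y). R \<omega> t y) w) * (\<lambda>((\<omega>, t), y). Q n \<omega> t y) w) \<in> borel_measurable (P \<Otimes>\<^sub>M K)"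
      using bounded_fieldD(1)[OF R] Q by measurable
    then show ?thesis by (simp add: case_prod_unfold)
  qed
  have IQ: "(\<lambda>(\<omega>, t). IQ n \<omega> t) \<in> borel_measurable P" for n
    unfolding IQ_def by (rule predictable_\<phi>_nn_integral[OF RQ])
  have Rh: "(\<lambda>(\<omega>, t). intensity (\<lambda>\<omega> t y. R \<omega> t y * h n \<omega> t y) \<omega> t) \<in> borel_measurable P" for n
    by (intro intensity_predictable bounded_fieldD(1)[OF bounded_field_mult[OF R h]])
  have IQ_eq: "time_integral (IQ n) \<omega> T = ennreal (real n) * time_integral (intensity (\<lambda>\<omega> t y. R \<omega> t y * h n \<omega> t y)) \<omega> T" for n \<omega>
    unfolding time_integral_cmult[OF Rh, symmetric]
  proof (rule time_integral_cong)
    fix t :: real assume good: "good \<omega>" and t: "0 < t"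
    have [measurable]: "R \<omega> t \<in> borel_measurable (\<phi> \<omega> t)" "h n \<omega> t \<in> borel_measurable (\<phi> \<omega> t)"
      using t by (auto intro!: field_section_measurable[OF bounded_fieldD(1)[OF R]]
          field_section_measurable[OF bounded_fieldD(1)[OF h]] good_space[OF good])
    show "IQ n \<omega> t = ennreal (real n) * intensity (\<lambda>\<omega> t y. R \<omega> t y * h n \<omega> t y) \<omega> t"
      unfolding IQ_def intensity_def Qh using bounded_fieldD(2)[OF R] bounded_fieldD(2)[OF h]
      by (simp add: nn_integral_cmult[symmetric] ennreal_mult ac_simps)
  qed
  note [measurable] = stoch_exp_measurable[OF R T]
  have step: "(\<integral>\<^sup>+\<omega>. ennreal (stoch_exp R \<omega> T) * jump_sum (Q n) \<omega> T \<partial>M) =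
      (\<integral>\<^sup>+\<omega>. ennreal (stoch_exp R \<omega> T) * time_integral (IQ n) \<omega> T \<partial>M)" for n
  proof -
    have Q_eq: "jump_sum (Q n) \<omega> T = ennreal (real n) * jump_sum (\<lambda>\<omega> t y. ennreal (h n \<omega> t y)) \<omega> T" for \<omega>
      unfolding jump_sum_cmult[symmetric] Qh[abs_def] ..
    have [measurable]: "(\<lambda>\<omega>. jump_sum (\<lambda>\<omega> t y. ennreal (h n \<omega> t y)) \<omega> T) \<in> borel_measurable M"
      by (intro jump_sum_measurable[OF field_compose[OF bounded_fieldD(1)[OF h] measurable_ennreal] T])
    note time_integral_measurable[OF Rh T, measurable]
    have "h n \<omega> t y \<le> exp (- A_path \<omega> t)" for \<omega> t y using h_le[of n \<omega> t y] e0(3)[of \<omega> t] by linarith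
    from girsanov_bounded[OF R h this]
    show ?thesis
      unfolding Q_eq IQ_eq by (simp add: mult.left_commute[of _ "ennreal (real n)"] nn_integral_cmult)
  qed
  have Q_inc: "incseq (\<lambda>n. Q n \<omega> t y)" for \<omega> t y
    unfolding incseq_def Q_def using e0(1)[of \<omega> t]
    by (intro allI impI min.mono order_refl ennreal_leI mult_right_mono) auto
  have Q_lim: "(\<lambda>n. Q n \<omega> t y) \<longlonglongrightarrow> H \<omega> t y" for \<omega> t y
  proof -
    have "filterlim (\<lambda>n. real n * e \<omega> t) at_top sequentially"
      by (rule filterlim_at_top_mult_tendsto_pos[OF tendsto_const e0(1) filterlim_real_sequentially])
    then have "(\<lambda>n. ennreal (real n * e \<omega> t)) \<longlonglongrightarrow> \<top>" by (simp add: ennreal_tendsto_top_eq_at_top)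
    from tendsto_min[OF tendsto_const this, of "H \<omega> t y"] show ?thesis by (simp add: Q_def min_def)
  qed
  have "(\<lambda>n. \<integral>\<^sup>+\<omega>. ennreal (stoch_exp R \<omega> T) * jump_sum (Q n) \<omega> T \<partial>M) \<longlonglongrightarrow>
      (\<integral>\<^sup>+\<omega>. ennreal (stoch_exp R \<omega> T) * jump_sum H \<omega> T \<partial>M)"
  proof (rule nn_integral_LIMSEQ)
    show "incseq (\<lambda>n \<omega>. ennreal (stoch_exp R \<omega> T) * jump_sum (Q n) \<omega> T)"
      using incseqD[OF Q_inc] by (auto simp: incseq_def le_fun_def jump_sum_def intro!: mult_left_mono sum_mono)
    show "(\<lambda>\<omega>. ennreal (stoch_exp R \<omega> T) * jump_sum (Q n) \<omega> T) \<in> borel_measurable M" for n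
      using jump_sum_measurable[OF Q T] by measurable
    show "(\<lambda>n. ennreal (stoch_exp R \<omega> T) * jump_sum (Q n) \<omega> T) \<longlonglongrightarrow> ennreal (stoch_exp R \<omega> T) * jump_sum H \<omega> T" for \<omega>
      by (intro ennreal_tendsto_cmult) (auto simp: jump_sum_def intro!: tendsto_sum Q_lim)
  qed
  moreover have "(\<lambda>n. \<integral>\<^sup>+\<omega>. ennreal (stoch_exp R \<omega> T) * time_integral (IQ n) \<omega> T \<partial>M) \<longlonglongrightarrow>
    (\<integral>\<^sup>+\<omega>. ennreal (stoch_exp R \<omega> T) * time_integral (\<lambda>\<omega> t. \<integral>\<^sup>+y. ennreal (R \<omega> t y) * H \<omega> t y \<partial>\<phi> \<omega> t) \<omega> T \<partial>M)"
  proof (rule nn_integral_LIMSEQ)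
    have inc: "IQ m \<omega> t \<le> IQ n \<omega> t" if "m \<le> n" for m n \<omega> t
      unfolding IQ_def using incseqD[OF Q_inc that] by (intro nn_integral_mono mult_left_mono) auto
    show "incseq (\<lambda>n \<omega>. ennreal (stoch_exp R \<omega> T) * time_integral (IQ n) \<omega> T)"
      using inc by (auto simp: incseq_def le_fun_def intro!: mult_left_mono time_integral_mono)
    show "(\<lambda>\<omega>. ennreal (stoch_exp R \<omega> T) * time_integral (IQ n) \<omega> T) \<in> borel_measurable M" for n
      using time_integral_measurable[OF IQ T] by measurable
    have lim: "(\<lambda>n. IQ n \<omega> t) \<longlonglongrightarrow> (\<integral>\<^sup>+y. ennreal (R \<omega> t y) * H \<omega> t y \<partial>\<phi> \<omega> t)" if "good \<omega>" "0 \<le> t" for \<omega> t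
      unfolding IQ_def
    proof (rule nn_integral_LIMSEQ)
      show "incseq (\<lambda>n y. ennreal (R \<omega> t y) * Q n \<omega> t y)"
        using incseqD[OF Q_inc] by (auto simp: incseq_def le_fun_def intro!: mult_left_mono)
      show "(\<lambda>y. ennreal (R \<omega> t y) * Q n \<omega> t y) \<in> borel_measurable (\<phi> \<omega> t)" for n
        by (rule field_section_measurable[OF RQ good_space[OF that(1)] that(2)])
      show "(\<lambda>n. ennreal (R \<omega> t y) * Q n \<omega> t y) \<longlonglongrightarrow> ennreal (R \<omega> t y) * H \<omega> t y" for y
        by (intro ennreal_tendsto_cmult Q_lim) simp
    qed
    show "(\<lambda>n. ennreal (stoch_exp R \<omega> T) * time_integral (IQ n) \<omega> T) \<longlonglongrightarrow>
      ennreal (stoch_exp R \<omega> T) * time_integral (\<lambda>\<omega> t. \<integral>\<^sup>+y. ennreal (R \<omega> t y) * H \<omega> t y \<partial>\<phi> \<omega> t) \<omega> T" for \<omega>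
      by (intro ennreal_tendsto_cmult tendsto_time_integral IQ lim) (auto simp: incseq_def inc)
  qed
  ultimately show ?thesis unfolding step by (rule LIMSEQ_unique)
qed

text \<open>\<open>girsanov\<close> for the positive and the negative part of \<open>Q\<close>, both
  covered by a sign \<open>q\<close> equal to 1 or -1. Finiteness of the right-hand sides follows
  from the bound \<open>C\<close> on \<open>R\<close>, and passes to the jump sums by the identity
  itself.\<close>

lemma girsanov_integral:
  assumes R: "bounded_field C R" and Q: "(\<lambda>((\<omega>, t), y). Q \<omega> t y) \<in> borel_measurable (P \<Otimes>\<^sub>M K)"
    and fin: "(\<integral>\<^sup>+\<omega>. ennreal (stoch_exp R \<omega> T) * time_integral (\<lambda>\<omega> t. \<integral>\<^sup>+y. ennreal \<bar>Q \<omega> t y\<bar> \<partial>\<phi> \<omega> t) \<omega> T \<partial>M) < \<infinity>"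
  shows "integrable M (\<lambda>\<omega>. stoch_exp R \<omega> T * jump_sum Q \<omega> T)"
    "integrable M (\<lambda>\<omega>. stoch_exp R \<omega> T * compensated_integral (\<lambda>\<omega> t y. R \<omega> t y * Q \<omega> t y) \<omega> T)"
    "(\<integral>\<omega>. stoch_exp R \<omega> T * jump_sum Q \<omega> T \<partial>M) =
      (\<integral>\<omega>. stoch_exp R \<omega> T * compensated_integral (\<lambda>\<omega> t y. R \<omega> t y * Q \<omega> t y) \<omega> T \<partial>M)"
proof -
  let ?L = "\<lambda>\<omega>. stoch_exp R \<omega> T"
  note [measurable] = stoch_exp_measurable[OF R T]
  have L0: "0 \<le> ?L \<omega>" for \<omega> by (rule stoch_exp_nonneg[OF R])
  define js where "js q \<omega> = ennreal (?L \<omega>) * jump_sum (\<lambda>\<omega> t y. ennreal (q * Q \<omega> t y)) \<omega> T" for q :: real and \<omega>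
  define ti where "ti q \<omega> = ennreal (?L \<omega>) * time_integral (\<lambda>\<omega> t. \<integral>\<^sup>+y. ennreal (q * (R \<omega> t y * Q \<omega> t y)) \<partial>\<phi> \<omega> t) \<omega> T" for q :: real and \<omega>
  have qQ: "(\<lambda>((\<omega>, t), y). ennreal (q * Q \<omega> t y)) \<in> borel_measurable (P \<Otimes>\<^sub>M K)" for q :: real
    by (rule field_compose[OF Q, of "\<lambda>x. ennreal (q * x)"]) measurable
  have absQ: "(\<lambda>((\<omega>, t), y). ennreal \<bar>Q \<omega> t y\<bar>) \<in> borel_measurable (P \<Otimes>\<^sub>M K)"
    by (rule field_compose[OF Q]) measurable
  have RQ: "(\<lambda>((\<omega>, t), y). ennreal (q * (R \<omega> t y * Q \<omega> t y))) \<in> borel_measurable (P \<Otimes>\<^sub>M K)" for q :: real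
  proof -
    have "(\<lambda>w. ennreal (q * ((\<lambda>((\<omega>, t), y). R \<omega> t y) w * (\<lambda>((\<omega>, t), y). Q \<omega> t y) w))) \<in> borel_measurable (P \<Otimes>\<^sub>M K)"
      using bounded_fieldD(1)[OF R] Q by measurable
    then show ?thesis by (simp add: case_prod_unfold)
  qed
  have js_m: "js q \<in> borel_measurable M" for q
    unfolding js_def[abs_def] using jump_sum_measurable[OF qQ T] by measurable
  have ti_m: "ti q \<in> borel_measurable M" for q
    unfolding ti_def[abs_def] using time_integral_measurable[OF predictable_\<phi>_nn_integral[OF RQ] T] by measurable
  have split: "ennreal (R \<omega> t y) * ennreal (q * Q \<omega> t y) = ennreal (q * (R \<omega> t y * Q \<omega> t y))" for q \<omega> t y
    using bounded_fieldD(2)[OF R, of \<omega> t y] by (simp add: ennreal_mult'[symmetric] ac_simps)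
  have eq: "(\<integral>\<^sup>+\<omega>. js q \<omega> \<partial>M) = (\<integral>\<^sup>+\<omega>. ti q \<omega> \<partial>M)" for q
    unfolding js_def ti_def using girsanov[OF R qQ, of q] by (simp only: split)
  have ti_fin: "(\<integral>\<^sup>+\<omega>. ti q \<omega> \<partial>M) < \<infinity>" if q: "\<bar>q\<bar> = 1" for q
  proof -
    have "ti q \<omega> \<le> ennreal C * (ennreal (?L \<omega>) * time_integral (\<lambda>\<omega> t. \<integral>\<^sup>+y. ennreal \<bar>Q \<omega> t y\<bar> \<partial>\<phi> \<omega> t) \<omega> T)" for \<omega>
    proof -
      have "time_integral (\<lambda>\<omega> t. \<integral>\<^sup>+y. ennreal (q * (R \<omega> t y * Q \<omega> t y)) \<partial>\<phi> \<omega> t) \<omega> T \<le>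
          time_integral (\<lambda>\<omega> t. ennreal C * (\<integral>\<^sup>+y. ennreal \<bar>Q \<omega> t y\<bar> \<partial>\<phi> \<omega> t)) \<omega> T"
      proof (rule time_integral_mono)
        fix t :: real assume good: "good \<omega>" and t: "0 < t"
        have "q * (R \<omega> t y * Q \<omega> t y) \<le> C * \<bar>Q \<omega> t y\<bar>" for y
        proof -
          have "q * (R \<omega> t y * Q \<omega> t y) \<le> \<bar>q\<bar> * (R \<omega> t y * \<bar>Q \<omega> t y\<bar>)"
            using bounded_fieldD(2)[OF R, of \<omega> t y] abs_ge_self[of "q * (R \<omega> t y * Q \<omega> t y)"] by (simp add: abs_mult)
          also have "\<dots> \<le> C * \<bar>Q \<omega> t y\<bar>" using q bounded_fieldD(3)[OF R, of \<omega> t y] by (simp add: mult_right_mono)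
          finally show ?thesis .
        qed
        then have "(\<integral>\<^sup>+y. ennreal (q * (R \<omega> t y * Q \<omega> t y)) \<partial>\<phi> \<omega> t) \<le> (\<integral>\<^sup>+y. ennreal C * ennreal \<bar>Q \<omega> t y\<bar> \<partial>\<phi> \<omega> t)"
          using C by (intro nn_integral_mono) (simp add: ennreal_mult[symmetric] ennreal_leI)
        also have "\<dots> = ennreal C * (\<integral>\<^sup>+y. ennreal \<bar>Q \<omega> t y\<bar> \<partial>\<phi> \<omega> t)"
          using t by (intro nn_integral_cmult field_section_measurable[OF absQ good_space[OF good]]) simp
        finally show "(\<integral>\<^sup>+y. ennreal (q * (R \<omega> t y * Q \<omega> t y)) \<partial>\<phi> \<omega> t) \<le> ennreal C * (\<integral>\<^sup>+y. ennreal \<bar>Q \<omega> t y\<bar> \<partial>\<phi> \<omega> t)" .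
      qed
      also have "\<dots> = ennreal C * time_integral (\<lambda>\<omega> t. \<integral>\<^sup>+y. ennreal \<bar>Q \<omega> t y\<bar> \<partial>\<phi> \<omega> t) \<omega> T"
        by (rule time_integral_cmult[OF predictable_\<phi>_nn_integral[OF absQ]])
      finally show ?thesis unfolding ti_def by (subst mult.left_commute) (rule mult_left_mono, auto)
    qed
    then have "(\<integral>\<^sup>+\<omega>. ti q \<omega> \<partial>M) \<le> (\<integral>\<^sup>+\<omega>. ennreal C * (ennreal (?L \<omega>) * time_integral (\<lambda>\<omega> t. \<integral>\<^sup>+y. ennreal \<bar>Q \<omega> t y\<bar> \<partial>\<phi> \<omega> t) \<omega> T) \<partial>M)"
      by (intro nn_integral_mono)
    also have "\<dots> = ennreal C * (\<integral>\<^sup>+\<omega>. ennreal (?L \<omega>) * time_integral (\<lambda>\<omega> t. \<integral>\<^sup>+y. ennreal \<bar>Q \<omega> t y\<bar> \<partial>\<phi> \<omega> t) \<omega> T \<partial>M)"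
      using time_integral_measurable[OF predictable_\<phi>_nn_integral[OF absQ] T] by (intro nn_integral_cmult) measurable
    also have "\<dots> < \<infinity>" using fin by (simp add: ennreal_mult_less_top)
    finally show ?thesis .
  qed
  have js_fin: "(\<integral>\<^sup>+\<omega>. js q \<omega> \<partial>M) < \<infinity>" if "\<bar>q\<bar> = 1" for q
    unfolding eq by (rule ti_fin[OF that])
  have js_eq: "(\<lambda>\<omega>. ?L \<omega> * jump_sum Q \<omega> T) = (\<lambda>\<omega>. enn2real (js 1 \<omega>) - enn2real (js (- 1) \<omega>))"
    using L0 by (simp add: js_def enn2real_mult jump_sum_eq_diff[of Q] right_diff_distrib)
  have ti_eq: "(\<lambda>\<omega>. ?L \<omega> * compensated_integral (\<lambda>\<omega> t y. R \<omega> t y * Q \<omega> t y) \<omega> T) =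
      (\<lambda>\<omega>. enn2real (ti 1 \<omega>) - enn2real (ti (- 1) \<omega>))"
    using L0 by (simp add: ti_def enn2real_mult compensated_integral_def right_diff_distrib)
  have pm: "\<bar>1::real\<bar> = 1" "\<bar>- 1::real\<bar> = 1" by auto
  note J = integral_enn2real[OF js_m js_fin] and I = integral_enn2real[OF ti_m ti_fin]
  show "integrable M (\<lambda>\<omega>. ?L \<omega> * jump_sum Q \<omega> T)"
    unfolding js_eq by (intro Bochner_Integration.integrable_diff J pm)
  show "integrable M (\<lambda>\<omega>. ?L \<omega> * compensated_integral (\<lambda>\<omega> t y. R \<omega> t y * Q \<omega> t y) \<omega> T)"
    unfolding ti_eq by (intro Bochner_Integration.integrable_diff I pm)
  show "(\<integral>\<omega>. ?L \<omega> * jump_sum Q \<omega> T \<partial>M) = (\<integral>\<omega>. ?L \<omega> * compensated_integral (\<lambda>\<omega> t y. R \<omega> t y * Q \<omega> t y) \<omega> T \<partial>M)"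
    unfolding js_eq ti_eq by (simp add: Bochner_Integration.integral_diff J I pm eq)
qed

end

section \<open>Paths of the marks and the initial value\<close>

text \<open>A function vanishing outside \<open>(0,T]\<close> meets only the finitely many jumps up
  to \<open>T\<close>, so the integral is a finite sum although the jump measure may have infinitely
  many atoms.\<close>

lemma integral_jump_measure:
  fixes f :: "real \<times> 'k \<Rightarrow> real"
  assumes "good \<omega>" "f \<in> borel_measurable (borel \<Otimes>\<^sub>M K)" "0 \<le> T" and zero: "\<And>t y. t \<notin> {0<..T} \<Longrightarrow> f (t, y) = 0"
  shows "(\<integral>x. f x \<partial>jump_measure K \<tau> \<xi> \<omega>) = (\<Sum>n\<in>jumped \<omega> T. f (jump_time n \<omega>, \<xi> n \<omega>))"
proof -
  let ?X = "{n. 1 \<le> n \<and> \<tau> n \<omega> < \<infinity>}"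
  have sub: "{n \<in> ?X. f (jump_time n \<omega>, \<xi> n \<omega>) \<noteq> 0} \<subseteq> jumped \<omega> T"
  proof
    fix n assume n: "n \<in> {n \<in> ?X. f (jump_time n \<omega>, \<xi> n \<omega>) \<noteq> 0}"
    then have "jump_time n \<omega> \<le> T" using zero by fastforce
    moreover have "\<tau> n \<omega> = ennreal (jump_time n \<omega>)" using n by simp
    ultimately have "\<tau> n \<omega> \<le> ennreal T" using ennreal_leI by metis
    then show "n \<in> jumped \<omega> T" using n by (simp add: jumps_upto_def)
  qed
  have "(\<integral>x. f x \<partial>jump_measure K \<tau> \<xi> \<omega>) = (\<integral>n. f (jump_time n \<omega>, \<xi> n \<omega>) \<partial>count_space ?X)"
    unfolding jump_measure_def
    using assms(2) by (subst integral_distr[OF jump_measure_map_measurable[OF good_space[OF assms(1)]]]) auto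
  also have "\<dots> = (\<Sum>n | n \<in> ?X \<and> f (jump_time n \<omega>, \<xi> n \<omega>) \<noteq> 0. f (jump_time n \<omega>, \<xi> n \<omega>))"
    using finite_subset[OF sub] assms(1) by (intro lebesgue_integral_count_space_finite_support) auto
  also have "\<dots> = (\<Sum>n\<in>jumped \<omega> T. f (jump_time n \<omega>, \<xi> n \<omega>))"
  proof (intro sum.mono_neutral_left)
    show "{n. n \<in> ?X \<and> f (jump_time n \<omega>, \<xi> n \<omega>) \<noteq> 0} \<subseteq> jumped \<omega> T" using sub by simp
    show "\<forall>n\<in>jumped \<omega> T - {n. n \<in> ?X \<and> f (jump_time n \<omega>, \<xi> n \<omega>) \<noteq> 0}. f (jump_time n \<omega>, \<xi> n \<omega>) = 0"
      by (auto simp: jumps_upto_def order_le_less_trans)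
  qed (use assms(1) in simp)
  finally show ?thesis .
qed

text \<open>No jump has happened at time 0, so the counting variables that generate
  \<open>F 0\<close> vanish almost surely; sets of probability 0 or 1 are closed under complements
  and countable unions.\<close>

lemma AE_F_0_trivial:
  assumes "B \<in> sets (F 0)"
  shows "(AE \<omega> in M. \<omega> \<in> B) \<or> (AE \<omega> in M. \<omega> \<notin> B)"
  using assms unfolding sets_F
proof (induction rule: sigma_sets.induct)
  case (Basic B)
  then consider (1) C B' where "B = (\<lambda>\<omega>. counting_process \<tau> \<xi> C \<omega> 0) -` B' \<inter> space M" | (2) "B \<in> null_sets M"
    by auto
  then show ?case
  proof cases
    case 1
    have "AE \<omega> in M. counting_process \<tau> \<xi> C \<omega> 0 = 0"
      using AE_good
    proof eventually_elim
      case (elim \<omega>)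
      have "n \<notin> jumped \<omega> 0" for n using jump_time_pos[OF elim, of n 0] jumped_le[of n \<omega> 0] by auto
      then have "jumped \<omega> 0 = {}" by auto
      then show ?case using counting_process_eq_sum[OF good_jump_times[OF elim], of C 0] by simp
    qed
    then have "AE \<omega> in M. \<omega> \<in> B \<longleftrightarrow> 0 \<in> B'" using AE_space by eventually_elim (auto simp: 1)
    then show ?thesis by (cases "0 \<in> B'") auto
  next
    case 2
    then show ?thesis using AE_not_in by blast
  qed
next
  case (Compl B)
  have "AE \<omega> in M. (\<omega> \<in> space M - B) = (\<omega> \<notin> B)" using AE_space by eventually_elim auto
  with Compl.IH show ?case by (auto elim: AE_mp)
next
  case (Union B)
  show ?case
  proof (cases "\<exists>i. AE \<omega> in M. \<omega> \<in> B i")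
    case True
    then obtain i where "AE \<omega> in M. \<omega> \<in> B i" by blast
    then have "AE \<omega> in M. \<omega> \<in> (\<Union>i. B i)" by eventually_elim auto
    then show ?thesis ..
  next
    case False
    then have "AE \<omega> in M. \<omega> \<notin> B i" for i using Union.IH by blast
    then have "AE \<omega> in M. \<forall>i. \<omega> \<notin> B i" by (simp add: AE_all_countable)
    then have "AE \<omega> in M. \<omega> \<notin> (\<Union>i. B i)" by eventually_elim auto
    then show ?thesis ..
  qed
qed auto

text \<open>\<open>arctan\<close> makes the variable bounded, so it has a mean \<open>a\<close>. The
  events above and below \<open>a\<close> have probability 0 or 1, and probability 1 is impossible
  because the mean would then differ from \<open>a\<close>.\<close>

lemma AE_F_0_const:
  fixes f :: "'a \<Rightarrow> real"
  assumes f: "f \<in> borel_measurable (F 0)"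
  shows "\<exists>c. AE \<omega> in M. f \<omega> = c"
proof -
  have fM[measurable]: "f \<in> borel_measurable M"
    using f sets_F_subset[of 0] by (auto simp: measurable_def)
  have "\<bar>arctan y\<bar> \<le> pi / 2" for y
    using arctan_bounded[of y] unfolding abs_le_iff by linarith
  then have int: "integrable M (\<lambda>\<omega>. arctan (f \<omega>))"
    by (intro integrable_const_bound[where B = "pi / 2"]) auto
  define a where "a = (\<integral>\<omega>. arctan (f \<omega>) \<partial>M)"
  have m: "{\<omega> \<in> space (F 0). a < arctan (f \<omega>)} \<in> sets (F 0)" "{\<omega> \<in> space (F 0). arctan (f \<omega>) < a} \<in> sets (F 0)"
    using f by measurable
  have "\<not> (AE \<omega> in M. a < arctan (f \<omega>))"
    using expectation_less[of "\<lambda>\<omega>. - arctan (f \<omega>)" "- a"] int unfolding a_def by auto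
  then have 1: "AE \<omega> in M. \<omega> \<notin> {\<omega> \<in> space (F 0). a < arctan (f \<omega>)}"
    using AE_F_0_trivial[OF m(1)] by auto
  have "\<not> (AE \<omega> in M. arctan (f \<omega>) < a)"
    using expectation_less[OF int, of a] unfolding a_def by auto
  then have 2: "AE \<omega> in M. \<omega> \<notin> {\<omega> \<in> space (F 0). arctan (f \<omega>) < a}"
    using AE_F_0_trivial[OF m(2)] by auto
  have "AE \<omega> in M. f \<omega> = tan a"
    using 1 2 AE_space
  proof eventually_elim
    case (elim \<omega>)
    then have "arctan (f \<omega>) = a" by auto
    then show ?case using tan_arctan by metis
  qed
  then show ?thesis ..
qed

section \<open>The mark process and its left limit\<close>

definition left_mark :: "'a \<Rightarrow> real \<Rightarrow> 'k" where
  "left_mark \<omega> t = (if good \<omega> then \<xi> (card (jumped_before \<omega> t)) \<omega> else \<xi>0)"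

text \<open>The index selected by the definite description is the number of earlier jumps. In this
  form the left mark can be studied as a predictable process.\<close>

lemma mark_process_left_eq:
  assumes "good \<omega>" "0 < t"
  shows "mark_process_left \<tau> \<xi> \<omega> t = left_mark \<omega> t"
proof -
  interpret jump_times "\<lambda>n. \<tau> n \<omega>" by (rule good_jump_times[OF assms(1)])
  have "n = card (jumped_before \<omega> t)" if "\<tau> n \<omega> < ennreal t" "ennreal t \<le> \<tau> (Suc n) \<omega>" for n
    using jumps_before_eq[OF that] by simp
  moreover obtain m where "\<tau> m \<omega> < ennreal t" "ennreal t \<le> \<tau> (Suc m) \<omega>"
    using bracket_left[of "ennreal t"] assms by auto
  ultimately have "(THE n. \<tau> n \<omega> < ennreal t \<and> ennreal t \<le> \<tau> (Suc n) \<omega>) = card (jumped_before \<omega> t)"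
    by (metis (mono_tags, lifting) the_equality)
  then show ?thesis using assms by (simp add: mark_process_left_def left_mark_def)
qed

lemma mark_process_eq_left:
  assumes "0 < t" "\<And>n. \<tau> n \<omega> \<noteq> ennreal t"
  shows "mark_process \<tau> \<xi> \<omega> t = mark_process_left \<tau> \<xi> \<omega> t"
proof -
  have "(\<tau> n \<omega> \<le> ennreal t \<and> ennreal t < \<tau> (Suc n) \<omega>) \<longleftrightarrow> (\<tau> n \<omega> < ennreal t \<and> ennreal t \<le> \<tau> (Suc n) \<omega>)" for n
    using assms(2)[of n] assms(2)[of "Suc n"] by (auto simp: order_le_less)
  then show ?thesis using assms(1) by (simp add: mark_process_def mark_process_left_def)
qed

text \<open>The two processes differ at positive times only at jump times, a countable set, and a
  continuous path of \<open>A\<close> charges no single point.\<close>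

lemma AE_mark_process_eq_left:
  assumes "good \<omega>"
  shows "AE t in dA A \<omega>. 0 < t \<longrightarrow> mark_process \<tau> \<xi> \<omega> t = mark_process_left \<tau> \<xi> \<omega> t"
proof -
  interpret continuous_path "dA A \<omega>" "A \<omega>" using assms by (simp add: good_def)
  let ?N = "range (\<lambda>n. jump_time n \<omega>) \<inter> {0<..}"
  have "?N \<in> null_sets (dA A \<omega>)"
  proof -
    have "(\<Union>t\<in>?N. {t}) \<in> null_sets (dA A \<omega>)"
      using emeasure_singleton by (intro null_sets_UN') (auto simp: null_sets_def)
    then show ?thesis by simp
  qed
  then have "AE t in dA A \<omega>. t \<notin> ?N" by (rule AE_not_in)
  then show ?thesis
  proof eventually_elim
    case (elim t)
    have "\<tau> n \<omega> \<noteq> ennreal t" if "0 < t" for n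
      using elim that by (auto simp: image_iff) (metis enn2real_ennreal less_imp_le)
    then show ?case using mark_process_eq_left by blast
  qed
qed

text \<open>The \<open>n\<close>-th mark is read off from a jump sum over the jumps preceded by exactly \<open>n - 1\<close> others.\<close>

lemma left_mark_predictable: "(\<lambda>(\<omega>, t). left_mark \<omega> t) \<in> P \<rightarrow>\<^sub>M K"
proof (rule measurableI)
  show "(case w of (\<omega>, t) \<Rightarrow> left_mark \<omega> t) \<in> space K" if "w \<in> space P" for w
    using that mark_in_space initial_mark(1) by (auto simp: left_mark_def good_space)
next
  fix B assume B: "B \<in> sets K"
  define N where "N w = (case w of (\<omega>, t) \<Rightarrow> if good \<omega> then real (card (jumped_before \<omega> t)) else 0)" for w
  have N[measurable]: "N \<in> borel_measurable P"
    unfolding N_def[abs_def] by (rule card_jumped_before_predictable)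
  define H where "H n \<omega> t y = (if N (\<omega>, t) = real n - 1 then indicator B y else 0 :: ennreal)" for n :: nat and \<omega> t y
  have H: "(\<lambda>((\<omega>, t), y). H n \<omega> t y) \<in> borel_measurable (P \<Otimes>\<^sub>M K)" for n
  proof -
    have "(\<lambda>w. if N (fst w) = real n - 1 then indicator B (snd w) else 0 :: ennreal) \<in> borel_measurable (P \<Otimes>\<^sub>M K)"
      using B by measurable
    then show ?thesis by (simp add: case_prod_unfold H_def cong: if_cong)
  qed
  define S where "S n w = (case w of (\<omega>, t) \<Rightarrow> if good \<omega> then \<Sum>m\<in>jumped_before \<omega> t. H n \<omega> (jump_time m \<omega>) (\<xi> m \<omega>) else 0)" for n w
  have S[measurable]: "S n \<in> borel_measurable P" for n
    unfolding S_def[abs_def] by (rule predictable_jump_sum[OF H])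
  \<comment> \<open>With no earlier jump the left mark is \<open>\<xi>0\<close>. Otherwise its index
    is the count \<open>n\<close>, and \<open>S n\<close> is nonzero exactly when the
    \<open>n\<close>-th mark lies in \<open>B\<close>.\<close>
  have "{w \<in> space P. (\<not> good (fst w) \<or> N w = 0) \<and> \<xi>0 \<in> B \<or> good (fst w) \<and> (\<exists>n\<in>{1..}. N w = real n \<and> S n w \<noteq> 0)} \<in> sets P"
    by measurable
  also have "{w \<in> space P. (\<not> good (fst w) \<or> N w = 0) \<and> \<xi>0 \<in> B \<or> good (fst w) \<and> (\<exists>n\<in>{1..}. N w = real n \<and> S n w \<noteq> 0)} =
      (\<lambda>(\<omega>, t). left_mark \<omega> t) -` B \<inter> space P"
  proof -
    have iff: "(\<not> good \<omega> \<or> N (\<omega>, t) = 0) \<and> \<xi>0 \<in> B \<or> good \<omega> \<and> (\<exists>n\<in>{1..}. N (\<omega>, t) = real n \<and> S n (\<omega>, t) \<noteq> 0) \<longleftrightarrow> left_mark \<omega> t \<in> B"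
      if \<omega>: "\<omega> \<in> space M" for \<omega> t
    proof (cases "good \<omega>")
      case good: True
      let ?n = "card (jumped_before \<omega> t)"
      have N_eq: "N (\<omega>, t) = real ?n" using good by (simp add: N_def)
      show ?thesis
      proof (cases "?n = 0")
        case True
        then show ?thesis using good initial_mark(2)[OF \<omega>] by (auto simp: N_eq left_mark_def)
      next
        case False
        have "?n \<in> {1..?n}" using False by auto
        then have n_in: "?n \<in> jumped_before \<omega> t" unfolding jumped_before_eq[OF good, symmetric] .
        have HS: "H ?n \<omega> (jump_time m \<omega>) (\<xi> m \<omega>) = (if m = ?n then indicator B (\<xi> m \<omega>) else 0)" if m: "m \<in> jumped_before \<omega> t" for m
        proof -
          have "m \<in> jumped \<omega> t" using m jumped_before_subset_jumped[of t t \<omega>] by auto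
          from card_jumped_before_jump[OF good this] have "N (\<omega>, jump_time m \<omega>) = real m - 1"
            using m good by (simp add: N_def jumps_before_def of_nat_diff)
          then show ?thesis by (auto simp: H_def)
        qed
        have "S ?n (\<omega>, t) = (\<Sum>m\<in>jumped_before \<omega> t. if m = ?n then indicator B (\<xi> m \<omega>) else 0)"
          using good HS by (auto simp: S_def intro!: sum.cong)
        also have "\<dots> = indicator B (\<xi> ?n \<omega>)" using good n_in by (simp add: sum.delta)
        finally show ?thesis using good False by (auto simp: N_eq left_mark_def indicator_def Suc_le_eq card_gt_0_iff)
      qed
    qed (simp add: left_mark_def)
    show ?thesis
    proof (rule set_eqI)
      fix w :: "'a \<times> real"
      obtain \<omega> t where w: "w = (\<omega>, t)" by (cases w)
      show "w \<in> {w \<in> space P. (\<not> good (fst w) \<or> N w = 0) \<and> \<xi>0 \<in> B \<or> good (fst w) \<and> (\<exists>n\<in>{1..}. N w = real n \<and> S n w \<noteq> 0)} \<longleftrightarrow>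
          w \<in> (\<lambda>(\<omega>, t). left_mark \<omega> t) -` B \<inter> space P"
        using iff[of \<omega> t]
        by (simp only: w mem_Collect_eq vimage_eq Int_iff fst_conv snd_conv prod.case space_P mem_Times_iff) blast
    qed
  qed
  finally show "(\<lambda>(\<omega>, t). left_mark \<omega> t) -` B \<inter> space P \<in> sets P" .
qed

section \<open>The measure \<open>dA dP\<close> and its sections\<close>

lemma dA_section_measurable_good:
  assumes B: "B \<in> sets (M \<Otimes>\<^sub>M borel)"
  shows "(\<lambda>\<omega>. if good \<omega> then emeasure (dA A \<omega>) (Pair \<omega> -` B) else 0) \<in> borel_measurable M"
proof -
  have Pair: "Pair \<omega> \<in> borel \<rightarrow>\<^sub>M M \<Otimes>\<^sub>M borel" if "good \<omega>" for \<omega> :: 'a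
    using measurable_Pair1'[OF good_space[OF that]] .
  have sect: "Pair \<omega> -` D \<in> sets borel" if "D \<in> sets (M \<Otimes>\<^sub>M (borel :: real measure))" for D and \<omega> :: 'a
    using sets_Pair1[OF that] .
  let ?G = "{a \<times> b |a b. a \<in> sets M \<and> b \<in> range (\<lambda>c::real. {..c})}"
  \<comment> \<open>\<open>dA\<close> may have infinite total mass, while the kernel lemma asks for
    finite mass. Restricted to \<open>{..real n}\<close> the mass is a value of the path of
    \<open>A\<close>; the supremum over \<open>n\<close> recovers the full section.\<close>
  have \<kappa>: "(\<lambda>\<omega>. if good \<omega> then emeasure (dA A \<omega>) (Pair \<omega> -` B \<inter> {..real n}) else 0) \<in> borel_measurable M" for n
  proof -
    define \<kappa> where "\<kappa> \<omega> = (if good \<omega> then distr (restrict_space (dA A \<omega>) {..real n}) (M \<Otimes>\<^sub>M borel) (Pair \<omega>)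
      else null_measure (M \<Otimes>\<^sub>M borel))" for \<omega>
    have em: "emeasure (\<kappa> \<omega>) D = (if good \<omega> then emeasure (dA A \<omega>) (Pair \<omega> -` D \<inter> {..real n}) else 0)"
      if D: "D \<in> sets (M \<Otimes>\<^sub>M borel)" for D \<omega>
    proof (cases "good \<omega>")
      case True
      have "Pair \<omega> \<in> restrict_space (dA A \<omega>) {..real n} \<rightarrow>\<^sub>M M \<Otimes>\<^sub>M borel"
        using Pair[OF True] by (intro measurable_restrict_space1) (subst measurable_cong_sets[OF sets_dA refl])
      then show ?thesis
        using True D sect[OF D, of \<omega>] by (simp add: \<kappa>_def emeasure_distr emeasure_restrict_space space_restrict_space)
    qed (simp add: \<kappa>_def)
    have atMost: "emeasure (dA A \<omega>) {..c} = ennreal (A_path \<omega> (max 0 c))" if good: "good \<omega>" for \<omega> c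
    proof (cases "0 \<le> c")
      case True
      then have split: "{..c} = {..0} \<union> {0<..c}" by auto
      have "emeasure (dA A \<omega>) {..c} = emeasure (dA A \<omega>) {..0} + emeasure (dA A \<omega>) {0<..c}"
        unfolding split by (subst plus_emeasure) auto
      then show ?thesis
        using True good continuous_path.emeasure_Ioc[OF good_A_path[OF good], of 0 c] continuous_path.path_0[OF good_A_path[OF good]]
        by (simp add: good_def)
    next
      case False
      then have "emeasure (dA A \<omega>) {..c} \<le> emeasure (dA A \<omega>) {..0}" by (intro emeasure_mono) auto
      then show ?thesis using False good continuous_path.path_0[OF good_A_path[OF good]] by (simp add: good_def)
    qed
    have "sets (M \<Otimes>\<^sub>M (borel :: real measure)) = sets (sigma (space M \<times> space borel) ?G)"
    proof (rule sets_pair_eq)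
      show "sets M \<subseteq> Pow (space M)" by (rule sets.space_closed)
      show "sets M = sigma_sets (space M) (sets M)" by (simp add: sets.sigma_sets_eq)
      show "countable {space M}" "{space M} \<subseteq> sets M" "\<Union>{space M} = space M" by auto
      show "range (\<lambda>c::real. {..c}) \<subseteq> Pow (space borel)" by simp
      show "sets (borel :: real measure) = sigma_sets (space borel) (range (\<lambda>c. {..c}))"
        by (simp add: borel_eq_atMost)
      show "countable (range (\<lambda>n. {..real n}))" "range (\<lambda>n. {..real n}) \<subseteq> range (\<lambda>c. {..c})" by auto
      have "\<exists>n. x \<le> real n" for x by (rule real_arch_simple)
      then show "\<Union>(range (\<lambda>n. {..real n})) = space borel" by auto
    qed
    also have "\<dots> = sigma_sets (space M \<times> space borel) ?G"
      using sets.sets_into_space[of _ M] by (intro sets_measure_of) auto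
    finally have sets: "sets (M \<Otimes>\<^sub>M (borel :: real measure)) = sigma_sets (space M \<times> UNIV) ?G" by simp
    have "(\<lambda>\<omega>. \<integral>\<^sup>+x. indicator B x \<partial>\<kappa> \<omega>) \<in> borel_measurable M"
    proof (rule finite_kernel_nn_integral_measurable[OF sets])
      show "Int_stable ?G"
      proof (rule Int_stableI, clarify)
        fix a a' and c c' :: real assume "a \<in> sets M" "a' \<in> sets M"
        then show "\<exists>aa b. a \<times> {..c} \<inter> a' \<times> {..c'} = aa \<times> b \<and> aa \<in> sets M \<and> b \<in> range (\<lambda>c. {..c})"
          by (intro exI[of _ "a \<inter> a'"] exI[of _ "{..min c c'}"]) auto
      qed
      show "?G \<subseteq> Pow (space M \<times> UNIV)" using sets.sets_into_space[of _ M] by auto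
      show "space M \<times> (UNIV :: real set) \<noteq> {}" using not_empty by auto
      show "sets (\<kappa> \<omega>) = sets (M \<Otimes>\<^sub>M borel)" for \<omega> by (simp add: \<kappa>_def)
      have total: "emeasure (\<kappa> \<omega>) (space M \<times> UNIV) = ennreal (A_path \<omega> (real n))" for \<omega>
        using em[OF sets.top, of \<omega>] atMost[of \<omega> "real n"] good_space[of \<omega>]
        by (auto simp: space_pair_measure A_path_def)
      show "emeasure (\<kappa> \<omega>) (space M \<times> UNIV) < \<infinity>" for \<omega> by (simp add: total)
      have A_path[measurable]: "(\<lambda>\<omega>. A_path \<omega> t) \<in> borel_measurable M" if "0 \<le> t" for t
        using measurable_compose[OF section_measurable_M A_path_predictable, of t] that by simp
      show "(\<lambda>\<omega>. emeasure (\<kappa> \<omega>) (space M \<times> UNIV)) \<in> borel_measurable M" unfolding total by measurable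
      show "indicator B \<in> borel_measurable (M \<Otimes>\<^sub>M borel)" using B by measurable
      fix D assume "D \<in> ?G"
      then obtain a c where D: "D = a \<times> {..c}" and a: "a \<in> sets M" by auto
      then have DS: "D \<in> sets (M \<Otimes>\<^sub>M borel)" by auto
      have "emeasure (\<kappa> \<omega>) D = indicator a \<omega> * ennreal (A_path \<omega> (max 0 (min c (real n))))" for \<omega>
      proof (cases "good \<omega>")
        case True
        have "Pair \<omega> -` D \<inter> {..real n} = (if \<omega> \<in> a then {..min c (real n)} else {})" by (auto simp: D)
        then show ?thesis using True by (simp add: em[OF DS] atMost)
      qed (simp add: em[OF DS] A_path_def)
      moreover have "(\<lambda>\<omega>. indicator a \<omega> * ennreal (A_path \<omega> (max 0 (min c (real n))))) \<in> borel_measurable M"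
        using a A_path[of "max 0 (min c (real n))"] by measurable
      ultimately show "(\<lambda>\<omega>. emeasure (\<kappa> \<omega>) D) \<in> borel_measurable M" by simp
    qed
    also have "(\<lambda>\<omega>. \<integral>\<^sup>+x. indicator B x \<partial>\<kappa> \<omega>) = (\<lambda>\<omega>. emeasure (\<kappa> \<omega>) B)"
      using B by (intro ext nn_integral_indicator) (simp add: \<kappa>_def)
    finally show ?thesis by (simp add: em[OF B])
  qed
  have "(\<lambda>\<omega>. SUP n. if good \<omega> then emeasure (dA A \<omega>) (Pair \<omega> -` B \<inter> {..real n}) else 0) \<in> borel_measurable M"
    using \<kappa> by (intro borel_measurable_SUP) auto
  also have "(\<lambda>\<omega>. SUP n. if good \<omega> then emeasure (dA A \<omega>) (Pair \<omega> -` B \<inter> {..real n}) else 0) =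
    (\<lambda>\<omega>. if good \<omega> then emeasure (dA A \<omega>) (Pair \<omega> -` B) else 0)"
  proof
    fix \<omega>
    have "(SUP n. emeasure (dA A \<omega>) (Pair \<omega> -` B \<inter> {..real n})) = emeasure (dA A \<omega>) (\<Union>n. Pair \<omega> -` B \<inter> {..real n})"
      using sect[OF B] by (intro SUP_emeasure_incseq) (auto simp: incseq_def)
    also have "(\<Union>n. Pair \<omega> -` B \<inter> {..real n}) = Pair \<omega> -` B"
      using real_arch_simple by auto
    finally show "(SUP n. if good \<omega> then emeasure (dA A \<omega>) (Pair \<omega> -` B \<inter> {..real n}) else 0) =
       (if good \<omega> then emeasure (dA A \<omega>) (Pair \<omega> -` B) else 0)" by simp
  qed
  finally show ?thesis .
qed

lemma dA_section_measurable:
  assumes B: "B \<in> sets (M \<Otimes>\<^sub>M borel)"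
  shows "(\<lambda>\<omega>. emeasure (dA A \<omega>) (Pair \<omega> -` B)) \<in> borel_measurable M"
  by (rule borel_measurable_AE_complete[OF complete_measure_axioms dA_section_measurable_good[OF B]])
    (use AE_good in \<open>auto elim: AE_mp\<close>)

text \<open>\<open>measure_of\<close> has the prescribed values only if these are countably
  additive, and is the zero measure otherwise. Additivity interchanges a sum with the expectation
  and thus rests on measurability of the sections.\<close>

lemma emeasure_dA_dP:
  assumes "B \<in> sets (M \<Otimes>\<^sub>M borel)"
  shows "emeasure (dA_dP M A) B = (\<integral>\<^sup>+\<omega>. emeasure (dA A \<omega>) (Pair \<omega> -` B) \<partial>M)"
  unfolding dA_dP_def
proof (rule emeasure_measure_of_sigma)
  show "sigma_algebra (space M \<times> UNIV) (sets (M \<Otimes>\<^sub>M (borel :: real measure)))"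
    using sets.sigma_algebra_axioms[of "M \<Otimes>\<^sub>M (borel :: real measure)"] by (simp add: space_pair_measure)
  show "positive (sets (M \<Otimes>\<^sub>M borel)) (\<lambda>B. \<integral>\<^sup>+\<omega>. emeasure (dA A \<omega>) (Pair \<omega> -` B) \<partial>M)"
    by (simp add: positive_def)
  show "countably_additive (sets (M \<Otimes>\<^sub>M borel)) (\<lambda>B. \<integral>\<^sup>+\<omega>. emeasure (dA A \<omega>) (Pair \<omega> -` B) \<partial>M)"
  proof (rule countably_additiveI)
    fix X :: "nat \<Rightarrow> ('a \<times> real) set"
    assume X: "range X \<subseteq> sets (M \<Otimes>\<^sub>M borel)" "disjoint_family X"
    have "(\<Sum>i. emeasure (dA A \<omega>) (Pair \<omega> -` X i)) = emeasure (dA A \<omega>) (\<Union>i. Pair \<omega> -` X i)" for \<omega>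
      using X sets_Pair1[of "X _" M borel \<omega>] by (intro suminf_emeasure) (auto simp: disjoint_family_on_def)
    then have "(\<integral>\<^sup>+\<omega>. emeasure (dA A \<omega>) (Pair \<omega> -` (\<Union>i. X i)) \<partial>M) = (\<integral>\<^sup>+\<omega>. (\<Sum>i. emeasure (dA A \<omega>) (Pair \<omega> -` X i)) \<partial>M)"
      by (simp add: vimage_UN)
    also have "\<dots> = (\<Sum>i. \<integral>\<^sup>+\<omega>. emeasure (dA A \<omega>) (Pair \<omega> -` X i) \<partial>M)"
      using X by (intro nn_integral_suminf dA_section_measurable) auto
    finally show "(\<Sum>i. \<integral>\<^sup>+\<omega>. emeasure (dA A \<omega>) (Pair \<omega> -` X i) \<partial>M) = (\<integral>\<^sup>+\<omega>. emeasure (dA A \<omega>) (Pair \<omega> -` (\<Union>i. X i)) \<partial>M)" by simp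
  qed
qed (fact assms)

text \<open>A null set of \<open>dA dP\<close> has null sections along almost every path. This is
  how Hypothesis (S) is read path by path.\<close>

lemma AE_dA_dP:
  assumes "AE (\<omega>, t) in dA_dP M A. Q \<omega> t"
  shows "AE \<omega> in M. AE t in dA A \<omega>. Q \<omega> t"
proof -
  have sets: "sets (dA_dP M A) = sets (M \<Otimes>\<^sub>M borel)" and space: "space (dA_dP M A) = space M \<times> UNIV"
    unfolding dA_dP_def using sets.sigma_algebra_axioms[of "M \<Otimes>\<^sub>M (borel :: real measure)"]
    by (simp_all add: space_pair_measure sigma_algebra.sets_measure_of_eq sigma_algebra.space_measure_of_eq)
  obtain N where N: "{w \<in> space (dA_dP M A). \<not> (case w of (\<omega>, t) \<Rightarrow> Q \<omega> t)} \<subseteq> N" "emeasure (dA_dP M A) N = 0" "N \<in> sets (dA_dP M A)"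
    using AE_E[OF assms] by blast
  then have "(\<integral>\<^sup>+\<omega>. emeasure (dA A \<omega>) (Pair \<omega> -` N) \<partial>M) = 0" and NS: "N \<in> sets (M \<Otimes>\<^sub>M borel)"
    using emeasure_dA_dP[of N] by (simp_all add: sets)
  then have "AE \<omega> in M. emeasure (dA A \<omega>) (Pair \<omega> -` N) = 0"
    using nn_integral_0_iff_AE[OF dA_section_measurable[OF NS]] by simp
  then show ?thesis
    using AE_space
  proof eventually_elim
    case (elim \<omega>)
    have "Pair \<omega> -` N \<in> null_sets (dA A \<omega>)" using elim sets_Pair1[OF NS, of \<omega>] by (auto simp: null_sets_def)
    then show ?case
      by (rule AE_I') (use N(1) elim(2) in \<open>auto simp: space\<close>)
  qed
qed

section \<open>Extending the control data from \<open>[0,T]\<close> to the half-line\<close>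

abbreviation P_upto :: "real \<Rightarrow> ('a \<times> real) measure" where "P_upto T \<equiv> predictable_sigma_upto M F T"

lemma stop_into_upto: "0 \<le> T \<Longrightarrow> (\<lambda>(\<omega>, t). (\<omega>, min t T)) \<in> P \<rightarrow>\<^sub>M P_upto T"
  unfolding predictable_sigma_upto_def
  by (rule measurable_restrict_space2[OF _ stop_measurable_P]) auto

lemma stopped_field:
  assumes "predictable_field M K \<tau> \<xi> T Z" "0 \<le> T"
  shows "(\<lambda>((\<omega>, t), y). Z \<omega> (min t T) y) \<in> borel_measurable (P \<Otimes>\<^sub>M K)"
proof -
  have "(\<lambda>w. ((\<lambda>(\<omega>, t). (\<omega>, min t T)) (fst w), snd w)) \<in> P \<Otimes>\<^sub>M K \<rightarrow>\<^sub>M P_upto T \<Otimes>\<^sub>M K"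
    using stop_into_upto[OF assms(2)] by measurable
  from measurable_compose[OF this assms(1)[unfolded predictable_field_def]]
  show ?thesis by (simp add: case_prod_unfold)
qed

lemma stopped_control:
  assumes "v \<in> admissible M K \<tau> \<xi> T U" "0 \<le> T"
  shows "(\<lambda>(\<omega>, t). v \<omega> (min t T)) \<in> P \<rightarrow>\<^sub>M U"
  using measurable_compose[OF stop_into_upto[OF assms(2)], of "\<lambda>(\<omega>, t). v \<omega> t" U] assms(1)
  by (simp add: case_prod_unfold admissible_def)

lemma control_in_space:
  assumes "v \<in> admissible M K \<tau> \<xi> T U" "\<omega> \<in> space M" "0 \<le> t" "t \<le> T"
  shows "v \<omega> t \<in> space U"
  using measurable_space[of "\<lambda>(\<omega>, t). v \<omega> t" "P_upto T" U "(\<omega>, t)"] assms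
  by (auto simp: admissible_def predictable_sigma_upto_def space_restrict_space)

lemma controlled_field:
  assumes r: "(\<lambda>(((\<omega>, t), y), u). r \<omega> t y u) \<in> borel_measurable ((P_upto T \<Otimes>\<^sub>M K) \<Otimes>\<^sub>M U)"
    and v: "v \<in> admissible M K \<tau> \<xi> T U" and "0 \<le> T"
  shows "(\<lambda>((\<omega>, t), y). r \<omega> (min t T) y (v \<omega> (min t T))) \<in> borel_measurable (P \<Otimes>\<^sub>M K)"
proof -
  have "(\<lambda>w. (((\<lambda>(\<omega>, t). (\<omega>, min t T)) (fst w), snd w), (\<lambda>(\<omega>, t). v \<omega> (min t T)) (fst w)))
      \<in> P \<Otimes>\<^sub>M K \<rightarrow>\<^sub>M (P_upto T \<Otimes>\<^sub>M K) \<Otimes>\<^sub>M U"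
    using stop_into_upto[OF assms(3)] stopped_control[OF v assms(3)] by measurable
  from measurable_compose[OF this r] show ?thesis by (simp add: case_prod_unfold)
qed

text \<open>The left mark is inserted because it is predictable; the current mark in general is
  not.\<close>

lemma controlled_process:
  assumes l: "(\<lambda>(((\<omega>, t), x), u). l \<omega> t x u) \<in> borel_measurable ((P_upto T \<Otimes>\<^sub>M K) \<Otimes>\<^sub>M U)"
    and v: "v \<in> admissible M K \<tau> \<xi> T U" and "0 \<le> T"
  shows "(\<lambda>(\<omega>, t). l \<omega> (min t T) (left_mark \<omega> t) (v \<omega> (min t T))) \<in> borel_measurable P"
proof -
  have "(\<lambda>w. (w, (\<lambda>(\<omega>, t). left_mark \<omega> t) w)) \<in> P \<rightarrow>\<^sub>M P \<Otimes>\<^sub>M K"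
    using left_mark_predictable by measurable
  from measurable_compose[OF this controlled_field[OF assms]] show ?thesis by (simp add: case_prod_unfold)
qed

lemma mark_process_eq:
  assumes "good \<omega>"
  shows "mark_process \<tau> \<xi> \<omega> t = \<xi> (card (jumped \<omega> t)) \<omega>"
proof -
  interpret jump_times "\<lambda>n. \<tau> n \<omega>" by (rule good_jump_times[OF assms])
  have "n = card (jumped \<omega> t)" if "\<tau> n \<omega> \<le> ennreal t" "ennreal t < \<tau> (Suc n) \<omega>" for n
    using jumps_upto_eq[OF that] by simp
  moreover obtain m where "\<tau> m \<omega> \<le> ennreal t" "ennreal t < \<tau> (Suc m) \<omega>"
    using bracket[of "ennreal t"] by auto
  ultimately have "(THE n. \<tau> n \<omega> \<le> ennreal t \<and> ennreal t < \<tau> (Suc n) \<omega>) = card (jumped \<omega> t)"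
    by (metis (mono_tags, lifting) the_equality)
  then show ?thesis by (simp add: mark_process_def)
qed

text \<open>The index of the current mark is a nondecreasing function of time, hence Borel.\<close>

lemma mark_process_path_measurable:
  assumes "good \<omega>"
  shows "mark_process \<tau> \<xi> \<omega> \<in> borel \<rightarrow>\<^sub>M K"
proof -
  have "mono (\<lambda>t. real (card (jumped \<omega> t)))"
    using assms by (auto simp: mono_def intro!: card_mono jumped_mono)
  then have "(\<lambda>t. real (card (jumped \<omega> t))) \<in> borel_measurable borel" by (rule borel_measurable_mono)
  then have "(\<lambda>t. nat \<lfloor>real (card (jumped \<omega> t))\<rfloor>) \<in> borel \<rightarrow>\<^sub>M count_space UNIV" by measurable
  then have c: "(\<lambda>t. card (jumped \<omega> t)) \<in> borel \<rightarrow>\<^sub>M count_space UNIV" by simp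
  have "(\<lambda>n. \<xi> n \<omega>) \<in> count_space UNIV \<rightarrow>\<^sub>M K" using mark_in_space[OF good_space[OF assms]] by simp
  from measurable_compose[OF c this] show ?thesis using mark_process_eq[OF assms] by (simp add: fun_eq_iff[symmetric] cong: measurable_cong)
qed

end

section \<open>The control problem\<close>

locale control_solution = compensated_mpp M K \<tau> \<xi> \<xi>0 A \<phi>
  for M :: "'a measure" and K :: "'k measure" and \<tau> \<xi> \<xi>0 A \<phi> +
  fixes U :: "'u measure" and r l :: "'a \<Rightarrow> real \<Rightarrow> 'k \<Rightarrow> 'u \<Rightarrow> real" and g :: "'a \<Rightarrow> 'k \<Rightarrow> real"
    and T C C\<^sub>l \<beta> y0 :: real and Y :: "'a \<Rightarrow> real \<Rightarrow> real" and Z :: "'a \<Rightarrow> real \<Rightarrow> 'k \<Rightarrow> real"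
    and u_star :: "'a \<Rightarrow> real \<Rightarrow> 'u"
  assumes T_pos: "0 < T"
    and hyp_C: "hypothesis_C M K \<tau> \<xi> T U r l g C C\<^sub>l"
    and exp_integrable: "(\<integral>\<^sup>+\<omega>. ennreal (exp ((3 + C ^ 4) * A \<omega> T)) \<partial>M) < \<infinity>"
    and \<beta>: "0 < \<beta>"
    and Z_field: "predictable_field M K \<tau> \<xi> T Z"
    and Z_square: "(\<integral>\<^sup>+\<omega>. (\<integral>\<^sup>+t\<in>{0<..T}. (\<integral>\<^sup>+y. ennreal (exp (\<beta> * A \<omega> t) * \<bar>Z \<omega> t y\<bar>\<^sup>2) \<partial>\<phi> \<omega> t) \<partial>dA A \<omega>) \<partial>M) < \<infinity>"
    and Y_0: "AE \<omega> in M. Y \<omega> 0 = y0"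
    and bsde: "bsde_solution M K \<tau> \<xi> A \<phi> T g (hamiltonian \<phi> U r l) Y Z"
    and minimizing: "minimizing_control M K \<tau> \<xi> A \<phi> T U r l Z u_star"
begin

lemma T_nonneg: "0 \<le> T" using T_pos by simp

lemma C_gt_1: "1 < C" and C_l_pos: "0 < C\<^sub>l"
  using hyp_C by (auto simp: hypothesis_C_def)

text \<open>Clipping to \<open>[0,C]\<close> and stopping at \<open>T\<close> turn a bound valid
  almost surely on \<open>[0,T]\<close> into one valid everywhere, as \<open>bounded_field\<close>
  demands. On regular paths and within \<open>[0,T]\<close> nothing changes.\<close>

definition rate :: "('a \<Rightarrow> real \<Rightarrow> 'u) \<Rightarrow> 'a \<Rightarrow> real \<Rightarrow> 'k \<Rightarrow> real" where
  "rate v \<omega> t y = max 0 (min C (r \<omega> (min t T) y (v \<omega> (min t T))))"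

text \<open>Clipped and stopped like \<open>rate\<close>, and evaluated at the left mark so as to be
  predictable.\<close>

definition running :: "('a \<Rightarrow> real \<Rightarrow> 'u) \<Rightarrow> 'a \<Rightarrow> real \<Rightarrow> real" where
  "running v \<omega> t = max (- C\<^sub>l) (min C\<^sub>l (l \<omega> (min t T) (left_mark \<omega> t) (v \<omega> (min t T))))"

definition Zs :: "'a \<Rightarrow> real \<Rightarrow> 'k \<Rightarrow> real" where "Zs \<omega> t y = Z \<omega> (min t T) y"

text \<open>The expression whose infimum over control values is the hamiltonian, taken along the
  control \<open>v\<close>.\<close>

definition drive :: "('a \<Rightarrow> real \<Rightarrow> 'u) \<Rightarrow> 'a \<Rightarrow> real \<Rightarrow> real" where
  "drive v \<omega> t = running v \<omega> t + (\<integral>y. Zs \<omega> t y * (rate v \<omega> t y - 1) \<partial>\<phi> \<omega> t)"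

text \<open>Measured from \<open>drive u_star\<close> and not from the hamiltonian: the latter
  agrees with it along almost every path \<open>dA\<close>-almost everywhere, but only
  \<open>drive u_star\<close> is known to be predictable.\<close>

definition gap :: "('a \<Rightarrow> real \<Rightarrow> 'u) \<Rightarrow> 'a \<Rightarrow> real \<Rightarrow> real" where
  "gap v \<omega> t = drive v \<omega> t - drive u_star \<omega> t"

definition Z_mass :: "'a \<Rightarrow> real \<Rightarrow> ennreal" where
  "Z_mass \<omega> t = (\<integral>\<^sup>+y. ennreal \<bar>Zs \<omega> t y\<bar> \<partial>\<phi> \<omega> t)"

definition regular :: "'a \<Rightarrow> bool" where
  "regular \<omega> \<longleftrightarrow> good \<omega> \<and> (\<forall>t\<in>{0..T}. \<forall>y\<in>space K. \<forall>u\<in>space U. 0 \<le> r \<omega> t y u \<and> r \<omega> t y u \<le> C) \<and>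
     (\<forall>t\<in>{0..T}. \<forall>x\<in>space K. \<forall>u\<in>space U. \<bar>l \<omega> t x u\<bar> \<le> C\<^sub>l)"

lemma AE_regular: "AE \<omega> in M. regular \<omega>"
proof -
  have "AE \<omega> in M. \<forall>t\<in>{0..T}. \<forall>y\<in>space K. \<forall>u\<in>space U. 0 \<le> r \<omega> t y u \<and> r \<omega> t y u \<le> C"
    "AE \<omega> in M. \<forall>t\<in>{0..T}. \<forall>x\<in>space K. \<forall>u\<in>space U. \<bar>l \<omega> t x u\<bar> \<le> C\<^sub>l"
    using hyp_C by (auto simp: hypothesis_C_def)
  with AE_good show ?thesis by eventually_elim (simp add: regular_def)
qed

lemma regular_good: "regular \<omega> \<Longrightarrow> good \<omega>" by (simp add: regular_def)

abbreviation "controls \<equiv> admissible M K \<tau> \<xi> T U"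

lemma u_star_admissible: "u_star \<in> controls"
  using minimizing by (simp add: minimizing_control_def)

lemma r_measurable: "(\<lambda>(((\<omega>, t), y), u). r \<omega> t y u) \<in> borel_measurable ((P_upto T \<Otimes>\<^sub>M K) \<Otimes>\<^sub>M U)"
  and l_measurable: "(\<lambda>(((\<omega>, t), x), u). l \<omega> t x u) \<in> borel_measurable ((P_upto T \<Otimes>\<^sub>M K) \<Otimes>\<^sub>M U)"
  using hyp_C by (auto simp: hypothesis_C_def)

lemma rate_bounded:
  assumes "v \<in> controls"
  shows "bounded_field C (rate v)"
  unfolding bounded_field_def
proof (intro conjI allI)
  show "(\<lambda>((\<omega>, t), y). rate v \<omega> t y) \<in> borel_measurable (P \<Otimes>\<^sub>M K)"
    unfolding rate_def
    by (rule field_compose[OF controlled_field[OF r_measurable assms T_nonneg], of "\<lambda>x. max 0 (min C x)" borel]) measurable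
qed (use C_gt_1 in \<open>auto simp: rate_def\<close>)

lemma rate_eq:
  assumes "regular \<omega>" "v \<in> controls" "0 \<le> t" "t \<le> T" "y \<in> space K"
  shows "rate v \<omega> t y = r \<omega> t y (v \<omega> t)"
proof -
  have "0 \<le> r \<omega> t y (v \<omega> t) \<and> r \<omega> t y (v \<omega> t) \<le> C"
    using assms control_in_space[OF assms(2) good_space[OF regular_good[OF assms(1)]] assms(3,4)]
    by (simp add: regular_def)
  then show ?thesis using assms(4) by (simp add: rate_def)
qed

lemma left_mark_in_space: "good \<omega> \<Longrightarrow> left_mark \<omega> t \<in> space K"
  by (simp add: left_mark_def mark_in_space good_space)

lemma running_predictable:
  assumes "v \<in> controls"
  shows "(\<lambda>(\<omega>, t). running v \<omega> t) \<in> borel_measurable P"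
  unfolding running_def
  by (rule process_compose[OF controlled_process[OF l_measurable assms T_nonneg], of "\<lambda>x. max (- C\<^sub>l) (min C\<^sub>l x)" borel]) measurable

lemma running_eq:
  assumes "regular \<omega>" "v \<in> controls" "0 \<le> t" "t \<le> T"
  shows "running v \<omega> t = l \<omega> t (left_mark \<omega> t) (v \<omega> t)"
proof -
  have "\<bar>l \<omega> t (left_mark \<omega> t) (v \<omega> t)\<bar> \<le> C\<^sub>l"
    using assms control_in_space[OF assms(2) good_space[OF regular_good[OF assms(1)]] assms(3,4)]
      left_mark_in_space[OF regular_good[OF assms(1)]] by (auto simp: regular_def)
  then show ?thesis using assms by (auto simp: running_def)
qed

lemma Zs_measurable: "(\<lambda>((\<omega>, t), y). Zs \<omega> t y) \<in> borel_measurable (P \<Otimes>\<^sub>M K)"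
  unfolding Zs_def by (rule stopped_field[OF Z_field T_nonneg])

lemma Zs_rate_measurable:
  assumes "v \<in> controls"
  shows "(\<lambda>((\<omega>, t), y). Zs \<omega> t y * (rate v \<omega> t y - 1)) \<in> borel_measurable (P \<Otimes>\<^sub>M K)"
    "(\<lambda>((\<omega>, t), y). rate v \<omega> t y * Zs \<omega> t y) \<in> borel_measurable (P \<Otimes>\<^sub>M K)"
proof -
  have "(\<lambda>w. (\<lambda>((\<omega>, t), y). Zs \<omega> t y) w * ((\<lambda>((\<omega>, t), y). rate v \<omega> t y) w - 1)) \<in> borel_measurable (P \<Otimes>\<^sub>M K)"
    "(\<lambda>w. (\<lambda>((\<omega>, t), y). rate v \<omega> t y) w * (\<lambda>((\<omega>, t), y). Zs \<omega> t y) w) \<in> borel_measurable (P \<Otimes>\<^sub>M K)"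
    using Zs_measurable bounded_fieldD(1)[OF rate_bounded[OF assms]] by measurable
  then show "(\<lambda>((\<omega>, t), y). Zs \<omega> t y * (rate v \<omega> t y - 1)) \<in> borel_measurable (P \<Otimes>\<^sub>M K)"
    "(\<lambda>((\<omega>, t), y). rate v \<omega> t y * Zs \<omega> t y) \<in> borel_measurable (P \<Otimes>\<^sub>M K)"
    by (simp_all add: case_prod_unfold)
qed

lemma drive_predictable:
  assumes "v \<in> controls"
  shows "(\<lambda>(\<omega>, t). drive v \<omega> t) \<in> borel_measurable P"
proof -
  have "(\<lambda>w. (\<lambda>(\<omega>, t). running v \<omega> t) w + (\<lambda>(\<omega>, t). \<integral>y. Zs \<omega> t y * (rate v \<omega> t y - 1) \<partial>\<phi> \<omega> t) w) \<in> borel_measurable P"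
    using running_predictable[OF assms] predictable_\<phi>_integral[OF Zs_rate_measurable(1)[OF assms]] by measurable
  then show ?thesis by (simp add: case_prod_unfold drive_def)
qed

lemma gap_predictable:
  assumes "v \<in> controls"
  shows "(\<lambda>(\<omega>, t). gap v \<omega> t) \<in> borel_measurable P"
proof -
  have "(\<lambda>w. (\<lambda>(\<omega>, t). drive v \<omega> t) w - (\<lambda>(\<omega>, t). drive u_star \<omega> t) w) \<in> borel_measurable P"
    using drive_predictable[OF assms] drive_predictable[OF u_star_admissible] by measurable
  then show ?thesis by (simp add: case_prod_unfold gap_def)
qed

section \<open>Integrability of \<open>Z\<close> and of the drive, uniformly in the control\<close>

lemma abs_Zs_measurable: "(\<lambda>((\<omega>, t), y). ennreal \<bar>Zs \<omega> t y\<bar>) \<in> borel_measurable (P \<Otimes>\<^sub>M K)"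
  by (rule field_compose[OF Zs_measurable, of "\<lambda>x. ennreal \<bar>x\<bar>" borel]) measurable

lemma Z_mass_predictable: "(\<lambda>(\<omega>, t). Z_mass \<omega> t) \<in> borel_measurable P"
  unfolding Z_mass_def by (rule predictable_\<phi>_nn_integral[OF abs_Zs_measurable])

text \<open>With \<open>a = e\<^sup>\<beta>\<^sup>A\<^sup>/\<^sup>2|Z|\<close> and \<open>b = d e\<^sup>-\<^sup>\<beta>\<^sup>A\<^sup>/\<^sup>2\<close>, this is \<open>ab \<le> a\<^sup>2 + b\<^sup>2\<close> integrated; \<open>\<integral>e\<^sup>-\<^sup>\<beta>\<^sup>A dA \<le> 1/\<beta>\<close>.\<close>

lemma Z_mass_dominated:
  "(\<integral>\<^sup>+\<omega>. ennreal (dominating C T \<omega>) * time_integral Z_mass \<omega> T \<partial>M) < \<infinity>"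
proof -
  define sq where "sq \<omega> t y = exp (\<beta> * A_path \<omega> t) * (Zs \<omega> t y)\<^sup>2" for \<omega> t y
  have sq: "(\<lambda>((\<omega>, t), y). ennreal (sq \<omega> t y)) \<in> borel_measurable (P \<Otimes>\<^sub>M K)"
  proof -
    have "(\<lambda>w. ennreal (exp (\<beta> * (\<lambda>((\<omega>, t), y). A_path \<omega> t) w) * ((\<lambda>((\<omega>, t), y). Zs \<omega> t y) w)\<^sup>2)) \<in> borel_measurable (P \<Otimes>\<^sub>M K)"
      using process_field[OF A_path_predictable] Zs_measurable by measurable
    then show ?thesis by (simp add: case_prod_unfold sq_def)
  qed
  note sq_p = predictable_\<phi>_nn_integral[OF sq]
  have ex: "(\<lambda>(\<omega>, t). ennreal (exp (- \<beta> * A_path \<omega> t))) \<in> borel_measurable P"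
    by (rule process_compose[OF A_path_predictable, of "\<lambda>x. ennreal (exp (- \<beta> * x))" borel]) measurable
  let ?S = "\<lambda>\<omega>. time_integral (\<lambda>\<omega> t. \<integral>\<^sup>+y. ennreal (sq \<omega> t y) \<partial>\<phi> \<omega> t) \<omega> T"
  have S_m: "?S \<in> borel_measurable M" by (rule time_integral_measurable[OF sq_p T_nonneg])
  have d_m: "(\<lambda>\<omega>. dominating C T \<omega>) \<in> borel_measurable M"
    by (rule dominating_measurable[OF C_gt_1 T_nonneg exp_integrable])
  have "(\<integral>\<^sup>+\<omega>. ennreal (dominating C T \<omega>) * time_integral Z_mass \<omega> T \<partial>M) \<le>
      (\<integral>\<^sup>+\<omega>. ?S \<omega> + ennreal ((dominating C T \<omega>)\<^sup>2) * ennreal (1 / \<beta>) \<partial>M)"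
  proof (rule nn_integral_mono_AE, rule AE_mp[OF AE_good], rule AE_I2, rule impI)
    fix \<omega> assume good: "good \<omega>"
    define d where "d = dominating C T \<omega>"
    have d1: "1 \<le> d" unfolding d_def by (rule dominating_ge(3)[OF C_gt_1 T_nonneg exp_integrable good])
    have "ennreal d * time_integral Z_mass \<omega> T = time_integral (\<lambda>\<omega> t. ennreal d * Z_mass \<omega> t) \<omega> T"
      by (rule time_integral_cmult[OF Z_mass_predictable, symmetric])
    also have "\<dots> \<le> time_integral (\<lambda>\<omega> t. (\<integral>\<^sup>+y. ennreal (sq \<omega> t y) \<partial>\<phi> \<omega> t) + ennreal (d\<^sup>2) * ennreal (exp (- \<beta> * A_path \<omega> t))) \<omega> T"
    proof (rule time_integral_mono)
      fix t :: real assume t: "0 < t"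
      define x where "x = exp (\<beta> * A_path \<omega> t / 2)"
      have x: "0 < x" "x\<^sup>2 = exp (\<beta> * A_path \<omega> t)" by (auto simp: x_def exp_double[symmetric])
      have xi: "(1 / x)\<^sup>2 = exp (- \<beta> * A_path \<omega> t)"
        by (simp add: x_def exp_double[symmetric] exp_minus power_divide inverse_eq_divide)
      have pt: "d * \<bar>z\<bar> \<le> exp (\<beta> * A_path \<omega> t) * z\<^sup>2 + d\<^sup>2 * exp (- \<beta> * A_path \<omega> t)" for z :: real
      proof -
        have "0 \<le> (x * \<bar>z\<bar> - d * (1 / x))\<^sup>2" by simp
        also have "\<dots> = x\<^sup>2 * z\<^sup>2 - 2 * (d * \<bar>z\<bar>) + d\<^sup>2 * (1 / x)\<^sup>2"
          using x(1) by (simp add: power2_diff power_mult_distrib power_divide)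
        finally have "2 * (d * \<bar>z\<bar>) \<le> exp (\<beta> * A_path \<omega> t) * z\<^sup>2 + d\<^sup>2 * exp (- \<beta> * A_path \<omega> t)"
          unfolding x(2) xi by linarith
        moreover have "0 \<le> d * \<bar>z\<bar>" using d1 by simp
        ultimately show ?thesis by linarith
      qed
      note space = good_space[OF good]
      have "ennreal d * Z_mass \<omega> t = (\<integral>\<^sup>+y. ennreal d * ennreal \<bar>Zs \<omega> t y\<bar> \<partial>\<phi> \<omega> t)"
        unfolding Z_mass_def using t
        by (intro nn_integral_cmult[symmetric] field_section_measurable[OF abs_Zs_measurable space]) simp
      also have "\<dots> \<le> (\<integral>\<^sup>+y. ennreal (sq \<omega> t y) + ennreal (d\<^sup>2) * ennreal (exp (- \<beta> * A_path \<omega> t)) \<partial>\<phi> \<omega> t)"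
      proof (rule nn_integral_mono)
        fix y
        have "ennreal d * ennreal \<bar>Zs \<omega> t y\<bar> = ennreal (d * \<bar>Zs \<omega> t y\<bar>)" using d1 by (simp add: ennreal_mult)
        also have "\<dots> \<le> ennreal (sq \<omega> t y + d\<^sup>2 * exp (- \<beta> * A_path \<omega> t))"
          unfolding sq_def by (rule ennreal_leI[OF pt])
        also have "\<dots> = ennreal (sq \<omega> t y) + ennreal (d\<^sup>2) * ennreal (exp (- \<beta> * A_path \<omega> t))"
          by (simp add: sq_def ennreal_mult)
        finally show "ennreal d * ennreal \<bar>Zs \<omega> t y\<bar> \<le> ennreal (sq \<omega> t y) + ennreal (d\<^sup>2) * ennreal (exp (- \<beta> * A_path \<omega> t))" .
      qed
      also have "\<dots> = (\<integral>\<^sup>+y. ennreal (sq \<omega> t y) \<partial>\<phi> \<omega> t) + ennreal (d\<^sup>2) * ennreal (exp (- \<beta> * A_path \<omega> t))"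
        using t field_section_measurable[OF sq space, of t] nn_integral_\<phi>_const[OF space, of t]
        by (subst nn_integral_add) auto
      finally show "ennreal d * Z_mass \<omega> t \<le> (\<integral>\<^sup>+y. ennreal (sq \<omega> t y) \<partial>\<phi> \<omega> t) + ennreal (d\<^sup>2) * ennreal (exp (- \<beta> * A_path \<omega> t))" .
    qed
    also have "\<dots> = ?S \<omega> + ennreal (d\<^sup>2) * time_integral (\<lambda>\<omega> t. ennreal (exp (- \<beta> * A_path \<omega> t))) \<omega> T"
      by (rule time_integral_add_cmult[OF sq_p ex])
    also have "\<dots> \<le> ?S \<omega> + ennreal (d\<^sup>2) * ennreal (1 / \<beta>)"
      using continuous_path.nn_integral_exp_uminus_le[OF good_A_path[OF good] \<beta> T_nonneg] good
      by (intro add_left_mono mult_left_mono) (auto simp: time_integral_def)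
    finally show "ennreal (dominating C T \<omega>) * time_integral Z_mass \<omega> T \<le> ?S \<omega> + ennreal ((dominating C T \<omega>)\<^sup>2) * ennreal (1 / \<beta>)"
      by (simp add: d_def)
  qed
  also have "\<dots> = (\<integral>\<^sup>+\<omega>. ?S \<omega> \<partial>M) + (\<integral>\<^sup>+\<omega>. ennreal ((dominating C T \<omega>)\<^sup>2) \<partial>M) * ennreal (1 / \<beta>)"
    using S_m d_m by (simp add: nn_integral_add nn_integral_multc)
  also have "(\<integral>\<^sup>+\<omega>. ?S \<omega> \<partial>M) = (\<integral>\<^sup>+\<omega>. (\<integral>\<^sup>+t\<in>{0<..T}. (\<integral>\<^sup>+y. ennreal (exp (\<beta> * A \<omega> t) * \<bar>Z \<omega> t y\<bar>\<^sup>2) \<partial>\<phi> \<omega> t) \<partial>dA A \<omega>) \<partial>M)"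
    by (rule nn_integral_cong_AE, rule AE_mp[OF AE_good], rule AE_I2)
       (auto simp: time_integral_def sq_def A_path_def Zs_def indicator_def intro!: nn_integral_cong)
  also have "\<dots> + (\<integral>\<^sup>+\<omega>. ennreal ((dominating C T \<omega>)\<^sup>2) \<partial>M) * ennreal (1 / \<beta>) < \<infinity>"
    using Z_square dominating_square_finite[OF C_gt_1 T_nonneg exp_integrable]
    by (simp add: ennreal_add_less_top ennreal_mult_less_top)
  finally show ?thesis .
qed

text \<open>\<open>dominating\<close> is at least 1 on good paths, so finiteness of its product with
  the integral passes to the integral.\<close>

lemma AE_Z_mass_finite: "AE \<omega> in M. time_integral Z_mass \<omega> T < \<infinity>"
proof -
  have "AE \<omega> in M. ennreal (dominating C T \<omega>) * time_integral Z_mass \<omega> T \<noteq> \<infinity>"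
    using Z_mass_dominated dominating_measurable[OF C_gt_1 T_nonneg exp_integrable]
      time_integral_measurable[OF Z_mass_predictable T_nonneg]
    by (intro nn_integral_PInf_AE) (measurable, auto)
  with AE_good show ?thesis
  proof eventually_elim
    case (elim \<omega>)
    have "ennreal (dominating C T \<omega>) \<noteq> 0"
      using dominating_ge(3)[OF C_gt_1 T_nonneg exp_integrable elim(1)] by (simp add: ennreal_eq_0_iff)
    with elim(2) show ?case by (auto simp: ennreal_mult_eq_top_iff less_top)
  qed
qed

lemma abs_drive_le:
  assumes v: "v \<in> controls" and "\<omega> \<in> space M" "0 \<le> t"
  shows "ennreal \<bar>drive v \<omega> t\<bar> \<le> ennreal C\<^sub>l + ennreal (C + 1) * Z_mass \<omega> t"
proof -
  have "ennreal \<bar>\<integral>y. Zs \<omega> t y * (rate v \<omega> t y - 1) \<partial>\<phi> \<omega> t\<bar> \<le> (\<integral>\<^sup>+y. ennreal \<bar>Zs \<omega> t y * (rate v \<omega> t y - 1)\<bar> \<partial>\<phi> \<omega> t)"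
  \<comment> \<open>Where the integrand is not integrable, the Bochner integral is 0 by default and
    the inequality is trivial; so the bound holds at every time.\<close>
  proof (cases "integrable (\<phi> \<omega> t) (\<lambda>y. Zs \<omega> t y * (rate v \<omega> t y - 1))")
    case True
    then show ?thesis using integral_norm_bound_ennreal[OF True] by simp
  qed (simp add: not_integrable_integral_eq)
  also have "\<dots> \<le> (\<integral>\<^sup>+y. ennreal (C + 1) * ennreal \<bar>Zs \<omega> t y\<bar> \<partial>\<phi> \<omega> t)"
  proof (rule nn_integral_mono)
    fix y
    have "\<bar>rate v \<omega> t y - 1\<bar> \<le> C + 1" using bounded_fieldD(2,3)[OF rate_bounded[OF v], of \<omega> t y] by auto
    then have "\<bar>Zs \<omega> t y * (rate v \<omega> t y - 1)\<bar> \<le> (C + 1) * \<bar>Zs \<omega> t y\<bar>"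
      by (simp add: abs_mult mult.commute[of "\<bar>Zs \<omega> t y\<bar>"] mult_right_mono)
    then show "ennreal \<bar>Zs \<omega> t y * (rate v \<omega> t y - 1)\<bar> \<le> ennreal (C + 1) * ennreal \<bar>Zs \<omega> t y\<bar>"
      using C_gt_1 by (subst ennreal_mult[symmetric]) (auto intro!: ennreal_leI)
  qed
  also have "\<dots> = ennreal (C + 1) * Z_mass \<omega> t"
    unfolding Z_mass_def using assms
    by (intro nn_integral_cmult field_section_measurable[OF abs_Zs_measurable])
  finally have I: "ennreal \<bar>\<integral>y. Zs \<omega> t y * (rate v \<omega> t y - 1) \<partial>\<phi> \<omega> t\<bar> \<le> ennreal (C + 1) * Z_mass \<omega> t" .
  have "\<bar>running v \<omega> t\<bar> \<le> C\<^sub>l" using C_l_pos by (auto simp: running_def)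
  then have "\<bar>drive v \<omega> t\<bar> \<le> C\<^sub>l + \<bar>\<integral>y. Zs \<omega> t y * (rate v \<omega> t y - 1) \<partial>\<phi> \<omega> t\<bar>"
    unfolding drive_def by linarith
  then have "ennreal \<bar>drive v \<omega> t\<bar> \<le> ennreal (C\<^sub>l + \<bar>\<integral>y. Zs \<omega> t y * (rate v \<omega> t y - 1) \<partial>\<phi> \<omega> t\<bar>)" by (rule ennreal_leI)
  also have "\<dots> = ennreal C\<^sub>l + ennreal \<bar>\<integral>y. Zs \<omega> t y * (rate v \<omega> t y - 1) \<partial>\<phi> \<omega> t\<bar>"
    using C_l_pos by (simp add: ennreal_plus)
  finally show ?thesis using I by (meson add_left_mono order_trans)
qed

lemma drive_integral_le:
  assumes v: "v \<in> controls" and good: "good \<omega>"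
  shows "time_integral (\<lambda>\<omega> t. ennreal \<bar>drive v \<omega> t\<bar>) \<omega> T \<le>
    ennreal C\<^sub>l * ennreal (A \<omega> T) + ennreal (C + 1) * time_integral Z_mass \<omega> T"
proof -
  have "time_integral (\<lambda>\<omega> t. ennreal \<bar>drive v \<omega> t\<bar>) \<omega> T \<le> time_integral (\<lambda>\<omega> t. ennreal C\<^sub>l + ennreal (C + 1) * Z_mass \<omega> t) \<omega> T"
    using abs_drive_le[OF v good_space[OF good]] by (intro time_integral_mono) auto
  also have "\<dots> = time_integral (\<lambda>\<omega> t. ennreal C\<^sub>l) \<omega> T + ennreal (C + 1) * time_integral Z_mass \<omega> T"
    by (intro time_integral_add_cmult Z_mass_predictable) (simp add: case_prod_unfold)
  finally show ?thesis by (simp add: time_integral_const[OF good T_nonneg])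
qed

lemma gap_integral_le:
  assumes v: "v \<in> controls" and good: "good \<omega>"
  shows "time_integral (\<lambda>\<omega> t. ennreal \<bar>gap v \<omega> t\<bar>) \<omega> T \<le>
    2 * (ennreal C\<^sub>l * ennreal (A \<omega> T) + ennreal (C + 1) * time_integral Z_mass \<omega> T)"
proof -
  have m: "(\<lambda>(\<omega>, t). ennreal \<bar>drive w \<omega> t\<bar>) \<in> borel_measurable P" if "w \<in> controls" for w
    by (rule process_compose[OF drive_predictable[OF that], of "\<lambda>x. ennreal \<bar>x\<bar>" borel]) measurable
  have "time_integral (\<lambda>\<omega> t. ennreal \<bar>gap v \<omega> t\<bar>) \<omega> T \<le>
      time_integral (\<lambda>\<omega> t. ennreal \<bar>drive v \<omega> t\<bar> + 1 * ennreal \<bar>drive u_star \<omega> t\<bar>) \<omega> T"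
  proof (rule time_integral_mono)
    fix t :: real
    have "\<bar>gap v \<omega> t\<bar> \<le> \<bar>drive v \<omega> t\<bar> + \<bar>drive u_star \<omega> t\<bar>" by (simp add: gap_def abs_triangle_ineq4)
    then show "ennreal \<bar>gap v \<omega> t\<bar> \<le> ennreal \<bar>drive v \<omega> t\<bar> + 1 * ennreal \<bar>drive u_star \<omega> t\<bar>"
      by (simp add: ennreal_plus[symmetric] ennreal_leI del: ennreal_plus)
  qed
  also have "\<dots> = time_integral (\<lambda>\<omega> t. ennreal \<bar>drive v \<omega> t\<bar>) \<omega> T + 1 * time_integral (\<lambda>\<omega> t. ennreal \<bar>drive u_star \<omega> t\<bar>) \<omega> T"
    by (rule time_integral_add_cmult[OF m[OF v] m[OF u_star_admissible]])
  also have "\<dots> \<le> 2 * (ennreal C\<^sub>l * ennreal (A \<omega> T) + ennreal (C + 1) * time_integral Z_mass \<omega> T)"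
    unfolding mult_2 mult_1 by (intro add_mono drive_integral_le[OF _ good] v u_star_admissible)
  finally show ?thesis .
qed

lemma stoch_exp_le:
  assumes "v \<in> controls" "good \<omega>"
  shows "stoch_exp (rate v) \<omega> T \<le> dominating C T \<omega>"
  using stoch_exp_le_dominating(2)[OF rate_bounded[OF assms(1)] _ assms(2) T_nonneg order_refl] C_gt_1 by simp

text \<open>\<open>dominating\<close> majorizes the density and, through \<open>exp A\<close>, also
  \<open>A\<close>. The gap integral weighted by the density is thus bounded by the square of
  \<open>dominating\<close> and by \<open>dominating\<close> times the mass of \<open>Z\<close>,
  both of finite mean. The bound is the same for every control.\<close>

lemma gap_dominated:
  assumes v: "v \<in> controls"
  shows "(\<integral>\<^sup>+\<omega>. ennreal (stoch_exp (rate v) \<omega> T) * time_integral (\<lambda>\<omega> t. ennreal \<bar>gap v \<omega> t\<bar>) \<omega> T \<partial>M) < \<infinity>"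
proof -
  let ?d = "dominating C T"
  have d_m[measurable]: "(\<lambda>\<omega>. ?d \<omega>) \<in> borel_measurable M"
    by (rule dominating_measurable[OF C_gt_1 T_nonneg exp_integrable])
  note [measurable] = time_integral_measurable[OF Z_mass_predictable T_nonneg]
  have "(\<integral>\<^sup>+\<omega>. ennreal (stoch_exp (rate v) \<omega> T) * time_integral (\<lambda>\<omega> t. ennreal \<bar>gap v \<omega> t\<bar>) \<omega> T \<partial>M) \<le>
    (\<integral>\<^sup>+\<omega>. (2 * ennreal C\<^sub>l) * ennreal ((?d \<omega>)\<^sup>2) + (2 * ennreal (C + 1)) * (ennreal (?d \<omega>) * time_integral Z_mass \<omega> T) \<partial>M)"
  proof (rule nn_integral_mono_AE, rule AE_mp[OF AE_good], rule AE_I2, rule impI)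
    fix \<omega> assume good: "good \<omega>"
    have d1: "1 \<le> ?d \<omega>" by (rule dominating_ge(3)[OF C_gt_1 T_nonneg exp_integrable good])
    have "A \<omega> T \<le> ?d \<omega>"
      using dominating_ge(1)[OF C_gt_1 T_nonneg exp_integrable good] exp_ge_add_one_self[of "A \<omega> T"] by linarith
    then have A: "ennreal (A \<omega> T) \<le> ennreal (?d \<omega>)" by (rule ennreal_leI)
    have "ennreal (stoch_exp (rate v) \<omega> T) * time_integral (\<lambda>\<omega> t. ennreal \<bar>gap v \<omega> t\<bar>) \<omega> T \<le>
      ennreal (?d \<omega>) * (2 * (ennreal C\<^sub>l * ennreal (A \<omega> T) + ennreal (C + 1) * time_integral Z_mass \<omega> T))"
      by (intro mult_mono ennreal_leI stoch_exp_le v good gap_integral_le) auto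
    also have "\<dots> \<le> ennreal (?d \<omega>) * (2 * (ennreal C\<^sub>l * ennreal (?d \<omega>) + ennreal (C + 1) * time_integral Z_mass \<omega> T))"
      using A by (intro mult_left_mono add_right_mono) auto
    also have "\<dots> = (2 * ennreal C\<^sub>l) * (ennreal (?d \<omega>) * ennreal (?d \<omega>)) + (2 * ennreal (C + 1)) * (ennreal (?d \<omega>) * time_integral Z_mass \<omega> T)"
      by (simp add: distrib_left ac_simps)
    also have "ennreal (?d \<omega>) * ennreal (?d \<omega>) = ennreal ((?d \<omega>)\<^sup>2)"
      using d1 by (simp add: ennreal_mult[symmetric] power2_eq_square)
    finally show "ennreal (stoch_exp (rate v) \<omega> T) * time_integral (\<lambda>\<omega> t. ennreal \<bar>gap v \<omega> t\<bar>) \<omega> T \<le>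
      (2 * ennreal C\<^sub>l) * ennreal ((?d \<omega>)\<^sup>2) + (2 * ennreal (C + 1)) * (ennreal (?d \<omega>) * time_integral Z_mass \<omega> T)" .
  qed
  also have "\<dots> = (2 * ennreal C\<^sub>l) * (\<integral>\<^sup>+\<omega>. ennreal ((?d \<omega>)\<^sup>2) \<partial>M) +
      (2 * ennreal (C + 1)) * (\<integral>\<^sup>+\<omega>. ennreal (?d \<omega>) * time_integral Z_mass \<omega> T \<partial>M)"
    by (simp add: nn_integral_add nn_integral_cmult)
  also have "\<dots> < \<infinity>"
    using dominating_square_finite[OF C_gt_1 T_nonneg exp_integrable] Z_mass_dominated
    by (simp add: ennreal_add_less_top ennreal_mult_less_top)
  finally show ?thesis .
qed

lemma Z_girsanov_finite:
  assumes v: "v \<in> controls"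
  shows "(\<integral>\<^sup>+\<omega>. ennreal (stoch_exp (rate v) \<omega> T) * time_integral (\<lambda>\<omega> t. \<integral>\<^sup>+y. ennreal \<bar>Zs \<omega> t y\<bar> \<partial>\<phi> \<omega> t) \<omega> T \<partial>M) < \<infinity>"
proof -
  have "(\<integral>\<^sup>+\<omega>. ennreal (stoch_exp (rate v) \<omega> T) * time_integral (\<lambda>\<omega> t. \<integral>\<^sup>+y. ennreal \<bar>Zs \<omega> t y\<bar> \<partial>\<phi> \<omega> t) \<omega> T \<partial>M) \<le>
      (\<integral>\<^sup>+\<omega>. ennreal (dominating C T \<omega>) * time_integral Z_mass \<omega> T \<partial>M)"
    unfolding Z_mass_def[abs_def, symmetric]
    by (rule nn_integral_mono_AE, rule AE_mp[OF AE_good], rule AE_I2)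
       (auto intro!: mult_right_mono ennreal_leI stoch_exp_le v)
  then show ?thesis using Z_mass_dominated by (rule order_le_less_trans)
qed

lemma drive_eq:
  assumes \<omega>: "regular \<omega>" and v: "v \<in> controls" and s: "0 < s" "s \<le> T"
  shows "drive v \<omega> s = l \<omega> s (left_mark \<omega> s) (v \<omega> s) + (\<integral>y. Z \<omega> s y * (r \<omega> s y (v \<omega> s) - 1) \<partial>\<phi> \<omega> s)"
proof -
  have "space (\<phi> \<omega> s) = space K"
    using \<phi>_sets[OF good_space[OF regular_good[OF \<omega>]], of s] s by (intro sets_eq_imp_space_eq) simp
  then have "(\<integral>y. Zs \<omega> s y * (rate v \<omega> s y - 1) \<partial>\<phi> \<omega> s) = (\<integral>y. Z \<omega> s y * (r \<omega> s y (v \<omega> s) - 1) \<partial>\<phi> \<omega> s)"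
    using rate_eq[OF \<omega> v, of s] s by (intro Bochner_Integration.integral_cong refl) (simp add: Zs_def)
  then show ?thesis using running_eq[OF \<omega> v, of s] s by (simp add: drive_def)
qed

text \<open>A real infimum is below each value only if the set is bounded below. Integrability of
  \<open>Z\<close> over the marks provides this: the bracket is at least \<open>- C\<^sub>l\<close>
  minus \<open>C + 1\<close> times the integral of the absolute value of \<open>Z\<close>, for every
  control value.\<close>

lemma hamiltonian_le_drive:
  assumes \<omega>: "regular \<omega>" and v: "v \<in> controls" and s: "0 < s" "s \<le> T"
    and int: "integrable (\<phi> \<omega> s) (Zs \<omega> s)"
  shows "hamiltonian \<phi> U r l \<omega> s (left_mark \<omega> s) (Z \<omega> s) \<le> drive v \<omega> s"
proof -
  have space: "space (\<phi> \<omega> s) = space K"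
    using \<phi>_sets[OF good_space[OF regular_good[OF \<omega>]], of s] s by (intro sets_eq_imp_space_eq) simp
  have Zs: "Zs \<omega> s y = Z \<omega> s y" for y using s by (simp add: Zs_def)
  let ?J = "\<lambda>u. l \<omega> s (left_mark \<omega> s) u + (\<integral>y. Z \<omega> s y * (r \<omega> s y u - 1) \<partial>\<phi> \<omega> s)"
  have "bdd_below (?J ` space U)"
  proof (rule bdd_belowI2)
    fix u assume u: "u \<in> space U"
    have "\<bar>\<integral>y. Z \<omega> s y * (r \<omega> s y u - 1) \<partial>\<phi> \<omega> s\<bar> \<le> (\<integral>y. (C + 1) * \<bar>Zs \<omega> s y\<bar> \<partial>\<phi> \<omega> s)"
    proof (cases "integrable (\<phi> \<omega> s) (\<lambda>y. Z \<omega> s y * (r \<omega> s y u - 1))")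
      case True
      have "\<bar>\<integral>y. Z \<omega> s y * (r \<omega> s y u - 1) \<partial>\<phi> \<omega> s\<bar> \<le> (\<integral>y. \<bar>Z \<omega> s y * (r \<omega> s y u - 1)\<bar> \<partial>\<phi> \<omega> s)"
        by (rule integral_abs_bound)
      also have "\<dots> \<le> (\<integral>y. (C + 1) * \<bar>Zs \<omega> s y\<bar> \<partial>\<phi> \<omega> s)"
      proof (rule integral_mono)
        fix y assume "y \<in> space (\<phi> \<omega> s)"
        then have "0 \<le> r \<omega> s y u \<and> r \<omega> s y u \<le> C" using \<omega> s u by (simp add: regular_def space)
        then have "\<bar>r \<omega> s y u - 1\<bar> \<le> C + 1" by auto
        then show "\<bar>Z \<omega> s y * (r \<omega> s y u - 1)\<bar> \<le> (C + 1) * \<bar>Zs \<omega> s y\<bar>"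
          by (simp add: Zs abs_mult mult.commute[of "\<bar>Z \<omega> s y\<bar>"] mult_right_mono)
      qed (use True int in auto)
      finally show ?thesis .
    next
      case False
      then show ?thesis using C_gt_1 by (simp add: not_integrable_integral_eq integral_nonneg_AE)
    qed
    moreover have "\<bar>l \<omega> s (left_mark \<omega> s) u\<bar> \<le> C\<^sub>l"
      using \<omega> s u left_mark_in_space[OF regular_good[OF \<omega>]] by (simp add: regular_def)
    ultimately show "- C\<^sub>l - (\<integral>y. (C + 1) * \<bar>Zs \<omega> s y\<bar> \<partial>\<phi> \<omega> s) \<le> ?J u" by linarith
  qed
  then have "hamiltonian \<phi> U r l \<omega> s (left_mark \<omega> s) (Z \<omega> s) \<le> ?J (v \<omega> s)"
    unfolding hamiltonian_def using control_in_space[OF v good_space[OF regular_good[OF \<omega>]], of s] s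
    by (intro cINF_lower) auto
  then show ?thesis unfolding drive_eq[OF assms(1-4)] .
qed

section \<open>Identities along one regular path\<close>

lemma AE_minimizing:
  "AE \<omega> in M. AE s in dA A \<omega>. s \<in> {0..T} \<longrightarrow>
     hamiltonian \<phi> U r l \<omega> s (mark_process_left \<tau> \<xi> \<omega> s) (Z \<omega> s) =
     l \<omega> s (mark_process_left \<tau> \<xi> \<omega> s) (u_star \<omega> s) + (\<integral>y. Z \<omega> s y * (r \<omega> s y (u_star \<omega> s) - 1) \<partial>\<phi> \<omega> s)"
  using minimizing by (intro AE_dA_dP) (simp add: minimizing_control_def)

text \<open>Gathers the almost sure statements in use, including the BSDE at time 0 only, so that
  the following lemmas concern one fixed path.\<close>

definition regular_path :: "'a \<Rightarrow> bool" where
  "regular_path \<omega> \<longleftrightarrow> regular \<omega> \<and> time_integral Z_mass \<omega> T < \<infinity> \<and> Y \<omega> 0 = y0 \<and>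
     Y \<omega> 0 + q_integral K \<tau> \<xi> A \<phi> Z 0 T \<omega> = g \<omega> (mark_process \<tau> \<xi> \<omega> T) +
        (LINT s:{0<..T}|completion (dA A \<omega>). hamiltonian \<phi> U r l \<omega> s (mark_process \<tau> \<xi> \<omega> s) (Z \<omega> s)) \<and>
     (AE s in dA A \<omega>. s \<in> {0..T} \<longrightarrow>
        hamiltonian \<phi> U r l \<omega> s (mark_process_left \<tau> \<xi> \<omega> s) (Z \<omega> s) =
        l \<omega> s (mark_process_left \<tau> \<xi> \<omega> s) (u_star \<omega> s) + (\<integral>y. Z \<omega> s y * (r \<omega> s y (u_star \<omega> s) - 1) \<partial>\<phi> \<omega> s))"

lemma AE_regular_path: "AE \<omega> in M. regular_path \<omega>"
proof -
  have "AE \<omega> in M. Y \<omega> 0 + q_integral K \<tau> \<xi> A \<phi> Z 0 T \<omega> = g \<omega> (mark_process \<tau> \<xi> \<omega> T) +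
        (LINT s:{0<..T}|completion (dA A \<omega>). hamiltonian \<phi> U r l \<omega> s (mark_process \<tau> \<xi> \<omega> s) (Z \<omega> s))"
    using bsde T_nonneg by (simp add: bsde_solution_def)
  with AE_regular AE_Z_mass_finite Y_0 AE_minimizing show ?thesis
    by eventually_elim (simp add: regular_path_def)
qed

context
  fixes \<omega> assumes \<omega>: "regular_path \<omega>"
begin

lemma path_regular: "regular \<omega>" and path_good: "good \<omega>" and path_Z_mass: "time_integral Z_mass \<omega> T < \<infinity>"
  using \<omega> regular_good by (auto simp: regular_path_def)

lemma AE_left_mark: "AE s in dA A \<omega>. s \<in> {0<..T} \<longrightarrow> mark_process \<tau> \<xi> \<omega> s = left_mark \<omega> s \<and> mark_process_left \<tau> \<xi> \<omega> s = left_mark \<omega> s"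
  using AE_mark_process_eq_left[OF path_good] by eventually_elim (auto simp: mark_process_left_eq[OF path_good])

text \<open>The BSDE evaluates the hamiltonian at the current mark, Hypothesis (S) at the left mark.
  The marks agree \<open>dA\<close>-almost everywhere, so both evaluations equal the drive of the
  minimizing control.\<close>

lemma AE_hamiltonian_eq_drive:
  "AE s in dA A \<omega>. s \<in> {0<..T} \<longrightarrow> hamiltonian \<phi> U r l \<omega> s (mark_process \<tau> \<xi> \<omega> s) (Z \<omega> s) = drive u_star \<omega> s \<and>
     hamiltonian \<phi> U r l \<omega> s (left_mark \<omega> s) (Z \<omega> s) = drive u_star \<omega> s"
proof -
  have "AE s in dA A \<omega>. s \<in> {0..T} \<longrightarrow>
        hamiltonian \<phi> U r l \<omega> s (mark_process_left \<tau> \<xi> \<omega> s) (Z \<omega> s) =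
        l \<omega> s (mark_process_left \<tau> \<xi> \<omega> s) (u_star \<omega> s) + (\<integral>y. Z \<omega> s y * (r \<omega> s y (u_star \<omega> s) - 1) \<partial>\<phi> \<omega> s)"
    using \<omega> by (simp add: regular_path_def)
  with AE_left_mark show ?thesis
    by eventually_elim (auto simp: drive_eq[OF path_regular u_star_admissible])
qed

lemma Zs_integral:
  "AE s in dA A \<omega>. s \<in> {0<..T} \<longrightarrow> integrable (\<phi> \<omega> s) (Zs \<omega> s)"
  "set_integrable (dA A \<omega>) {0<..T} (\<lambda>s. \<integral>y. Zs \<omega> s y \<partial>\<phi> \<omega> s)"
  "(LINT s:{0<..T}|dA A \<omega>. (\<integral>y. Zs \<omega> s y \<partial>\<phi> \<omega> s)) = compensated_integral Zs \<omega> T"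
  using compensated_integral_eq[OF Zs_measurable path_good path_Z_mass[unfolded Z_mass_def[abs_def]]] by auto

text \<open>The hamiltonian lies below the drive of \<open>v\<close> and equals the drive of
  \<open>u_star\<close>; the two facts hold together at almost every time, where \<open>Z\<close> is
  integrable over the marks.\<close>

lemma gap_nonneg:
  assumes v: "v \<in> controls"
  shows "AE s in dA A \<omega>. s \<in> {0<..T} \<longrightarrow> 0 \<le> gap v \<omega> s"
  using AE_hamiltonian_eq_drive Zs_integral(1)
proof eventually_elim
  case (elim s)
  show ?case
  proof
    assume s: "s \<in> {0<..T}"
    with hamiltonian_le_drive[OF path_regular v, of s] elim show "0 \<le> gap v \<omega> s" by (auto simp: gap_def)
  qed
qed

lemma drive_integrable:
  assumes v: "v \<in> controls"
  shows "set_integrable (dA A \<omega>) {0<..T} (drive v \<omega>)"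
proof (rule real_time_integral_eq(1)[OF drive_predictable[OF v] path_good])
  show "time_integral (\<lambda>\<omega> t. ennreal \<bar>drive v \<omega> t\<bar>) \<omega> T < \<infinity>"
    by (rule order_le_less_trans[OF drive_integral_le[OF v path_good]])
       (use path_Z_mass in \<open>simp add: ennreal_add_less_top ennreal_mult_less_top\<close>)
qed

lemma gap_integral:
  assumes v: "v \<in> controls"
  shows "(LINT s:{0<..T}|dA A \<omega>. gap v \<omega> s) = real_time_integral (gap v) \<omega> T"
proof (rule real_time_integral_eq(2)[OF gap_predictable[OF v] path_good])
  show "time_integral (\<lambda>\<omega> t. ennreal \<bar>gap v \<omega> t\<bar>) \<omega> T < \<infinity>"
    by (rule order_le_less_trans[OF gap_integral_le[OF v path_good]])
       (use path_Z_mass in \<open>simp add: ennreal_add_less_top ennreal_mult_less_top\<close>)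
qed

lemma gap_integral_nonneg:
  assumes "v \<in> controls"
  shows "0 \<le> real_time_integral (gap v) \<omega> T"
  unfolding gap_integral[OF assms, symmetric] set_lebesgue_integral_def
  by (rule integral_nonneg_AE) (use gap_nonneg[OF assms] in \<open>eventually_elim, auto simp: indicator_def\<close>)

lemma running_integral:
  assumes v: "v \<in> controls"
  shows "set_integrable (dA A \<omega>) {0<..T} (running v \<omega>)"
    "(LINT s:{0<..T}|dA A \<omega>. l \<omega> s (mark_process \<tau> \<xi> \<omega> s) (v \<omega> s)) = (LINT s:{0<..T}|dA A \<omega>. running v \<omega> s)"
proof -
  have "\<bar>running v \<omega> t\<bar> \<le> C\<^sub>l" for t using C_l_pos by (auto simp: running_def)
  then have "time_integral (\<lambda>\<omega> t. ennreal \<bar>running v \<omega> t\<bar>) \<omega> T \<le> ennreal C\<^sub>l * ennreal (A \<omega> T)"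
    using path_good T_nonneg by (intro time_integral_le ennreal_leI) auto
  then have "time_integral (\<lambda>\<omega> t. ennreal \<bar>running v \<omega> t\<bar>) \<omega> T < \<infinity>"
    by (rule order_le_less_trans) (simp add: ennreal_mult_less_top)
  from real_time_integral_eq(1)[OF running_predictable[OF v] path_good this]
  show i: "set_integrable (dA A \<omega>) {0<..T} (running v \<omega>)" .
  \<comment> \<open>\<open>dA\<close> is not complete, so agreement almost everywhere with
    \<open>running v\<close> does not give measurability of the integrand at the current mark. It is
    built here by composition along the path.\<close>
  have "(\<lambda>(\<omega>, t). (\<omega>, t)) \<in> P \<rightarrow>\<^sub>M P" by simp
  from measurable_compose[OF path_measurable[OF this good_space[OF path_good]] stop_into_upto[OF T_nonneg]]
  have [measurable]: "(\<lambda>s. (\<omega>, min (max 0 s) T)) \<in> borel \<rightarrow>\<^sub>M P_upto T" by simp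
  have [measurable]: "(\<lambda>s. v \<omega> (min (max 0 s) T)) \<in> borel \<rightarrow>\<^sub>M U"
    by (rule path_measurable[OF stopped_control[OF v T_nonneg] good_space[OF path_good]])
  note [measurable] = mark_process_path_measurable[OF path_good]
  have "(\<lambda>s. (((\<omega>, min (max 0 s) T), mark_process \<tau> \<xi> \<omega> s), v \<omega> (min (max 0 s) T)))
      \<in> borel \<rightarrow>\<^sub>M (P_upto T \<Otimes>\<^sub>M K) \<Otimes>\<^sub>M U" by measurable
  from measurable_compose[OF this l_measurable]
  have [measurable]: "(\<lambda>s. l \<omega> (min (max 0 s) T) (mark_process \<tau> \<xi> \<omega> s) (v \<omega> (min (max 0 s) T))) \<in> borel_measurable borel"
    by simp
  have "(\<lambda>s. indicator {0<..T} s *\<^sub>R l \<omega> (min (max 0 s) T) (mark_process \<tau> \<xi> \<omega> s) (v \<omega> (min (max 0 s) T))) \<in> borel_measurable (dA A \<omega>)"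
    by measurable
  also have "(\<lambda>s. indicator {0<..T} s *\<^sub>R l \<omega> (min (max 0 s) T) (mark_process \<tau> \<xi> \<omega> s) (v \<omega> (min (max 0 s) T))) =
      (\<lambda>s. indicator {0<..T} s *\<^sub>R l \<omega> s (mark_process \<tau> \<xi> \<omega> s) (v \<omega> s))"
    by (auto simp: indicator_def)
  finally have m: "(\<lambda>s. indicator {0<..T} s *\<^sub>R l \<omega> s (mark_process \<tau> \<xi> \<omega> s) (v \<omega> s)) \<in> borel_measurable (dA A \<omega>)" .
  show "(LINT s:{0<..T}|dA A \<omega>. l \<omega> s (mark_process \<tau> \<xi> \<omega> s) (v \<omega> s)) = (LINT s:{0<..T}|dA A \<omega>. running v \<omega> s)"
    unfolding set_lebesgue_integral_def
  proof (rule integral_cong_AE[OF m])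
    show "(\<lambda>s. indicator {0<..T} s *\<^sub>R running v \<omega> s) \<in> borel_measurable (dA A \<omega>)"
      using i unfolding set_integrable_def by (rule borel_measurable_integrable)
    show "AE s in dA A \<omega>. indicator {0<..T} s *\<^sub>R l \<omega> s (mark_process \<tau> \<xi> \<omega> s) (v \<omega> s) = indicator {0<..T} s *\<^sub>R running v \<omega> s"
      using AE_left_mark by eventually_elim (auto simp: indicator_def running_eq[OF path_regular v])
  qed
qed

text \<open>In the completion, agreement almost everywhere with the measurable
  \<open>drive u_star\<close> makes the path of the hamiltonian measurable, and the integral of a
  Borel function is unchanged by completing.\<close>

lemma generator_integral:
  "(LINT s:{0<..T}|completion (dA A \<omega>). hamiltonian \<phi> U r l \<omega> s (mark_process \<tau> \<xi> \<omega> s) (Z \<omega> s)) =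
    (LINT s:{0<..T}|dA A \<omega>. drive u_star \<omega> s)"
proof -
  let ?f = "\<lambda>s. indicator {0<..T} s *\<^sub>R hamiltonian \<phi> U r l \<omega> s (mark_process \<tau> \<xi> \<omega> s) (Z \<omega> s)"
  let ?h = "\<lambda>s. indicator {0<..T} s *\<^sub>R drive u_star \<omega> s"
  have h: "?h \<in> borel_measurable (dA A \<omega>)"
    using drive_integrable[OF u_star_admissible] unfolding set_integrable_def by (rule borel_measurable_integrable)
  note hc = measurable_completion[OF h]
  have "AE s in dA A \<omega>. ?h s = ?f s"
    using AE_hamiltonian_eq_drive by eventually_elim (auto simp: indicator_def)
  then have ae: "AE s in completion (dA A \<omega>). ?h s = ?f s" by (rule AE_completion)
  have fc: "?f \<in> borel_measurable (completion (dA A \<omega>))"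
    by (rule borel_measurable_AE_complete[OF completion.complete_measure_axioms hc ae]) simp
  have "(\<integral>s. ?f s \<partial>completion (dA A \<omega>)) = (\<integral>s. ?h s \<partial>completion (dA A \<omega>))"
    by (rule integral_cong_AE[OF fc hc]) (use ae in \<open>auto elim: AE_mp\<close>)
  also have "\<dots> = (\<integral>s. ?h s \<partial>dA A \<omega>)" by (rule integral_completion[OF h])
  finally show ?thesis by (simp only: set_lebesgue_integral_def)
qed

lemma q_integral_eq: "q_integral K \<tau> \<xi> A \<phi> Z 0 T \<omega> = jump_sum Zs \<omega> T - compensated_integral Zs \<omega> T"
proof -
  define f where "f x = indicator ({0<..T} \<times> space K) x *\<^sub>R (\<lambda>(t, y). Zs \<omega> (max 0 t) y) x" for x
  have f: "f \<in> borel_measurable (borel \<Otimes>\<^sub>M K)"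
    unfolding f_def using field_path_measurable[OF Zs_measurable good_space[OF path_good]] by measurable
  have "(LINT x:{0<..T} \<times> space K|jump_measure K \<tau> \<xi> \<omega>. Z \<omega> (fst x) (snd x)) = (\<integral>x. f x \<partial>jump_measure K \<tau> \<xi> \<omega>)"
    unfolding set_lebesgue_integral_def
    by (intro Bochner_Integration.integral_cong refl) (auto simp: f_def Zs_def indicator_def)
  also have "\<dots> = (\<Sum>n\<in>jumped \<omega> T. f (jump_time n \<omega>, \<xi> n \<omega>))"
    by (rule integral_jump_measure[OF path_good f T_nonneg]) (auto simp: f_def)
  also have "\<dots> = jump_sum Zs \<omega> T"
    unfolding jump_sum_def using path_good jump_time_pos[OF path_good] jumped_le[OF _ T_nonneg] mark_in_space[OF good_space[OF path_good]]
    by (auto intro!: sum.cong simp: f_def max_def less_imp_le)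
  finally have 1: "(LINT x:{0<..T} \<times> space K|jump_measure K \<tau> \<xi> \<omega>. Z \<omega> (fst x) (snd x)) = jump_sum Zs \<omega> T" .
  have "(LINT s:{0<..T}|dA A \<omega>. (\<integral>y. Z \<omega> s y \<partial>\<phi> \<omega> s)) = (LINT s:{0<..T}|dA A \<omega>. (\<integral>y. Zs \<omega> s y \<partial>\<phi> \<omega> s))"
    unfolding set_lebesgue_integral_def
    by (intro Bochner_Integration.integral_cong refl) (auto simp: Zs_def[abs_def] indicator_def)
  then show ?thesis unfolding q_integral_def 1 Zs_integral(3) by simp
qed

lemma rate_Zs_integral:
  assumes v: "v \<in> controls"
  shows "set_integrable (dA A \<omega>) {0<..T} (\<lambda>s. \<integral>y. rate v \<omega> s y * Zs \<omega> s y \<partial>\<phi> \<omega> s)"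
    "(LINT s:{0<..T}|dA A \<omega>. (\<integral>y. rate v \<omega> s y * Zs \<omega> s y \<partial>\<phi> \<omega> s)) = compensated_integral (\<lambda>\<omega> t y. rate v \<omega> t y * Zs \<omega> t y) \<omega> T"
    "AE s in dA A \<omega>. s \<in> {0<..T} \<longrightarrow> integrable (\<phi> \<omega> s) (\<lambda>y. rate v \<omega> s y * Zs \<omega> s y)"
proof -
  have "time_integral (\<lambda>\<omega> t. \<integral>\<^sup>+y. ennreal \<bar>rate v \<omega> t y * Zs \<omega> t y\<bar> \<partial>\<phi> \<omega> t) \<omega> T \<le>
      time_integral (\<lambda>\<omega> t. ennreal C * Z_mass \<omega> t) \<omega> T"
  proof (rule time_integral_mono)
    fix t :: real assume t: "0 < t"
    have "(\<integral>\<^sup>+y. ennreal \<bar>rate v \<omega> t y * Zs \<omega> t y\<bar> \<partial>\<phi> \<omega> t) \<le> (\<integral>\<^sup>+y. ennreal C * ennreal \<bar>Zs \<omega> t y\<bar> \<partial>\<phi> \<omega> t)"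
      using bounded_fieldD(2,3)[OF rate_bounded[OF v]] C_gt_1
      by (intro nn_integral_mono, subst ennreal_mult[symmetric]) (auto simp: abs_mult intro!: ennreal_leI mult_right_mono)
    also have "\<dots> = ennreal C * Z_mass \<omega> t"
      unfolding Z_mass_def using t
      by (intro nn_integral_cmult field_section_measurable[OF abs_Zs_measurable good_space[OF path_good]]) simp
    finally show "(\<integral>\<^sup>+y. ennreal \<bar>rate v \<omega> t y * Zs \<omega> t y\<bar> \<partial>\<phi> \<omega> t) \<le> ennreal C * Z_mass \<omega> t" .
  qed
  also have "\<dots> = ennreal C * time_integral Z_mass \<omega> T" by (rule time_integral_cmult[OF Z_mass_predictable])
  also have "\<dots> < \<infinity>" using path_Z_mass by (simp add: ennreal_mult_less_top)
  finally have "time_integral (\<lambda>\<omega> t. \<integral>\<^sup>+y. ennreal \<bar>rate v \<omega> t y * Zs \<omega> t y\<bar> \<partial>\<phi> \<omega> t) \<omega> T < \<infinity>" .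
  from compensated_integral_eq[OF Zs_rate_measurable(2)[OF v] path_good this]
  show "set_integrable (dA A \<omega>) {0<..T} (\<lambda>s. \<integral>y. rate v \<omega> s y * Zs \<omega> s y \<partial>\<phi> \<omega> s)"
    "(LINT s:{0<..T}|dA A \<omega>. (\<integral>y. rate v \<omega> s y * Zs \<omega> s y \<partial>\<phi> \<omega> s)) = compensated_integral (\<lambda>\<omega> t y. rate v \<omega> t y * Zs \<omega> t y) \<omega> T"
    "AE s in dA A \<omega>. s \<in> {0<..T} \<longrightarrow> integrable (\<phi> \<omega> s) (\<lambda>y. rate v \<omega> s y * Zs \<omega> s y)"
    by auto
qed

text \<open>The BSDE at time 0 replaces the terminal cost by \<open>y0\<close>, the
  \<open>q\<close>-integral of \<open>Z\<close> and the drive of \<open>u_star\<close>. Writing the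
  latter as the drive of \<open>v\<close> minus the gap cancels the running cost, and the term with
  \<open>rate v - 1\<close> turns the compensator \<open>\<phi> dA\<close> of the jump sum into
  \<open>rate v \<phi> dA\<close>, which is the compensator under the measure of
  \<open>v\<close>.\<close>

lemma cost_integrand_eq:
  assumes v: "v \<in> controls"
  shows "(LINT s:{0<..T}|dA A \<omega>. l \<omega> s (mark_process \<tau> \<xi> \<omega> s) (v \<omega> s)) + g \<omega> (mark_process \<tau> \<xi> \<omega> T) =
    y0 + (jump_sum Zs \<omega> T - compensated_integral (\<lambda>\<omega> t y. rate v \<omega> t y * Zs \<omega> t y) \<omega> T) + real_time_integral (gap v) \<omega> T"
proof -
  let ?w = "\<lambda>s. running v \<omega> s + (\<integral>y. rate v \<omega> s y * Zs \<omega> s y \<partial>\<phi> \<omega> s)"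
  let ?q = "\<lambda>s. (\<integral>y. Zs \<omega> s y \<partial>\<phi> \<omega> s) + drive u_star \<omega> s"
  note w = set_integral_add[OF running_integral(1)[OF v] rate_Zs_integral(1)[OF v]]
  note q = set_integral_add[OF Zs_integral(2) drive_integrable[OF u_star_admissible]]
  note wq = set_integral_diff[OF w(1) q(1)]
  have "(LINT s:{0<..T}|dA A \<omega>. gap v \<omega> s) = (LINT s:{0<..T}|dA A \<omega>. ?w s - ?q s)"
    unfolding set_lebesgue_integral_def
  proof (rule integral_cong_AE)
    show "(\<lambda>s. indicator {0<..T} s *\<^sub>R (?w s - ?q s)) \<in> borel_measurable (dA A \<omega>)"
      using wq(1) unfolding set_integrable_def by (rule borel_measurable_integrable)
    have "set_integrable (dA A \<omega>) {0<..T} (gap v \<omega>)"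
      unfolding gap_def[abs_def] by (rule set_integral_diff(1)[OF drive_integrable[OF v] drive_integrable[OF u_star_admissible]])
    then show "(\<lambda>s. indicator {0<..T} s *\<^sub>R gap v \<omega> s) \<in> borel_measurable (dA A \<omega>)"
      unfolding set_integrable_def by (rule borel_measurable_integrable)
    \<comment> \<open>Splitting the integral of \<open>Zs * (rate v - 1)\<close> needs both parts
      integrable over the marks, which holds at \<open>dA\<close>-almost every time.\<close>
    show "AE s in dA A \<omega>. indicator {0<..T} s *\<^sub>R gap v \<omega> s = indicator {0<..T} s *\<^sub>R (?w s - ?q s)"
      using rate_Zs_integral(3)[OF v] Zs_integral(1)
    proof eventually_elim
      case (elim s)
      show ?case
      proof (cases "s \<in> {0<..T}")
        case True
        have "(\<integral>y. Zs \<omega> s y * (rate v \<omega> s y - 1) \<partial>\<phi> \<omega> s) = (\<integral>y. rate v \<omega> s y * Zs \<omega> s y - Zs \<omega> s y \<partial>\<phi> \<omega> s)"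
          by (intro Bochner_Integration.integral_cong refl) (simp add: algebra_simps)
        also have "\<dots> = (\<integral>y. rate v \<omega> s y * Zs \<omega> s y \<partial>\<phi> \<omega> s) - (\<integral>y. Zs \<omega> s y \<partial>\<phi> \<omega> s)"
          using elim True by (intro Bochner_Integration.integral_diff) auto
        finally show ?thesis by (simp add: gap_def drive_def[of v])
      qed simp
    qed
  qed
  also have "\<dots> = (LINT s:{0<..T}|dA A \<omega>. running v \<omega> s) + compensated_integral (\<lambda>\<omega> t y. rate v \<omega> t y * Zs \<omega> t y) \<omega> T
      - (compensated_integral Zs \<omega> T + (LINT s:{0<..T}|dA A \<omega>. drive u_star \<omega> s))"
    by (simp only: wq(2) w(2) q(2) rate_Zs_integral(2)[OF v] Zs_integral(3))
  finally have "real_time_integral (gap v) \<omega> T =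
      (LINT s:{0<..T}|dA A \<omega>. running v \<omega> s) + compensated_integral (\<lambda>\<omega> t y. rate v \<omega> t y * Zs \<omega> t y) \<omega> T
      - (compensated_integral Zs \<omega> T + (LINT s:{0<..T}|dA A \<omega>. drive u_star \<omega> s))"
    unfolding gap_integral[OF v] .
  moreover have "y0 + (jump_sum Zs \<omega> T - compensated_integral Zs \<omega> T) =
      g \<omega> (mark_process \<tau> \<xi> \<omega> T) + (LINT s:{0<..T}|dA A \<omega>. drive u_star \<omega> s)"
    using \<omega> q_integral_eq generator_integral by (simp add: regular_path_def)
  ultimately show ?thesis unfolding running_integral(2)[OF v] by linarith
qed

end

section \<open>The cost as a mean under the controlled measure\<close>

lemma control_density_eq:
  assumes \<omega>: "regular \<omega>" and v: "v \<in> controls"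
  shows "control_density \<tau> \<xi> A \<phi> r v \<omega> T = stoch_exp (rate v) \<omega> T"
proof -
  note good = regular_good[OF \<omega>] and R = rate_bounded[OF v]
  interpret path: continuous_path "dA A \<omega>" "A \<omega>" using good by (simp add: good_def)
  have "time_integral (intensity (rate v)) \<omega> T < \<infinity>"
    using compensating_le(1)[OF R good T_nonneg] by (simp add: order_le_less_trans)
  then have fin: "time_integral (\<lambda>\<omega> t. \<integral>\<^sup>+y. ennreal \<bar>rate v \<omega> t y\<bar> \<partial>\<phi> \<omega> t) \<omega> T < \<infinity>"
    using bounded_fieldD(2)[OF R] by (simp add: intensity_def[abs_def])
  note ci = compensated_integral_eq[OF bounded_fieldD(1)[OF R] good fin]
  have comp: "compensated_integral (rate v) \<omega> T = compensating (rate v) \<omega> T"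
    using bounded_fieldD(2)[OF R] good by (simp add: compensated_integral_def compensating_def intensity_def[abs_def] ennreal_neg time_integral_def)
  have one: "set_integrable (dA A \<omega>) {0<..T} (\<lambda>_. 1::real)" "(LINT s:{0<..T}|dA A \<omega>. (1::real)) = A \<omega> T"
    using path.measure_Ioc[of 0 T] path.emeasure_Ioc[of 0 T] T_nonneg path.path_0
    by (auto simp: set_lebesgue_integral_def set_integrable_def)
  \<comment> \<open>\<open>\<phi>\<close> is a probability measure, so the constant 1 integrates to
    1 over the marks and then to \<open>A\<close> over time; this turns the exponent of the control
    density into that of \<open>stoch_exp\<close>.\<close>
  have inner: "(\<integral>y. 1 - r \<omega> s y (v \<omega> s) \<partial>\<phi> \<omega> s) = 1 - (\<integral>y. rate v \<omega> s y \<partial>\<phi> \<omega> s)" if s: "s \<in> {0<..T}" for s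
  proof -
    interpret phi: prob_space "\<phi> \<omega> s" using s good_space[OF good] by (intro \<phi>_prob) auto
    have space: "space (\<phi> \<omega> s) = space K"
      using \<phi>_sets[OF good_space[OF good], of s] s by (intro sets_eq_imp_space_eq) simp
    have "(\<integral>y. 1 - r \<omega> s y (v \<omega> s) \<partial>\<phi> \<omega> s) = (\<integral>y. 1 - rate v \<omega> s y \<partial>\<phi> \<omega> s)"
      using rate_eq[OF \<omega> v, of s] s by (intro Bochner_Integration.integral_cong refl) (simp add: space)
    moreover have "integrable (\<phi> \<omega> s) (rate v \<omega> s)"
      using bounded_fieldD[OF R] s by (intro phi.integrable_const_bound[where B = C] field_section_measurable[OF bounded_fieldD(1)[OF R] good_space[OF good]]) auto
    ultimately show ?thesis by (simp add: phi.prob_space)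
  qed
  have "(LINT s:{0<..T}|dA A \<omega>. (\<integral>y. 1 - r \<omega> s y (v \<omega> s) \<partial>\<phi> \<omega> s)) = (LINT s:{0<..T}|dA A \<omega>. 1 - (\<integral>y. rate v \<omega> s y \<partial>\<phi> \<omega> s))"
    unfolding set_lebesgue_integral_def by (intro Bochner_Integration.integral_cong refl) (simp add: indicator_def inner)
  also have "\<dots> = A \<omega> T - compensating (rate v) \<omega> T"
    using set_integral_diff(2)[OF one(1) ci(2)] one(2) ci(3) comp by simp
  finally have e: "(LINT s:{0<..T}|dA A \<omega>. (\<integral>y. 1 - r \<omega> s y (v \<omega> s) \<partial>\<phi> \<omega> s)) = A \<omega> T - compensating (rate v) \<omega> T" .
  have "(\<Prod>n\<in>jumped \<omega> T. r \<omega> (jump_time n \<omega>) (\<xi> n \<omega>) (v \<omega> (jump_time n \<omega>))) = (\<Prod>n\<in>jumped \<omega> T. rate v \<omega> (jump_time n \<omega>) (\<xi> n \<omega>))"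
    using rate_eq[OF \<omega> v] jumped_le[OF _ T_nonneg] mark_in_space[OF good_space[OF good]] by (intro prod.cong refl) simp
  then show ?thesis
    unfolding control_density_def stoch_exp_def e using good by (simp add: jumps_upto_def)
qed

text \<open>The difference of jump sum and compensated integral has mean zero under the new measure.\<close>

lemma cost_eq:
  assumes v: "v \<in> controls"
  shows "integrable M (\<lambda>\<omega>. stoch_exp (rate v) \<omega> T * real_time_integral (gap v) \<omega> T)"
    "cost M \<tau> \<xi> A \<phi> T r l g v = y0 + (\<integral>\<omega>. stoch_exp (rate v) \<omega> T * real_time_integral (gap v) \<omega> T \<partial>M)"
proof -
  let ?L = "\<lambda>\<omega>. stoch_exp (rate v) \<omega> T"
  let ?S = "\<lambda>\<omega>. jump_sum Zs \<omega> T" and ?B = "\<lambda>\<omega>. compensated_integral (\<lambda>\<omega> t y. rate v \<omega> t y * Zs \<omega> t y) \<omega> T"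
  let ?G = "\<lambda>\<omega>. real_time_integral (gap v) \<omega> T"
  note R = rate_bounded[OF v]
  have L[measurable]: "?L \<in> borel_measurable M" by (rule stoch_exp_measurable[OF R T_nonneg])
  have G[measurable]: "?G \<in> borel_measurable M" by (rule real_time_integral_measurable[OF gap_predictable[OF v] T_nonneg])
  have S[measurable]: "?S \<in> borel_measurable M" by (rule real_jump_sum_measurable[OF Zs_measurable T_nonneg])
  have B[measurable]: "?B \<in> borel_measurable M"
  proof -
    have m: "(\<lambda>\<omega>. time_integral (\<lambda>\<omega> t. \<integral>\<^sup>+y. ennreal (q * (rate v \<omega> t y * Zs \<omega> t y)) \<partial>\<phi> \<omega> t) \<omega> T) \<in> borel_measurable M" for q :: real
      by (intro time_integral_measurable T_nonneg predictable_\<phi>_nn_integral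
          field_compose[OF Zs_rate_measurable(2)[OF v], of "\<lambda>x. ennreal (q * x)"]) measurable
    show ?thesis unfolding compensated_integral_def using m[of 1] m[of "- 1"] by simp
  qed
  note L1 = stoch_exp_integrable[OF C_gt_1 T_nonneg exp_integrable R]
  note gi = girsanov_integral[OF C_gt_1 T_nonneg exp_integrable R Zs_measurable Z_girsanov_finite[OF v]]
  have L0: "0 \<le> ?L \<omega>" for \<omega> by (rule stoch_exp_nonneg[OF R])
  show LG: "integrable M (\<lambda>\<omega>. ?L \<omega> * ?G \<omega>)"
  proof (rule integrableI_bounded)
    have "(\<integral>\<^sup>+\<omega>. ennreal (norm (?L \<omega> * ?G \<omega>)) \<partial>M) \<le>
        (\<integral>\<^sup>+\<omega>. ennreal (?L \<omega>) * time_integral (\<lambda>\<omega> t. ennreal \<bar>gap v \<omega> t\<bar>) \<omega> T \<partial>M)"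
      using L0 abs_real_time_integral_le by (intro nn_integral_mono) (simp add: abs_mult ennreal_mult mult_left_mono)
    then show "(\<integral>\<^sup>+\<omega>. ennreal (norm (?L \<omega> * ?G \<omega>)) \<partial>M) < \<infinity>"
      using gap_dominated[OF v] by (rule order_le_less_trans)
  qed measurable
  let ?I = "\<lambda>\<omega>. (LINT s:{0<..T}|dA A \<omega>. l \<omega> s (mark_process \<tau> \<xi> \<omega> s) (v \<omega> s)) + g \<omega> (mark_process \<tau> \<xi> \<omega> T)"
  let ?cd = "\<lambda>\<omega>. control_density \<tau> \<xi> A \<phi> r v \<omega> T"
  have I: "AE \<omega> in M. y0 + (?S \<omega> - ?B \<omega>) + ?G \<omega> = ?I \<omega>"
    using AE_regular_path by eventually_elim (simp add: cost_integrand_eq[OF _ v])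
  \<comment> \<open>Measurability of the whole cost integrand, terminal cost included, is inherited
    from the other side of \<open>I\<close> by completeness of \<open>M\<close>.\<close>
  have Im: "?I \<in> borel_measurable M"
  proof (rule borel_measurable_AE_complete[OF complete_measure_axioms _ I])
    show "(\<lambda>\<omega>. y0 + (?S \<omega> - ?B \<omega>) + ?G \<omega>) \<in> borel_measurable M" by measurable
  qed simp
  have cd: "AE \<omega> in M. ?L \<omega> = ?cd \<omega>"
    using AE_regular by eventually_elim (simp add: control_density_eq[OF _ v])
  have cdm: "?cd \<in> borel_measurable M"
    by (rule borel_measurable_AE_complete[OF complete_measure_axioms L cd]) simp
  have "cost M \<tau> \<xi> A \<phi> T r l g v = (\<integral>\<omega>. ?cd \<omega> *\<^sub>R ?I \<omega> \<partial>M)"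
    unfolding cost_def controlled_measure_def
  proof (rule integral_density[OF Im cdm])
    show "AE \<omega> in M. 0 \<le> ?cd \<omega>" using cd
    proof eventually_elim
      case (elim \<omega>)
      show ?case unfolding elim[symmetric] by (rule L0)
    qed
  qed
  also have "\<dots> = (\<integral>\<omega>. ?L \<omega> * y0 + (?L \<omega> * ?S \<omega> - ?L \<omega> * ?B \<omega>) + ?L \<omega> * ?G \<omega> \<partial>M)"
  proof (rule integral_cong_AE)
    show "(\<lambda>\<omega>. ?cd \<omega> *\<^sub>R ?I \<omega>) \<in> borel_measurable M" using Im cdm by simp
    show "AE \<omega> in M. ?cd \<omega> *\<^sub>R ?I \<omega> = ?L \<omega> * y0 + (?L \<omega> * ?S \<omega> - ?L \<omega> * ?B \<omega>) + ?L \<omega> * ?G \<omega>"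
      using I cd
    proof eventually_elim
      case (elim \<omega>)
      then show ?case by (simp only: elim(1)[symmetric] elim(2)[symmetric] real_scaleR_def) (simp add: algebra_simps)
    qed
  qed measurable
  also have "\<dots> = y0 + (\<integral>\<omega>. ?L \<omega> * ?G \<omega> \<partial>M)"
    using L1 gi LG by simp
  finally show "cost M \<tau> \<xi> A \<phi> T r l g v = y0 + (\<integral>\<omega>. ?L \<omega> * ?G \<omega> \<partial>M)" .
qed

lemma cost_ge:
  assumes v: "v \<in> controls"
  shows "y0 \<le> cost M \<tau> \<xi> A \<phi> T r l g v"
proof -
  have "0 \<le> (\<integral>\<omega>. stoch_exp (rate v) \<omega> T * real_time_integral (gap v) \<omega> T \<partial>M)"
  proof (rule integral_nonneg_AE)
    show "AE \<omega> in M. 0 \<le> stoch_exp (rate v) \<omega> T * real_time_integral (gap v) \<omega> T"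
      using AE_regular_path
      by eventually_elim (intro mult_nonneg_nonneg stoch_exp_nonneg[OF rate_bounded[OF v]] gap_integral_nonneg v)
  qed
  then show ?thesis unfolding cost_eq(2)[OF v] by simp
qed

text \<open>For the minimizing control the gap vanishes identically, not just almost everywhere,
  because it is measured from that control.\<close>

lemma cost_u_star: "cost M \<tau> \<xi> A \<phi> T r l g u_star = y0"
proof -
  have "gap u_star = (\<lambda>_ _. 0)" by (simp add: gap_def[abs_def])
  then have "real_time_integral (gap u_star) \<omega> T = 0" for \<omega> by (simp add: real_time_integral_def)
  then show ?thesis unfolding cost_eq(2)[OF u_star_admissible] by simp
qed

end

theorem theorem4p6:
  fixes M :: "'a measure" and K :: "'k measure" and U :: "'u measure"
    and \<tau> :: "nat \<Rightarrow> 'a \<Rightarrow> ennreal" and \<xi> :: "nat \<Rightarrow> 'a \<Rightarrow> 'k" and \<xi>0 :: 'k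
    and A :: "'a \<Rightarrow> real \<Rightarrow> real" and \<phi> :: "'a \<Rightarrow> real \<Rightarrow> 'k measure"
    and r l :: "'a \<Rightarrow> real \<Rightarrow> 'k \<Rightarrow> 'u \<Rightarrow> real" and g :: "'a \<Rightarrow> 'k \<Rightarrow> real"
    and T C\<^sub>r C\<^sub>l \<beta> :: real
    and Y :: "'a \<Rightarrow> real \<Rightarrow> real" and Z :: "'a \<Rightarrow> real \<Rightarrow> 'k \<Rightarrow> real"
    and u_star :: "'a \<Rightarrow> real \<Rightarrow> 'u"
  assumes "compensated_mpp M K \<tau> \<xi> \<xi>0 A \<phi>"
    and "0 < T"
    and "hypothesis_C M K \<tau> \<xi> T U r l g C\<^sub>r C\<^sub>l"
    and "hypothesis_S M K \<tau> \<xi> A \<phi> T U r l"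
    and "(\<integral>\<^sup>+\<omega>. ennreal (exp ((3 + C\<^sub>r ^ 4) * A \<omega> T)) \<partial>M) < \<infinity>"
    and "(SUP (\<omega>, t, y, u)\<in>space M \<times> {0..T} \<times> space K \<times> space U.
            ennreal \<bar>r \<omega> t y u - 1\<bar>)\<^sup>2 < ennreal \<beta>"
    and "(\<integral>\<^sup>+\<omega>. ennreal (exp (\<beta> * A \<omega> T)) \<partial>M) < \<infinity>"
    and "(\<integral>\<^sup>+\<omega>. ennreal (\<bar>g \<omega> (mark_process \<tau> \<xi> \<omega> T)\<bar>\<^sup>2 * exp (\<beta> * A \<omega> T)) \<partial>M) < \<infinity>"
    and "(Y, Z) \<in> K_space M K \<tau> \<xi> A \<phi> T \<beta>"
    and "bsde_solution M K \<tau> \<xi> A \<phi> T g (hamiltonian \<phi> U r l) Y Z"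
    and "minimizing_control M K \<tau> \<xi> A \<phi> T U r l Z u_star"
  shows "optimal_control M K \<tau> \<xi> A \<phi> T U r l g u_star \<and>
         (AE \<omega> in M. Y \<omega> 0 = cost M \<tau> \<xi> A \<phi> T r l g u_star) \<and>
         ereal (cost M \<tau> \<xi> A \<phi> T r l g u_star) =
           (INF u\<in>admissible M K \<tau> \<xi> T U. ereal (cost M \<tau> \<xi> A \<phi> T r l g u))"
proof -
  interpret mpp: compensated_mpp M K \<tau> \<xi> \<xi>0 A \<phi> by fact
  have KZ: "progressive_upto (mpp_filtration M K \<tau> \<xi>) T Y" "predictable_field M K \<tau> \<xi> T Z"
    "(\<integral>\<^sup>+\<omega>. (\<integral>\<^sup>+t\<in>{0<..T}. (\<integral>\<^sup>+y. ennreal (exp (\<beta> * A \<omega> t) * \<bar>Z \<omega> t y\<bar>\<^sup>2) \<partial>\<phi> \<omega> t) \<partial>dA A \<omega>) \<partial>M) < \<infinity>"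
    using assms(9) by (auto simp: K_space_def ennreal_add_less_top)
  obtain y0 where y0: "AE \<omega> in M. Y \<omega> 0 = y0"
    using mpp.AE_F_0_const[OF mpp.progressive_time_0[OF KZ(1)]] assms(2) by auto
  \<comment> \<open>Forced by the strict bound on the supremum: \<open>ennreal\<close> sends
    nonpositive reals to 0, and nothing in \<open>ennreal\<close> lies strictly below 0.\<close>
  have "0 < \<beta>"
  proof (rule ccontr)
    assume "\<not> 0 < \<beta>"
    then have "ennreal \<beta> = 0" by (simp add: ennreal_neg)
    with assms(6) show False by simp
  qed
  then interpret control_solution M K \<tau> \<xi> \<xi>0 A \<phi> U r l g T C\<^sub>r C\<^sub>l \<beta> y0 Y Z u_star
    using assms KZ y0 by unfold_locales auto
  note opt = cost_ge[folded cost_u_star]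
  have "ereal (cost M \<tau> \<xi> A \<phi> T r l g u_star) = (INF u\<in>controls. ereal (cost M \<tau> \<xi> A \<phi> T r l g u))"
    using opt u_star_admissible by (intro antisym INF_greatest INF_lower) auto
  moreover have "AE \<omega> in M. Y \<omega> 0 = cost M \<tau> \<xi> A \<phi> T r l g u_star"
    unfolding cost_u_star by (rule y0)
  ultimately show ?thesis
    using opt u_star_admissible by (auto simp: optimal_control_def)
qed

end
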